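(* Assume: (1) $h\sim\kappa^{-(1+\gamma)}$ for some $0<\gamma\le1$, and $h<\overline h(\kappa,p)$ (mesh threshold described in the context); (2) every subdomain $\Omega_l$ is star-shaped with respect to a disc of radius $\sim d_l$, and $\#\Lambda(l)\lesssim1$ for all $1\le l\le N$; (3) $\Omega$ is star-shaped with respect to a disk, $0\le\epsilon\le\kappa$, $d/\delta\lesssim1$, and $d\sim\kappa^{-(1+\tau)}$ with $0\le\tau\le\frac13$. Then there exists a constant $C_0>0$ independent of the parameters $\kappa,\epsilon,h,d,\delta$ such that, if $\kappa d\le C_0$ and the tolerance $\rho\in(0,1)$ is chosen to satisfy $\rho\kappa\le C_0$, the operator $P^\rho_\epsilon=B_\epsilon^{-1}A_\epsilon$ satisfies $$\|P^\rho_\epsilon v_h\|_{1,\kappa}\lesssim\|v_h\|_{1,\kappa}\quad\forall v_h\in V_h(\Omega)$$ and $$|(v_h,P^\rho_\epsilon v_h)_{1,\kappa}|\gtrsim\|v_h\|_{1,\kappa}^2\quad\forall v_h\in V_h(\Omega).$$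
   Context: **Basic setting.** $\Omega\subset\mathbb{R}^2$ is a bounded, connected Lipschitz domain, $\kappa>0$, $\epsilon\ge0$. All functions are complex valued. For $v,w\in H^1(\Omega)$, $$a_\epsilon(v,w)=\int_\Omega\nabla v\cdot\nabla\bar w\,dx-(\kappa^2+\mathrm{i}\epsilon)\int_\Omega v\bar w\,dx-\mathrm{i}\kappa\int_{\partial\Omega}v\bar w\,ds,\qquad (v,w)_{1,\kappa}=\int_\Omega\nabla v\cdot\nabla\bar w\,dx+\kappa^2\int_\Omega v\bar w\,dx,$$ $\|v\|_{1,\kappa}=(v,v)_{1,\kappa}^{1/2}$; for a subdomain $G$, $(\cdot,\cdot)_{1,\kappa,G}$ and $\|\cdot\|_{1,\kappa,G}$ are the same with integrals over $G$. $\mathcal T_h$ is a quasi-uniform, shape-regular mesh of $\Omega$ with mesh diameter $h$, and $V_h(\Omega)$ is the conforming nodal finite element space of fixed order $p$ on $\mathcal T_h$. For $G$ a union of elements, $V_h(G)=\{v_h|_G:v_h\in V_h(\Omega)\}$ and $V_h(\partial G)=\{v_h|_{\partial G}:v_h\in V_h(G)\}$. **Domain decomposition.** $\overline\Omega=\bigcup_{l=1}^N\overline{\Omega_l'}$ is a non-overlapping decomposition, each $\Omega'_l$ a union of elements with diameter $d_l\sim d$; each $\Omega'_l$ is extended by several layers of elements to a larger subdomain $\Omega_l$ (Lipschitz, of characteristic length scale $d_l$), giving an overlapping decomposition with overlap $\delta$. $\Lambda(l)=\{j:\Omega_j\cap\Omega_l\ne\emptyset\}$. $\{\chi_l\}_{l=1}^N$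 is a partition of unity on $\overline\Omega$: $\operatorname{supp}\chi_l\subseteq\overline\Omega_l$, $0\le\chi_l\le1$, $\sum_l\chi_l=1$, $|\nabla\chi_l|\lesssim\delta^{-1}$. $E_l:V_h(\Omega_l)\to V_h(\Omega)$ keeps nodal values at nodes in $\overline\Omega_l$ and sets the other nodal values to $0$. $D_l:V_h(\Omega)\to V_h(\Omega)$ is $D_lv_h=\pi_h(\chi_lv_h)$ with $\pi_h$ the nodal interpolation onto $V_h(\Omega)$. The local form is $$a_{\epsilon,l}(v,w)=\int_{\Omega_l}\nabla v\cdot\nabla\bar w\,dx-(\kappa^2+\mathrm{i}\epsilon)\int_{\Omega_l}v\bar w\,dx-\mathrm{i}\kappa\int_{\partial\Omega_l}v\bar w\,ds.$$ **Coarse space.** For $\lambda_h\in V_h(\partial\Omega_l)$, $\mathcal E_{\epsilon,l}(\lambda_h)\in V_h(\Omega_l)$ is defined by $a_{\epsilon,l}(\mathcal E_{\epsilon,l}(\lambda_h),w_h)=\int_{\partial\Omega_l}\lambda_h\bar w_h\,ds$ for all $w_h\in V_h(\Omega_l)$, and $V_h^\partial(\Omega_l)=\{\mathcal E_{\epsilon,l}(\lambda_h):\lambda_h\in V_h(\partial\Omega_l)\}$, of dimension $m_l$. Let $(\lambda_l^i,\xi_l^i)_{i=1}^{m_l}$, with $0\le\lambda_l^1\le\dots\le\lambda_l^{m_l}$ and $(\xi_l^i,\xi_l^j)_{1,\kappa,\Omega_l}=\delta_{ij}$, be the eigenpairs of: find $\xi\in V_h^\partial(\Omega_l)$ with $(D_lE_l\xi,D_lE_l\theta)_{1,\kappa,\Omega_l}=\lambda(\xi,\theta)_{1,\kappa,\Omega_l}$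 for all $\theta\in V_h^\partial(\Omega_l)$. For a tolerance $\rho\in(0,1)$ let $m_l^\rho$ be such that $\lambda_l^{m_l^\rho-1}<\rho^2\le\lambda_l^{m_l^\rho}$; $V_{h,0}^\rho(\Omega_l)=\operatorname{span}\{\xi_l^i:i\ge m_l^\rho\}$ and $V_{h,0}^\rho(\Omega)=\{\sum_{l=1}^ND_lE_lv_l:v_l\in V_{h,0}^\rho(\Omega_l)\}$. **Preconditioner.** Operators $A_\epsilon$ on $V_h(\Omega)$, $A_{\epsilon,l}$ on $V_h(\Omega_l)$ and $A_0^\rho$ on $V_{h,0}^\rho(\Omega)$ represent $a_\epsilon$, $a_{\epsilon,l}$ and $a_\epsilon$ restricted to $V_{h,0}^\rho(\Omega)$, respectively, with respect to the $L^2$ inner product (e.g. $\int_\Omega(A_\epsilon v_h)\bar w_h\,dx=a_\epsilon(v_h,w_h)$). $E_0:V_{h,0}^\rho(\Omega)\to V_h(\Omega)$ is the inclusion, and ${}^*$ denotes the $L^2$ adjoint. Then $$B_\epsilon^{-1}=(I-E_0(A_0^\rho)^{-1}E_0^*A_\epsilon)\sum_{l=1}^ND_lE_lA_{\epsilon,l}^{-1}E_l^*+E_0(A_0^\rho)^{-1}E_0^*.$$ Equivalently $P_\epsilon^\rho=B_\epsilon^{-1}A_\epsilon=(I-P_0^\rho)\sum_lD_lE_lP_{\epsilon,l}+P_0^\rho$, where $P_{\epsilon,l}v_h\in V_h(\Omega_l)$ solves $a_{\epsilon,l}(P_{\epsilon,l}v_h,w)=a_\epsilon(v_h,E_lw)$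 for all $w\in V_h(\Omega_l)$, and $P_0^\rho v_h\in V_{h,0}^\rho(\Omega)$ solves $a_\epsilon(P_0^\rho v_h,w)=a_\epsilon(v_h,w)$ for all $w\in V_{h,0}^\rho(\Omega)$. **Mesh threshold.** $\overline h(\kappa,p)$ is a threshold such that $h<\overline h(\kappa,p)$ guarantees, on the star-shaped domains $\Omega$ and $\Omega_l$, the discrete inf-sup estimates $$\|v_h\|_{1,\kappa}\lesssim\min\{1+\kappa,\kappa^2/\epsilon\}\sup_{0\ne w_h\in V_h(\Omega)}\frac{|a_\epsilon(v_h,w_h)|}{\|w_h\|_{1,\kappa}},\qquad \|v_h\|_{1,\kappa,\Omega_l}\lesssim\min\{1+\kappa d_l,\kappa^2/\epsilon\}\sup_{0\ne w_h\in V_h(\Omega_l)}\frac{|a_{\epsilon,l}(v_h,w_h)|}{\|w_h\|_{1,\kappa,\Omega_l}}$$ for all $v_h$ in $V_h(\Omega)$, $V_h(\Omega_l)$ respectively, and the same estimates for the adjoint forms $(v,w)\mapsto\overline{a_\epsilon(w,v)}$ and $(v,w)\mapsto\overline{a_{\epsilon,l}(w,v)}$ (with $\kappa^2/\epsilon=\infty$ if $\epsilon=0$). **Convention.** $a\lesssim b$ (equivalently $b\gtrsim a$) means $a\le Cb$ with a constant $C>0$ independent of $\kappa,\epsilon,h,d,\delta,\rho,l$ and of the functions involved (it may depend on $\Omega$); $a\sim b$ means $a\lesssim b\lesssim a$. *)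

theory Defs
  imports "HOL-Analysis.Analysis"
begin

type_synonym pt = "real^2"
type_synonym scalar_fun = "pt \<Rightarrow> complex"

section \<open>Domains\<close>

text \<open>Near each boundary point the domain is the strict epigraph of a Lipschitz function in an
  orthonormal frame (\<open>e1\<close>, \<open>e2\<close>) centred at that point.\<close>

definition lipschitz_domain :: "pt set \<Rightarrow> bool" where
  "lipschitz_domain \<Omega> \<longleftrightarrow>
     open \<Omega> \<and> bounded \<Omega> \<and> connected \<Omega> \<and> \<Omega> \<noteq> {} \<and>
     (\<forall>x\<in>frontier \<Omega>. \<exists>e1 e2 r s M g.
        norm e1 = 1 \<and> norm e2 = 1 \<and> e1 \<bullet> e2 = 0 \<and> 0 < r \<and> 0 < s \<and>
        M-lipschitz_on {-r..r} g \<and>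
        (\<forall>a b. \<bar>a\<bar> < r \<and> \<bar>b\<bar> < s \<longrightarrow>
           (x + a *\<^sub>R e1 + b *\<^sub>R e2 \<in> \<Omega> \<longleftrightarrow> (g a :: real) < b)))"

definition star_shaped_wrt_disc :: "pt set \<Rightarrow> pt \<Rightarrow> real \<Rightarrow> bool" where
  "star_shaped_wrt_disc S z r \<longleftrightarrow>
     0 < r \<and> ball z r \<subseteq> S \<and> (\<forall>y\<in>ball z r. \<forall>x\<in>S. closed_segment y x \<subseteq> S)"

section \<open>Meshes and finite element spaces\<close>

text \<open>A mesh is a conforming triangulation by closed triangles. A subdomain that is a union of
  elements is given by its set \<open>\<G>\<close> of elements: its closure is \<open>\<Union>\<G>\<close>, the open subdomain is
  \<open>interior (\<Union>\<G>)\<close>.\<close>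

definition mesh_size :: "pt set set \<Rightarrow> real" where
  "mesh_size \<T> = Max (diameter ` \<T>)"

definition regular_mesh :: "real \<Rightarrow> pt set \<Rightarrow> pt set set \<Rightarrow> bool" where
  "regular_mesh K \<Omega> \<T> \<longleftrightarrow>
     triangulation \<T> \<and> \<T> \<noteq> {} \<and> (\<forall>T\<in>\<T>. 2 simplex T) \<and> \<Union>\<T> = closure \<Omega> \<and>
     (\<forall>T\<in>\<T>. \<exists>z. ball z (diameter T / K) \<subseteq> T) \<and>
     (\<forall>T\<in>\<T>. mesh_size \<T> \<le> K * diameter T)"

definition poly_on :: "nat \<Rightarrow> pt set \<Rightarrow> scalar_fun \<Rightarrow> bool" where
  "poly_on p T v \<longleftrightarrow>
     (\<exists>c. \<forall>x\<in>T. v x = (\<Sum>i\<le>p. \<Sum>j\<le>p - i. c i j * of_real ((x $ 1) ^ i * (x $ 2) ^ j)))"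

text \<open>Finite element functions live on a closed region; they are represented by functions on the
  plane that vanish outside it, so that equality of functions is equality on the region.\<close>

definition fe_space :: "nat \<Rightarrow> pt set set \<Rightarrow> scalar_fun set" where
  "fe_space p \<T> =
     {v. continuous_on (\<Union>\<T>) v \<and> (\<forall>T\<in>\<T>. poly_on p T v) \<and> (\<forall>x. x \<notin> \<Union>\<T> \<longrightarrow> v x = 0)}"

definition restr :: "pt set \<Rightarrow> scalar_fun \<Rightarrow> scalar_fun" where
  "restr S v = (\<lambda>x. if x \<in> S then v x else 0)"

definition fe_local :: "nat \<Rightarrow> pt set set \<Rightarrow> pt set set \<Rightarrow> scalar_fun set" where
  "fe_local p \<T> \<G> = restr (\<Union>\<G>) ` fe_space p \<T>"

definition fe_trace :: "nat \<Rightarrow> pt set set \<Rightarrow> pt set set \<Rightarrow> scalar_fun set" where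
  "fe_trace p \<T> \<G> = restr (frontier (\<Union>\<G>)) ` fe_local p \<T> \<G>"

text \<open>Lagrange nodes: the points of each triangle whose barycentric coordinates are multiples of
  \<open>1 / p\<close>.\<close>

definition nodes :: "nat \<Rightarrow> pt set set \<Rightarrow> pt set" where
  "nodes p \<T> =
     {x. \<exists>T\<in>\<T>. \<exists>k :: pt \<Rightarrow> nat.
        (\<Sum>a | a extreme_point_of T. k a) = p \<and>
        x = (\<Sum>a | a extreme_point_of T. (real (k a) / real p) *\<^sub>R a)}"

definition interp :: "nat \<Rightarrow> pt set set \<Rightarrow> scalar_fun \<Rightarrow> scalar_fun" where
  "interp p \<T> f = (THE v. v \<in> fe_space p \<T> \<and> (\<forall>x\<in>nodes p \<T>. v x = f x))"

section \<open>Inner products and sesquilinear forms\<close>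

text \<open>The classical gradient. A finite element function is smooth inside every element, so this
  agrees with the weak gradient off the null set formed by the element boundaries. For the same
  reason it makes no difference that integrals below are over closed regions.\<close>

definition grad :: "scalar_fun \<Rightarrow> pt \<Rightarrow> complex^2" where
  "grad v x = (\<chi> i. frechet_derivative v (at x) (axis i 1))"

definition dirichlet_ip :: "pt set \<Rightarrow> scalar_fun \<Rightarrow> scalar_fun \<Rightarrow> complex" where
  "dirichlet_ip S v w = (LINT x:S|lebesgue. \<Sum>i\<in>UNIV. grad v x $ i * cnj (grad w x $ i))"

definition l2_ip :: "pt set \<Rightarrow> scalar_fun \<Rightarrow> scalar_fun \<Rightarrow> complex" where
  "l2_ip S v w = (LINT x:S|lebesgue. v x * cnj (w x))"

text \<open>Arc length integral over a segment; it does not depend on how the end points are ordered.\<close>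

definition edge_integral :: "pt set \<Rightarrow> scalar_fun \<Rightarrow> complex" where
  "edge_integral e f =
     (let ab = (SOME ab. e = closed_segment (fst ab) (snd ab))
      in of_real (dist (fst ab) (snd ab)) *
         integral {0..1} (\<lambda>t. f (linepath (fst ab) (snd ab) t)))"

definition boundary_edges :: "pt set set \<Rightarrow> pt set set" where
  "boundary_edges \<G> = {e. \<exists>T\<in>\<G>. e edge_of T \<and> e \<subseteq> frontier (\<Union>\<G>)}"

definition boundary_ip :: "pt set set \<Rightarrow> scalar_fun \<Rightarrow> scalar_fun \<Rightarrow> complex" where
  "boundary_ip \<G> v w = (\<Sum>e\<in>boundary_edges \<G>. edge_integral e (\<lambda>x. v x * cnj (w x)))"

definition ip1 :: "real \<Rightarrow> pt set \<Rightarrow> scalar_fun \<Rightarrow> scalar_fun \<Rightarrow> complex" where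
  "ip1 \<kappa> S v w = dirichlet_ip S v w + of_real (\<kappa>\<^sup>2) * l2_ip S v w"

definition norm1 :: "real \<Rightarrow> pt set \<Rightarrow> scalar_fun \<Rightarrow> real" where
  "norm1 \<kappa> S v = sqrt (Re (ip1 \<kappa> S v v))"

text \<open>The form \<open>a\<^sub>\<epsilon>\<close> for \<open>\<G> = \<T>\<close>, and \<open>a\<^bsub>\<epsilon>,l\<^esub>\<close> for the elements \<open>\<G>\<close> of the
  \<open>l\<close>-th subdomain.\<close>

definition helm :: "real \<Rightarrow> real \<Rightarrow> pt set set \<Rightarrow> scalar_fun \<Rightarrow> scalar_fun \<Rightarrow> complex" where
  "helm \<kappa> \<epsilon> \<G> v w =
     dirichlet_ip (\<Union>\<G>) v w - (of_real (\<kappa>\<^sup>2) + \<i> * of_real \<epsilon>) * l2_ip (\<Union>\<G>) v w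
     - \<i> * of_real \<kappa> * boundary_ip \<G> v w"

section \<open>Overlapping decompositions\<close>

definition add_layer :: "pt set set \<Rightarrow> pt set set \<Rightarrow> pt set set" where
  "add_layer \<T> \<G> = {T\<in>\<T>. T \<inter> \<Union>\<G> \<noteq> {}}"

text \<open>\<open>\<C> l\<close> and \<open>\<G> l\<close> are the elements of the non-overlapping subdomain \<open>\<Omega>'\<^sub>l\<close> and of its
  extension \<open>\<Omega>\<^sub>l\<close>; \<open>d\<^sub>l\<close> is the diameter of \<open>\<Omega>'\<^sub>l\<close>. The overlap \<open>\<delta>\<close> is, up to the constant \<open>K\<close>,
  the width of the strip added to \<open>\<Omega>'\<^sub>l\<close>.\<close>

definition overlapping_decomposition ::
  "real \<Rightarrow> pt set set \<Rightarrow> real \<Rightarrow> real \<Rightarrow> nat \<Rightarrow> (nat \<Rightarrow> pt set set) \<Rightarrow> (nat \<Rightarrow> pt set set) \<Rightarrow> bool" where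
  "overlapping_decomposition K \<T> d \<delta> N \<C> \<G> \<longleftrightarrow>
     0 < d \<and> 0 < \<delta> \<and> 1 \<le> N \<and>
     (\<Union>l\<in>{1..N}. \<C> l) = \<T> \<and> disjoint_family_on \<C> {1..N} \<and>
     (\<forall>l\<in>{1..N}.
        \<C> l \<noteq> {} \<and>
        d \<le> K * diameter (\<Union>(\<C> l)) \<and> diameter (\<Union>(\<C> l)) \<le> K * d \<and>
        (\<exists>n\<ge>1. \<G> l = (add_layer \<T> ^^ n) (\<C> l)) \<and>
        (\<forall>x\<in>\<Union>\<T>. infdist x (\<Union>(\<C> l)) < \<delta> / K \<longrightarrow> x \<in> \<Union>(\<G> l)) \<and>
        (\<forall>x\<in>\<Union>(\<G> l). infdist x (\<Union>(\<C> l)) \<le> K * \<delta>) \<and>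
        lipschitz_domain (interior (\<Union>(\<G> l))) \<and>
        diameter (\<Union>(\<G> l)) \<le> K * diameter (\<Union>(\<C> l)))"

definition star_shaped_subdomains ::
  "real \<Rightarrow> nat \<Rightarrow> (nat \<Rightarrow> pt set set) \<Rightarrow> (nat \<Rightarrow> pt set set) \<Rightarrow> bool" where
  "star_shaped_subdomains K N \<C> \<G> \<longleftrightarrow>
     (\<forall>l\<in>{1..N}. \<exists>z r. diameter (\<Union>(\<C> l)) \<le> K * r \<and> r \<le> K * diameter (\<Union>(\<C> l)) \<and>
        star_shaped_wrt_disc (interior (\<Union>(\<G> l))) z r)"

definition neighbours :: "nat \<Rightarrow> (nat \<Rightarrow> pt set set) \<Rightarrow> nat \<Rightarrow> nat set" where
  "neighbours N \<G> l = {j\<in>{1..N}. interior (\<Union>(\<G> j)) \<inter> interior (\<Union>(\<G> l)) \<noteq> {}}"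

text \<open>The bound on the gradient is the one in \<open>W\<^sup>1\<^sup>,\<^sup>\<infinity>\<close>: the weak gradient of a continuous function on
  an open set is bounded by \<open>M\<close> iff the function is \<open>M\<close>-Lipschitz along segments inside the set.\<close>

definition partition_of_unity ::
  "real \<Rightarrow> pt set \<Rightarrow> real \<Rightarrow> nat \<Rightarrow> (nat \<Rightarrow> pt set set) \<Rightarrow> (nat \<Rightarrow> pt \<Rightarrow> real) \<Rightarrow> bool" where
  "partition_of_unity K \<Omega> \<delta> N \<G> pu \<longleftrightarrow>
     (\<forall>x\<in>closure \<Omega>. (\<Sum>l=1..N. pu l x) = 1) \<and>
     (\<forall>l\<in>{1..N}.
        continuous_on (closure \<Omega>) (pu l) \<and>
        (\<forall>x\<in>closure \<Omega>. 0 \<le> pu l x \<and> pu l x \<le> 1) \<and>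
        (\<forall>x\<in>closure \<Omega>. x \<notin> \<Union>(\<G> l) \<longrightarrow> pu l x = 0) \<and>
        (\<forall>x y. closed_segment x y \<subseteq> \<Omega> \<longrightarrow> \<bar>pu l x - pu l y\<bar> \<le> K / \<delta> * dist x y))"

text \<open>\<open>E\<^sub>l\<close>: elements of \<open>fe_local\<close> vanish outside \<open>\<Union>\<G>\<close>, so interpolating them sets the
  nodal values outside to zero.\<close>

definition ext :: "nat \<Rightarrow> pt set set \<Rightarrow> scalar_fun \<Rightarrow> scalar_fun" where
  "ext p \<T> w = interp p \<T> w"

definition weight :: "nat \<Rightarrow> pt set set \<Rightarrow> (pt \<Rightarrow> real) \<Rightarrow> scalar_fun \<Rightarrow> scalar_fun" where
  "weight p \<T> \<phi> v = interp p \<T> (\<lambda>x. of_real (\<phi> x) * v x)"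

section \<open>Discrete inf-sup estimates and the mesh threshold\<close>

definition inf_sup ::
  "real \<Rightarrow> scalar_fun set \<Rightarrow> (scalar_fun \<Rightarrow> real) \<Rightarrow> (scalar_fun \<Rightarrow> scalar_fun \<Rightarrow> complex) \<Rightarrow> bool" where
  "inf_sup M V nrm b \<longleftrightarrow>
     (\<forall>v\<in>V. nrm v \<le> M * (SUP w\<in>V - {\<lambda>x. 0}. cmod (b v w) / nrm w))"

definition min_stab :: "real \<Rightarrow> real \<Rightarrow> real \<Rightarrow> real" where
  "min_stab s \<kappa> \<epsilon> = (if \<epsilon> = 0 then s else min s (\<kappa>\<^sup>2 / \<epsilon>))"

text \<open>\<open>hbar\<close> is a threshold for the domain \<open>\<Omega>\<close> and order \<open>p\<close>: on all meshes and decompositions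
  of the given regularity \<open>K\<close> that are finer than \<open>hbar \<kappa> p\<close>, the inf-sup estimates hold with the
  constant \<open>M\<close>. As \<open>M\<close> is the constant resulting from \<open>K\<close>, it must not be identified with \<open>K\<close>.\<close>

definition mesh_threshold :: "real \<Rightarrow> real \<Rightarrow> pt set \<Rightarrow> nat \<Rightarrow> (real \<Rightarrow> nat \<Rightarrow> real) \<Rightarrow> bool" where
  "mesh_threshold K M \<Omega> p hbar \<longleftrightarrow>
     (\<forall>\<kappa> \<epsilon> \<T> d \<delta> N \<C> \<G>.
        0 < \<kappa> \<and> 0 \<le> \<epsilon> \<and> \<epsilon> \<le> \<kappa> \<and>
        regular_mesh K \<Omega> \<T> \<and> overlapping_decomposition K \<T> d \<delta> N \<C> \<G> \<and>
        star_shaped_subdomains K N \<C> \<G> \<and> mesh_size \<T> < hbar \<kappa> p \<longrightarrow>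
        inf_sup (M * min_stab (1 + \<kappa>) \<kappa> \<epsilon>) (fe_space p \<T>) (norm1 \<kappa> (\<Union>\<T>)) (helm \<kappa> \<epsilon> \<T>) \<and>
        inf_sup (M * min_stab (1 + \<kappa>) \<kappa> \<epsilon>) (fe_space p \<T>) (norm1 \<kappa> (\<Union>\<T>))
          (\<lambda>v w. cnj (helm \<kappa> \<epsilon> \<T> w v)) \<and>
        (\<forall>l\<in>{1..N}.
           inf_sup (M * min_stab (1 + \<kappa> * diameter (\<Union>(\<C> l))) \<kappa> \<epsilon>)
             (fe_local p \<T> (\<G> l)) (norm1 \<kappa> (\<Union>(\<G> l))) (helm \<kappa> \<epsilon> (\<G> l)) \<and>
           inf_sup (M * min_stab (1 + \<kappa> * diameter (\<Union>(\<C> l))) \<kappa> \<epsilon>)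
             (fe_local p \<T> (\<G> l)) (norm1 \<kappa> (\<Union>(\<G> l)))
             (\<lambda>v w. cnj (helm \<kappa> \<epsilon> (\<G> l) w v))))"

section \<open>Spectral coarse space\<close>

definition variational_solution ::
  "scalar_fun set \<Rightarrow> (scalar_fun \<Rightarrow> scalar_fun \<Rightarrow> complex) \<Rightarrow> (scalar_fun \<Rightarrow> complex) \<Rightarrow> scalar_fun" where
  "variational_solution V b F = (THE u. u \<in> V \<and> (\<forall>w\<in>V. b u w = F w))"

definition harmonic_ext ::
  "nat \<Rightarrow> pt set set \<Rightarrow> real \<Rightarrow> real \<Rightarrow> pt set set \<Rightarrow> scalar_fun \<Rightarrow> scalar_fun" where
  "harmonic_ext p \<T> \<kappa> \<epsilon> \<G> g =
     variational_solution (fe_local p \<T> \<G>) (helm \<kappa> \<epsilon> \<G>) (boundary_ip \<G> g)"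

definition harmonic_space ::
  "nat \<Rightarrow> pt set set \<Rightarrow> real \<Rightarrow> real \<Rightarrow> pt set set \<Rightarrow> scalar_fun set" where
  "harmonic_space p \<T> \<kappa> \<epsilon> \<G> = harmonic_ext p \<T> \<kappa> \<epsilon> \<G> ` fe_trace p \<T> \<G>"

definition complex_span :: "nat set \<Rightarrow> (nat \<Rightarrow> scalar_fun) \<Rightarrow> scalar_fun set" where
  "complex_span I f = {\<lambda>x. \<Sum>i\<in>I. c i * f i x | c. True}"

text \<open>A complete system of eigenpairs. The spanning and orthonormality conditions make
  \<open>\<xi> 1, \<dots>, \<xi> m\<close> a basis, so \<open>m\<close> is the dimension of \<open>harmonic_space\<close>.\<close>

definition eigenpairs ::
  "nat \<Rightarrow> pt set set \<Rightarrow> real \<Rightarrow> real \<Rightarrow> pt set set \<Rightarrow> (pt \<Rightarrow> real) \<Rightarrow>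
   nat \<Rightarrow> (nat \<Rightarrow> real) \<Rightarrow> (nat \<Rightarrow> scalar_fun) \<Rightarrow> bool" where
  "eigenpairs p \<T> \<kappa> \<epsilon> \<G> \<phi> m ev \<xi> \<longleftrightarrow>
     complex_span {1..m} \<xi> = harmonic_space p \<T> \<kappa> \<epsilon> \<G> \<and>
     (\<forall>i\<in>{1..m}. \<forall>j\<in>{1..m}. ip1 \<kappa> (\<Union>\<G>) (\<xi> i) (\<xi> j) = (if i = j then 1 else 0)) \<and>
     (\<forall>i\<in>{1..m}. 0 \<le> ev i) \<and> (\<forall>i\<in>{1..m}. \<forall>j\<in>{i..m}. ev i \<le> ev j) \<and>
     (\<forall>i\<in>{1..m}. \<forall>\<theta>\<in>harmonic_space p \<T> \<kappa> \<epsilon> \<G>.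
        ip1 \<kappa> (\<Union>\<G>) (weight p \<T> \<phi> (ext p \<T> (\<xi> i))) (weight p \<T> \<phi> (ext p \<T> \<theta>)) =
        of_real (ev i) * ip1 \<kappa> (\<Union>\<G>) (\<xi> i) \<theta>)"

text \<open>\<open>k\<close> is the index of the first eigenvalue not below \<open>\<rho>\<^sup>2\<close>, with the conventions
  \<open>ev 0 = -\<infinity>\<close> and \<open>ev (m + 1) = \<infinity>\<close> when there is none on one of the sides.\<close>

definition cutoff_index :: "real \<Rightarrow> nat \<Rightarrow> (nat \<Rightarrow> real) \<Rightarrow> nat \<Rightarrow> bool" where
  "cutoff_index \<rho> m ev k \<longleftrightarrow>
     1 \<le> k \<and> k \<le> m + 1 \<and> (2 \<le> k \<longrightarrow> ev (k - 1) < \<rho>\<^sup>2) \<and> (k \<le> m \<longrightarrow> \<rho>\<^sup>2 \<le> ev k)"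

definition coarse_space ::
  "nat \<Rightarrow> pt set set \<Rightarrow> nat \<Rightarrow> (nat \<Rightarrow> pt \<Rightarrow> real) \<Rightarrow>
   (nat \<Rightarrow> nat) \<Rightarrow> (nat \<Rightarrow> nat) \<Rightarrow> (nat \<Rightarrow> nat \<Rightarrow> scalar_fun) \<Rightarrow> scalar_fun set" where
  "coarse_space p \<T> N pu m k \<xi> =
     {\<lambda>x. \<Sum>l=1..N. weight p \<T> (pu l) (ext p \<T> (v l)) x | v.
        \<forall>l\<in>{1..N}. v l \<in> complex_span {k l..m l} (\<xi> l)}"

section \<open>The preconditioned operator\<close>

definition form_op ::
  "scalar_fun set \<Rightarrow> pt set set \<Rightarrow> real \<Rightarrow> real \<Rightarrow> scalar_fun \<Rightarrow> scalar_fun" where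
  "form_op V \<G> \<kappa> \<epsilon> v = variational_solution V (l2_ip (\<Union>\<G>)) (helm \<kappa> \<epsilon> \<G> v)"

definition ext_adjoint :: "nat \<Rightarrow> pt set set \<Rightarrow> pt set set \<Rightarrow> scalar_fun \<Rightarrow> scalar_fun" where
  "ext_adjoint p \<T> \<G> v =
     variational_solution (fe_local p \<T> \<G>) (l2_ip (\<Union>\<G>)) (\<lambda>w. l2_ip (\<Union>\<T>) v (ext p \<T> w))"

definition coarse_adjoint :: "pt set set \<Rightarrow> scalar_fun set \<Rightarrow> scalar_fun \<Rightarrow> scalar_fun" where
  "coarse_adjoint \<T> V0 v = variational_solution V0 (l2_ip (\<Union>\<T>)) (\<lambda>w. l2_ip (\<Union>\<T>) v w)"

definition one_level ::
  "nat \<Rightarrow> pt set set \<Rightarrow> real \<Rightarrow> real \<Rightarrow> nat \<Rightarrow> (nat \<Rightarrow> pt set set) \<Rightarrow> (nat \<Rightarrow> pt \<Rightarrow> real) \<Rightarrow>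
   scalar_fun \<Rightarrow> scalar_fun" where
  "one_level p \<T> \<kappa> \<epsilon> N \<G> pu f =
     (\<lambda>x. \<Sum>l=1..N. weight p \<T> (pu l) (ext p \<T>
        (the_inv_into (fe_local p \<T> (\<G> l)) (form_op (fe_local p \<T> (\<G> l)) (\<G> l) \<kappa> \<epsilon>)
          (ext_adjoint p \<T> (\<G> l) f))) x)"

text \<open>\<open>coarse_solve\<close> is \<open>E\<^sub>0 (A\<^sub>0\<^sup>\<rho>)\<^sup>-\<^sup>1 E\<^sub>0\<^sup>*\<close>; the inclusion \<open>E\<^sub>0\<close> is implicit.\<close>

definition coarse_solve ::
  "pt set set \<Rightarrow> real \<Rightarrow> real \<Rightarrow> scalar_fun set \<Rightarrow> scalar_fun \<Rightarrow> scalar_fun" where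
  "coarse_solve \<T> \<kappa> \<epsilon> V0 f = the_inv_into V0 (form_op V0 \<T> \<kappa> \<epsilon>) (coarse_adjoint \<T> V0 f)"

definition B_inv ::
  "nat \<Rightarrow> pt set set \<Rightarrow> real \<Rightarrow> real \<Rightarrow> nat \<Rightarrow> (nat \<Rightarrow> pt set set) \<Rightarrow> (nat \<Rightarrow> pt \<Rightarrow> real) \<Rightarrow>
   scalar_fun set \<Rightarrow> scalar_fun \<Rightarrow> scalar_fun" where
  "B_inv p \<T> \<kappa> \<epsilon> N \<G> pu V0 f =
     (let y = one_level p \<T> \<kappa> \<epsilon> N \<G> pu f
      in (\<lambda>x. y x - coarse_solve \<T> \<kappa> \<epsilon> V0 (form_op (fe_space p \<T>) \<T> \<kappa> \<epsilon> y) x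
              + coarse_solve \<T> \<kappa> \<epsilon> V0 f x))"

definition P_op ::
  "nat \<Rightarrow> pt set set \<Rightarrow> real \<Rightarrow> real \<Rightarrow> nat \<Rightarrow> (nat \<Rightarrow> pt set set) \<Rightarrow> (nat \<Rightarrow> pt \<Rightarrow> real) \<Rightarrow>
   scalar_fun set \<Rightarrow> scalar_fun \<Rightarrow> scalar_fun" where
  "P_op p \<T> \<kappa> \<epsilon> N \<G> pu V0 v =
     B_inv p \<T> \<kappa> \<epsilon> N \<G> pu V0 (form_op (fe_space p \<T>) \<T> \<kappa> \<epsilon> v)"

end

theory Submission
 imports Defs "HOL-Library.Function_Algebras"
begin

text \<open>The preconditioned operator \<open>P\<close> is close to the identity: \<open>\<parallel>P v - v\<parallel> \<le> \<parallel>v\<parallel> / 2\<close> in the energy norm. Both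
 claims follow at once, the upper bound with constant \<open>3/2\<close>, the lower one with \<open>1/2\<close>.

 Let \<open>P\<^sub>l v\<close> be the local solutions, \<open>P\<^sub>0\<close> the coarse projection and \<open>\<phi>\<^sub>l\<close> the difference of the restriction of \<open>v\<close> to the
 \<open>l\<close>-th subdomain and \<open>P\<^sub>l v\<close>. As the weights add up to one, \<open>v - \<Sum> D\<^sub>l E\<^sub>l P\<^sub>l v = \<Sum> D\<^sub>l E\<^sub>l \<phi>\<^sub>l\<close>. The form applied
 to \<open>\<phi>\<^sub>l\<close> vanishes on test functions with zero trace, so \<open>\<phi>\<^sub>l\<close> is discrete harmonic (\<open>harmonic_spaceI\<close>). Its components
 along the retained modes glue to an element of the coarse space, which the coarse correction removes. The discarded ones
 glue to a remainder \<open>r\<close>, and \<open>P v - v = - (r - P\<^sub>0 r)\<close>. Two estimates remain.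

 First, \<open>\<parallel>r\<parallel> \<le> C \<rho> \<kappa> \<parallel>v\<parallel>\<close>. Discarded modes lose a factor \<open>\<rho>\<close> under weighting (\<open>spectral_split\<close>), and
 \<open>\<parallel>P\<^sub>l v\<parallel> \<le> C \<kappa> \<parallel>v\<parallel>\<close> on a neighbourhood of the subdomain: with \<open>\<kappa> d\<close> bounded the local inf-sup constant is
 bounded, and extension by zero costs \<open>1 / (h \<kappa>)\<close>, which is at most a multiple of \<open>\<kappa>\<close> since \<open>\<gamma> \<le> 1\<close>
 (\<open>localised_form_bound\<close>, \<open>Pl_bound\<close>).

 Second, \<open>\<parallel>r - P\<^sub>0 r\<parallel> \<le> C \<parallel>r\<parallel>\<close>, by the duality argument of Schatz (\<open>schatz\<close>). For \<open>e = r - P\<^sub>0 r\<close> the adjoint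
 solution \<open>w\<close> with data \<open>2 \<kappa>\<^sup>2 e\<close> satisfies \<open>\<parallel>w\<parallel> \<le> C \<kappa> \<parallel>e\<parallel>\<close>, and Galerkin orthogonality leaves only the
 distance of \<open>w\<close> to the coarse space. In each subdomain \<open>w\<close> is the sum of a discrete harmonic function and a corrector
 with zero trace, which the Friedrichs inequality makes small with \<open>d\<close>. Gluing gives the distance
 \<open>C (\<kappa> d + \<rho> \<kappa>) \<parallel>e\<parallel>\<close> (\<open>coarse_approximation\<close>), which is small enough.

 The argument needs the sesquilinear form to be bounded uniformly in \<open>\<kappa>\<close>, hence a trace inequality with the
 factor \<open>\<kappa>\<close> on the star-shaped domain; for finite element functions it comes from differentiating the mass along
 dilations (\<open>trace_inequality\<close>). Finally, \<open>\<kappa>\<close> is bounded below, because the mesh size cannot exceed the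
 domain.\<close>

abbreviation mass :: "pt set \<Rightarrow> scalar_fun \<Rightarrow> real" where "mass S u \<equiv> Re (l2_ip S u u)"
abbreviation energy :: "pt set \<Rightarrow> scalar_fun \<Rightarrow> real" where "energy S u \<equiv> Re (dirichlet_ip S u u)"
abbreviation energy1 :: "real \<Rightarrow> pt set \<Rightarrow> scalar_fun \<Rightarrow> real" where "energy1 \<kappa> S u \<equiv> Re (ip1 \<kappa> S u u)"

section \<open>Sesquilinear forms on finite-dimensional function spaces\<close>

definition scl :: "complex \<Rightarrow> ('a \<Rightarrow> complex) \<Rightarrow> 'a \<Rightarrow> complex" (infixr "*\<^sub>C" 75) where
 "c *\<^sub>C f = (\<lambda>x. c * f x)"

declare plus_fun_apply [simp del] zero_fun_apply [simp del] minus_apply [simp del] uminus_apply [simp del]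

lemma scl_apply: "(c *\<^sub>C f) x = c * f x"
 by (simp add: scl_def)

interpretation cvs: vector_space scl
 by standard (auto simp: fun_eq_iff algebra_simps scl_def plus_fun_apply)

lemma sum_fun_apply: "(\<Sum>i\<in>A. f i) x = (\<Sum>i\<in>A. f i x)"
 by (induction A rule: infinite_finite_induct) (auto simp: plus_fun_apply zero_fun_apply)

text \<open>Carriers are subspaces of a function type that is itself infinite dimensional, so dimension is expressed
 by a finite spanning set.\<close>

definition fdim :: "('a \<Rightarrow> complex) set \<Rightarrow> bool" where
 "fdim V \<longleftrightarrow> cvs.subspace V \<and> (\<exists>B. finite B \<and> V \<subseteq> cvs.span B)"

lemmas fapply = scl_apply plus_fun_apply zero_fun_apply minus_apply uminus_apply sum_fun_apply

lemma fdim_subspace [intro]: "fdim V ==> cvs.subspace V"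
 by (simp add: fdim_def)

lemma fdim_subset: "fdim V ==> cvs.subspace W ==> W \<subseteq> V ==> fdim W"
 by (auto simp: fdim_def)

definition sesq :: "('a \<Rightarrow> complex) set \<Rightarrow> (('a \<Rightarrow> complex) \<Rightarrow> ('a \<Rightarrow> complex) \<Rightarrow> complex) \<Rightarrow> bool" where
 "sesq V b \<longleftrightarrow>
   (\<forall>u\<in>V. \<forall>v\<in>V. \<forall>w\<in>V. b (u + v) w = b u w + b v w \<and> b w (u + v) = b w u + b w v) \<and>
   (\<forall>c. \<forall>u\<in>V. \<forall>w\<in>V. b (c *\<^sub>C u) w = c * b u w \<and> b u (c *\<^sub>C w) = cnj c * b u w)"

definition psd :: "('a \<Rightarrow> complex) set \<Rightarrow> (('a \<Rightarrow> complex) \<Rightarrow> ('a \<Rightarrow> complex) \<Rightarrow> complex) \<Rightarrow> bool" where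
 "psd V b \<longleftrightarrow> sesq V b \<and> (\<forall>u\<in>V. \<forall>v\<in>V. b v u = cnj (b u v)) \<and> (\<forall>u\<in>V. 0 \<le> Re (b u u))"

definition antilin :: "('a \<Rightarrow> complex) set \<Rightarrow> (('a \<Rightarrow> complex) \<Rightarrow> complex) \<Rightarrow> bool" where
 "antilin V F \<longleftrightarrow> (\<forall>u\<in>V. \<forall>v\<in>V. F (u + v) = F u + F v) \<and> (\<forall>c. \<forall>u\<in>V. F (c *\<^sub>C u) = cnj c * F u)"

definition snorm :: "(('a \<Rightarrow> complex) \<Rightarrow> ('a \<Rightarrow> complex) \<Rightarrow> complex) \<Rightarrow> ('a \<Rightarrow> complex) \<Rightarrow> real" where
 "snorm b u = sqrt (Re (b u u))"

lemma sesqD: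
 assumes "sesq V b" "u \<in> V" "v \<in> V"
 shows "w \<in> V ==> b (u + v) w = b u w + b v w" "w \<in> V ==> b w (u + v) = b w u + b w v"
  "b (c *\<^sub>C u) v = c * b u v" "b u (c *\<^sub>C v) = cnj c * b u v"
 using assms unfolding sesq_def by auto

lemma sesq_subset: "sesq V b ==> W \<subseteq> V ==> sesq W b"
 unfolding sesq_def by (auto simp: subset_iff)

lemma psd_subset: "psd V b ==> W \<subseteq> V ==> psd W b"
 unfolding psd_def by (meson sesq_subset subsetD)

lemma psd_sesq: "psd V b ==> sesq V b"
 unfolding psd_def by (rule conjunct1)

lemma psd_nonneg: "psd V b ==> u \<in> V ==> 0 \<le> Re (b u u)"
 unfolding psd_def by blast

lemma psd_sym: "psd V b ==> u \<in> V ==> v \<in> V ==> b v u = cnj (b u v)"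
 unfolding psd_def by blast

lemma sesq_zero:
 assumes "sesq V b" "cvs.subspace V" "u \<in> V"
 shows "b 0 u = 0" "b u 0 = 0"
 using sesqD(3)[OF assms(1) assms(3,3), of 0] sesqD(4)[OF assms(1) assms(3,3), of 0]
 by (auto simp: scl_def zero_fun_def)

lemma sesq_minus:
 assumes "sesq V b" "cvs.subspace V" "u \<in> V" "w \<in> V"
 shows "b (- u) w = - b u w" "b w (- u) = - b w u"
 using sesqD(3)[OF assms(1) assms(3,4), of "-1"] sesqD(4)[OF assms(1) assms(4,3), of "-1"]
 by (auto simp: scl_def fun_Compl_def)

lemma sesq_diff:
 assumes "sesq V b" "cvs.subspace V" "u \<in> V" "v \<in> V" "w \<in> V"
 shows "b (u - v) w = b u w - b v w" "b w (u - v) = b w u - b w v"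
proof -
 have n: "- v \<in> V" using assms cvs.subspace_neg by blast
 show "b (u - v) w = b u w - b v w" "b w (u - v) = b w u - b w v"
  using sesqD(1,2)[OF assms(1,3) n, of w] sesq_minus[OF assms(1,2,4,5)] assms by auto
qed

lemma sesq_sum:
 assumes "sesq V b" "cvs.subspace V" "\<And>i. i \<in> A ==> f i \<in> V" "w \<in> V"
 shows "b (\<Sum>i\<in>A. f i) w = (\<Sum>i\<in>A. b (f i) w)" "b w (\<Sum>i\<in>A. f i) = (\<Sum>i\<in>A. b w (f i))"
proof -
 have "b (\<Sum>i\<in>A. f i) w = (\<Sum>i\<in>A. b (f i) w) \<and> b w (\<Sum>i\<in>A. f i) = (\<Sum>i\<in>A. b w (f i))"
  using assms(3)
 proof (induction A rule: infinite_finite_induct)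
  case (insert x A)
  have "(\<Sum>i\<in>A. f i) \<in> V" using insert by (intro cvs.subspace_sum assms(2)) auto
  then show ?case
   using insert sesqD(1,2)[OF assms(1), of "f x" "\<Sum>i\<in>A. f i" w] assms(4) by auto
 qed (use sesq_zero[OF assms(1,2,4)] in auto)
 then show "b (\<Sum>i\<in>A. f i) w = (\<Sum>i\<in>A. b (f i) w)" "b w (\<Sum>i\<in>A. f i) = (\<Sum>i\<in>A. b w (f i))"
  by auto
qed

lemma antilin_sum:
 assumes "antilin V F" "cvs.subspace V" "\<And>i. i \<in> A ==> f i \<in> V"
 shows "F (\<Sum>i\<in>A. c i *\<^sub>C f i) = (\<Sum>i\<in>A. cnj (c i) * F (f i))"
 using assms(3)
proof (induction A rule: infinite_finite_induct)
 case (insert x A)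
 have "(\<Sum>i\<in>A. c i *\<^sub>C f i) \<in> V" "c x *\<^sub>C f x \<in> V"
  using insert by (auto intro!: cvs.subspace_sum assms(2) cvs.subspace_scale)
 then show ?case using insert assms(1) unfolding antilin_def by auto
next
 case empty
 have "0 \<in> V" using assms(2) cvs.subspace_0 by blast
 then have "F (0 *\<^sub>C 0) = cnj 0 * F 0" using assms(1) unfolding antilin_def by blast
 then show ?case by (simp add: scl_def zero_fun_def)
next
 case (infinite A)
 have "0 \<in> V" using assms(2) cvs.subspace_0 by blast
 then have "F (0 *\<^sub>C 0) = cnj 0 * F 0" using assms(1) unfolding antilin_def by blast
 then show ?case using infinite by (simp add: scl_def zero_fun_def)
qed

lemma span_finite_sum:
 assumes "finite B" "u \<in> cvs.span B"
 obtains c where "u = (\<Sum>x\<in>B. c x *\<^sub>C x)"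
 using assms by (auto simp: cvs.span_finite)

text \<open>A square linear system with trivial kernel is solvable. The images of a basis under
 \<open>u \<mapsto> (b u w)\<close>, \<open>w\<close> in the basis, stay independent; were the right-hand side not in their span,
 there would be one independent vector too many.\<close>

lemma galerkin_unique_solution:
 assumes V: "fdim V" and b: "sesq V b" and inj: "\<And>u. u \<in> V ==> (\<forall>w\<in>V. b u w = 0) ==> u = 0"
  and F: "antilin V F"
 shows "\<exists>!u. u \<in> V \<and> (\<forall>w\<in>V. b u w = F w)"
proof -
 have sub: "cvs.subspace V" using V by auto
 obtain B where B: "B \<subseteq> V" "cvs.independent B" "V \<subseteq> cvs.span B"
  using cvs.maximal_independent_subset[of V] by blast
 obtain B0 where B0: "finite B0" "V \<subseteq> cvs.span B0" using V by (auto simp: fdim_def)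
 have finB: "finite B" using cvs.independent_span_bound[OF B0(1) B(2)] B B0 by auto
 have VB: "V = cvs.span B" using B sub cvs.span_minimal by blast
 define R where "R = (\<lambda>G w. if w \<in> B then G w else (0::complex))"
 define L where "L = (\<lambda>u. R (b u))"
 have cV: "c x *\<^sub>C x \<in> V" if "x \<in> B" for c x using that B sub cvs.subspace_scale by blast
 have bsum: "b u (\<Sum>x\<in>B. c x *\<^sub>C x) = (\<Sum>x\<in>B. cnj (c x) * b u x)" if u: "u \<in> V" for u c
 proof -
  have "b u (\<Sum>x\<in>B. c x *\<^sub>C x) = (\<Sum>x\<in>B. b u (c x *\<^sub>C x))" by (rule sesq_sum(2)[OF b sub cV u])
  also have "... = (\<Sum>x\<in>B. cnj (c x) * b u x)" using B u by (intro sum.cong sesqD(4)[OF b]) auto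
  finally show ?thesis .
 qed
 have ext0: "\<forall>w\<in>V. b u w = 0" if "u \<in> V" "L u = 0" for u
 proof
  fix w assume "w \<in> V"
  then have "w \<in> cvs.span B" using VB by simp
  then obtain c where w: "w = (\<Sum>x\<in>B. c x *\<^sub>C x)" by (rule span_finite_sum[OF finB])
  have "b u x = 0" if "x \<in> B" for x
   using fun_cong[OF \<open>L u = 0\<close>, of x] that by (simp add: L_def R_def fapply)
  then show "b u w = 0" unfolding w bsum[OF \<open>u \<in> V\<close>] by simp
 qed
 have Lsum: "L (\<Sum>x\<in>B. c x *\<^sub>C x) = (\<Sum>x\<in>B. c x *\<^sub>C L x)" for c
 proof
  fix w
  have "b (\<Sum>x\<in>B. c x *\<^sub>C x) w = (\<Sum>x\<in>B. c x * b x w)" if "w \<in> B"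
  proof -
   have wV: "w \<in> V" using that B by auto
   have "b (\<Sum>x\<in>B. c x *\<^sub>C x) w = (\<Sum>x\<in>B. b (c x *\<^sub>C x) w)"
    by (rule sesq_sum(1)[OF b sub cV wV])
   also have "... = (\<Sum>x\<in>B. c x * b x w)"
    using B wV by (intro sum.cong sesqD(3)[OF b]) auto
   finally show ?thesis .
  qed
  then show "L (\<Sum>x\<in>B. c x *\<^sub>C x) w = (\<Sum>x\<in>B. c x *\<^sub>C L x) w"
   by (auto simp: L_def R_def fapply)
 qed
 have comb: "c x = 0" if "(\<Sum>x\<in>B. c x *\<^sub>C L x) = 0" "x \<in> B" for c x
 proof -
  have "(\<Sum>x\<in>B. c x *\<^sub>C x) \<in> V"
   using B sub by (intro cvs.subspace_sum cvs.subspace_scale) auto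
  then have "(\<Sum>x\<in>B. c x *\<^sub>C x) = 0" using inj ext0 that(1) Lsum by simp
  then show ?thesis using cvs.independentD[OF B(2) finB subset_refl] that(2) by blast
 qed
 have injL: "inj_on L B"
 proof (rule inj_onI, rule ccontr)
  fix x y assume xy: "x \<in> B" "y \<in> B" "L x = L y" "x \<noteq> y"
  define c where "c = (\<lambda>z. if z = x then 1 else if z = y then -1 else (0::complex))"
  have "(\<Sum>z\<in>B. c z *\<^sub>C L z) = (\<Sum>z\<in>{x,y}. c z *\<^sub>C L z)"
   using xy finB by (intro sum.mono_neutral_right) (auto simp: c_def scl_def zero_fun_def)
  also have "... = 0" using xy by (auto simp: c_def fun_eq_iff fapply)
  finally show False using comb[of c x] xy by (simp add: c_def)
 qed
 have indL: "cvs.independent (L ` B)"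
 proof -
  have "\<forall>y\<in>L ` B. g y = 0" if g: "(\<Sum>x\<in>L ` B. g x *\<^sub>C x) = 0" for g
  proof
   fix y assume "y \<in> L ` B"
   then obtain x where x: "x \<in> B" "y = L x" by blast
   define c where "c = (\<lambda>x. g (L x))"
   have "(\<Sum>x\<in>B. c x *\<^sub>C L x) = 0" using g by (simp add: sum.reindex[OF injL] c_def o_def)
   then have "c x = 0" using x(1) by (rule comb)
   then show "g y = 0" by (simp add: c_def x(2))
  qed
  then show ?thesis using cvs.dependent_finite[of "L ` B"] finB by blast
 qed
 define D where "D = (\<lambda>w v. if v = w then (1::complex) else 0) ` B"
 have inD: "R G \<in> cvs.span D" for G
 proof -
  have "R G = (\<Sum>w\<in>B. G w *\<^sub>C (\<lambda>v. if v = w then (1::complex) else 0))"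
  proof (rule ext)
   fix v
   have "(\<Sum>w\<in>B. G w * (if v = w then 1 else 0)) = (\<Sum>w\<in>B. if v = w then G w else 0)"
    by (intro sum.cong) auto
   also have "... = R G v" using finB by (simp add: R_def sum.delta')
   finally show "R G v = (\<Sum>w\<in>B. G w *\<^sub>C (\<lambda>v. if v = w then (1::complex) else 0)) v"
    by (simp only: fapply)
  qed
  also have "... \<in> cvs.span D"
   by (intro cvs.span_sum cvs.span_scale cvs.span_base) (auto simp: D_def)
  finally show ?thesis .
 qed
 have "R F \<in> cvs.span (L ` B)"
 proof (rule ccontr)
  assume n: "R F \<notin> cvs.span (L ` B)"
  then have ind: "cvs.independent (insert (R F) (L ` B))" using indL cvs.independent_insertI by blast
  have "insert (R F) (L ` B) \<subseteq> cvs.span D" using inD by (auto simp: L_def)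
  then have "card (insert (R F) (L ` B)) \<le> card D"
   using cvs.independent_span_bound[OF _ ind] finB by (auto simp: D_def)
  also have "card D \<le> card B" unfolding D_def by (rule card_image_le[OF finB])
  also have "card B = card (L ` B)" using injL by (simp add: card_image)
  finally show False
   using n finB cvs.span_base[of "R F" "L ` B"] by (auto simp: card_insert_if split: if_splits)
 qed
 then obtain c where c: "R F = (\<Sum>y\<in>L ` B. c y *\<^sub>C y)"
  using finB by (elim span_finite_sum[rotated]) auto
 define u where "u = (\<Sum>x\<in>B. c (L x) *\<^sub>C x)"
 have uV: "u \<in> V" unfolding u_def using B sub by (intro cvs.subspace_sum cvs.subspace_scale) auto
 have Lu: "L u = R F"
 proof -
  define d where "d = (\<lambda>x. c (L x))"
  have "L u = (\<Sum>x\<in>B. d x *\<^sub>C L x)" unfolding Lsum[symmetric] by (simp only: u_def d_def)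
  also have "... = R F" unfolding c by (simp add: sum.reindex[OF injL] o_def d_def)
  finally show ?thesis .
 qed
 have "b u w = F w" if "w \<in> V" for w
 proof -
  have "w \<in> cvs.span B" using that VB by simp
  then obtain d where w: "w = (\<Sum>x\<in>B. d x *\<^sub>C x)" by (rule span_finite_sum[OF finB])
  have "b u w = (\<Sum>x\<in>B. cnj (d x) * b u x)" unfolding w by (rule bsum[OF uV])
  also have "... = (\<Sum>x\<in>B. cnj (d x) * F x)"
  proof (rule sum.cong)
   fix x assume "x \<in> B"
   then show "cnj (d x) * b u x = cnj (d x) * F x"
    using fun_cong[OF Lu, of x] by (simp add: L_def R_def)
  qed simp
  also have "... = F w" unfolding w
   by (rule antilin_sum[OF F sub, of B "\<lambda>x. x" d, symmetric]) (use B in auto)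
  finally show ?thesis .
 qed
 note sol = this
 have uniq: "u' = u" if u': "u' \<in> V" "\<forall>w\<in>V. b u' w = F w" for u'
 proof -
  have d: "u' - u \<in> V" using u' uV sub cvs.subspace_diff by blast
  have "\<forall>w\<in>V. b (u' - u) w = 0"
   using sesq_diff(1)[OF b sub u'(1) uV] u'(2) sol by auto
  then have "u' - u = 0" by (rule inj[OF d])
  then show ?thesis by simp
 qed
 show ?thesis
 proof (rule ex1I[of _ u])
  show "u \<in> V \<and> (\<forall>w\<in>V. b u w = F w)" using uV sol by auto
 qed (use uniq in auto)
qed

lemma psd_real: "psd V b ==> u \<in> V ==> b u u = of_real (Re (b u u))"
 unfolding psd_def by (metis Reals_cnj_iff of_real_Re)

lemma quadratic_nonneg:
 fixes a c n :: real
 assumes "\<And>t. 0 \<le> a - 2 * t * n + t\<^sup>2 * n * c" "0 \<le> c" "0 \<le> n"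
 shows "n \<le> a * c"
proof (cases "c = 0")
 case True
 have "n = 0"
 proof (rule ccontr)
  assume n: "n \<noteq> 0"
  have "2 * ((a + 1) / (2 * n)) * n = a + 1" using n by (simp add: field_simps)
  then show False using assms(1)[of "(a + 1) / (2 * n)"] True by simp
 qed
 then show ?thesis using True by simp
next
 case False
 then have c: "0 < c" using assms by simp
 have "(1 / c)\<^sup>2 * n * c = n / c" using c by (simp add: power2_eq_square)
 then have "n / c \<le> a" using assms(1)[of "1 / c"] by simp
 then show ?thesis using c by (simp add: field_simps)
qed

text \<open>The form need not be definite, so the quadratic polynomial is only required to be nonnegative.\<close>

lemma psd_cauchy_schwarz_sq:
 assumes b: "psd V b" and V: "cvs.subspace V" and u: "u \<in> V" and v: "v \<in> V"
 shows "(cmod (b u v))\<^sup>2 \<le> Re (b u u) * Re (b v v)"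
proof -
 define \<beta> where "\<beta> = b u v"
 have s: "sesq V b" using b psd_sesq by auto
 have key: "0 \<le> Re (b u u) - 2 * t * (cmod \<beta>)\<^sup>2 + t\<^sup>2 * (cmod \<beta>)\<^sup>2 * Re (b v v)" for t :: real
 proof -
  define l where "l = - (of_real t * \<beta>)"
  have lv: "l *\<^sub>C v \<in> V" using v V cvs.subspace_scale by blast
  have w: "u + l *\<^sub>C v \<in> V" using u lv V cvs.subspace_add by blast
  have "b (u + l *\<^sub>C v) (u + l *\<^sub>C v) = b u u + cnj l * b u v + l * b v u + l * cnj l * b v v"
   using sesqD(1)[OF s u lv w] sesqD(2)[OF s u lv u] sesqD(2)[OF s u lv lv]
    sesqD(3)[OF s v lv, of l] sesqD(3)[OF s v u, of l] sesqD(4)[OF s u v, of l]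
    sesqD(4)[OF s v v, of l] by (simp add: algebra_simps)
  moreover have "b v u = cnj \<beta>" using b u v unfolding psd_def \<beta>_def by blast
  moreover have "b v v = of_real (Re (b v v))" using psd_real[OF b v] .
  moreover have "Re (cnj l * \<beta>) = - t * (cmod \<beta>)\<^sup>2" "Re (l * cnj \<beta>) = - t * (cmod \<beta>)\<^sup>2"
   "l * cnj l = of_real (t\<^sup>2 * (cmod \<beta>)\<^sup>2)"
   unfolding cmod_power2 l_def
   by (simp_all add: algebra_simps power2_eq_square complex_eq_iff)
  moreover have "0 \<le> Re (b (u + l *\<^sub>C v) (u + l *\<^sub>C v))" using b w unfolding psd_def by blast
  ultimately have "0 \<le> Re (b u u + cnj l * \<beta> + l * cnj \<beta> + of_real (t\<^sup>2 * (cmod \<beta>)\<^sup>2) * of_real (Re (b v v)))"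
   by (simp only: \<beta>_def)
  also have "... = Re (b u u) + Re (cnj l * \<beta>) + Re (l * cnj \<beta>) + t\<^sup>2 * (cmod \<beta>)\<^sup>2 * Re (b v v)"
   by (simp only: of_real_mult[symmetric] plus_complex.simps Re_complex_of_real)
  finally show ?thesis
   unfolding \<open>Re (cnj l * \<beta>) = - t * (cmod \<beta>)\<^sup>2\<close> \<open>Re (l * cnj \<beta>) = - t * (cmod \<beta>)\<^sup>2\<close> by simp
 qed
 have "0 \<le> Re (b v v)" using b v unfolding psd_def by blast
 then have "(cmod \<beta>)\<^sup>2 \<le> Re (b u u) * Re (b v v)"
  by (intro quadratic_nonneg[of "Re (b u u)" "(cmod \<beta>)\<^sup>2" "Re (b v v)"] key zero_le_power2)
 then show ?thesis by (simp only: \<beta>_def)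
qed

lemma psd_cauchy_schwarz:
 assumes "psd V b" "cvs.subspace V" "u \<in> V" "v \<in> V"
 shows "cmod (b u v) \<le> snorm b u * snorm b v"
 unfolding snorm_def real_sqrt_mult[symmetric]
 by (rule real_le_rsqrt[OF psd_cauchy_schwarz_sq[OF assms]])

lemma snorm_nonneg [simp]: "psd V b ==> u \<in> V ==> 0 \<le> snorm b u"
 by (simp add: snorm_def psd_nonneg)

lemma snorm_sq: "psd V b ==> u \<in> V ==> (snorm b u)\<^sup>2 = Re (b u u)"
 by (simp add: snorm_def psd_nonneg)

lemma snorm_triangle:
 assumes b: "psd V b" and V: "cvs.subspace V" and u: "u \<in> V" and v: "v \<in> V"
 shows "snorm b (u + v) \<le> snorm b u + snorm b v"
proof -
 have s: "sesq V b" using b psd_sesq by auto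
 have w: "u + v \<in> V" using u v V cvs.subspace_add by blast
 have "(snorm b (u + v))\<^sup>2 = Re (b u u) + Re (b u v) + Re (b v u) + Re (b v v)"
  using sesqD(1)[OF s u v w] sesqD(2)[OF s u v u] sesqD(2)[OF s u v v] snorm_sq[OF b w] by simp
 also have "... \<le> (snorm b u)\<^sup>2 + 2 * (snorm b u * snorm b v) + (snorm b v)\<^sup>2"
  using psd_cauchy_schwarz[OF b V u v] psd_cauchy_schwarz[OF b V v u]
   complex_Re_le_cmod[of "b u v"] complex_Re_le_cmod[of "b v u"] snorm_sq[OF b u] snorm_sq[OF b v]
  by (simp add: mult.commute)
 also have "... = (snorm b u + snorm b v)\<^sup>2" by (simp add: power2_eq_square algebra_simps)
 finally show ?thesis using power2_le_imp_le snorm_nonneg[OF b u] snorm_nonneg[OF b v] by fastforce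
qed

lemma snorm_scl:
 assumes "psd V b" "cvs.subspace V" "u \<in> V"
 shows "snorm b (c *\<^sub>C u) = cmod c * snorm b u"
proof -
 have s: "sesq V b" using assms psd_sesq by auto
 have cu: "c *\<^sub>C u \<in> V" using assms cvs.subspace_scale by blast
 have "b (c *\<^sub>C u) (c *\<^sub>C u) = (c * cnj c) * b u u"
  using sesqD(3)[OF s assms(3) cu, of c] sesqD(4)[OF s assms(3,3), of c] by simp
 then have "Re (b (c *\<^sub>C u) (c *\<^sub>C u)) = (cmod c)\<^sup>2 * Re (b u u)"
  by (simp add: complex_norm_square[symmetric] del: of_real_power)
 then show ?thesis by (simp add: snorm_def real_sqrt_mult)
qed

lemma snorm_minus:
 assumes "psd V b" "cvs.subspace V" "u \<in> V"
 shows "snorm b (- u) = snorm b u"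
 using snorm_scl[OF assms, of "-1"] by (simp add: scl_def fun_Compl_def)

lemma snorm_diff:
 assumes "psd V b" "cvs.subspace V" "u \<in> V" "v \<in> V"
 shows "snorm b (u - v) \<le> snorm b u + snorm b v"
 using snorm_triangle[OF assms(1-3), of "- v"] snorm_minus[OF assms(1,2,4)] assms cvs.subspace_neg
 by auto

lemma snorm_sum:
 assumes b: "psd V b" and V: "cvs.subspace V" and f: "\<And>i. i \<in> A ==> f i \<in> V"
 shows "snorm b (\<Sum>i\<in>A. f i) \<le> (\<Sum>i\<in>A. snorm b (f i))"
 using f
proof (induction A rule: infinite_finite_induct)
 case (insert x A)
 have "(\<Sum>i\<in>A. f i) \<in> V" using insert by (intro cvs.subspace_sum V) auto
 then show ?case using insert snorm_triangle[OF b V, of "f x" "\<Sum>i\<in>A. f i"] by auto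
qed (use sesq_zero[OF psd_sesq[OF b] V cvs.subspace_0[OF V]] in \<open>auto simp: snorm_def\<close>)

lemma riesz_unique_solution:
 assumes "fdim V" "psd V b" "\<And>u. u \<in> V ==> b u u = 0 ==> u = 0" "antilin V F"
 shows "\<exists>!u. u \<in> V \<and> (\<forall>w\<in>V. b u w = F w)"
 by (rule galerkin_unique_solution[OF assms(1) psd_sesq[OF assms(2)] _ assms(4)]) (use assms(3) in blast)

lemma variational_solution:
 assumes "\<exists>!u. u \<in> V \<and> (\<forall>w\<in>V. b u w = F w)"
 shows "variational_solution V b F \<in> V" "w \<in> V ==> b (variational_solution V b F) w = F w"
  "u \<in> V ==> (\<And>w. w \<in> V ==> b u w = F w) ==> variational_solution V b F = u"
proof -
 note * = theI'[OF assms, folded variational_solution_def]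
 show "variational_solution V b F \<in> V" "w \<in> V ==> b (variational_solution V b F) w = F w"
  using * by auto
 show "u \<in> V ==> (\<And>w. w \<in> V ==> b u w = F w) ==> variational_solution V b F = u"
  using * assms by blast
qed

lemma complex_span_eq: "finite I ==> complex_span I f = cvs.span (f ` I)"
proof
 assume I: "finite I"
 show "complex_span I f \<subseteq> cvs.span (f ` I)"
 proof
  fix u assume "u \<in> complex_span I f"
  then obtain c where "u = (\<lambda>x. \<Sum>i\<in>I. c i * f i x)" by (auto simp: complex_span_def)
  then have "u = (\<Sum>i\<in>I. c i *\<^sub>C f i)" by (simp add: fun_eq_iff fapply)
  also have "... \<in> cvs.span (f ` I)"
   by (intro cvs.span_sum cvs.span_scale cvs.span_base) auto
  finally show "u \<in> cvs.span (f ` I)" .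
 qed
 show "cvs.span (f ` I) \<subseteq> complex_span I f"
 proof (rule cvs.span_minimal)
  show "f ` I \<subseteq> complex_span I f"
  proof
   fix u assume "u \<in> f ` I"
   then obtain j where j: "j \<in> I" "u = f j" by auto
   have "(\<Sum>i\<in>I. (if i = j then 1 else 0) * f i x) = u x" for x
   proof -
    have "(\<Sum>i\<in>I. (if i = j then 1 else 0) * f i x) = (\<Sum>i\<in>I. if i = j then f i x else 0)"
     by (intro sum.cong) auto
    then show ?thesis using I j by (simp add: sum.delta)
   qed
   then have "u = (\<lambda>x. \<Sum>i\<in>I. (if i = j then 1 else 0) * f i x)" by simp
   then show "u \<in> complex_span I f"
    unfolding complex_span_def by (intro CollectI exI[of _ "\<lambda>i. if i = j then 1 else 0"]) simp
  qed
  have a: "\<exists>c. (\<lambda>x. \<Sum>i\<in>I. c1 i * f i x) + (\<lambda>x. \<Sum>i\<in>I. c2 i * f i x) = (\<lambda>x. \<Sum>i\<in>I. c i * f i x)" for c1 c2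
   by (intro exI[of _ "\<lambda>i. c1 i + c2 i"]) (simp add: fun_eq_iff fapply sum.distrib algebra_simps)
  have s: "\<exists>c. a *\<^sub>C (\<lambda>x. \<Sum>i\<in>I. c1 i * f i x) = (\<lambda>x. \<Sum>i\<in>I. c i * f i x)" for c1 a
   by (intro exI[of _ "\<lambda>i. a * c1 i"]) (simp add: fun_eq_iff fapply sum_distrib_left algebra_simps)
  have z: "\<exists>c. 0 = (\<lambda>x. \<Sum>i\<in>I. c i * f i x)"
   by (intro exI[of _ "\<lambda>i. 0"]) (simp add: fun_eq_iff fapply)
  show "cvs.subspace (complex_span I f)"
   unfolding cvs.subspace_def complex_span_def using a s z by blast
 qed
qed

section \<open>Polynomials in the plane\<close>

definition mono2 :: "nat \<Rightarrow> nat \<Rightarrow> scalar_fun" where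
 "mono2 i j = (\<lambda>x. of_real ((x $ 1) ^ i * (x $ 2) ^ j))"

definition Pol :: "nat \<Rightarrow> scalar_fun set" where
 "Pol p = cvs.span {mono2 i j | i j. i + j \<le> p}"

lemma Pol_subspace: "cvs.subspace (Pol p)"
 by (simp add: Pol_def)

lemma Pol_fdim: "fdim (Pol p)"
proof -
 have "{mono2 i j | i j. i + j \<le> p} \<subseteq> (\<lambda>(i, j). mono2 i j) ` ({..p} \<times> {..p})" by auto
 then have "finite {mono2 i j | i j. i + j \<le> p}" by (rule finite_subset) auto
 then show ?thesis unfolding fdim_def Pol_def by auto
qed

lemma Pol_coeffs: "q \<in> Pol p \<longleftrightarrow> (\<exists>c. \<forall>x. q x = (\<Sum>i\<le>p. \<Sum>j\<le>p - i. c i j * of_real ((x $ 1) ^ i * (x $ 2) ^ j)))"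
 (is "_ \<longleftrightarrow> ?R q")
proof
 have "Pol p \<subseteq> {q. ?R q}"
  unfolding Pol_def
 proof (rule cvs.span_minimal)
  show "{mono2 i j | i j. i + j \<le> p} \<subseteq> {q. ?R q}"
  proof clarify
   fix i0 j0 assume ij: "i0 + j0 \<le> p"
   define c where "c i j = (if i = i0 \<and> j = j0 then 1 else (0::complex))" for i j
   have "mono2 i0 j0 x = (\<Sum>i\<le>p. \<Sum>j\<le>p - i. c i j * of_real ((x $ 1) ^ i * (x $ 2) ^ j))" for x
   proof -
    have "(\<Sum>j\<le>p - i. c i j * of_real ((x $ 1) ^ i * (x $ 2) ^ j)) = (if i = i0 then mono2 i0 j0 x else 0)" if "i \<le> p" for i
    proof -
     have "(\<Sum>j\<le>p - i. c i j * of_real ((x $ 1) ^ i * (x $ 2) ^ j))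
       = (\<Sum>j\<le>p - i. if j = j0 then (if i = i0 then mono2 i0 j0 x else 0) else 0)"
      by (intro sum.cong) (auto simp: c_def mono2_def)
     also have "... = (if i = i0 then mono2 i0 j0 x else 0)"
      using ij by (auto simp: sum.delta)
     finally show ?thesis .
    qed
    then have "(\<Sum>i\<le>p. \<Sum>j\<le>p - i. c i j * of_real ((x $ 1) ^ i * (x $ 2) ^ j))
      = (\<Sum>i\<le>p. if i = i0 then mono2 i0 j0 x else 0)" by (intro sum.cong) auto
    also have "... = mono2 i0 j0 x" using ij by (simp add: sum.delta)
    finally show ?thesis by simp
   qed
   then show "?R (mono2 i0 j0)" by blast
  qed
  show "cvs.subspace {q. ?R q}"
   unfolding cvs.subspace_def
  proof (intro conjI ballI allI)
   show "0 \<in> {q. ?R q}" by (auto simp: zero_fun_apply intro!: exI[of _ "\<lambda>i j. 0"])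
   fix u v assume "u \<in> {q. ?R q}" "v \<in> {q. ?R q}"
   then obtain c d where "\<forall>x. u x = (\<Sum>i\<le>p. \<Sum>j\<le>p - i. c i j * of_real ((x $ 1) ^ i * (x $ 2) ^ j))"
    "\<forall>x. v x = (\<Sum>i\<le>p. \<Sum>j\<le>p - i. d i j * of_real ((x $ 1) ^ i * (x $ 2) ^ j))" by blast
   then have "\<forall>x. (u + v) x = (\<Sum>i\<le>p. \<Sum>j\<le>p - i. (c i j + d i j) * of_real ((x $ 1) ^ i * (x $ 2) ^ j))"
    by (simp only: plus_fun_apply sum.distrib distrib_right) simp
   then show "u + v \<in> {q. ?R q}" by (intro CollectI exI[of _ "\<lambda>i j. c i j + d i j"]) simp
  next
   fix a u assume "u \<in> {q. ?R q}"
   then obtain c where "\<forall>x. u x = (\<Sum>i\<le>p. \<Sum>j\<le>p - i. c i j * of_real ((x $ 1) ^ i * (x $ 2) ^ j))" by blast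
   then have "\<forall>x. (a *\<^sub>C u) x = (\<Sum>i\<le>p. \<Sum>j\<le>p - i. (a * c i j) * of_real ((x $ 1) ^ i * (x $ 2) ^ j))"
    by (simp add: scl_apply sum_distrib_left mult.assoc)
   then show "a *\<^sub>C u \<in> {q. ?R q}" by (intro CollectI exI[of _ "\<lambda>i j. a * c i j"]) simp
  qed
 qed
 then show "q \<in> Pol p ==> ?R q" by auto
next
 assume "?R q"
 then obtain c where c: "\<forall>x. q x = (\<Sum>i\<le>p. \<Sum>j\<le>p - i. c i j * of_real ((x $ 1) ^ i * (x $ 2) ^ j))" by blast
 have "q = (\<Sum>i\<le>p. \<Sum>j\<le>p - i. c i j *\<^sub>C mono2 i j)"
  by (rule ext) (simp add: c fapply mono2_def)
 also have "... \<in> Pol p"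
  unfolding Pol_def by (intro cvs.span_sum cvs.span_scale cvs.span_base CollectI exI conjI refl) auto
 finally show "q \<in> Pol p" .
qed

lemma Pol_coeffsE:
 assumes "q \<in> Pol p"
 obtains c where "\<forall>x. q x = (\<Sum>i\<le>p. \<Sum>j\<le>p - i. c i j * of_real ((x $ 1) ^ i * (x $ 2) ^ j))"
proof -
 have "\<exists>c. \<forall>x. q x = (\<Sum>i\<le>p. \<Sum>j\<le>p - i. c i j * of_real ((x $ 1) ^ i * (x $ 2) ^ j))"
  using assms unfolding Pol_coeffs .
 then show thesis
 proof (rule exE)
  fix c assume "\<forall>x. q x = (\<Sum>i\<le>p. \<Sum>j\<le>p - i. c i j * of_real ((x $ 1) ^ i * (x $ 2) ^ j))"
  then show thesis by (rule that)
 qed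
qed

lemma poly_on_iff: "poly_on p T v \<longleftrightarrow> (\<exists>q\<in>Pol p. \<forall>x\<in>T. v x = q x)"
proof
 assume "poly_on p T v"
 then obtain c where c: "\<forall>x\<in>T. v x = (\<Sum>i\<le>p. \<Sum>j\<le>p - i. c i j * of_real ((x $ 1) ^ i * (x $ 2) ^ j))"
  unfolding poly_on_def by blast
 define q :: scalar_fun where "q = (\<lambda>x. \<Sum>i\<le>p. \<Sum>j\<le>p - i. c i j * of_real ((x $ 1) ^ i * (x $ 2) ^ j))"
 have "q \<in> Pol p" unfolding Pol_coeffs q_def by blast
 moreover have "\<forall>x\<in>T. v x = q x" using c unfolding q_def .
 ultimately show "\<exists>q\<in>Pol p. \<forall>x\<in>T. v x = q x" by blast
next
 assume "\<exists>q\<in>Pol p. \<forall>x\<in>T. v x = q x"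
 then obtain q where q: "q \<in> Pol p" "\<forall>x\<in>T. v x = q x" by blast
 from q(1) obtain c where "\<forall>x. q x = (\<Sum>i\<le>p. \<Sum>j\<le>p - i. c i j * of_real ((x $ 1) ^ i * (x $ 2) ^ j))"
  by (rule Pol_coeffsE)
 note c = spec[OF this]
 show "poly_on p T v" unfolding poly_on_def
 proof (intro exI[of _ c] ballI)
  fix x assume "x \<in> T"
  then show "v x = (\<Sum>i\<le>p. \<Sum>j\<le>p - i. c i j * of_real ((x $ 1) ^ i * (x $ 2) ^ j))"
   unfolding c[symmetric] using q(2) by blast
 qed
qed

lemma Pol_mono: "p \<le> q ==> Pol p \<subseteq> Pol q"
 unfolding Pol_def by (rule cvs.span_mono, clarify, intro exI conjI, rule refl, linarith)

lemma mono2_Pol: "i + j \<le> p ==> mono2 i j \<in> Pol p"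
 unfolding Pol_def by (rule cvs.span_base) blast

lemma Pol_induct [consumes 1, case_names zero add scale mono]:
 assumes "q \<in> Pol p" "P 0" "\<And>u v. P u ==> P v ==> P (u + v)" "\<And>c u. P u ==> P (c *\<^sub>C u)"
  "\<And>i j. i + j \<le> p ==> P (mono2 i j)"
 shows "P q"
proof -
 have "Pol p \<subseteq> {q. P q}"
  unfolding Pol_def using assms
  by (intro cvs.span_minimal) (auto simp: cvs.subspace_def)
 then show ?thesis using assms(1) by auto
qed

lemma Pol_add: "u \<in> Pol p ==> v \<in> Pol p ==> (\<lambda>x. u x + v x) \<in> Pol p"
 using cvs.subspace_add[OF Pol_subspace, of u p v] by (simp add: plus_fun_def)

lemma Pol_scale: "u \<in> Pol p ==> (\<lambda>x. c * u x) \<in> Pol p"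
 using cvs.subspace_scale[OF Pol_subspace, of u p c] by (simp add: scl_def)

lemma Pol_sum: "(\<And>i. i \<in> I ==> u i \<in> Pol p) ==> (\<lambda>x. \<Sum>i\<in>I. u i x) \<in> Pol p"
proof -
 assume u: "\<And>i. i \<in> I ==> u i \<in> Pol p"
 have "(\<lambda>x. \<Sum>i\<in>I. u i x) = (\<Sum>i\<in>I. u i)" by (rule ext) (simp only: sum_fun_apply)
 then show ?thesis using cvs.subspace_sum[OF Pol_subspace, of I u p] u by simp
qed

lemma Pol_const: "(\<lambda>x. c) \<in> Pol p"
proof -
 have "c *\<^sub>C mono2 0 0 \<in> Pol p"
  unfolding Pol_def by (intro cvs.span_scale cvs.span_base CollectI exI conjI refl) auto
 then show ?thesis by (simp add: scl_def mono2_def)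
qed

lemma Pol_mult:
 assumes "u \<in> Pol p" "v \<in> Pol q"
 shows "(\<lambda>x. u x * v x) \<in> Pol (p + q)"
 using assms(1)
proof (induction rule: Pol_induct)
 case zero then show ?case using Pol_const[of 0] by (simp add: zero_fun_apply)
next
 case (add a b)
 then show ?case using Pol_add[OF add] by (simp add: plus_fun_apply distrib_right)
next
 case (scale c a)
 then show ?case using Pol_scale[OF scale, of c] by (simp add: scl_apply mult.assoc)
next
 case (mono i j)
 show ?case using assms(2)
 proof (induction rule: Pol_induct)
  case zero then show ?case using Pol_const[of 0] by (simp add: zero_fun_apply)
 next
  case (add a b)
  then show ?case using Pol_add[OF add] by (simp add: plus_fun_apply distrib_left)
 next
  case (scale c a)
  then show ?case using Pol_scale[OF scale, of c] by (simp add: scl_apply mult.left_commute)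
 next
  case (mono k l)
  have "(\<lambda>x. mono2 i j x * mono2 k l x) = mono2 (i + k) (j + l)"
   by (auto simp: mono2_def fun_eq_iff power_add)
  moreover have "mono2 (i + k) (j + l) \<in> Pol (p + q)"
   unfolding Pol_def using \<open>i + j \<le> p\<close> \<open>k + l \<le> q\<close>
   by (intro cvs.span_base CollectI exI[of _ "i + k"] exI[of _ "j + l"]) auto
  ultimately show ?case by simp
 qed
qed

lemma Pol_power: "u \<in> Pol 1 ==> (\<lambda>x. u x ^ n) \<in> Pol n"
proof (induction n)
 case 0 then show ?case using Pol_const[of 1] by simp
next
 case (Suc n)
 then show ?case using Pol_mult[of u 1 "\<lambda>x. u x ^ n" n] by simp
qed

lemma Pol_prod: "finite I ==> (\<And>i. i \<in> I ==> u i \<in> Pol (k i)) ==> (\<lambda>x. \<Prod>i\<in>I. u i x) \<in> Pol (\<Sum>i\<in>I. k i)"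
proof (induction I rule: finite_induct)
 case empty then show ?case using Pol_const[of 1] by simp
next
 case (insert a I)
 then show ?case using Pol_mult[of "u a" "k a" "\<lambda>x. \<Prod>i\<in>I. u i x" "\<Sum>i\<in>I. k i"] by simp
qed

lemma Pol_affine: "(\<lambda>x. of_real (\<alpha> + \<beta> * x $ 1 + \<gamma> * x $ 2)) \<in> Pol 1"
proof -
 have "of_real \<alpha> *\<^sub>C mono2 0 0 + (of_real \<beta> *\<^sub>C mono2 1 0 + of_real \<gamma> *\<^sub>C mono2 0 1) \<in> Pol 1"
  unfolding Pol_def by (intro cvs.span_add cvs.span_scale cvs.span_base CollectI exI conjI refl) auto
 then show ?thesis by (simp add: plus_fun_def scl_def mono2_def add.assoc)
qed

lemma Pol_compose_affine:
 assumes "q \<in> Pol p" "(\<lambda>x. of_real (A x $ 1)) \<in> Pol 1" "(\<lambda>x. of_real (A x $ 2)) \<in> Pol 1"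
 shows "(\<lambda>x. q (A x)) \<in> Pol p"
 using assms(1)
proof (induction rule: Pol_induct)
 case zero then show ?case using Pol_const[of 0] by (simp add: zero_fun_apply)
next
 case (add a b)
 then show ?case using Pol_add[OF add] by (simp add: plus_fun_apply)
next
 case (scale c a)
 then show ?case using Pol_scale[OF scale, of c] by (simp add: scl_apply)
next
 case (mono i j)
 have "(\<lambda>x. of_real (A x $ 1) ^ i * of_real (A x $ 2) ^ j) \<in> Pol (i + j)"
  using Pol_mult[OF Pol_power[OF assms(2)] Pol_power[OF assms(3)]] .
 then show ?case using Pol_mono[OF mono] by (auto simp: mono2_def)
qed

lemma Pol_derivative:
 assumes "q \<in> Pol p"
 shows "\<exists>q1\<in>Pol p. \<exists>q2\<in>Pol p. \<forall>x. (q has_derivative (\<lambda>h. q1 x * of_real (h $ 1) + q2 x * of_real (h $ 2))) (at x)"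
 using assms
proof (induction rule: Pol_induct)
 case zero
 then show ?case
  by (intro bexI[of _ "\<lambda>x. 0"] Pol_const) (auto simp: zero_fun_def)
next
 case (add a b)
 then obtain a1 a2 b1 b2 where ab: "a1 \<in> Pol p" "a2 \<in> Pol p" "b1 \<in> Pol p" "b2 \<in> Pol p"
  "\<And>x. (a has_derivative (\<lambda>h. a1 x * of_real (h $ 1) + a2 x * of_real (h $ 2))) (at x)"
  "\<And>x. (b has_derivative (\<lambda>h. b1 x * of_real (h $ 1) + b2 x * of_real (h $ 2))) (at x)" by blast
 define q1 where "q1 = (\<lambda>x. a1 x + b1 x)"
 define q2 where "q2 = (\<lambda>x. a2 x + b2 x)"
 have "(a + b has_derivative (\<lambda>h. q1 x * of_real (h $ 1) + q2 x * of_real (h $ 2))) (at x)" for x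
  unfolding plus_fun_def
  by (rule has_derivative_eq_rhs[OF has_derivative_add[OF ab(5,6)]]) (simp add: algebra_simps q1_def q2_def)
 moreover have "q1 \<in> Pol p" "q2 \<in> Pol p" unfolding q1_def q2_def by (intro Pol_add ab)+
 ultimately show ?case by blast
next
 case (scale c a)
 then obtain a1 a2 where ab: "a1 \<in> Pol p" "a2 \<in> Pol p"
  "\<And>x. (a has_derivative (\<lambda>h. a1 x * of_real (h $ 1) + a2 x * of_real (h $ 2))) (at x)" by blast
 define q1 where "q1 = (\<lambda>x. c * a1 x)"
 define q2 where "q2 = (\<lambda>x. c * a2 x)"
 have "(c *\<^sub>C a has_derivative (\<lambda>h. q1 x * of_real (h $ 1) + q2 x * of_real (h $ 2))) (at x)" for x
  unfolding scl_def
  by (rule has_derivative_eq_rhs[OF has_derivative_mult_right[OF ab(3)]]) (simp add: algebra_simps q1_def q2_def)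
 moreover have "q1 \<in> Pol p" "q2 \<in> Pol p" unfolding q1_def q2_def by (intro Pol_scale ab)+
 ultimately show ?case by blast
next
 case (mono i j)
 define q1 where "q1 = of_nat i *\<^sub>C mono2 (i - 1) j"
 define q2 where "q2 = of_nat j *\<^sub>C mono2 i (j - 1)"
 have P: "q1 \<in> Pol p" "q2 \<in> Pol p"
  unfolding q1_def q2_def using mono
  by (auto intro!: cvs.subspace_scale[OF Pol_subspace] mono2_Pol)
 have "(mono2 i j has_derivative (\<lambda>h. q1 x * of_real (h $ 1) + q2 x * of_real (h $ 2))) (at x)" for x
 proof -
  have c: "((\<lambda>x::pt. x $ k) has_derivative (\<lambda>h. h $ k)) (at x)" for k
   by (rule bounded_linear.has_derivative[OF bounded_linear_vec_nth has_derivative_ident])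
  have "((\<lambda>x. (x $ 1) ^ i * (x $ 2) ^ j) has_derivative
    (\<lambda>h. (x $ 1) ^ i * (of_nat j * (h $ 2) * (x $ 2) ^ (j - 1)) + (of_nat i * (h $ 1) * (x $ 1) ^ (i - 1)) * (x $ 2) ^ j)) (at x)"
   by (rule has_derivative_mult[OF has_derivative_power[OF c] has_derivative_power[OF c]])
  from has_derivative_of_real[OF this] show ?thesis
   unfolding mono2_def q1_def q2_def
   by (rule has_derivative_eq_rhs) (auto simp: scl_def mono2_def fun_eq_iff algebra_simps)
 qed
 then show ?case using P by blast
qed

lemma Pol_continuous: "q \<in> Pol p ==> continuous_on S q"
 by (meson Pol_derivative continuous_at_imp_continuous_on has_derivative_continuous)

section \<open>Unisolvence of the Lagrange nodes\<close>

text \<open>By induction on the degree: a polynomial vanishing on the bottom row of the lattice is divisible by the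
 second coordinate, and the quotient vanishes on the remaining, smaller lattice.\<close>

lemma Pol_lattice_zero:
 assumes "q \<in> Pol p" "\<And>i j. i + j \<le> p ==> q (vector [of_nat i, of_nat j]) = 0"
 shows "q = 0"
 using assms
proof (induction p arbitrary: q)
 case 0
 from 0(1) obtain c0 where "\<forall>x. q x = (\<Sum>i\<le>0. \<Sum>j\<le>0 - i. c0 i j * of_real ((x $ 1) ^ i * (x $ 2) ^ j))"
  by (rule Pol_coeffsE)
 note c0 = spec[OF this]
 define c where "c = c0 0 0"
 have c: "q x = c" for x unfolding c0 c_def by simp
 then have "c = 0" using 0(2)[of 0 0] by simp
 then show ?case using c by (auto simp: fun_eq_iff zero_fun_apply)
next
 case (Suc p)
 from Suc.prems(1) obtain c where "\<forall>x. q x = (\<Sum>i\<le>Suc p. \<Sum>j\<le>Suc p - i. c i j * of_real ((x $ 1) ^ i * (x $ 2) ^ j))"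
  by (rule Pol_coeffsE)
 note c = spec[OF this]
 have c0: "c i 0 = 0" if "i \<le> Suc p" for i
 proof (rule ccontr)
  assume n: "c i 0 \<noteq> 0"
  let ?Z = "{z::complex. (\<Sum>i\<le>Suc p. c i 0 * z ^ i) = 0}"
  have Z: "finite ?Z \<and> card ?Z \<le> Suc p"
   by (rule Transcendental.polyfun_rootbound[where c="\<lambda>i. c i 0", OF n that])
  have "of_nat ` {..Suc p} \<subseteq> ?Z"
  proof (rule subsetI)
   fix z :: complex assume "z \<in> of_nat ` {..Suc p}"
   then obtain k where k: "k \<in> {..Suc p}" "z = of_nat k" by blast
   then have "0 = q (vector [of_nat k, of_nat 0])" using Suc.prems(2)[of k 0] by auto
   also have "... = (\<Sum>i\<le>Suc p. c i 0 * of_nat k ^ i)"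
    unfolding c
   proof (rule sum.cong[OF refl])
    fix i
    have "(\<Sum>j\<le>Suc p - i. c i j * of_real (((vector [of_nat k, of_nat 0]::pt) $ 1) ^ i * ((vector [of_nat k, of_nat 0]::pt) $ 2) ^ j))
      = (\<Sum>j\<in>{0}. c i j * of_real (((vector [of_nat k, of_nat 0]::pt) $ 1) ^ i * ((vector [of_nat k, of_nat 0]::pt) $ 2) ^ j))"
     by (rule sum.mono_neutral_right) (auto simp: vector_2)
    then show "(\<Sum>j\<le>Suc p - i. c i j * of_real (((vector [of_nat k, of_nat 0]::pt) $ 1) ^ i * ((vector [of_nat k, of_nat 0]::pt) $ 2) ^ j))
      = c i 0 * of_nat k ^ i" by (simp add: vector_2)
   qed
   finally show "z \<in> ?Z" using k by simp
  qed
  then have "card (of_nat ` {..Suc p} :: complex set) \<le> card ?Z" using Z card_mono by blast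
  also have "... \<le> Suc p" using Z by auto
  finally show False by (subst (asm) card_image) (auto simp: inj_on_def)
 qed
 define q1 :: scalar_fun where "q1 = (\<lambda>x. \<Sum>i\<le>p. \<Sum>j\<le>p - i. c i (Suc j) * of_real ((x $ 1) ^ i * (x $ 2) ^ j))"
 have q1: "q1 \<in> Pol p" unfolding Pol_coeffs q1_def by (rule exI[of _ "\<lambda>i j. c i (Suc j)"]) blast
 have qq: "q x = of_real (x $ 2) * q1 x" for x
 proof -
  have "q x = (\<Sum>i\<le>p. \<Sum>j\<le>Suc p - i. c i j * of_real ((x $ 1) ^ i * (x $ 2) ^ j))"
   unfolding c using c0[of "Suc p"] by simp
  also have "... = (\<Sum>i\<le>p. of_real (x $ 2) * (\<Sum>j\<le>p - i. c i (Suc j) * of_real ((x $ 1) ^ i * (x $ 2) ^ j)))"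
  proof (rule sum.cong[OF refl])
   fix i assume i: "i \<in> {..p}"
   have e: "Suc p - i = Suc (p - i)" using i by auto
   show "(\<Sum>j\<le>Suc p - i. c i j * of_real ((x $ 1) ^ i * (x $ 2) ^ j)) =
     of_real (x $ 2) * (\<Sum>j\<le>p - i. c i (Suc j) * of_real ((x $ 1) ^ i * (x $ 2) ^ j))"
    unfolding e sum.atMost_Suc_shift sum_distrib_left using c0[of i] i
    by (auto intro!: sum.cong simp: mult_ac)
  qed
  also have "... = of_real (x $ 2) * q1 x" by (simp add: q1_def sum_distrib_left)
  finally show ?thesis .
 qed
 define q2 where "q2 = (\<lambda>x. q1 (x + vector [0, 1]))"
 have a1: "(\<lambda>x. of_real ((x + vector [0, 1] :: pt) $ 1)) \<in> Pol 1"
  using Pol_affine[of 0 1 0] by (simp add: vector_2)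
 have a2: "(\<lambda>x. of_real ((x + vector [0, 1] :: pt) $ 2)) \<in> Pol 1"
  using Pol_affine[of 1 0 1] by (simp add: vector_2 add.commute)
 have "q2 \<in> Pol p" unfolding q2_def by (rule Pol_compose_affine[OF q1 a1 a2])
 moreover have "q2 (vector [of_nat i, of_nat j]) = 0" if "i + j \<le> p" for i j
 proof -
  have "vector [of_nat i, of_nat j] + vector [0, 1] = (vector [of_nat i, of_nat (Suc j)] :: pt)"
   by (simp add: vec_eq_iff forall_2 vector_2)
  moreover have "q (vector [of_nat i, of_nat (Suc j)]) = 0" using Suc.prems(2)[of i "Suc j"] that by simp
  ultimately show ?thesis unfolding q2_def qq by (simp add: vector_2 del: of_nat_Suc)
 qed
 ultimately have "q2 = 0" by (rule Suc.IH)
 then have "q2 (x - vector [0, 1]) = 0" for x by (simp add: zero_fun_apply)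
 then have "q1 x = 0" for x by (simp add: q2_def)
 then show ?case by (auto simp: fun_eq_iff qq zero_fun_apply)
qed

section \<open>Lagrange interpolation on triangles\<close>

definition triangle_verts :: "pt set \<Rightarrow> bool" where
 "triangle_verts V \<longleftrightarrow> finite V \<and> \<not> affine_dependent V \<and> card V = 3"

text \<open>Barycentric coordinates with respect to an affinely independent set.\<close>

definition bc :: "pt set \<Rightarrow> pt \<Rightarrow> pt \<Rightarrow> real" where
 "bc V x = (SOME u. sum u V = 1 \<and> (\<Sum>a\<in>V. u a *\<^sub>R a) = x \<and> (\<forall>a. a \<notin> V \<longrightarrow> u a = 0))"

lemma bc_props:
 assumes "finite V" "x \<in> affine hull V"
 shows "sum (bc V x) V = 1" "(\<Sum>a\<in>V. bc V x a *\<^sub>R a) = x" "a \<notin> V ==> bc V x a = 0"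
proof -
 obtain u where u: "sum u V = 1" "(\<Sum>a\<in>V. u a *\<^sub>R a) = x"
  using assms affine_hull_finite[of V] by auto
 define w where "w a = (if a \<in> V then u a else 0)" for a
 define P where "P u \<longleftrightarrow> sum u V = 1 \<and> (\<Sum>a\<in>V. u a *\<^sub>R a) = x \<and> (\<forall>a. a \<notin> V \<longrightarrow> u a = 0)" for u
 have "P w" using u by (auto simp: w_def P_def)
 then have "P (Eps P)" by (rule someI[of P w])
 moreover have "bc V x = Eps P" unfolding bc_def P_def[abs_def] ..
 ultimately have *: "sum (bc V x) V = 1 \<and> (\<Sum>a\<in>V. bc V x a *\<^sub>R a) = x \<and> (\<forall>a. a \<notin> V \<longrightarrow> bc V x a = 0)"
  unfolding P_def by simp
 show "sum (bc V x) V = 1" "(\<Sum>a\<in>V. bc V x a *\<^sub>R a) = x" "a \<notin> V ==> bc V x a = 0"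
  using * by auto
qed

lemma bc_unique:
 assumes V: "finite V" "\<not> affine_dependent V"
  and u: "sum u V = 1" "(\<Sum>a\<in>V. u a *\<^sub>R a) = x" "\<And>a. a \<notin> V ==> u a = 0"
 shows "bc V x = u"
proof
 fix a
 have x: "x \<in> affine hull V" using affine_hull_finite[OF V(1)] u by auto
 note b = bc_props[OF V(1) x]
 show "bc V x a = u a"
 proof (cases "a \<in> V")
  case True
  define w where "w a = bc V x a - u a" for a
  have "sum w V = 0" using b(1) u(1) by (simp add: w_def sum_subtractf)
  moreover have "(\<Sum>a\<in>V. w a *\<^sub>R a) = 0"
   using b(2) u(2) by (simp add: w_def scaleR_diff_left sum_subtractf)
  ultimately have "w a = 0" using V affine_dependent_explicit_finite[OF V(1)] True by blast
  then show ?thesis by (simp add: w_def)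
 qed (use b(3) u(3) in auto)
qed

lemma triangle_affine_hull:
 assumes "triangle_verts V" shows "affine hull V = UNIV"
proof -
 have "aff_dim V = 2"
  using assms affine_independent_iff_card[of V] by (auto simp: triangle_verts_def)
 then have "aff_dim V = DIM(pt)" by simp
 then show ?thesis using aff_dim_eq_full[of V] by blast
qed

lemma bc_triangle:
 assumes "triangle_verts V"
 shows "sum (bc V x) V = 1" "(\<Sum>a\<in>V. bc V x a *\<^sub>R a) = x" "a \<notin> V ==> bc V x a = 0"
 using bc_props[of V x] assms triangle_affine_hull[OF assms] by (auto simp: triangle_verts_def)

lemma bc_triangle_unique:
 assumes "triangle_verts V" "sum u V = 1" "(\<Sum>a\<in>V. u a *\<^sub>R a) = x" "\<And>a. a \<notin> V ==> u a = 0"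
 shows "bc V x = u"
 using assms bc_unique[of V u x] by (auto simp: triangle_verts_def)

lemma convex_hull_bc:
 assumes V: "finite V" "\<not> affine_dependent V" and x: "x \<in> affine hull V"
 shows "x \<in> convex hull V \<longleftrightarrow> (\<forall>a\<in>V. 0 \<le> bc V x a)"
proof
 assume "x \<in> convex hull V"
 then obtain u where u: "\<forall>a\<in>V. 0 \<le> u a" "sum u V = 1" "(\<Sum>a\<in>V. u a *\<^sub>R a) = x"
  using convex_hull_finite[OF V(1)] by auto
 define w where "w a = (if a \<in> V then u a else 0)" for a
 have "bc V x = w" using u by (intro bc_unique V) (auto simp: w_def)
 then show "\<forall>a\<in>V. 0 \<le> bc V x a" using u by (auto simp: w_def)
next
 assume "\<forall>a\<in>V. 0 \<le> bc V x a"
 then show "x \<in> convex hull V"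
  using convex_hull_finite[OF V(1)] bc_props[OF V(1) x] by auto
qed

lemma triangle_bc_iff:
 assumes "triangle_verts V"
 shows "x \<in> convex hull V \<longleftrightarrow> (\<forall>a\<in>V. 0 \<le> bc V x a)"
 using convex_hull_bc[of V x] triangle_affine_hull[OF assms] assms by (auto simp: triangle_verts_def)

lemma bc_le_1:
 assumes "triangle_verts V" "x \<in> convex hull V"
 shows "0 \<le> bc V x a" "bc V x a \<le> 1"
proof -
 have p: "\<forall>a\<in>V. 0 \<le> bc V x a" using assms triangle_bc_iff by blast
 then show "0 \<le> bc V x a" using bc_triangle(3)[OF assms(1)] by (cases "a \<in> V") auto
 show "bc V x a \<le> 1"
 proof (cases "a \<in> V")
  case True
  then have "bc V x a \<le> sum (bc V x) V"
   using p assms(1) by (intro member_le_sum) (auto simp: triangle_verts_def)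
  then show ?thesis using bc_triangle(1)[OF assms(1)] by simp
 qed (use bc_triangle(3)[OF assms(1)] in auto)
qed

lemma bc_face:
 assumes V: "triangle_verts V" and W: "W \<subseteq> V" and x: "x \<in> convex hull W"
 shows "bc V x = bc W x"
proof -
 have "finite V" "\<not> affine_dependent V" using V by (auto simp: triangle_verts_def)
 then have fW: "finite W" "\<not> affine_dependent W"
  using W finite_subset[of W V] affine_dependent_subset[of W V] by blast+
 have "x \<in> affine hull W" using x convex_hull_subset_affine_hull by blast
 note b = bc_props[OF fW(1) this]
 have fV: "finite V" using V by (simp add: triangle_verts_def)
 show ?thesis
 proof (rule bc_triangle_unique[OF V])
  have "sum (bc W x) V = sum (bc W x) W" using W b(3) fV by (intro sum.mono_neutral_right) auto
  then show "sum (bc W x) V = 1" using b(1) by simp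
  have "(\<Sum>a\<in>V. bc W x a *\<^sub>R a) = (\<Sum>a\<in>W. bc W x a *\<^sub>R a)"
   using W b(3) fV by (intro sum.mono_neutral_right) auto
  then show "(\<Sum>a\<in>V. bc W x a *\<^sub>R a) = x" using b(2) by simp
 qed (use W b(3) in auto)
qed

lemma bc_affine:
 assumes V: "triangle_verts V"
 shows "bc V x a = bc V 0 a + (bc V (axis 1 1) a - bc V 0 a) * x $ 1 + (bc V (axis 2 1) a - bc V 0 a) * x $ 2"
proof -
 define u where "u a = (1 - x $ 1 - x $ 2) * bc V 0 a + x $ 1 * bc V (axis 1 1) a + x $ 2 * bc V (axis 2 1) a" for a
 have "bc V x = u"
 proof (rule bc_triangle_unique[OF V])
  show "sum u V = 1"
   unfolding u_def sum.distrib sum_distrib_left[symmetric] bc_triangle(1)[OF V] by simp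
  have "(\<Sum>a\<in>V. u a *\<^sub>R a) = (1 - x $ 1 - x $ 2) *\<^sub>R (\<Sum>a\<in>V. bc V 0 a *\<^sub>R a)
    + (x $ 1) *\<^sub>R (\<Sum>a\<in>V. bc V (axis 1 1) a *\<^sub>R a) + (x $ 2) *\<^sub>R (\<Sum>a\<in>V. bc V (axis 2 1) a *\<^sub>R a)"
   unfolding u_def scaleR_sum_right sum.distrib[symmetric] by (simp add: scaleR_add_left)
  also have "... = x"
   unfolding bc_triangle(2)[OF V] by (simp add: vec_eq_iff forall_2 axis_def)
  finally show "(\<Sum>a\<in>V. u a *\<^sub>R a) = x" .
 qed (use bc_triangle(3)[OF V] in \<open>auto simp: u_def\<close>)
 then show ?thesis by (simp add: u_def algebra_simps)
qed

lemma bc_Pol: "triangle_verts V ==> (\<lambda>x. of_real (s * bc V x a + t)) \<in> Pol 1"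
proof -
 assume V: "triangle_verts V"
 have "(\<lambda>x. complex_of_real (s * bc V x a + t)) = (\<lambda>x. of_real ((s * bc V 0 a + t)
   + (s * (bc V (axis 1 1) a - bc V 0 a)) * x $ 1 + (s * (bc V (axis 2 1) a - bc V 0 a)) * x $ 2))"
  by (rule ext, subst bc_affine[OF V]) (simp add: algebra_simps)
 then show ?thesis by (simp only: Pol_affine)
qed

lemma bc_continuous: "triangle_verts V ==> continuous_on S (\<lambda>x. bc V x a)"
 by (subst bc_affine) (auto intro!: continuous_intros)

definition multi_idx :: "nat \<Rightarrow> pt set \<Rightarrow> (pt \<Rightarrow> nat) set" where
 "multi_idx p V = {k. (\<forall>a. a \<notin> V \<longrightarrow> k a = 0) \<and> sum k V = p}"

definition node :: "nat \<Rightarrow> pt set \<Rightarrow> (pt \<Rightarrow> nat) \<Rightarrow> pt" where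
 "node p V k = (\<Sum>a\<in>V. (real (k a) / real p) *\<^sub>R a)"

text \<open>The Lagrange basis function that is one at the node with index \<open>k\<close> and zero at the others.
 As a product of binomial coefficients it visibly vanishes at every node whose index is not
 above \<open>k\<close> in some component.\<close>

definition lagr :: "nat \<Rightarrow> pt set \<Rightarrow> (pt \<Rightarrow> nat) \<Rightarrow> scalar_fun" where
 "lagr p V k x = of_real (\<Prod>a\<in>V. (real p * bc V x a) gchoose k a)"

lemma multi_idx_le: "finite V ==> k \<in> multi_idx p V ==> k a \<le> p"
proof (cases "a \<in> V")
 case True
 assume "finite V" "k \<in> multi_idx p V"
 then have "k a \<le> sum k V" using True by (intro member_le_sum) auto
 then show ?thesis using \<open>k \<in> multi_idx p V\<close> by (simp add: multi_idx_def)
qed (auto simp: multi_idx_def)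

lemma finite_multi_idx: "finite V ==> finite (multi_idx p V)"
proof -
 assume V: "finite V"
 have "multi_idx p V \<subseteq> {k. \<forall>a. (a \<in> V \<longrightarrow> k a \<in> {..p}) \<and> (a \<notin> V \<longrightarrow> k a = 0)}"
  using multi_idx_le[OF V] by (auto simp: multi_idx_def)
 then show ?thesis using finite_set_of_finite_funs[OF V, of "{..p}" 0] finite_subset by blast
qed

lemma card_multi_idx: "finite V ==> card (multi_idx p V) \<le> (p + 1) ^ card V"
proof -
 assume V: "finite V"
 have "inj_on (\<lambda>k. restrict k V) (multi_idx p V)"
 proof (rule inj_onI, rule ext)
  fix k l a assume "k \<in> multi_idx p V" "l \<in> multi_idx p V" "restrict k V = restrict l V"
  then show "k a = l a" by (cases "a \<in> V") (auto simp: multi_idx_def restrict_def dest: fun_cong[of _ _ a])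
 qed
 moreover have "(\<lambda>k. restrict k V) ` multi_idx p V \<subseteq> V \<rightarrow>\<^sub>E {..p}"
  using multi_idx_le[OF V] by (auto simp: PiE_def extensional_def)
 moreover have "finite (V \<rightarrow>\<^sub>E {..p})" using V by (auto intro: finite_PiE)
 ultimately have "card (multi_idx p V) \<le> card (V \<rightarrow>\<^sub>E {..p})" by (rule card_inj_on_le)
 then show ?thesis using V by (simp add: card_PiE)
qed

lemma bc_node:
 assumes V: "triangle_verts V" and p: "1 \<le> p" and k: "k \<in> multi_idx p V"
 shows "bc V (node p V k) a = real (k a) / real p"
proof -
 have "bc V (node p V k) = (\<lambda>a. real (k a) / real p)"
 proof (rule bc_triangle_unique[OF V])
  have "(\<Sum>a\<in>V. real (k a) / real p) = real (sum k V) / real p" by (simp add: sum_divide_distrib)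
  also have "sum k V = p" using k by (simp add: multi_idx_def)
  finally show "(\<Sum>a\<in>V. real (k a) / real p) = 1" using p by simp
 qed (use k in \<open>auto simp: node_def multi_idx_def\<close>)
 then show ?thesis by simp
qed

lemma node_in_hull:
 assumes "triangle_verts V" "1 \<le> p" "k \<in> multi_idx p V"
 shows "node p V k \<in> convex hull V"
 using triangle_bc_iff[OF assms(1)] bc_node[OF assms] by auto

lemma lagr_node:
 assumes V: "triangle_verts V" and p: "1 \<le> p" and k: "k \<in> multi_idx p V" and m: "m \<in> multi_idx p V"
 shows "lagr p V k (node p V m) = (if m = k then 1 else 0)"
proof -
 have fV: "finite V" using V by (simp add: triangle_verts_def)
 have e: "lagr p V k (node p V m) = of_real (\<Prod>a\<in>V. real (m a choose k a))"
  using p by (simp add: lagr_def bc_node[OF V p m] binomial_gbinomial)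
 show ?thesis
 proof (cases "m = k")
  case True then show ?thesis using e by simp
 next
  case False
  have "\<exists>a\<in>V. m a < k a"
  proof (rule ccontr)
   assume "\<not> ?thesis"
   then have le: "\<And>a. a \<in> V ==> k a \<le> m a" by force
   have "sum k V = sum m V" using k m by (simp add: multi_idx_def)
   then have "\<And>a. a \<in> V ==> k a = m a" using le fV sum_mono_inv[of k V m] by blast
   moreover have "\<And>a. a \<notin> V ==> k a = m a" using k m by (simp add: multi_idx_def)
   ultimately have "k = m" by (intro ext) blast
   then show False using False by simp
  qed
  then have "(\<Prod>a\<in>V. real (m a choose k a)) = 0" using fV by (auto simp: prod_zero_iff binomial_eq_0)
  then show ?thesis using e False by simp
 qed
qed

lemma gchoose_Pol:
 assumes "(\<lambda>x. of_real (f x)) \<in> Pol 1" "\<And>t. (\<lambda>x. of_real (f x - t)) \<in> Pol 1"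
 shows "(\<lambda>x. of_real (f x gchoose n)) \<in> Pol n"
proof -
 have "(\<lambda>x. \<Prod>i\<in>{0..<n}. complex_of_real (f x - real i)) \<in> Pol (\<Sum>i\<in>{0..<n}. 1)"
  by (rule Pol_prod, simp, rule assms(2))
 then have "(\<lambda>x. \<Prod>i\<in>{0..<n}. complex_of_real (f x - real i)) \<in> Pol n" by simp
 from Pol_scale[OF this, of "inverse (fact n)"] show ?thesis
  by (simp add: gbinomial_prod_rev field_simps of_real_divide)
qed

lemma lagr_Pol:
 assumes V: "triangle_verts V" and k: "k \<in> multi_idx p V"
 shows "lagr p V k \<in> Pol p"
proof -
 have "(\<lambda>x. \<Prod>a\<in>V. complex_of_real ((real p * bc V x a) gchoose k a)) \<in> Pol (\<Sum>a\<in>V. k a)"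
 proof (rule Pol_prod)
  fix a
  show "(\<lambda>x. complex_of_real ((real p * bc V x a) gchoose k a)) \<in> Pol (k a)"
  proof (rule gchoose_Pol)
   show "(\<lambda>x. complex_of_real (real p * bc V x a)) \<in> Pol 1"
    using bc_Pol[OF V, of "real p" a 0] by (simp only: add_0_right)
   show "(\<lambda>x. complex_of_real (real p * bc V x a - t)) \<in> Pol 1" for t
    using bc_Pol[OF V, of "real p" a "- t"] by (simp only: add_uminus_conv_diff)
  qed
 qed (use V in \<open>auto simp: triangle_verts_def\<close>)
 then show ?thesis using k by (simp add: multi_idx_def lagr_def[abs_def])
qed

lemma Pol_zero_nodes:
 assumes V: "triangle_verts V" and p: "1 \<le> p" and r: "r \<in> Pol p"
  and z: "\<And>k. k \<in> multi_idx p V ==> r (node p V k) = 0"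
 shows "r = 0"
proof -
 obtain a b c where abc: "V = {a, b, c}" "a \<noteq> b" "b \<noteq> c" "a \<noteq> c"
  using V card_3_iff[of V] by (auto simp: triangle_verts_def)
 define A :: "pt \<Rightarrow> pt" where "A y = c + (y $ 1 / real p) *\<^sub>R (a - c) + (y $ 2 / real p) *\<^sub>R (b - c)" for y
 have A1: "(\<lambda>y. of_real (A y $ i)) \<in> Pol 1" for i
  using Pol_affine[of "c $ i" "(a - c) $ i / real p" "(b - c) $ i / real p"]
  by (simp add: A_def mult.commute)
 have "(\<lambda>y. r (A y)) = 0"
 proof (rule Pol_lattice_zero[OF Pol_compose_affine[OF r A1 A1]])
  fix i j :: nat assume ij: "i + j \<le> p"
  define k where "k = (\<lambda>v. if v = a then i else if v = b then j else if v = c then p - i - j else 0)"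
  have k: "k \<in> multi_idx p V" using abc ij by (auto simp: multi_idx_def k_def)
  have e: "real (p - i - j) / real p = 1 - real i / real p - real j / real p"
   using ij p by (simp add: field_simps of_nat_diff)
  have "node p V k = (real i / real p) *\<^sub>R a + ((real j / real p) *\<^sub>R b + (real (p - i - j) / real p) *\<^sub>R c)"
   using abc by (simp add: node_def k_def)
  also have "... = A (vector [of_nat i, of_nat j])"
   unfolding e by (simp add: A_def vector_2 scaleR_diff_left scaleR_diff_right)
  finally have "node p V k = A (vector [of_nat i, of_nat j])" .
  then show "r (A (vector [of_nat i, of_nat j])) = 0" using z[OF k] by simp
 qed
 moreover have "\<exists>y. A y = x" for x
 proof -
  have s: "bc V x a + bc V x b + bc V x c = 1" "bc V x a *\<^sub>R a + bc V x b *\<^sub>R b + bc V x c *\<^sub>R c = x"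
   using bc_triangle(1,2)[OF V, of x] abc by (auto simp: add.assoc)
  have "A (vector [real p * bc V x a, real p * bc V x b]) = bc V x a *\<^sub>R a + bc V x b *\<^sub>R b + (1 - bc V x a - bc V x b) *\<^sub>R c"
   using p by (simp add: A_def vector_2 algebra_simps)
  also have "1 - bc V x a - bc V x b = bc V x c" using s(1) by simp
  finally show ?thesis using s(2) by auto
 qed
 moreover have "r (A y) = 0" for y
  using fun_cong[OF calculation(1), of y] by (simp only: zero_fun_apply)
 ultimately show ?thesis by (intro ext) (metis zero_fun_apply)
qed

lemma Pol_lagrange:
 assumes V: "triangle_verts V" and p: "1 \<le> p" and q: "q \<in> Pol p"
 shows "q x = (\<Sum>k\<in>multi_idx p V. q (node p V k) * lagr p V k x)"
proof -
 have fV: "finite V" using V by (simp add: triangle_verts_def)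
 define s where "s = (\<lambda>x. \<Sum>k\<in>multi_idx p V. q (node p V k) * lagr p V k x)"
 have sP: "s \<in> Pol p" unfolding s_def by (intro Pol_sum Pol_scale lagr_Pol[OF V])
 have "q - s = 0"
 proof (rule Pol_zero_nodes[OF V p])
  show "q - s \<in> Pol p" by (rule cvs.subspace_diff[OF Pol_subspace q sP])
  fix m assume m: "m \<in> multi_idx p V"
  have "s (node p V m) = (\<Sum>k\<in>multi_idx p V. if k = m then q (node p V k) else 0)"
   unfolding s_def by (intro sum.cong) (auto simp: lagr_node[OF V p _ m])
  also have "... = q (node p V m)" using m finite_multi_idx[OF fV] by (simp add: sum.delta)
  finally show "(q - s) (node p V m) = 0" by (simp add: minus_apply)
 qed
 then have "q = s" by simp
 then show ?thesis unfolding s_def by (rule fun_cong)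
qed

definition lagr_interp :: "nat \<Rightarrow> pt set \<Rightarrow> scalar_fun \<Rightarrow> scalar_fun" where
 "lagr_interp p V f x = (\<Sum>k\<in>multi_idx p V. f (node p V k) * lagr p V k x)"

lemma lagr_interp_Pol: "triangle_verts V ==> lagr_interp p V f \<in> Pol p"
 unfolding lagr_interp_def[abs_def] by (intro Pol_sum Pol_scale lagr_Pol)

lemma lagr_interp_node:
 assumes V: "triangle_verts V" and p: "1 \<le> p" and m: "m \<in> multi_idx p V"
 shows "lagr_interp p V f (node p V m) = f (node p V m)"
proof -
 have fV: "finite V" using V by (simp add: triangle_verts_def)
 have "lagr_interp p V f (node p V m) = (\<Sum>k\<in>multi_idx p V. if k = m then f (node p V k) else 0)"
  unfolding lagr_interp_def by (intro sum.cong) (auto simp: lagr_node[OF V p _ m])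
 also have "... = f (node p V m)" using m finite_multi_idx[OF fV] by (simp add: sum.delta)
 finally show ?thesis .
qed

lemma gchoose_0: "(0::real) gchoose k = (if k = 0 then 1 else 0)"
 by (cases k) auto

text \<open>On a face the interpolant only sees the nodes of that face, in a form that does not mention the
 rest of the triangle. This is what makes elementwise interpolants match across edges.\<close>

lemma lagr_interp_face:
 assumes V: "triangle_verts V" and W: "W \<subseteq> V" and x: "x \<in> convex hull W"
 shows "lagr_interp p V f x = lagr_interp p W f x"
proof -
 have fV: "finite V" using V by (simp add: triangle_verts_def)
 have fW: "finite W" using fV W finite_subset by auto
 have b: "bc V x = bc W x" by (rule bc_face[OF V W x])
 have z: "bc W x a = 0" if "a \<notin> W" for a
  using bc_props(3)[OF fW _ that] x convex_hull_subset_affine_hull by blast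
 have sub: "multi_idx p W \<subseteq> multi_idx p V"
 proof
  fix k assume k: "k \<in> multi_idx p W"
  have "sum k V = sum k W" using k W fV by (intro sum.mono_neutral_right) (auto simp: multi_idx_def)
  then show "k \<in> multi_idx p V" using k W by (auto simp: multi_idx_def)
 qed
 have out: "lagr p V k x = 0" if "k \<in> multi_idx p V - multi_idx p W" for k
 proof -
  have "\<exists>a\<in>V - W. k a \<noteq> 0"
  proof (rule ccontr)
   assume n: "\<not> ?thesis"
   have "sum k V = sum k W" using n W fV by (intro sum.mono_neutral_right) auto
   moreover have "k a = 0" if "a \<notin> W" for a
    using \<open>k \<in> multi_idx p V - multi_idx p W\<close> that n by (cases "a \<in> V") (auto simp: multi_idx_def)
   ultimately have "k \<in> multi_idx p W" using that by (auto simp: multi_idx_def)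
   then show False using that by blast
  qed
  then obtain a where "a \<in> V - W" "k a \<noteq> 0" by blast
  then have "a \<in> V \<and> (real p * bc V x a) gchoose k a = 0" using z by (simp add: b gchoose_0)
  then have "(\<Prod>a\<in>V. (real p * bc V x a) gchoose k a) = 0" using fV by (auto simp: prod_zero_iff)
  then show ?thesis by (simp add: lagr_def)
 qed
 have ins: "node p V k = node p W k" "lagr p V k x = lagr p W k x" if "k \<in> multi_idx p W" for k
 proof -
  show "node p V k = node p W k"
   unfolding node_def using that W fV by (intro sum.mono_neutral_right) (auto simp: multi_idx_def)
  have "(\<Prod>a\<in>V. (real p * bc V x a) gchoose k a) = (\<Prod>a\<in>W. (real p * bc V x a) gchoose k a)"
   using that W fV by (intro prod.mono_neutral_right) (auto simp: multi_idx_def)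
  then show "lagr p V k x = lagr p W k x" by (simp add: lagr_def b)
 qed
 have "lagr_interp p V f x = (\<Sum>k\<in>multi_idx p W. f (node p V k) * lagr p V k x)"
  unfolding lagr_interp_def using sub out finite_multi_idx[OF fV] by (intro sum.mono_neutral_right) auto
 then show ?thesis unfolding lagr_interp_def using ins by simp
qed

lemma lagr_bound:
 assumes V: "triangle_verts V" and p: "1 \<le> p" and k: "k \<in> multi_idx p V" and x: "x \<in> convex hull V"
 shows "cmod (lagr p V k x) \<le> real p ^ p"
proof -
 have fV: "finite V" using V by (simp add: triangle_verts_def)
 have "\<bar>(real p * bc V x a) gchoose k a\<bar> \<le> real p ^ k a" for a
 proof -
  have t: "0 \<le> real p * bc V x a" "real p * bc V x a \<le> real p"
   using bc_le_1[OF V x, of a] by (auto simp: mult_left_le)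
  have "\<bar>\<Prod>i = 0..<k a. real p * bc V x a - real i\<bar> \<le> (\<Prod>i = 0..<k a. real p)"
   unfolding abs_prod
  proof (rule prod_mono)
   fix i assume "i \<in> {0..<k a}"
   then have "real i \<le> real p" using multi_idx_le[OF fV k, of a] by auto
   then show "0 \<le> \<bar>real p * bc V x a - real i\<bar> \<and> \<bar>real p * bc V x a - real i\<bar> \<le> real p"
    using t by auto
  qed
  also have "... = real p ^ k a" by simp
  finally have "\<bar>\<Prod>i = 0..<k a. real p * bc V x a - real i\<bar> \<le> real p ^ k a" .
  moreover have "\<bar>(real p * bc V x a) gchoose k a\<bar> \<le> \<bar>\<Prod>i = 0..<k a. real p * bc V x a - real i\<bar>"
   unfolding gbinomial_prod_rev abs_divide by (simp add: divide_le_eq mult_le_cancel_left1 fact_ge_1)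
  ultimately show ?thesis by linarith
 qed
 then have "\<bar>\<Prod>a\<in>V. (real p * bc V x a) gchoose k a\<bar> \<le> (\<Prod>a\<in>V. real p ^ k a)"
  unfolding abs_prod by (intro prod_mono) auto
 also have "... = real p ^ p" using k by (simp add: power_sum[symmetric] multi_idx_def)
 finally show ?thesis by (simp add: lagr_def del: of_real_prod)
qed

lemma lagr_interp_bound:
 assumes V: "triangle_verts V" and p: "1 \<le> p" and x: "x \<in> convex hull V"
  and B: "\<And>k. k \<in> multi_idx p V ==> cmod (f (node p V k)) \<le> B"
 shows "cmod (lagr_interp p V f x) \<le> (real p + 1) ^ 3 * real p ^ p * B"
proof -
 have fV: "finite V" and c3: "card V = 3" using V by (auto simp: triangle_verts_def)
 have B0: "0 \<le> B"
 proof -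
  obtain a where a: "a \<in> V" using c3 by fastforce
  have "(\<lambda>v. if v = a then p else 0) \<in> multi_idx p V" using a fV by (auto simp: multi_idx_def)
  from B[OF this] show ?thesis by (meson norm_ge_zero order_trans)
 qed
 have "cmod (lagr_interp p V f x) \<le> (\<Sum>k\<in>multi_idx p V. B * real p ^ p)"
  unfolding lagr_interp_def using B B0 lagr_bound[OF V p _ x]
  by (intro sum_norm_le) (auto simp: norm_mult intro!: mult_mono)
 also have "... = real (card (multi_idx p V)) * (B * real p ^ p)" by simp
 also have "... \<le> (real p + 1) ^ 3 * (B * real p ^ p)"
 proof (rule mult_right_mono)
  have "real (card (multi_idx p V)) \<le> real ((p + 1) ^ 3)"
   using card_multi_idx[OF fV, of p] c3 by (intro of_nat_mono) auto
  then show "real (card (multi_idx p V)) \<le> (real p + 1) ^ 3" by (simp add: add.commute)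
 qed (use B0 in auto)
 finally show ?thesis by (simp add: mult_ac)
qed

section \<open>Integrals of piecewise polynomials\<close>

lemma lint_spike:
 fixes f g :: "pt \<Rightarrow> 'b::euclidean_space"
 assumes f: "set_integrable lebesgue S f" and N: "negligible N" and eq: "\<And>x. x \<in> S - N ==> g x = f x"
 shows "set_integrable lebesgue S g" "(LINT x:S|lebesgue. g x) = (LINT x:S|lebesgue. f x)"
proof -
 show g: "set_integrable lebesgue S g" by (rule absolutely_integrable_spike[OF f N eq])
 show "(LINT x:S|lebesgue. g x) = (LINT x:S|lebesgue. f x)"
  unfolding set_lebesgue_integral_eq_integral(2)[OF f] set_lebesgue_integral_eq_integral(2)[OF g]
  using integral_spike[OF N, of S f g] eq by metis
qed

lemma lint_compact_continuous:
 fixes f :: "pt \<Rightarrow> 'b::euclidean_space"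
 assumes "compact S" "continuous_on S f"
 shows "set_integrable lebesgue S f"
 unfolding set_integrable_def
 using borel_integrable_compact[OF assms] by (subst integrable_completion) auto

lemma lint_nonneg:
 fixes f :: "pt \<Rightarrow> real"
 assumes "\<And>x. x \<in> S ==> 0 \<le> f x"
 shows "0 \<le> (LINT x:S|lebesgue. f x)"
 unfolding set_lebesgue_integral_def
 by (rule Bochner_Integration.integral_nonneg) (use assms in \<open>auto split: split_indicator\<close>)

lemma lint_mono_set:
 fixes f :: "pt \<Rightarrow> real"
 assumes f: "set_integrable lebesgue B f" and A: "A \<in> sets lebesgue" "A \<subseteq> B"
  and nn: "\<And>x. x \<in> B ==> 0 \<le> f x"
 shows "(LINT x:A|lebesgue. f x) \<le> (LINT x:B|lebesgue. f x)"
proof -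
 have fA: "set_integrable lebesgue A f" by (rule set_integrable_subset[OF f A])
 show ?thesis
  unfolding set_lebesgue_integral_def
 proof (rule integral_mono)
  fix x show "indicat_real A x *\<^sub>R f x \<le> indicat_real B x *\<^sub>R f x"
   using A nn[of x] by (auto split: split_indicator)
 qed (use f fA in \<open>auto simp: set_integrable_def\<close>)
qed

lemma psd_lint:
 fixes B :: "scalar_fun \<Rightarrow> scalar_fun \<Rightarrow> scalar_fun"
 assumes V: "cvs.subspace V" and int: "\<And>u v. u \<in> V ==> v \<in> V ==> set_integrable lebesgue S (B u v)"
  and N: "negligible N" and pt: "\<And>x. x \<in> S - N ==> psd V (\<lambda>u v. B u v x)"
 shows "psd V (\<lambda>u v. LINT x:S|lebesgue. B u v x)"
proof -
 note sq = psd_sesq[OF pt]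
 have a1: "(LINT x:S|lebesgue. B (u + v) w x) = (LINT x:S|lebesgue. B u w x) + (LINT x:S|lebesgue. B v w x)"
  if "u \<in> V" "v \<in> V" "w \<in> V" for u v w
 proof -
  have "(LINT x:S|lebesgue. B (u + v) w x) = (LINT x:S|lebesgue. B u w x + B v w x)"
   by (rule lint_spike(2)[OF _ N]) (use sesqD(1)[OF sq] int that in auto)
  then show ?thesis using int that by simp
 qed
 have a2: "(LINT x:S|lebesgue. B w (u + v) x) = (LINT x:S|lebesgue. B w u x) + (LINT x:S|lebesgue. B w v x)"
  if "u \<in> V" "v \<in> V" "w \<in> V" for u v w
 proof -
  have "(LINT x:S|lebesgue. B w (u + v) x) = (LINT x:S|lebesgue. B w u x + B w v x)"
   by (rule lint_spike(2)[OF _ N]) (use sesqD(2)[OF sq] int that in auto)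
  then show ?thesis using int that by simp
 qed
 have s1: "(LINT x:S|lebesgue. B (c *\<^sub>C u) w x) = c * (LINT x:S|lebesgue. B u w x)" if "u \<in> V" "w \<in> V" for u w c
 proof -
  have "(LINT x:S|lebesgue. B (c *\<^sub>C u) w x) = (LINT x:S|lebesgue. c * B u w x)"
   by (rule lint_spike(2)[OF _ N]) (use sesqD(3)[OF sq] int that in auto)
  then show ?thesis by simp
 qed
 have s2: "(LINT x:S|lebesgue. B w (c *\<^sub>C u) x) = cnj c * (LINT x:S|lebesgue. B w u x)" if "u \<in> V" "w \<in> V" for u w c
 proof -
  have "(LINT x:S|lebesgue. B w (c *\<^sub>C u) x) = (LINT x:S|lebesgue. cnj c * B w u x)"
   by (rule lint_spike(2)[OF _ N]) (use sesqD(4)[OF sq] int that in auto)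
  then show ?thesis by simp
 qed
 have h: "(LINT x:S|lebesgue. B v u x) = cnj (LINT x:S|lebesgue. B u v x)" if "u \<in> V" "v \<in> V" for u v
 proof -
  have "(LINT x:S|lebesgue. B u v x) = (LINT x:S|lebesgue. cnj (B v u x))"
  proof (rule lint_spike(2)[OF _ N])
   have "set_integrable lebesgue S (B v u)" using int that by auto
   then have "integrable lebesgue (\<lambda>x. cnj (indicat_real S x *\<^sub>R B v u x))"
    unfolding set_integrable_def by (rule integrable_cnj)
   then show "set_integrable lebesgue S (\<lambda>x. cnj (B v u x))"
    unfolding set_integrable_def by simp
   fix x assume "x \<in> S - N"
   then show "B u v x = cnj (B v u x)" using psd_sym[OF pt] that by blast
  qed
  also have "... = cnj (LINT x:S|lebesgue. B v u x)"
   using Bochner_Integration.integral_cnj[of lebesgue "\<lambda>x. indicat_real S x *\<^sub>R B v u x"]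
   unfolding set_lebesgue_integral_def complex_cnj_scaleR .
  finally show ?thesis by simp
 qed
 have n: "0 \<le> Re (LINT x:S|lebesgue. B u u x)" if "u \<in> V" for u
 proof -
  have i: "set_integrable lebesgue S (B u u)" using int that by auto
  have e: "(LINT x:S|lebesgue. B u u x) = (LINT x:S|lebesgue. if x \<in> N then 0 else B u u x)"
   by (rule sym, rule lint_spike(2)[OF i N]) auto
  have i2: "set_integrable lebesgue S (\<lambda>x. if x \<in> N then 0 else B u u x)"
   by (rule lint_spike(1)[OF i N]) auto
  have "Re (LINT x:S|lebesgue. if x \<in> N then 0 else B u u x) = (LINT x:S|lebesgue. Re (if x \<in> N then 0 else B u u x))"
   using i2 unfolding set_lebesgue_integral_def set_integrable_def
   by (subst integral_Re[symmetric]) auto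
  also have "... \<ge> 0" by (rule lint_nonneg) (use psd_nonneg[OF pt] that in auto)
  finally show ?thesis unfolding e .
 qed
 show ?thesis unfolding psd_def sesq_def
  by (intro conjI ballI allI; (rule a1 a2 s1 s2 h n; assumption))
qed

definition elt :: "pt set \<Rightarrow> bool" where
 "elt T \<longleftrightarrow> compact T \<and> convex T \<and> interior T \<noteq> {}"

definition pw :: "nat \<Rightarrow> pt set set \<Rightarrow> scalar_fun set" where
 "pw p \<G> = {u. \<forall>T\<in>\<G>. poly_on p T u}"

lemma pw_subspace: "cvs.subspace (pw p \<G>)"
 unfolding cvs.subspace_def
proof (intro conjI ballI allI)
 show "0 \<in> pw p \<G>"
  unfolding pw_def poly_on_iff using cvs.subspace_0[OF Pol_subspace] by blast
next
 fix u v assume uv: "u \<in> pw p \<G>" "v \<in> pw p \<G>"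
 show "u + v \<in> pw p \<G>"
  unfolding pw_def poly_on_iff
 proof clarify
  fix T assume "T \<in> \<G>"
  then obtain a b where "a \<in> Pol p" "\<forall>x\<in>T. u x = a x" "b \<in> Pol p" "\<forall>x\<in>T. v x = b x"
   using uv unfolding pw_def poly_on_iff by blast
  then show "\<exists>q\<in>Pol p. \<forall>x\<in>T. (u + v) x = q x"
   by (intro bexI[of _ "a + b"] cvs.subspace_add[OF Pol_subspace]) (auto simp: plus_fun_apply)
 qed
next
 fix c u assume u: "u \<in> pw p \<G>"
 show "c *\<^sub>C u \<in> pw p \<G>"
  unfolding pw_def poly_on_iff
 proof clarify
  fix T assume "T \<in> \<G>"
  then obtain a where "a \<in> Pol p" "\<forall>x\<in>T. u x = a x"
   using u unfolding pw_def poly_on_iff by blast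
  then show "\<exists>q\<in>Pol p. \<forall>x\<in>T. (c *\<^sub>C u) x = q x"
   by (intro bexI[of _ "c *\<^sub>C a"] cvs.subspace_scale[OF Pol_subspace]) (auto simp: scl_apply)
 qed
qed

lemma pw_mono: "\<G>' \<subseteq> \<G> ==> pw p \<G> \<subseteq> pw p \<G>'"
 by (auto simp: pw_def)

lemma pw_Pol: "q \<in> Pol p ==> q \<in> pw p \<G>"
 by (auto simp: pw_def poly_on_iff)

lemma pwE:
 assumes "u \<in> pw p \<G>" "T \<in> \<G>"
 obtains q where "q \<in> Pol p" "\<And>x. x \<in> T ==> u x = q x"
 using assms unfolding pw_def poly_on_iff by blast

lemma grad_derivative:
 assumes "(u has_derivative D) (at x)"
 shows "grad u x $ i = D (axis i 1)"
 using frechet_derivative_at[OF assms] by (simp add: grad_def)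

lemma derivative_grad:
 assumes "(u has_derivative D) (at x)"
 shows "D h = grad u x $ 1 * of_real (h $ 1) + grad u x $ 2 * of_real (h $ 2)"
proof -
 interpret bounded_linear D using assms by (rule has_derivative_bounded_linear)
 have "h = (h $ 1) *\<^sub>R axis 1 1 + (h $ 2) *\<^sub>R axis 2 1"
  by (simp add: vec_eq_iff forall_2 axis_def)
 then have "D h = (h $ 1) *\<^sub>R D (axis 1 1) + (h $ 2) *\<^sub>R D (axis 2 1)"
  by (metis add scaleR)
 then show ?thesis by (simp add: grad_derivative[OF assms] scaleR_conv_of_real)
qed

lemma pw_has_derivative:
 assumes "u \<in> pw p \<G>" "T \<in> \<G>" "x \<in> interior T"
 shows "\<exists>D. (u has_derivative D) (at x)"
proof -
 obtain q where q: "q \<in> Pol p" "\<And>x. x \<in> T ==> u x = q x" using pwE[OF assms(1,2)] by blast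
 obtain D where D: "(q has_derivative D) (at x)" using Pol_derivative[OF q(1)] by blast
 have "(u has_derivative D) (at x)"
  by (rule has_derivative_transform_within_open[OF D open_interior assms(3)])
   (use q interior_subset in force)
 then show ?thesis by blast
qed

lemma pw_grad:
 assumes "u \<in> pw p \<G>" "T \<in> \<G>"
 shows "\<exists>g\<in>Pol p. \<forall>x\<in>interior T. grad u x $ i = g x"
proof -
 obtain q where q: "q \<in> Pol p" "\<And>x. x \<in> T ==> u x = q x" using pwE[OF assms] by blast
 obtain q1 q2 where d: "q1 \<in> Pol p" "q2 \<in> Pol p"
  "\<And>x. (q has_derivative (\<lambda>h. q1 x * of_real (h $ 1) + q2 x * of_real (h $ 2))) (at x)"
  using Pol_derivative[OF q(1)] by blast
 have "grad u x $ j = (if j = 1 then q1 x else q2 x)" if "x \<in> interior T" for x j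
 proof -
  have "(u has_derivative (\<lambda>h. q1 x * of_real (h $ 1) + q2 x * of_real (h $ 2))) (at x)"
   by (rule has_derivative_transform_within_open[OF d(3) open_interior that])
    (use q interior_subset in force)
  from grad_derivative[OF this, of j] show ?thesis
   using exhaust_2[of j] by (auto simp: axis_def)
 qed
 then show ?thesis using d by (cases "i = 1") auto
qed

lemma grad_add_scale:
 assumes "(u has_derivative D) (at x)" "(v has_derivative E) (at x)"
 shows "grad (u + v) x = grad u x + grad v x" "grad (c *\<^sub>C u) x $ i = c * grad u x $ i"
proof -
 have "(u + v has_derivative (\<lambda>h. D h + E h)) (at x)"
  unfolding plus_fun_def by (rule has_derivative_add[OF assms])
 from grad_derivative[OF this] show "grad (u + v) x = grad u x + grad v x"
  using grad_derivative[OF assms(1)] grad_derivative[OF assms(2)] by (simp add: vec_eq_iff)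
 have "(c *\<^sub>C u has_derivative (\<lambda>h. c * D h)) (at x)"
  unfolding scl_def by (rule has_derivative_mult_right[OF assms(1)])
 from grad_derivative[OF this] show "grad (c *\<^sub>C u) x $ i = c * grad u x $ i"
  using grad_derivative[OF assms(1)] by simp
qed

definition grad_ip :: "scalar_fun \<Rightarrow> scalar_fun \<Rightarrow> scalar_fun" where
 "grad_ip u v x = (\<Sum>i\<in>UNIV. grad u x $ i * cnj (grad v x $ i))"

definition val_ip :: "scalar_fun \<Rightarrow> scalar_fun \<Rightarrow> scalar_fun" where
 "val_ip u v x = u x * cnj (v x)"

lemma dirichlet_ip_eq: "dirichlet_ip S u v = (LINT x:S|lebesgue. grad_ip u v x)"
 by (simp add: dirichlet_ip_def grad_ip_def)

lemma l2_ip_eq: "l2_ip S u v = (LINT x:S|lebesgue. val_ip u v x)"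
 by (simp add: l2_ip_def val_ip_def)

lemma psd_val_ip: "psd V (\<lambda>u v. val_ip u v x)"
 unfolding psd_def sesq_def val_ip_def
 by (auto simp: fapply algebra_simps)

lemma psd_grad_ip:
 assumes "T \<in> \<G>" "x \<in> interior T"
 shows "psd (pw p \<G>) (\<lambda>u v. grad_ip u v x)"
proof -
 have d: "\<exists>D. (u has_derivative D) (at x)" if "u \<in> pw p \<G>" for u
  using pw_has_derivative[OF that assms] .
 have ga: "grad (u + v) x = grad u x + grad v x" if "u \<in> pw p \<G>" "v \<in> pw p \<G>" for u v
  using d[OF that(1)] d[OF that(2)] grad_add_scale(1) by blast
 have gs: "grad (c *\<^sub>C u) x $ i = c * grad u x $ i" if "u \<in> pw p \<G>" for u c i
  using d[OF that] grad_add_scale(2) by blast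
 have nn: "0 \<le> Re (z * cnj z)" for z by (simp add: complex_mult_cnj)
 show ?thesis
  unfolding psd_def sesq_def
  by (intro conjI ballI allI)
   (auto simp: grad_ip_def ga gs sum_2 algebra_simps sum.distrib sum_distrib_left intro!: add_nonneg_nonneg)
qed

lemma elt_frontier_negligible: "elt T ==> negligible (frontier T)"
 by (simp add: elt_def negligible_convex_frontier)

lemma elt_minus_frontier: "elt T ==> x \<in> T - frontier T ==> x \<in> interior T"
 by (auto simp: frontier_def elt_def compact_imp_closed)

lemma val_ip_integrable_elt:
 assumes "elt T" "u \<in> pw p \<G>" "v \<in> pw p \<G>" "T \<in> \<G>"
 shows "set_integrable lebesgue T (val_ip u v)"
proof -
 obtain q where q: "q \<in> Pol p" "\<And>x. x \<in> T ==> u x = q x" using pwE[OF assms(2,4)] by blast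
 obtain r where r: "r \<in> Pol p" "\<And>x. x \<in> T ==> v x = r x" using pwE[OF assms(3,4)] by blast
 have "set_integrable lebesgue T (\<lambda>x. q x * cnj (r x))"
  using assms(1) by (intro lint_compact_continuous continuous_intros Pol_continuous[OF q(1)] Pol_continuous[OF r(1)])
   (auto simp: elt_def)
 then show ?thesis
  by (rule lint_spike(1)[OF _ negligible_empty]) (simp add: val_ip_def q(2) r(2))
qed

lemma grad_ip_integrable_elt:
 assumes "elt T" "u \<in> pw p \<G>" "v \<in> pw p \<G>" "T \<in> \<G>"
 shows "set_integrable lebesgue T (grad_ip u v)"
proof -
 have "\<exists>q. \<forall>i. q i \<in> Pol p \<and> (\<forall>x\<in>interior T. grad u x $ i = q i x)"
  using pw_grad[OF assms(2,4)] by (intro choice) blast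
 then obtain q where q: "\<And>i. q i \<in> Pol p" "\<And>i x. x \<in> interior T ==> grad u x $ i = q i x" by blast
 have "\<exists>r. \<forall>i. r i \<in> Pol p \<and> (\<forall>x\<in>interior T. grad v x $ i = r i x)"
  using pw_grad[OF assms(3,4)] by (intro choice) blast
 then obtain r where r: "\<And>i. r i \<in> Pol p" "\<And>i x. x \<in> interior T ==> grad v x $ i = r i x" by blast
 have "set_integrable lebesgue T (\<lambda>x. \<Sum>i\<in>UNIV. q i x * cnj (r i x))"
  using assms(1)
  by (intro lint_compact_continuous continuous_intros Pol_continuous[OF q(1)] Pol_continuous[OF r(1)])
   (auto simp: elt_def)
 then show ?thesis
 proof (rule lint_spike(1)[OF _ elt_frontier_negligible[OF assms(1)]])
  fix x assume "x \<in> T - frontier T"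
  then have "x \<in> interior T" by (rule elt_minus_frontier[OF assms(1)])
  then show "grad_ip u v x = (\<Sum>i\<in>UNIV. q i x * cnj (r i x))" by (simp add: grad_ip_def q(2) r(2))
 qed
qed

definition elts :: "pt set set \<Rightarrow> bool" where
 "elts \<G> \<longleftrightarrow> finite \<G> \<and> (\<forall>T\<in>\<G>. elt T) \<and> (\<forall>T\<in>\<G>. \<forall>T'\<in>\<G>. T \<noteq> T' \<longrightarrow> negligible (T \<inter> T'))"

lemma elts_subset: "elts \<G> ==> \<H> \<subseteq> \<G> ==> elts \<H>"
 unfolding elts_def by (meson finite_subset subsetD)

lemma elt_sets: "elt T ==> T \<in> sets lebesgue"
 by (simp add: elt_def borel_compact)

lemma ip_integrable:
 assumes "elts \<G>" "u \<in> pw p \<G>" "v \<in> pw p \<G>"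
 shows "set_integrable lebesgue (\<Union>\<G>) (val_ip u v)" "set_integrable lebesgue (\<Union>\<G>) (grad_ip u v)"
proof -
 have e: "\<Union>\<G> = (\<Union>T\<in>\<G>. T)" by simp
 show "set_integrable lebesgue (\<Union>\<G>) (val_ip u v)" "set_integrable lebesgue (\<Union>\<G>) (grad_ip u v)"
  unfolding e using assms
  by (intro set_integrable_UN val_ip_integrable_elt[OF _ assms(2,3)] grad_ip_integrable_elt[OF _ assms(2,3)] elt_sets;
    auto simp: elts_def)+
qed

lemma lint_union_elts:
 fixes f :: "pt \<Rightarrow> 'b::euclidean_space"
 assumes "elts \<G>" "\<And>T. T \<in> \<G> ==> set_integrable lebesgue T f"
 shows "(LINT x:(\<Union>\<G>)|lebesgue. f x) = (\<Sum>T\<in>\<G>. LINT x:T|lebesgue. f x)"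
proof -
 have "(LINT x:(\<Union>T\<in>\<G>. T)|lebesgue. f x) = (\<Sum>T\<in>\<G>. LINT x:T|lebesgue. f x)"
 proof (rule set_integral_finite_UN_AE)
  fix S T assume ST: "S \<in> \<G>" "T \<in> \<G>"
  show "AE x in lebesgue. x \<in> S \<and> x \<in> T \<longrightarrow> S = T"
  proof (cases "S = T")
   case False
   then have "S \<inter> T \<in> null_sets lebesgue"
    using assms(1) ST unfolding elts_def negligible_iff_null_sets[symmetric] by simp
   from AE_not_in[OF this] show ?thesis by eventually_elim auto
  qed auto
 qed (use assms elt_sets in \<open>auto simp: elts_def\<close>)
 then show ?thesis by simp
qed

lemma ip_union:
 assumes "elts \<G>" "u \<in> pw p \<G>" "v \<in> pw p \<G>"
 shows "l2_ip (\<Union>\<G>) u v = (\<Sum>T\<in>\<G>. l2_ip T u v)"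
  "dirichlet_ip (\<Union>\<G>) u v = (\<Sum>T\<in>\<G>. dirichlet_ip T u v)"
proof -
 have "\<And>T. T \<in> \<G> ==> elt T" using assms(1) by (simp add: elts_def)
 then show "l2_ip (\<Union>\<G>) u v = (\<Sum>T\<in>\<G>. l2_ip T u v)"
  "dirichlet_ip (\<Union>\<G>) u v = (\<Sum>T\<in>\<G>. dirichlet_ip T u v)"
  unfolding l2_ip_eq dirichlet_ip_eq
  by (intro lint_union_elts assms val_ip_integrable_elt[OF _ assms(2,3)] grad_ip_integrable_elt[OF _ assms(2,3)]; auto)+
qed

lemma psd_ips:
 assumes G: "elts \<G>"
 shows "psd (pw p \<G>) (l2_ip (\<Union>\<G>))" "psd (pw p \<G>) (dirichlet_ip (\<Union>\<G>))"
proof -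
 have "psd (pw p \<G>) (\<lambda>u v. LINT x:(\<Union>\<G>)|lebesgue. val_ip u v x)"
  by (rule psd_lint[OF pw_subspace ip_integrable(1)[OF G] negligible_empty psd_val_ip])
 then show "psd (pw p \<G>) (l2_ip (\<Union>\<G>))" by (simp add: l2_ip_eq[abs_def])
 have N: "negligible (\<Union>T\<in>\<G>. frontier T)"
 proof (rule negligible_Union)
  show "finite (frontier ` \<G>)" using G by (simp add: elts_def)
  show "negligible F" if F: "F \<in> frontier ` \<G>" for F
  proof -
   obtain T where T: "T \<in> \<G>" "F = frontier T" using F by blast
   then have "elt T" using G unfolding elts_def by blast
   then show ?thesis using T elt_frontier_negligible by simp
  qed
 qed
 have "psd (pw p \<G>) (\<lambda>u v. LINT x:(\<Union>\<G>)|lebesgue. grad_ip u v x)"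
 proof (rule psd_lint[OF pw_subspace ip_integrable(2)[OF G] N])
  fix x assume "x \<in> \<Union>\<G> - (\<Union>T\<in>\<G>. frontier T)"
  then obtain T where T: "T \<in> \<G>" "x \<in> T - frontier T" by blast
  have "elt T" using G T unfolding elts_def by blast
  then have "x \<in> interior T" using T(2) by (rule elt_minus_frontier)
  with T(1) show "psd (pw p \<G>) (\<lambda>u v. grad_ip u v x)" by (rule psd_grad_ip)
 qed
 then show "psd (pw p \<G>) (dirichlet_ip (\<Union>\<G>))" by (simp add: dirichlet_ip_eq[abs_def])
qed

lemma psd_ip1:
 assumes "elts \<G>" shows "psd (pw p \<G>) (ip1 \<kappa> (\<Union>\<G>))"
proof -
 note d = psd_ips(2)[OF assms, of p] and l = psd_ips(1)[OF assms, of p]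
 show ?thesis
  unfolding psd_def sesq_def ip1_def
 proof (intro conjI ballI allI)
  fix u assume u: "u \<in> pw p \<G>"
  show "0 \<le> Re (dirichlet_ip (\<Union>\<G>) u u + of_real (\<kappa>\<^sup>2) * l2_ip (\<Union>\<G>) u u)"
   using psd_nonneg[OF d u] psd_nonneg[OF l u] by simp
  fix v assume v: "v \<in> pw p \<G>"
  show "dirichlet_ip (\<Union>\<G>) v u + of_real (\<kappa>\<^sup>2) * l2_ip (\<Union>\<G>) v u =
    cnj (dirichlet_ip (\<Union>\<G>) u v + of_real (\<kappa>\<^sup>2) * l2_ip (\<Union>\<G>) u v)"
   using psd_sym[OF d u v] psd_sym[OF l u v] by simp
 qed (simp_all add: sesqD[OF psd_sesq[OF d]] sesqD[OF psd_sesq[OF l]] algebra_simps)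
qed

lemma norm1_eq: "norm1 \<kappa> S = snorm (ip1 \<kappa> S)"
 by (simp add: norm1_def[abs_def] snorm_def[abs_def])

lemma norm1_sq_eq: "energy1 \<kappa> S u = energy S u + \<kappa>\<^sup>2 * mass S u"
 by (simp add: ip1_def)

lemma l2_ip_self: "l2_ip S u u = of_real (LINT x:S|lebesgue. (cmod (u x))\<^sup>2)"
 unfolding l2_ip_def by (simp only: complex_norm_square[symmetric] of_real_power[symmetric] set_integral_complex_of_real)

lemma dirichlet_ip_self: "dirichlet_ip S u u = of_real (LINT x:S|lebesgue. (\<Sum>i\<in>UNIV. (cmod (grad u x $ i))\<^sup>2))"
 unfolding dirichlet_ip_def
 by (simp only: complex_norm_square[symmetric] of_real_power[symmetric] of_real_sum[symmetric] set_integral_complex_of_real)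

section \<open>Inverse estimates\<close>

lemma lebesgue_affine:
 assumes h: "h \<noteq> 0"
 shows "lebesgue = density (distr lebesgue lebesgue (\<lambda>y :: pt. z + h *\<^sub>R y)) (\<lambda>_. ennreal (h\<^sup>2))"
  "(\<lambda>y :: pt. z + h *\<^sub>R y) \<in> lebesgue \<rightarrow>\<^sub>M lebesgue"
proof -
 have T: "(\<lambda>x :: pt. z + (\<Sum>j\<in>Basis. (h * (x \<bullet> j)) *\<^sub>R j)) = (\<lambda>y. z + h *\<^sub>R y)"
 proof
  fix x :: pt
  have "(\<Sum>j\<in>Basis. (h * (x \<bullet> j)) *\<^sub>R j) = h *\<^sub>R (\<Sum>j\<in>Basis. (x \<bullet> j) *\<^sub>R j)"
   by (simp add: scaleR_sum_right)
  then show "z + (\<Sum>j\<in>Basis. (h * (x \<bullet> j)) *\<^sub>R j) = z + h *\<^sub>R x" by (simp add: euclidean_representation)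
 qed
 have c: "(\<Prod>j\<in>(Basis::pt set). \<bar>h\<bar>) = h\<^sup>2" by simp
 show "lebesgue = density (distr lebesgue lebesgue (\<lambda>y :: pt. z + h *\<^sub>R y)) (\<lambda>_. ennreal (h\<^sup>2))"
  using lebesgue_affine_euclidean[of "\<lambda>_. h" z] h unfolding T c by simp
 show "(\<lambda>y :: pt. z + h *\<^sub>R y) \<in> lebesgue \<rightarrow>\<^sub>M lebesgue"
  using lebesgue_affine_measurable[of "\<lambda>_. h" z] h unfolding T by simp
qed

lemma lebesgue_integral_affine:
 fixes f :: "pt \<Rightarrow> 'b::{banach, second_countable_topology}"
 assumes f: "f \<in> borel_measurable lebesgue" and h: "h \<noteq> 0"
 shows "integral\<^sup>L lebesgue f = h\<^sup>2 *\<^sub>R integral\<^sup>L lebesgue (\<lambda>y. f (z + h *\<^sub>R y))"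
proof -
 let ?D = "distr lebesgue lebesgue (\<lambda>y. z + h *\<^sub>R y)"
 have fd: "f \<in> borel_measurable ?D" using f by simp
 have "integral\<^sup>L lebesgue f = integral\<^sup>L (density ?D (\<lambda>_. ennreal (h\<^sup>2))) f"
  using lebesgue_affine(1)[OF h] by simp
 also have "... = integral\<^sup>L ?D (\<lambda>x. h\<^sup>2 *\<^sub>R f x)" by (rule integral_density[OF fd]) auto
 also have "... = integral\<^sup>L lebesgue (\<lambda>x. h\<^sup>2 *\<^sub>R f (z + h *\<^sub>R x))"
  by (rule integral_distr[OF lebesgue_affine(2)[OF h]]) (use f in measurable)
 finally show ?thesis by simp
qed

lemma lint_affine:
 fixes f :: "pt \<Rightarrow> 'b::euclidean_space"
 assumes S: "compact S" and f: "continuous_on ((\<lambda>y. z + h *\<^sub>R y) ` S) f" and h: "h \<noteq> 0"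
 shows "(LINT x:(\<lambda>y. z + h *\<^sub>R y) ` S|lebesgue. f x) = h\<^sup>2 *\<^sub>R (LINT y:S|lebesgue. f (z + h *\<^sub>R y))"
proof -
 let ?I = "(\<lambda>y. z + h *\<^sub>R y) ` S"
 have cI: "compact ?I" using S by (intro compact_continuous_image continuous_intros) auto
 have "(\<lambda>x. indicat_real ?I x *\<^sub>R f x) \<in> borel_measurable borel"
  by (rule borel_measurable_continuous_on_indicator[OF borel_compact[OF cI] f])
 then have "(\<lambda>x. indicat_real ?I x *\<^sub>R f x) \<in> borel_measurable lborel"
  by (simp only: measurable_lborel2)
 then have m: "(\<lambda>x. indicat_real ?I x *\<^sub>R f x) \<in> borel_measurable lebesgue"
  by (rule measurable_completion)
 have e: "indicat_real ?I (z + h *\<^sub>R y) = indicat_real S y" for y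
  using h by (auto simp: indicator_def)
 show ?thesis
  unfolding set_lebesgue_integral_def using lebesgue_integral_affine[OF m h, of z] unfolding e .
qed

definition rbox :: "real \<Rightarrow> pt set" where
 "rbox s = cbox (vector [- s, - s]) (vector [s, s])"

lemma mem_rbox: "x \<in> rbox s \<longleftrightarrow> \<bar>x $ 1\<bar> \<le> s \<and> \<bar>x $ 2\<bar> \<le> s"
 by (auto simp: rbox_def mem_box_cart forall_2 vector_2)

lemma rbox_elt: "0 < s ==> elt (rbox s)"
proof -
 assume s: "0 < s"
 have "0 \<in> box (vector [- s, - s]) (vector [s, s] :: pt)"
  using s by (auto simp: mem_box_cart forall_2 vector_2)
 then show ?thesis by (auto simp: elt_def rbox_def interior_cbox)
qed

lemma triangle_verts_ref: "s \<noteq> 0 ==> triangle_verts {0, axis 1 s, axis 2 s}"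
proof -
 assume s: "s \<noteq> 0"
 have d: "(0::pt) \<noteq> axis 1 s" "(0::pt) \<noteq> axis 2 s" "(axis 1 s :: pt) \<noteq> axis 2 s"
  using s by (auto simp: axis_eq_axis axis_eq_0_iff vec_eq_iff axis_def split: if_splits)
 have "\<not> affine_dependent {0, axis 1 s, axis 2 s :: pt}"
 proof
  assume "affine_dependent {0, axis 1 s, axis 2 s :: pt}"
  then obtain U where U: "sum U {0, axis 1 s, axis 2 s :: pt} = 0" "\<exists>v\<in>{0, axis 1 s, axis 2 s}. U v \<noteq> 0"
   "(\<Sum>v\<in>{0, axis 1 s, axis 2 s}. U v *\<^sub>R v) = 0"
   by (subst (asm) affine_dependent_explicit_finite) auto
  have "U (axis 1 s) *\<^sub>R axis 1 s + U (axis 2 s) *\<^sub>R (axis 2 s :: pt) = 0" using U(3) d by simp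
  then have "U (axis 1 s) * s = 0" "U (axis 2 s) * s = 0"
   by (auto simp: vec_eq_iff forall_2 axis_def)
  then have "U (axis 1 s) = 0" "U (axis 2 s) = 0" using s by auto
  then show False using U(1,2) d by auto
 qed
 then show ?thesis using d by (simp add: triangle_verts_def)
qed

lemma Pol_zero_rbox:
 assumes q: "q \<in> Pol p" and p: "1 \<le> p" and s: "0 < s" and z: "l2_ip (rbox s) q q = 0"
 shows "q = 0"
proof -
 let ?a = "vector [- s, - s] :: pt" and ?b = "vector [s, s] :: pt"
 have c: "continuous_on (cbox ?a ?b) (\<lambda>x. (cmod (q x))\<^sup>2)"
  by (intro continuous_intros Pol_continuous[OF q])
 have "set_integrable lebesgue (rbox s) (\<lambda>x. (cmod (q x))\<^sup>2)"
  using c by (intro lint_compact_continuous) (auto simp: rbox_def)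
 note i = has_integral_set_lebesgue[OF this]
 have "(LINT x:rbox s|lebesgue. (cmod (q x))\<^sup>2) = 0" using z unfolding l2_ip_self by simp
 then have i0: "((\<lambda>x. (cmod (q x))\<^sup>2) has_integral 0) (cbox ?a ?b)" using i by (simp add: rbox_def)
 have ne: "box ?a ?b \<noteq> {}"
 proof -
  have "0 \<in> box ?a ?b" using s by (auto simp: mem_box_cart forall_2 vector_2)
  then show ?thesis by blast
 qed
 have zero: "q x = 0" if "x \<in> rbox s" for x
  using has_integral_0_cbox_imp_0[OF c _ i0 ne, of x] that by (simp add: rbox_def)
 show ?thesis
 proof (rule Pol_zero_nodes[OF triangle_verts_ref p q])
  show "s \<noteq> 0" using s by simp
  fix k assume "k \<in> multi_idx p {0, axis 1 s, axis 2 s}"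
  then have "node p {0, axis 1 s, axis 2 s} k \<in> convex hull {0, axis 1 s, axis 2 s}"
   using s p by (intro node_in_hull triangle_verts_ref) auto
  also have "... \<subseteq> rbox s"
  proof (rule hull_minimal)
   show "{0, axis 1 s, axis 2 s} \<subseteq> rbox s" using s by (auto simp: mem_rbox axis_def)
   show "convex (rbox s)" by (simp add: rbox_def)
  qed
  finally show "q (node p {0, axis 1 s, axis 2 s} k) = 0" by (rule zero)
 qed
qed

definition inv_bound :: "nat \<Rightarrow> real \<Rightarrow> real \<Rightarrow> bool" where
 "inv_bound p s C \<longleftrightarrow> 0 < C \<and> (\<forall>q\<in>Pol p. \<forall>y\<in>cball 0 1.
   (cmod (q y))\<^sup>2 \<le> C * mass (rbox s) q \<and>
   (\<forall>D h. (q has_derivative D) (at y) \<longrightarrow> (cmod (D h))\<^sup>2 \<le> C * mass (rbox s) q * (norm h)\<^sup>2))"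

lemma inv_boundD:
 assumes "inv_bound p s C" "q \<in> Pol p" "y \<in> cball 0 1"
 shows "(cmod (q y))\<^sup>2 \<le> C * mass (rbox s) q"
  and "(q has_derivative D) (at y) ==> (cmod (D h))\<^sup>2 \<le> C * mass (rbox s) q * (norm h)\<^sup>2"
 using assms unfolding inv_bound_def by auto

text \<open>Point evaluations are continuous on a finite-dimensional space with the \<open>L\<^sup>2\<close> inner product, by the
 Riesz theorem; expanding in the finitely many Lagrange functions makes the bound uniform on the unit disc.\<close>

lemma inv_bound_exists:
 assumes p: "1 \<le> p" and s: "0 < s"
 shows "\<exists>C. inv_bound p s C"
proof -
 let ?V = "{0, axis 1 s, axis 2 s} :: pt set"
 have V: "triangle_verts ?V" using s by (intro triangle_verts_ref) auto
 let ?K = "multi_idx p ?V"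
 let ?b = "l2_ip (rbox s)"
 have fK: "finite ?K" using V by (intro finite_multi_idx) (simp add: triangle_verts_def)
 have el: "elts {rbox s}" using rbox_elt[OF s] by (simp add: elts_def)
 have b: "psd (Pol p) ?b"
  using psd_subset[OF psd_ips(1)[OF el, of p], of "Pol p"] pw_Pol by auto
 have "\<exists>R. \<forall>q\<in>Pol p. cmod (q x) \<le> R * snorm ?b q" for x
 proof -
  have "\<exists>!r. r \<in> Pol p \<and> (\<forall>q\<in>Pol p. ?b r q = cnj (q x))"
  proof (rule riesz_unique_solution[OF Pol_fdim b])
   show "u = 0" if "u \<in> Pol p" "?b u u = 0" for u using Pol_zero_rbox[OF that(1) p s that(2)] .
   show "antilin (Pol p) (\<lambda>q. cnj (q x))" by (simp add: antilin_def fapply)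
  qed
  then obtain r where r: "r \<in> Pol p" "\<And>q. q \<in> Pol p ==> ?b r q = cnj (q x)" by blast
  have "cmod (q x) \<le> snorm ?b r * snorm ?b q" if q: "q \<in> Pol p" for q
   using psd_cauchy_schwarz[OF b Pol_subspace r(1) q] r(2)[OF q] by simp
  then show ?thesis by blast
 qed
 then have "\<forall>x. \<exists>R. \<forall>q\<in>Pol p. cmod (q x) \<le> R * snorm ?b q" by blast
 from choice[OF this] obtain R where R: "\<And>x q. q \<in> Pol p ==> cmod (q x) \<le> R x * snorm ?b q" by blast
 have "\<exists>B. \<forall>y\<in>cball 0 1. cmod (f y) \<le> B" if f: "f \<in> Pol p" for f
 proof -
  have "compact (f ` cball 0 1)" by (intro compact_continuous_image Pol_continuous[OF f]) auto
  then have "bounded (f ` cball 0 1)" by (rule compact_imp_bounded)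
  then show ?thesis unfolding bounded_iff by blast
 qed
 then have "\<forall>f\<in>Pol p. \<exists>B. \<forall>y\<in>cball 0 1. cmod (f y) \<le> B" by blast
 from bchoice[OF this] obtain B where B: "\<And>f y. f \<in> Pol p ==> y \<in> cball 0 1 ==> cmod (f y) \<le> B f" by blast
 define L where "L = lagr p ?V"
 have LP: "L k \<in> Pol p" if "k \<in> ?K" for k unfolding L_def by (rule lagr_Pol[OF V that])
 define der where "der k g \<longleftrightarrow> fst g \<in> Pol p \<and> snd g \<in> Pol p \<and>
   (\<forall>x. (L k has_derivative (\<lambda>h. fst g x * of_real (h $ 1) + snd g x * of_real (h $ 2))) (at x))" for k g
 have "\<forall>k\<in>?K. \<exists>g. der k g"
 proof
  fix k assume "k \<in> ?K"
  then obtain q1 q2 where "q1 \<in> Pol p" "q2 \<in> Pol p"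
   "\<forall>x. (L k has_derivative (\<lambda>h. q1 x * of_real (h $ 1) + q2 x * of_real (h $ 2))) (at x)"
   using Pol_derivative[OF LP] by blast
  then have "der k (q1, q2)" by (simp add: der_def)
  then show "\<exists>g. der k g" ..
 qed
 from bchoice[OF this] obtain g where der: "\<And>k. k \<in> ?K ==> der k (g k)" by blast
 have g: "fst (g k) \<in> Pol p" "snd (g k) \<in> Pol p"
  "(L k has_derivative (\<lambda>h. fst (g k) x * of_real (h $ 1) + snd (g k) x * of_real (h $ 2))) (at x)"
  if k: "k \<in> ?K" for k x
 proof -
  note d = der[OF k, unfolded der_def]
  show "fst (g k) \<in> Pol p" by (rule conjunct1[OF d])
  show "snd (g k) \<in> Pol p" by (rule conjunct1[OF conjunct2[OF d]])
  show "(L k has_derivative (\<lambda>h. fst (g k) x * of_real (h $ 1) + snd (g k) x * of_real (h $ 2))) (at x)"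
   by (rule spec[OF conjunct2[OF conjunct2[OF d]]])
 qed
 define nd where "nd = node p ?V"
 define C1 where "C1 = (\<Sum>k\<in>?K. \<bar>R (nd k)\<bar> * \<bar>B (L k)\<bar>)"
 define C2 where "C2 = (\<Sum>k\<in>?K. \<bar>R (nd k)\<bar> * (\<bar>B (fst (g k))\<bar> + \<bar>B (snd (g k))\<bar>))"
 have exp: "q y = (\<Sum>k\<in>?K. q (nd k) * L k y)" if "q \<in> Pol p" for q y
  unfolding nd_def L_def by (rule Pol_lagrange[OF V p that])
 have Rq: "cmod (q (nd k)) \<le> \<bar>R (nd k)\<bar> * snorm ?b q" if "q \<in> Pol p" for q k
 proof -
  have "R (nd k) * snorm ?b q \<le> \<bar>R (nd k)\<bar> * snorm ?b q"
   using snorm_nonneg[OF b that] by (intro mult_right_mono) auto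
  then show ?thesis using R[OF that, of "nd k"] by linarith
 qed
 have v1: "cmod (q y) \<le> C1 * snorm ?b q" if q: "q \<in> Pol p" and y: "y \<in> cball 0 1" for q y
 proof -
  have "cmod (q y) = cmod (\<Sum>k\<in>?K. q (nd k) * L k y)" by (rule arg_cong[OF exp[OF q]])
  also have "... \<le> (\<Sum>k\<in>?K. (\<bar>R (nd k)\<bar> * snorm ?b q) * \<bar>B (L k)\<bar>)"
  proof (rule sum_norm_le)
   fix k assume k: "k \<in> ?K"
   have "cmod (L k y) \<le> \<bar>B (L k)\<bar>" using B[OF LP[OF k] y] by linarith
   then show "cmod (q (nd k) * L k y) \<le> (\<bar>R (nd k)\<bar> * snorm ?b q) * \<bar>B (L k)\<bar>"
    unfolding norm_mult using Rq[OF q, of k] snorm_nonneg[OF b q] by (intro mult_mono) auto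
  qed
  also have "... = C1 * snorm ?b q" by (simp add: C1_def sum_distrib_left sum_distrib_right mult_ac)
  finally show ?thesis .
 qed
 have v2: "cmod (D h) \<le> C2 * snorm ?b q * norm h"
  if q: "q \<in> Pol p" and y: "y \<in> cball 0 1" and D: "(q has_derivative D) (at y)" for q y D h
 proof -
  let ?G = "\<lambda>k h. fst (g k) y * of_real (h $ 1) + snd (g k) y * of_real (h $ 2)"
  have "((\<lambda>y. \<Sum>k\<in>?K. q (nd k) * L k y) has_derivative (\<lambda>h. \<Sum>k\<in>?K. q (nd k) * ?G k h)) (at y)"
   by (intro has_derivative_sum has_derivative_mult_right g(3))
  moreover have "(\<lambda>y. \<Sum>k\<in>?K. q (nd k) * L k y) = q" by (rule ext, rule exp[OF q, symmetric])
  ultimately have "(q has_derivative (\<lambda>h. \<Sum>k\<in>?K. q (nd k) * ?G k h)) (at y)"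
   by (simp only:)
  then have "D = (\<lambda>h. \<Sum>k\<in>?K. q (nd k) * ?G k h)" by (rule has_derivative_unique[OF D])
  then have "cmod (D h) = cmod (\<Sum>k\<in>?K. q (nd k) * ?G k h)" by simp
  also have "... \<le> (\<Sum>k\<in>?K. (\<bar>R (nd k)\<bar> * snorm ?b q) * ((\<bar>B (fst (g k))\<bar> + \<bar>B (snd (g k))\<bar>) * norm h))"
  proof (rule sum_norm_le)
   fix k assume k: "k \<in> ?K"
   have c: "cmod (f y * of_real (h $ i)) \<le> \<bar>B f\<bar> * norm h" if "f \<in> Pol p" for f i
    unfolding norm_mult using B[OF that y] component_le_norm_cart[of h i]
    by (intro mult_mono) auto
   have "cmod (?G k h) \<le> (\<bar>B (fst (g k))\<bar> + \<bar>B (snd (g k))\<bar>) * norm h"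
    using norm_triangle_le[OF add_mono[OF c[OF g(1)[OF k], of 1] c[OF g(2)[OF k], of 2]]]
    by (simp add: distrib_right)
   then show "cmod (q (nd k) * ?G k h) \<le> (\<bar>R (nd k)\<bar> * snorm ?b q) * ((\<bar>B (fst (g k))\<bar> + \<bar>B (snd (g k))\<bar>) * norm h)"
    unfolding norm_mult using Rq[OF q, of k] snorm_nonneg[OF b q] by (intro mult_mono) auto
  qed
  also have "... = C2 * snorm ?b q * norm h" by (simp add: C2_def sum_distrib_left sum_distrib_right mult_ac)
  finally show ?thesis .
 qed
 define C where "C = C1\<^sup>2 + C2\<^sup>2 + 1"
 have "inv_bound p s C"
  unfolding inv_bound_def
 proof (intro conjI ballI allI impI)
  show "0 < C" unfolding C_def by (simp add: add_nonneg_pos)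
  fix q and y :: pt assume q: "q \<in> Pol p" and y: "y \<in> cball 0 1"
  have N: "Re (?b q q) = (snorm ?b q)\<^sup>2" using snorm_sq[OF b q] by simp
  have "(cmod (q y))\<^sup>2 \<le> (C1 * snorm ?b q)\<^sup>2" using v1[OF q y] by (intro power_mono) auto
  also have "... \<le> C * Re (?b q q)" unfolding N power_mult_distrib C_def by (intro mult_right_mono) auto
  finally show "(cmod (q y))\<^sup>2 \<le> C * Re (?b q q)" .
  fix D h assume D: "(q has_derivative D) (at y)"
  have "(cmod (D h))\<^sup>2 \<le> (C2 * snorm ?b q * norm h)\<^sup>2" using v2[OF q y D] by (intro power_mono) auto
  also have "... \<le> C * Re (?b q q) * (norm h)\<^sup>2"
   unfolding N power_mult_distrib C_def by (intro mult_right_mono) auto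
  finally show "(cmod (D h))\<^sup>2 \<le> C * Re (?b q q) * (norm h)\<^sup>2" .
 qed
 then show ?thesis ..
qed

definition invC :: "nat \<Rightarrow> real \<Rightarrow> real" where
 "invC p K = (SOME C. inv_bound p (1 / (3 * K)) C)"

lemma invC: "1 \<le> p ==> 1 \<le> K ==> inv_bound p (1 / (3 * K)) (invC p K)"
 unfolding invC_def by (rule someI_ex, rule inv_bound_exists) auto

lemma invC_pos: "1 \<le> p ==> 1 \<le> K ==> 0 < invC p K"
 using invC unfolding inv_bound_def by blast

definition fat :: "real \<Rightarrow> pt set \<Rightarrow> bool" where
 "fat K T \<longleftrightarrow> elt T \<and> (\<exists>z. ball z (diameter T / K) \<subseteq> T)"

lemma elt_diameter_pos: assumes "elt T" shows "0 < diameter T"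
proof -
 obtain x where "x \<in> interior T" using assms unfolding elt_def by blast
 then obtain e where e: "0 < e" "cball x e \<subseteq> interior T"
  using open_contains_cball[of "interior T"] open_interior by blast
 have xe: "0 < e" "cball x e \<subseteq> T" using e interior_subset by blast+
 have "diameter (cball x e) \<le> diameter T"
  using assms xe by (intro diameter_subset) (auto simp: elt_def compact_imp_bounded)
 then show ?thesis using xe by simp
qed

abbreviation disc_area :: real where "disc_area \<equiv> measure lebesgue (ball (0::pt) 1)"

lemma disc_area_pos: "0 < disc_area"
 using content_ball_pos[of 1 "0::pt"] by simp

lemma measure_ball2: "0 \<le> r ==> measure lebesgue (ball (c::pt) r) = r\<^sup>2 * disc_area"
 using content_ball_conv_unit_ball[of r c] by simp

lemma elt_measure_le:
 assumes "elt T" shows "measure lebesgue T \<le> 4 * (diameter T)\<^sup>2 * disc_area"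
proof -
 obtain x where x: "x \<in> T" using assms interior_subset unfolding elt_def by blast
 have d: "0 < diameter T" using elt_diameter_pos[OF assms] .
 have "T \<subseteq> ball x (2 * diameter T)"
  using diameter_bounded_bound[of T x] x assms d by (force simp: elt_def compact_imp_bounded)
 then have "measure lebesgue T \<le> measure lebesgue (ball x (2 * diameter T))"
  using elt_sets[OF assms] by (intro measure_mono_fmeasurable) auto
 also have "... = (2 * diameter T)\<^sup>2 * disc_area" using d by (intro measure_ball2) auto
 finally show ?thesis by (simp add: power_mult_distrib)
qed

lemma lint_bound:
 fixes f :: "pt \<Rightarrow> real"
 assumes T: "elt T" and f: "set_integrable lebesgue T f" and B: "\<And>x. x \<in> interior T ==> f x \<le> B" and B0: "0 \<le> B"
 shows "(LINT x:T|lebesgue. f x) \<le> 4 * (diameter T)\<^sup>2 * disc_area * B"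
proof -
 let ?f = "\<lambda>x. if x \<in> frontier T then 0 else f x"
 have N: "negligible (frontier T)" by (rule elt_frontier_negligible[OF T])
 have i: "set_integrable lebesgue T ?f" by (rule lint_spike(1)[OF f N]) auto
 have c: "set_integrable lebesgue T (\<lambda>x. B)"
  using T by (intro lint_compact_continuous) (auto simp: elt_def)
 have "(LINT x:T|lebesgue. f x) = (LINT x:T|lebesgue. ?f x)"
  by (rule sym, rule lint_spike(2)[OF f N]) auto
 also have "... \<le> (LINT x:T|lebesgue. B)"
  using elt_minus_frontier[OF T] B B0 by (intro set_integral_mono i c) auto
 also have "... = measure lebesgue T * B"
  unfolding set_lebesgue_integral_def using elt_sets[OF T] by simp
 also have "... \<le> 4 * (diameter T)\<^sup>2 * disc_area * B"
  using elt_measure_le[OF T] B0 by (intro mult_right_mono)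
 finally show ?thesis .
qed

context
 fixes p :: nat and K :: real and T :: "pt set" and u :: scalar_fun
 assumes p: "1 \<le> p" and K: "1 \<le> K" and T: "fat K T" and u: "u \<in> pw p {T}"
begin

text \<open>A fat element contains a square of comparable size and lies in the disc about the same centre with its
 diameter as radius. Scaling to unit diameter leaves one fixed square and the unit disc.\<close>

lemma local_inverse:
 shows "x \<in> T ==> (cmod (u x))\<^sup>2 \<le> invC p K / (diameter T)\<^sup>2 * mass T u" (is "_ ==> ?A")
  and "x \<in> interior T ==> (cmod (grad u x $ i))\<^sup>2 \<le> invC p K / (diameter T) ^ 4 * mass T u" (is "_ ==> ?B")
proof -
 let ?h = "diameter T" and ?s = "1 / (3 * K)" and ?C = "invC p K"
 have eT: "elt T" using T by (simp add: fat_def)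
 obtain z where z: "ball z (?h / K) \<subseteq> T" using T by (auto simp: fat_def)
 have h: "0 < ?h" by (rule elt_diameter_pos[OF eT])
 have zT: "z \<in> T" using z h K by (auto simp: subset_iff)
 obtain q where q: "q \<in> Pol p" "\<And>x. x \<in> T ==> u x = q x" using pwE[OF u] by blast
 define Q where "Q = (\<lambda>y. q (z + ?h *\<^sub>R y))"
 have QP: "Q \<in> Pol p"
  unfolding Q_def
 proof (rule Pol_compose_affine[OF q(1)])
  show "(\<lambda>x. complex_of_real ((z + ?h *\<^sub>R x) $ 1)) \<in> Pol 1" using Pol_affine[of "z $ 1" ?h 0] by simp
  show "(\<lambda>x. complex_of_real ((z + ?h *\<^sub>R x) $ 2)) \<in> Pol 1" using Pol_affine[of "z $ 2" 0 ?h] by simp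
 qed
 let ?I = "(\<lambda>y. z + ?h *\<^sub>R y) ` rbox ?s"
 have sub: "?I \<subseteq> T"
 proof
  fix x assume "x \<in> ?I"
  then obtain y where y: "y \<in> rbox ?s" "x = z + ?h *\<^sub>R y" by blast
  have "norm y \<le> (\<Sum>i\<in>UNIV. \<bar>y $ i\<bar>)" by (rule norm_le_l1_cart)
  also have "... \<le> ?s + ?s" using y(1) by (auto simp: mem_rbox sum_2)
  also have "... < 1 / K" using K by (simp add: field_simps)
  finally have "?h * norm y < ?h * (1 / K)" using h by (rule mult_strict_left_mono)
  then have "x \<in> ball z (?h / K)" using y h by (simp add: dist_norm)
  then show "x \<in> T" using z by blast
 qed
 have N: "mass (rbox ?s) Q \<le> mass T u / ?h\<^sup>2"
 proof -
  have i: "set_integrable lebesgue T (\<lambda>x. (cmod (q x))\<^sup>2)"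
   using eT by (intro lint_compact_continuous continuous_intros Pol_continuous[OF q(1)]) (auto simp: elt_def)
  have cI: "compact ?I"
   by (intro compact_continuous_image continuous_intros) (auto simp: rbox_def)
  have "?h\<^sup>2 * (LINT y:rbox ?s|lebesgue. (cmod (Q y))\<^sup>2) = (LINT x:?I|lebesgue. (cmod (q x))\<^sup>2)"
   unfolding Q_def using h
   by (subst lint_affine) (auto simp: rbox_def intro!: continuous_intros Pol_continuous[OF q(1)])
  also have "... \<le> (LINT x:T|lebesgue. (cmod (q x))\<^sup>2)"
   using sub cI by (intro lint_mono_set i) (auto simp: borel_compact)
  also have "... = (LINT x:T|lebesgue. (cmod (u x))\<^sup>2)"
   using q(2) elt_sets[OF eT] by (intro set_lebesgue_integral_cong) auto
  finally show ?thesis unfolding l2_ip_self using h by (simp add: field_simps)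
 qed
 have N0: "0 \<le> mass (rbox ?s) Q" unfolding l2_ip_self by (simp add: lint_nonneg)
 have C: "inv_bound p ?s ?C" by (rule invC[OF p K])
 have C0: "0 < ?C" by (rule invC_pos[OF p K])
 have y: "(1 / ?h) *\<^sub>R (x - z) \<in> cball 0 1" "z + ?h *\<^sub>R ((1 / ?h) *\<^sub>R (x - z)) = x" if "x \<in> T" for x
 proof -
  have "norm (x - z) \<le> ?h"
   using diameter_bounded_bound[of T x z] that zT eT by (auto simp: elt_def compact_imp_bounded dist_norm)
  then have "norm (x - z) / ?h \<le> 1" using h by (simp only: divide_le_eq_1_pos)
  moreover have "norm ((1 / ?h) *\<^sub>R (x - z)) = norm (x - z) / ?h" using h by simp
  ultimately show "(1 / ?h) *\<^sub>R (x - z) \<in> cball 0 1" by (simp only: mem_cball_0)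
  show "z + ?h *\<^sub>R ((1 / ?h) *\<^sub>R (x - z)) = x" using h by simp
 qed
 show ?A if x: "x \<in> T"
 proof -
  have "(cmod (Q ((1 / ?h) *\<^sub>R (x - z))))\<^sup>2 \<le> ?C * mass (rbox ?s) Q"
   by (rule inv_boundD(1)[OF C QP y(1)[OF x]])
  also have "Q ((1 / ?h) *\<^sub>R (x - z)) = u x" unfolding Q_def y(2)[OF x] q(2)[OF x] ..
  also have "?C * mass (rbox ?s) Q \<le> ?C * (mass T u / ?h\<^sup>2)"
   using N C0 by (intro mult_left_mono) auto
  finally show ?thesis by simp
 qed
 show ?B if xi: "x \<in> interior T"
 proof -
  have x: "x \<in> T" using xi interior_subset by blast
  obtain D where D: "(q has_derivative D) (at x)" using Pol_derivative[OF q(1)] by blast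
  have "(u has_derivative D) (at x)"
   by (rule has_derivative_transform_within_open[OF D open_interior xi])
    (use q interior_subset in force)
  then have gr: "grad u x $ i = D (axis i 1)" by (rule grad_derivative)
  have Dl: "linear D" using D has_derivative_linear by blast
  let ?y = "(1 / ?h) *\<^sub>R (x - z)"
  have inner: "((\<lambda>y. z + ?h *\<^sub>R y) has_derivative (\<lambda>k. ?h *\<^sub>R k)) (at ?y)"
   by (auto intro!: derivative_eq_intros)
  have "(q has_derivative D) (at (z + ?h *\<^sub>R ?y))" using D y(2)[OF x] by simp
  from has_derivative_compose[OF inner this]
  have "(Q has_derivative (\<lambda>k. D (?h *\<^sub>R k))) (at ?y)" unfolding Q_def by simp
  then have "(cmod (D (?h *\<^sub>R axis i 1)))\<^sup>2 \<le> ?C * mass (rbox ?s) Q * (norm (axis i 1 :: pt))\<^sup>2"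
   by (rule inv_boundD(2)[OF C QP y(1)[OF x], where D = "\<lambda>k. D (?h *\<^sub>R k)"])
  also have "... \<le> ?C * (mass T u / ?h\<^sup>2)"
   unfolding norm_axis_1 power_one mult_1_right by (rule mult_left_mono[OF N less_imp_le[OF C0]])
  also have "D (?h *\<^sub>R axis i 1) = ?h *\<^sub>R D (axis i 1)" by (rule linear_scale[OF Dl])
  also have "(cmod (?h *\<^sub>R D (axis i 1)))\<^sup>2 = ?h\<^sup>2 * (cmod (D (axis i 1)))\<^sup>2"
   by (simp only: norm_scaleR power_mult_distrib power2_abs)
  finally have "(?h\<^sup>2 * (cmod (D (axis i 1)))\<^sup>2) / ?h\<^sup>2 \<le> (?C * (mass T u / ?h\<^sup>2)) / ?h\<^sup>2"
   by (rule divide_right_mono) simp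
  moreover have "(?h\<^sup>2 * (cmod (D (axis i 1)))\<^sup>2) / ?h\<^sup>2 = (cmod (D (axis i 1)))\<^sup>2" using h by simp
  moreover have "(?C * (mass T u / ?h\<^sup>2)) / ?h\<^sup>2 = ?C / ?h ^ 4 * mass T u"
   by (simp add: power4_eq_xxxx power2_eq_square)
  ultimately show ?thesis unfolding gr by (simp only:)
 qed
qed

lemma local_inverse_grad:
 "energy T u \<le> 8 * disc_area * invC p K / (diameter T)\<^sup>2 * mass T u"
proof -
 let ?h = "diameter T" and ?N = "mass T u"
 have eT: "elt T" using T by (simp add: fat_def)
 have h: "0 < ?h" by (rule elt_diameter_pos[OF eT])
 have i: "set_integrable lebesgue T (\<lambda>x. \<Sum>i\<in>UNIV. (cmod (grad u x $ i))\<^sup>2)"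
 proof -
  have "integrable lebesgue (\<lambda>x. Re (indicat_real T x *\<^sub>R grad_ip u u x))"
   using grad_ip_integrable_elt[OF eT u u] unfolding set_integrable_def by (intro integrable_Re) simp
  moreover have "Re (indicat_real T x *\<^sub>R grad_ip u u x) = indicat_real T x *\<^sub>R (\<Sum>i\<in>UNIV. (cmod (grad u x $ i))\<^sup>2)" for x
   by (simp add: grad_ip_def complex_norm_square[symmetric] sum_2 cmod_power2 complex_mult_cnj)
  ultimately show ?thesis unfolding set_integrable_def by (simp only:)
 qed
 have N0: "0 \<le> ?N" unfolding l2_ip_self by (simp add: lint_nonneg)
 have "energy T u \<le> 4 * ?h\<^sup>2 * disc_area * (2 * (invC p K / ?h ^ 4 * ?N))"
  unfolding dirichlet_ip_self Re_complex_of_real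
 proof (rule lint_bound[OF eT i])
  fix x assume "x \<in> interior T"
  then show "(\<Sum>i\<in>UNIV. (cmod (grad u x $ i))\<^sup>2) \<le> 2 * (invC p K / ?h ^ 4 * ?N)"
   unfolding sum_2 using local_inverse(2)[of x 1] local_inverse(2)[of x 2] by linarith
 qed (use N0 invC_pos[OF p K] in auto)
 also have "... = 8 * disc_area * invC p K / ?h\<^sup>2 * ?N"
  using h by (simp add: field_simps power4_eq_xxxx power2_eq_square)
 finally show ?thesis .
qed

lemma local_l2_sup:
 assumes B: "\<And>x. x \<in> T ==> cmod (u x) \<le> B"
 shows "mass T u \<le> 4 * (diameter T)\<^sup>2 * disc_area * B\<^sup>2"
proof -
 have eT: "elt T" using T by (simp add: fat_def)
 obtain q where q: "q \<in> Pol p" "\<And>x. x \<in> T ==> u x = q x" using pwE[OF u] by blast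
 have i: "set_integrable lebesgue T (\<lambda>x. (cmod (q x))\<^sup>2)"
  using eT by (intro lint_compact_continuous continuous_intros Pol_continuous[OF q(1)]) (auto simp: elt_def)
 then have "set_integrable lebesgue T (\<lambda>x. (cmod (u x))\<^sup>2)"
  by (rule lint_spike(1)[OF _ negligible_empty]) (simp add: q(2))
 then show ?thesis
  unfolding l2_ip_self Re_complex_of_real
  by (rule lint_bound[OF eT]) (use B interior_subset in \<open>auto intro!: power_mono\<close>)
qed

lemma local_grad_sup:
 assumes B: "\<And>x. x \<in> T ==> cmod (u x) \<le> B"
 shows "energy T u \<le> 32 * disc_area\<^sup>2 * invC p K * B\<^sup>2"
proof -
 have h: "0 < diameter T" using T elt_diameter_pos by (simp add: fat_def)
 have "energy T u \<le> 8 * disc_area * invC p K / (diameter T)\<^sup>2 * mass T u"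
  by (rule local_inverse_grad)
 also have "... \<le> 8 * disc_area * invC p K / (diameter T)\<^sup>2 * (4 * (diameter T)\<^sup>2 * disc_area * B\<^sup>2)"
  using local_l2_sup[OF B] invC_pos[OF p K] by (intro mult_left_mono) auto
 also have "... = 32 * disc_area\<^sup>2 * invC p K * B\<^sup>2"
  using h by (simp add: field_simps power2_eq_square)
 finally show ?thesis .
qed

end

section \<open>Boundary edges of a union of triangles\<close>

definition tri :: "pt set \<Rightarrow> bool" where
 "tri T \<longleftrightarrow> (\<exists>V. triangle_verts V \<and> T = convex hull V)"

definition verts :: "pt set \<Rightarrow> pt set" where
 "verts T = {a. a extreme_point_of T}"

lemma verts_hull: "\<not> affine_dependent V ==> verts (convex hull V) = V"
 by (auto simp: verts_def extreme_point_of_convex_hull_affine_independent)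

lemma tri_verts:
 assumes "tri T" shows "triangle_verts (verts T)" "T = convex hull (verts T)"
proof -
 obtain V where V: "triangle_verts V" "T = convex hull V" using assms unfolding tri_def by blast
 then have "verts T = V" by (simp add: verts_hull triangle_verts_def)
 then show "triangle_verts (verts T)" "T = convex hull (verts T)" using V by auto
qed

lemma two_simplex_tri: "2 simplex T ==> tri T"
 unfolding simplex_def tri_def triangle_verts_def
 by (metis aff_independent_finite numeral_2_eq_2 numeral_3_eq_3 of_nat_eq_iff of_nat_numeral one_plus_numeral add.commute semiring_norm(3))

lemma tri_elt: "tri T ==> elt T"
proof -
 assume T: "tri T"
 note v = tri_verts[OF T]
 have a: "affine hull T = UNIV" using v triangle_affine_hull by (metis affine_hull_convex_hull)
 have f: "finite (verts T)" "verts T \<noteq> {}" using v(1) by (auto simp: triangle_verts_def)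
 have c: "compact T" "convex T" using v(2) f(1) finite_imp_compact_convex_hull by (metis, metis convex_convex_hull)
 have "T \<noteq> {}" using v(2) f(2) by (metis convex_hull_eq_empty)
 then have "rel_interior T \<noteq> {}" using c rel_interior_eq_empty by blast
 then show ?thesis using c rel_interior_interior[OF a] by (simp add: elt_def)
qed

lemma tri_aff_dim: "tri T ==> aff_dim T = 2"
proof -
 assume T: "tri T"
 note v = tri_verts[OF T]
 have "affine hull T = UNIV" using v triangle_affine_hull by (metis affine_hull_convex_hull)
 then have "aff_dim T = DIM(pt)" using aff_dim_eq_full by blast
 then show ?thesis by simp
qed

definition conforming :: "pt set set \<Rightarrow> bool" where
 "conforming \<G> \<longleftrightarrow> finite \<G> \<and> (\<forall>T\<in>\<G>. tri T) \<and>
   (\<forall>T\<in>\<G>. \<forall>T'\<in>\<G>. (T \<inter> T') face_of T \<and> (T \<inter> T') face_of T')"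

lemma conforming_subset: "conforming \<G> ==> \<H> \<subseteq> \<G> ==> conforming \<H>"
 unfolding conforming_def by (meson finite_subset subsetD)

lemma conforming_proper_face:
 assumes "conforming \<G>" "T \<in> \<G>" "T' \<in> \<G>" "T \<noteq> T'"
 shows "T \<inter> T' \<noteq> T"
proof
 assume e: "T \<inter> T' = T"
 have t: "tri T" "tri T'" and "(T \<inter> T') face_of T'" using assms unfolding conforming_def by auto
 then have "T face_of T'" using e by simp
 moreover have "convex T'" using t tri_elt by (simp add: elt_def)
 ultimately have "aff_dim T < aff_dim T'" using assms(4) face_of_aff_dim_lt by blast
 then show False using t tri_aff_dim by simp
qed

lemma conforming_disjoint_interior:
 assumes "conforming \<G>" "T \<in> \<G>" "T' \<in> \<G>" "T \<noteq> T'"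
 shows "T' \<inter> interior T = {}"
proof -
 have "(T \<inter> T') face_of T" using assms unfolding conforming_def by auto
 then have "(T \<inter> T') \<inter> interior T = {}"
  using face_of_disjoint_interior conforming_proper_face[OF assms] by blast
 then show ?thesis using interior_subset by blast
qed

lemma conforming_elts: "conforming \<G> ==> elts \<G>"
 unfolding elts_def
proof (intro conjI ballI impI)
 assume G: "conforming \<G>"
 show "finite \<G>" using G by (simp add: conforming_def)
 show el: "elt T" if "T \<in> \<G>" for T using G that tri_elt unfolding conforming_def by blast
 fix T T' assume T: "T \<in> \<G>" "T' \<in> \<G>" "T \<noteq> T'"
 have "T \<inter> T' \<subseteq> frontier T"
  using conforming_disjoint_interior[OF G T] closure_subset[of T] by (auto simp: frontier_def)
 then show "negligible (T \<inter> T')"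
  using elt_frontier_negligible[OF el[OF T(1)]] negligible_subset by blast
qed

lemma conforming_Union_closed: "conforming \<G> ==> closed (\<Union>\<G>)" "conforming \<G> ==> compact (\<Union>\<G>)"
proof -
 assume G: "conforming \<G>"
 have "\<forall>T\<in>\<G>. compact T" using conforming_elts[OF G] by (simp add: elts_def elt_def)
 then show "compact (\<Union>\<G>)" using G by (intro compact_Union) (auto simp: conforming_def)
 then show "closed (\<Union>\<G>)" by (rule compact_imp_closed)
qed

lemma bc_combination:
 assumes V: "triangle_verts V" and u: "finite A" "sum u A = 1"
 shows "bc V (\<Sum>v\<in>A. u v *\<^sub>R v) a = (\<Sum>v\<in>A. u v * bc V v a)"
proof -
 have "bc V (\<Sum>v\<in>A. u v *\<^sub>R v) = (\<lambda>a. \<Sum>v\<in>A. u v * bc V v a)"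
 proof (rule bc_triangle_unique[OF V])
  have "(\<Sum>a\<in>V. \<Sum>v\<in>A. u v * bc V v a) = (\<Sum>v\<in>A. u v * (\<Sum>a\<in>V. bc V v a))"
   by (subst sum.swap) (simp add: sum_distrib_left)
  then show "(\<Sum>a\<in>V. \<Sum>v\<in>A. u v * bc V v a) = 1" using u bc_triangle(1)[OF V] by simp
  have "(\<Sum>a\<in>V. (\<Sum>v\<in>A. u v * bc V v a) *\<^sub>R a) = (\<Sum>v\<in>A. u v *\<^sub>R (\<Sum>a\<in>V. bc V v a *\<^sub>R a))"
   unfolding scaleR_sum_left scaleR_sum_right by (subst sum.swap) simp
  then show "(\<Sum>a\<in>V. (\<Sum>v\<in>A. u v * bc V v a) *\<^sub>R a) = (\<Sum>v\<in>A. u v *\<^sub>R v)" using bc_triangle(2)[OF V] by simp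
 qed (use bc_triangle(3)[OF V] in auto)
 then show ?thesis by simp
qed

lemma bc_vertex: "triangle_verts V ==> a \<in> V ==> bc V a b = (if b = a then 1 else 0)"
proof -
 assume V: "triangle_verts V" and a: "a \<in> V"
 have fV: "finite V" using V by (simp add: triangle_verts_def)
 have "bc V a = (\<lambda>b. if b = a then 1 else 0)"
  by (rule bc_triangle_unique[OF V]) (use a fV in \<open>auto simp: if_distrib[of "\<lambda>t. t *\<^sub>R _"] sum.delta' sum.delta cong: if_cong\<close>)
 then show ?thesis by simp
qed

lemma bc_pos_interior:
 assumes V: "triangle_verts V" and x: "\<And>a. a \<in> V ==> 0 < bc V x a"
 shows "x \<in> interior (convex hull V)"
proof (rule interiorI)
 have fV: "finite V" using V by (simp add: triangle_verts_def)
 show "open (\<Inter>a\<in>V. {x. 0 < bc V x a})"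
  using fV by (intro open_INT ballI open_Collect_less continuous_intros bc_continuous[OF V]) auto
 show "x \<in> (\<Inter>a\<in>V. {x. 0 < bc V x a})" using x by auto
 show "(\<Inter>a\<in>V. {x. 0 < bc V x a}) \<subseteq> convex hull V"
  using triangle_bc_iff[OF V] by force
qed

lemma bc_pos_face:
 assumes V: "triangle_verts V" and W: "W \<subseteq> V" and x: "x \<in> convex hull W" and a: "bc V x a \<noteq> 0"
 shows "a \<in> W"
proof -
 have fW: "finite W" using V W finite_subset by (auto simp: triangle_verts_def)
 have "x \<in> affine hull W" using x convex_hull_subset_affine_hull by blast
 then show ?thesis using bc_props(3)[OF fW, of x a] bc_face[OF V W x] a by auto
qed

text \<open>Two triangles that share an edge lie on different sides of it, since otherwise they would
 overlap. So together they cover a neighbourhood of every relatively interior point of the edge.\<close>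

lemma shared_edge_interior:
 assumes G: "conforming \<G>" and T: "T \<in> \<G>" "T' \<in> \<G>" "T \<noteq> T'"
  and V: "verts T = {a, b, c}" "a \<noteq> b" "a \<noteq> c" "b \<noteq> c"
  and y: "0 < bc (verts T) y a" "0 < bc (verts T) y b" "bc (verts T) y c = 0" and yT': "y \<in> T'"
 shows "y \<in> interior (T \<union> T')"
proof -
 let ?V = "verts T" and ?V' = "verts T'"
 have t: "tri T" "tri T'" using G T unfolding conforming_def by auto
 have tV: "triangle_verts ?V" and tV': "triangle_verts ?V'" and hT: "T = convex hull ?V" and hT': "T' = convex hull ?V'"
  using t tri_verts by auto
 have ai: "\<not> affine_dependent ?V" "\<not> affine_dependent ?V'" using tV tV' by (auto simp: triangle_verts_def)
 have fT: "(T \<inter> T') face_of T" "(T \<inter> T') face_of T'" using G T unfolding conforming_def by auto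
 obtain W where W: "W \<subseteq> ?V" "T \<inter> T' = convex hull W"
  using fT(1) face_of_convex_hull_affine_independent[OF ai(1)] hT by metis
 obtain W' where W': "W' \<subseteq> ?V'" "T \<inter> T' = convex hull W'"
  using fT(2) face_of_convex_hull_affine_independent[OF ai(2)] hT' by metis
 have "verts (T \<inter> T') = W" using W ai affine_dependent_subset verts_hull by metis
 moreover have "verts (T \<inter> T') = W'" using W' ai affine_dependent_subset verts_hull by metis
 ultimately have WW': "W = W'" by simp
 have yT: "y \<in> T" using y triangle_bc_iff[OF tV, of y] hT V by auto
 then have yW: "y \<in> convex hull W" using yT' W by blast
 have abW: "a \<in> W" "b \<in> W" using bc_pos_face[OF tV W(1) yW] y by auto
 have "W \<noteq> ?V" using W(2) hT conforming_proper_face[OF G T] by auto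
 then have Wab: "W = {a, b}" using W(1) abW V by auto
 have c3: "card ?V' = 3" "finite ?V'" using tV' by (auto simp: triangle_verts_def)
 have "\<exists>c'. c' \<in> ?V' \<and> c' \<noteq> a \<and> c' \<noteq> b"
 proof (rule ccontr)
  assume "\<not> ?thesis"
  then have "?V' \<subseteq> {a, b}" by auto
  then have "card ?V' \<le> card {a, b}" by (intro card_mono) auto
  then show False using c3 V(2) by simp
 qed
 then obtain c' where c': "c' \<in> ?V'" "c' \<noteq> a" "c' \<noteq> b" by blast
 have V'eq: "?V' = {a, b, c'}"
 proof (rule sym, rule card_subset_eq[OF c3(2)])
  show "{a, b, c'} \<subseteq> ?V'" using c' W'(1) WW' Wab by auto
  show "card {a, b, c'} = card ?V'" using c' V(2) c3 by simp
 qed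
 define \<mu> where "\<mu> = bc ?V' c c'"
 have lam: "bc ?V' x c' = bc ?V x c * \<mu>" for x
 proof -
  have "x = (\<Sum>v\<in>?V. bc ?V x v *\<^sub>R v)" using bc_triangle(2)[OF tV] by simp
  then have "bc ?V' x c' = (\<Sum>v\<in>?V. bc ?V x v * bc ?V' v c')"
   using bc_combination[OF tV', of ?V "bc ?V x" c'] bc_triangle(1)[OF tV] V by simp
  also have "... = bc ?V x c * \<mu>"
   using bc_vertex[OF tV', of a c'] bc_vertex[OF tV', of b c'] V'eq V c' by (simp add: \<mu>_def)
  finally show ?thesis .
 qed
 have "\<mu> \<noteq> 0" using lam[of c'] bc_vertex[OF tV' c'(1), of c'] by auto
 have yb: "bc ?V' y = bc ?V y"
  using bc_face[OF tV W(1) yW] bc_face[OF tV' W'(1)] yW WW' by simp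
 define O' where "O' = {x. 0 < bc ?V x a} \<inter> {x. 0 < bc ?V x b} \<inter> {x. 0 < bc ?V' x a} \<inter> {x. 0 < bc ?V' x b}"
 have op: "open O'"
  unfolding O'_def
  by (intro open_Int open_Collect_less continuous_intros bc_continuous[OF tV] bc_continuous[OF tV'])
 have yO: "y \<in> O'" using y yb by (auto simp: O'_def)
 have neg: "\<mu> < 0"
 proof (rule ccontr)
  assume "\<not> \<mu> < 0"
  then have pos: "0 < \<mu>" using \<open>\<mu> \<noteq> 0\<close> by simp
  obtain e where e: "0 < e" "ball y e \<subseteq> O'" using op yO open_contains_ball by blast
  have cy: "c \<noteq> y" using y bc_vertex[OF tV, of c c] V by auto
  define t where "t = min (1/2) (e / (2 * dist y c))"
  have t: "0 < t" "t < 1" using e cy by (auto simp: t_def)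
  define x where "x = (1 - t) *\<^sub>R y + t *\<^sub>R c"
  have "dist y x = t * dist y c"
   unfolding x_def dist_norm using t
   by (simp add: algebra_simps flip: scaleR_diff_right)
  also have "... \<le> e / (2 * dist y c) * dist y c" by (intro mult_right_mono) (auto simp: t_def)
  also have "... < e" using e cy by simp
  finally have xO: "x \<in> O'" using e by auto
  have "bc ?V x c = t"
  proof -
   have "x = (\<Sum>v\<in>{y, c}. (if v = y then 1 - t else t) *\<^sub>R v)" using cy by (simp add: x_def)
   then have "bc ?V x c = (\<Sum>v\<in>{y, c}. (if v = y then 1 - t else t) * bc ?V v c)"
    using bc_combination[OF tV, of "{y, c}" "\<lambda>v. if v = y then 1 - t else t" c] cy by simp
   also have "... = t" using cy y bc_vertex[OF tV, of c c] V by simp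
   finally show ?thesis .
  qed
  then have l: "0 < bc ?V x c" "0 < bc ?V' x c'" using t pos lam[of x] by auto
  have "x \<in> T" using triangle_bc_iff[OF tV, of x] hT V l xO by (auto simp: O'_def intro: less_imp_le)
  moreover have "x \<in> T'" using triangle_bc_iff[OF tV', of x] hT' V'eq l xO by (auto simp: O'_def intro: less_imp_le)
  ultimately have "x \<in> convex hull W" using W by blast
  from bc_pos_face[OF tV W(1) this, of c] show False using l Wab V by auto
 qed
 have "O' \<subseteq> T \<union> T'"
 proof
  fix x assume x: "x \<in> O'"
  show "x \<in> T \<union> T'"
  proof (cases "0 \<le> bc ?V x c")
   case True
   then have "x \<in> T" using triangle_bc_iff[OF tV, of x] hT V x by (auto simp: O'_def intro: less_imp_le)
   then show ?thesis by blast
  next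
   case False
   then have "0 < bc ?V' x c'" using lam[of x] neg by (simp add: mult_neg_neg)
   then have "x \<in> T'" using triangle_bc_iff[OF tV', of x] hT' V'eq x by (auto simp: O'_def intro: less_imp_le)
   then show ?thesis by blast
  qed
 qed
 then show ?thesis using op yO interiorI by blast
qed

lemma boundary_edges_finite:
 assumes "conforming \<G>" shows "finite (boundary_edges \<G>)"
proof -
 have "boundary_edges \<G> \<subseteq> (\<Union>T\<in>\<G>. {e. e face_of T})"
  by (auto simp: boundary_edges_def edge_of_def)
 moreover have "finite {e. e face_of T}" if "T \<in> \<G>" for T
 proof -
  have "tri T" using assms that unfolding conforming_def by blast
  then have "polytope T" using tri_verts[of T] unfolding polytope_def triangle_verts_def by blast
  then show ?thesis by (rule finite_polytope_faces)
 qed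
 ultimately show ?thesis using assms finite_subset unfolding conforming_def by (metis (lifting) finite_UN)
qed

lemma tri_edge:
 assumes T: "tri T" and e: "e edge_of T"
 obtains a b where "a \<noteq> b" "e = closed_segment a b" "a \<in> verts T" "b \<in> verts T"
proof -
 note v = tri_verts[OF T]
 have ai: "\<not> affine_dependent (verts T)" "finite (verts T)" using v(1) by (auto simp: triangle_verts_def)
 have "e face_of convex hull (verts T)" "aff_dim e = 1" using e v(2) by (auto simp: edge_of_def)
 then obtain c where c: "c \<subseteq> verts T" "e = convex hull c"
  using face_of_convex_hull_affine_independent[OF ai(1)] by blast
 have "\<not> affine_dependent c" "finite c" using c ai affine_dependent_subset finite_subset by blast+
 then have "card c = 2"
  using \<open>aff_dim e = 1\<close> c(2) affine_independent_iff_card[of c] by (simp add: aff_dim_convex_hull)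
 then obtain a b where ab: "c = {a, b}" "a \<noteq> b" by (auto simp: card_2_iff)
 then have "e = closed_segment a b" using c(2) by (simp add: segment_convex_hull)
 then show ?thesis using ab c(1) that by blast
qed

lemma relative_interior_point_on_boundary_edge:
 assumes G: "conforming \<G>" and y: "y \<in> frontier (\<Union>\<G>)" and nv: "y \<notin> (\<Union>T\<in>\<G>. verts T)"
 shows "\<exists>e\<in>boundary_edges \<G>. y \<in> e"
proof -
 have "y \<in> \<Union>\<G>" using y conforming_Union_closed(1)[OF G] frontier_subset_closed by blast
 then obtain T where T: "T \<in> \<G>" "y \<in> T" by blast
 have tT: "tri T" using G T(1) unfolding conforming_def by blast
 let ?V = "verts T"
 have tV: "triangle_verts ?V" and hT: "T = convex hull ?V" using tri_verts[OF tT] by auto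
 have fV: "finite ?V" and ai: "\<not> affine_dependent ?V" using tV by (auto simp: triangle_verts_def)
 have nint: "y \<notin> interior S" if "S \<subseteq> \<Union>\<G>" for S
  using y interior_mono[OF that] by (auto simp: frontier_def)
 have nn: "0 \<le> bc ?V y v" for v using bc_le_1[OF tV] T hT by blast
 have "y \<notin> interior T" using nint[of T] T by blast
 then obtain c where c: "c \<in> ?V" "bc ?V y c = 0"
  using bc_pos_interior[OF tV, of y] hT nn by (metis less_eq_real_def)
 obtain a b where ab: "?V = {a, b, c}" "a \<noteq> b" "a \<noteq> c" "b \<noteq> c"
 proof -
  have "card (?V - {c}) = 2" using tV c(1) by (simp add: triangle_verts_def)
  then obtain a b where "?V - {c} = {a, b}" "a \<noteq> b" by (auto simp: card_2_iff)
  then show ?thesis using that[of a b] c(1) by blast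
 qed
 have sm: "bc ?V y a + bc ?V y b = 1" "bc ?V y a *\<^sub>R a + bc ?V y b *\<^sub>R b = y"
  using bc_triangle(1,2)[OF tV, of y] ab c by auto
 have "bc ?V y a \<noteq> 0" "bc ?V y b \<noteq> 0"
  using sm nv T(1) ab(1) by auto
 then have pos: "0 < bc ?V y a" "0 < bc ?V y b" using nn[of a] nn[of b] by auto
 let ?e = "closed_segment a b"
 have e: "?e edge_of T"
  unfolding edge_of_def
 proof
  have "?e face_of convex hull ?V"
   unfolding face_of_convex_hull_affine_independent[OF ai] segment_convex_hull
   by (rule exI[of _ "{a, b}"]) (simp add: ab(1))
  then show "?e face_of T" using hT by simp
  show "aff_dim ?e = 1" using ab by (simp add: segment_convex_hull aff_dim_convex_hull)
 qed
 have seg: "bc ?V x a = 1 - s \<and> bc ?V x b = s \<and> bc ?V x c = 0" if "x = (1 - s) *\<^sub>R a + s *\<^sub>R b" for x s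
 proof -
  have "bc ?V x = (\<lambda>v. if v = a then 1 - s else if v = b then s else 0)"
   by (rule bc_triangle_unique[OF tV]) (use ab that in auto)
  then show ?thesis using ab by auto
 qed
 have "y \<in> open_segment a b"
 proof -
  have "bc ?V y a = 1 - bc ?V y b" using sm(1) by simp
  then have "y = (1 - bc ?V y b) *\<^sub>R a + bc ?V y b *\<^sub>R b" "bc ?V y b < 1" using sm(2) pos by auto
  then show ?thesis unfolding in_segment using pos(2) ab(2) by blast
 qed
 have only: "T' = T" if T': "T' \<in> \<G>" "x \<in> T'" and x: "x \<in> open_segment a b" for T' x
 proof (rule ccontr)
  assume ne: "T' \<noteq> T"
  obtain s where s: "0 < s" "s < 1" "x = (1 - s) *\<^sub>R a + s *\<^sub>R b" using x by (auto simp: in_segment)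
  have bx: "0 < bc ?V x a" "0 < bc ?V x b" "bc ?V x c = 0" using seg[OF s(3)] s by auto
  have xT: "x \<in> T" using x e open_closed_segment edge_of_imp_subset by blast
  have "x \<in> T \<inter> T'" using xT T' by blast
  moreover obtain W where W: "W \<subseteq> ?V" "T \<inter> T' = convex hull W"
   using G T(1) T'(1) face_of_convex_hull_affine_independent[OF ai] hT unfolding conforming_def by metis
  ultimately have "a \<in> W" "b \<in> W" using bc_pos_face[OF tV W(1), of x] bx by auto
  then have "?e \<subseteq> T'" using W(2) hull_mono[of "{a, b}" W convex] by (auto simp: segment_convex_hull)
  then have "y \<in> T'" using \<open>y \<in> open_segment a b\<close> open_closed_segment by blast
  then have "y \<in> interior (T \<union> T')"
   using shared_edge_interior[OF G T(1) T'(1) ne[symmetric] ab, of y] pos c by blast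
  then show False using nint[of "T \<union> T'"] T T' by blast
 qed
 have fr: "open_segment a b \<subseteq> frontier (\<Union>\<G>)"
 proof
  fix x assume x: "x \<in> open_segment a b"
  have xT: "x \<in> T" using x e open_closed_segment edge_of_imp_subset by blast
  show "x \<in> frontier (\<Union>\<G>)"
  proof (rule ccontr)
   assume "x \<notin> frontier (\<Union>\<G>)"
   then have xi: "x \<in> interior (\<Union>\<G>)" using xT T(1) closure_subset[of "\<Union>\<G>"] by (auto simp: frontier_def)
   let ?U = "interior (\<Union>\<G>) - \<Union>(\<G> - {T})"
   have "closed (\<Union>(\<G> - {T}))"
    using conforming_Union_closed(1)[OF conforming_subset[OF G, of "\<G> - {T}"]] by blast
   then have "open ?U" by (intro open_Diff) auto
   moreover have "x \<in> ?U" using xi only[OF _ _ x] by blast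
   moreover have "?U \<subseteq> T" using interior_subset by blast
   ultimately have "x \<in> interior T" using interiorI by blast
   moreover have "?e face_of T" using e by (simp add: edge_of_def)
   moreover have "?e \<noteq> T"
    using e tri_aff_dim[OF tT] by (auto simp: edge_of_def)
   ultimately show False using face_of_disjoint_interior[of ?e T] x open_closed_segment by blast
  qed
 qed
 have "?e \<subseteq> frontier (\<Union>\<G>)"
  using closure_minimal[OF fr frontier_closed] ab(2) by simp
 then have "?e \<in> boundary_edges \<G>" using e T(1) by (auto simp: boundary_edges_def)
 then show ?thesis using \<open>y \<in> open_segment a b\<close> open_closed_segment by blast
qed

text \<open>The frontier of a union of triangles has no isolated points, so the boundary edges, which
 cover all of it but finitely many points and form a closed set, cover everything.\<close>

lemma frontier_boundary_edges:
 assumes G: "conforming \<G>" and x: "x \<in> frontier (\<Union>\<G>)"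
 shows "\<exists>e\<in>boundary_edges \<G>. x \<in> e"
proof -
 let ?S = "\<Union>\<G>" and ?P = "\<Union>T\<in>\<G>. verts T" and ?B = "\<Union>(boundary_edges \<G>)"
 have S: "closed ?S" by (rule conforming_Union_closed(1)[OF G])
 have tr: "tri T" if "T \<in> \<G>" for T using G that unfolding conforming_def by blast
 have fP: "finite ?P"
  using G tri_verts(1)[OF tr] by (auto simp: conforming_def triangle_verts_def)
 have cB: "closed ?B"
 proof (rule closed_Union[OF boundary_edges_finite[OF G]], clarify)
  fix e assume "e \<in> boundary_edges \<G>"
  then obtain T where "T \<in> \<G>" "e edge_of T" by (auto simp: boundary_edges_def)
  then obtain a b where "e = closed_segment a b" using tri_edge[OF tr] by metis
  then show "closed e" by simp
 qed
 have sub: "frontier ?S - ?P \<subseteq> ?B" using relative_interior_point_on_boundary_edge[OF G] by blast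
 have "x \<in> closure (frontier ?S - ?P)"
 proof (rule ccontr)
  assume "x \<notin> closure (frontier ?S - ?P)"
  then obtain e1 where e1: "0 < e1" "ball x e1 \<inter> (frontier ?S - ?P) = {}"
   by (metis closure_approachable disjoint_iff dist_commute mem_ball)
  obtain e2 where e2: "0 < e2" "\<And>q. q \<in> ?P ==> q \<noteq> x ==> e2 \<le> dist x q"
   using finite_set_avoid[OF fP, of x] by blast
  define e where "e = min e1 e2"
  have e: "0 < e" using e1 e2 by (simp add: e_def)
  let ?C = "ball x e - {x}"
  have Cf: "?C \<inter> frontier ?S = {}" using e1 e2(2) by (force simp: e_def)
  have conn: "connected ?C" by (rule connected_punctured_ball) simp
  have xS: "x \<in> ?S" using x S frontier_subset_closed by blast
  then obtain T where T: "T \<in> \<G>" "x \<in> T" by blast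
  have eT: "elt T" by (rule tri_elt[OF tr[OF T(1)]])
  obtain w where w: "w \<in> interior T" "w \<noteq> x"
  proof -
   have "interior T \<noteq> {x}" using not_open_singleton[of x] open_interior by metis
   then show ?thesis using eT that unfolding elt_def by blast
  qed
  define t where "t = min (1/2) (e / (2 * dist x w))"
  have t: "0 < t" "t < 1" using e w by (auto simp: t_def)
  let ?z = "x + t *\<^sub>R (w - x)"
  have zT: "?z \<in> T"
   using eT T(2) w interior_subset t convexD_alt[of T x w t] by (auto simp: elt_def algebra_simps)
  have "dist x ?z = t * dist x w" using t by (simp add: dist_norm norm_minus_commute)
  also have "... \<le> e / (2 * dist x w) * dist x w" by (intro mult_right_mono) (auto simp: t_def)
  also have "... < e" using e w by simp
  finally have "?z \<in> ?C" using t w by auto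
  then have ne: "?C \<inter> ?S \<noteq> {}" using zT T(1) by blast
  have "?C - ?S = {}" using connected_Int_frontier[OF conn ne] Cf by blast
  then have "ball x e \<subseteq> ?S" using xS by blast
  then have "x \<in> interior ?S" using e mem_interior by blast
  then show False using x by (simp add: frontier_def)
 qed
 then have "x \<in> closure ?B" using closure_mono[OF sub] by blast
 then show ?thesis using cB by (simp add: closure_closed)
qed

section \<open>Integrals over boundary edges\<close>

lemma has_integral_flip: "(g has_integral i) {0..1::real} ==> ((\<lambda>t. g (1 - t)) has_integral i) {0..1}"
proof -
 assume "(g has_integral i) {0..1}"
 then have "((\<lambda>x. g (- 1 *\<^sub>R x + 1)) has_integral (1 / (\<bar>-1\<bar> ^ DIM(real))) *\<^sub>R i) ((\<lambda>x. (1 / - 1) *\<^sub>R x + - ((1 / - 1) *\<^sub>R 1)) ` cbox 0 1)"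
  by (intro has_integral_affinity) auto
 moreover have "(\<lambda>x. (1 / - 1) *\<^sub>R x + - ((1 / - 1) *\<^sub>R 1)) ` cbox 0 1 = {0..1::real}"
 proof -
  have "(\<lambda>x. (1 / - 1) *\<^sub>R x + - ((1 / - 1) *\<^sub>R 1)) = (\<lambda>x::real. 1 - x)" by auto
  then show ?thesis by (simp add: image_diff_atLeastAtMost)
 qed
 ultimately show ?thesis by (simp add: algebra_simps)
qed

lemma integral_flip: "integral {0..1::real} g = integral {0..1} (\<lambda>t. g (1 - t))"
proof (cases "g integrable_on {0..1}")
 case True
 then have "(g has_integral integral {0..1} g) {0..1}" by (rule integrable_integral)
 from integral_unique[OF has_integral_flip[OF this]] show ?thesis by simp
next
 case False
 have "\<not> (\<lambda>t. g (1 - t)) integrable_on {0..1}"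
 proof
  assume "(\<lambda>t. g (1 - t)) integrable_on {0..1}"
  then have "((\<lambda>t. g (1 - t)) has_integral integral {0..1} (\<lambda>t. g (1 - t))) {0..1}" by (rule integrable_integral)
  from has_integral_flip[OF this] show False using False by auto
 qed
 then show ?thesis using False by (simp add: not_integrable_integral)
qed

lemma edge_integral_segment:
 "edge_integral (closed_segment a b) f = of_real (dist a b) * integral {0..1} (\<lambda>t. f (linepath a b t))"
proof -
 define P where "P ab \<longleftrightarrow> closed_segment a b = closed_segment (fst ab) (snd ab)" for ab :: "pt \<times> pt"
 have "P (a, b)" by (simp add: P_def)
 then have P: "P (Eps P)" by (rule someI[of P])
 obtain c d where cd: "Eps P = (c, d)" by (cases "Eps P")
 have e: "edge_integral (closed_segment a b) f = of_real (dist c d) * integral {0..1} (\<lambda>t. f (linepath c d t))"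
  unfolding edge_integral_def Let_def P_def[symmetric] using cd by (simp add: P_def[abs_def, symmetric])
 have "{a, b} = {c, d}" using P cd by (simp add: P_def closed_segment_eq)
 then consider "c = a" "d = b" | "c = b" "d = a" by (auto simp: doubleton_eq_iff)
 then show ?thesis
 proof cases
  case 1 then show ?thesis using e by simp
 next
  case 2
  have "integral {0..1} (\<lambda>t. f (linepath b a t)) = integral {0..1} (\<lambda>t. f (linepath b a (1 - t)))"
   by (rule integral_flip)
  also have "... = integral {0..1} (\<lambda>t. f (linepath a b t))"
   by (simp add: linepath_def add.commute)
  finally show ?thesis using e 2 by (simp add: dist_commute)
 qed
qed

section \<open>The boundary form\<close>

lemma psd_sum_forms:
 assumes b: "\<And>i. i \<in> I ==> psd V (b i)"
 shows "psd V (\<lambda>u v. \<Sum>i\<in>I. b i u v)"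
proof -
 note s = psd_sesq[OF b]
 show ?thesis
  unfolding psd_def sesq_def
 proof (intro conjI ballI allI)
  fix u v w assume uvw: "u \<in> V" "v \<in> V" "w \<in> V"
  show "(\<Sum>i\<in>I. b i (u + v) w) = (\<Sum>i\<in>I. b i u w) + (\<Sum>i\<in>I. b i v w)"
   unfolding sum.distrib[symmetric] by (intro sum.cong refl sesqD(1)[OF s] uvw)
  show "(\<Sum>i\<in>I. b i w (u + v)) = (\<Sum>i\<in>I. b i w u) + (\<Sum>i\<in>I. b i w v)"
   unfolding sum.distrib[symmetric] by (intro sum.cong refl sesqD(2)[OF s] uvw)
 next
  fix c u w assume uw: "u \<in> V" "w \<in> V"
  show "(\<Sum>i\<in>I. b i (c *\<^sub>C u) w) = c * (\<Sum>i\<in>I. b i u w)"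
   unfolding sum_distrib_left by (intro sum.cong refl sesqD(3)[OF s] uw)
  show "(\<Sum>i\<in>I. b i u (c *\<^sub>C w)) = cnj c * (\<Sum>i\<in>I. b i u w)"
   unfolding sum_distrib_left by (intro sum.cong refl sesqD(4)[OF s] uw)
 next
  fix u v assume uv: "u \<in> V" "v \<in> V"
  show "(\<Sum>i\<in>I. b i v u) = cnj (\<Sum>i\<in>I. b i u v)"
   unfolding cnj_sum by (intro sum.cong refl psd_sym[OF b] uv)
 next
  fix u assume "u \<in> V"
  then show "0 \<le> Re (\<Sum>i\<in>I. b i u u)"
   unfolding Re_sum by (intro sum_nonneg psd_nonneg[OF b])
 qed
qed

lemma psd_scale_form:
 assumes b: "psd V b" and r: "0 \<le> r"
 shows "psd V (\<lambda>u v. of_real r * b u v)"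
proof -
 note s = psd_sesq[OF b]
 show ?thesis
  unfolding psd_def sesq_def
 proof (intro conjI ballI allI)
  fix u v w assume "u \<in> V" "v \<in> V" "w \<in> V"
  then show "of_real r * b (u + v) w = of_real r * b u w + of_real r * b v w"
   "of_real r * b w (u + v) = of_real r * b w u + of_real r * b w v"
   unfolding distrib_left[symmetric] by (simp_all only: sesqD(1,2)[OF s])
 next
  fix c u w assume "u \<in> V" "w \<in> V"
  then show "of_real r * b (c *\<^sub>C u) w = c * (of_real r * b u w)"
   "of_real r * b u (c *\<^sub>C w) = cnj c * (of_real r * b u w)"
   by (simp_all only: sesqD(3,4)[OF s] mult.left_commute)
 next
  fix u v assume "u \<in> V" "v \<in> V"
  from psd_sym[OF b this] show "of_real r * b v u = cnj (of_real r * b u v)" by simp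
 next
  fix u assume "u \<in> V"
  from psd_nonneg[OF b this] r show "0 \<le> Re (of_real r * b u u)" by simp
 qed
qed

definition line_ip :: "pt \<Rightarrow> pt \<Rightarrow> scalar_fun \<Rightarrow> scalar_fun \<Rightarrow> complex" where
 "line_ip a b u v = integral {0..1} (\<lambda>t. u (linepath a b t) * cnj (v (linepath a b t)))"

lemma linepath_mem: "convex T ==> a \<in> T ==> b \<in> T ==> t \<in> {0..1} ==> linepath a b t \<in> T"
 by (meson closed_segment_subset linepath_in_path subsetD)

lemma pw_continuous_on_line:
 assumes "convex T" "T \<in> \<G>" "a \<in> T" "b \<in> T" "u \<in> pw p \<G>"
 shows "continuous_on {0..1} (\<lambda>t. u (linepath a b t))"
proof -
 obtain q where q: "q \<in> Pol p" "\<And>x. x \<in> T ==> u x = q x" using pwE[OF assms(5,2)] by blast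
 have "continuous_on {0..1} (\<lambda>t. q (linepath a b t))"
  by (rule continuous_on_compose2[OF Pol_continuous[OF q(1), of UNIV]]) (auto intro: continuous_intros)
 then show ?thesis
  by (rule continuous_on_eq) (use q(2) linepath_mem[OF assms(1,3,4)] in auto)
qed

lemma psd_line_ip:
 assumes T: "convex T" "T \<in> \<G>" "a \<in> T" "b \<in> T"
 shows "psd (pw p \<G>) (line_ip a b)"
proof -
 let ?l = "linepath a b"
 have int: "(\<lambda>t. u (?l t) * cnj (v (?l t))) integrable_on {0..1}" if "u \<in> pw p \<G>" "v \<in> pw p \<G>" for u v
  by (intro integrable_continuous_real continuous_intros pw_continuous_on_line[OF T, of _ p] that)
 have cn: "line_ip a b v u = cnj (line_ip a b u v)" if "u \<in> pw p \<G>" "v \<in> pw p \<G>" for u v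
 proof -
  have "integral {0..1} (cnj \<circ> (\<lambda>t. u (?l t) * cnj (v (?l t)))) = cnj (line_ip a b u v)"
   unfolding line_ip_def by (rule integral_linear[OF int[OF that] bounded_linear_cnj])
  moreover have "cnj \<circ> (\<lambda>t. u (?l t) * cnj (v (?l t))) = (\<lambda>t. v (?l t) * cnj (u (?l t)))"
   by (rule ext) (simp add: mult.commute)
  ultimately show ?thesis by (simp only: line_ip_def)
 qed
 have nn: "0 \<le> Re (line_ip a b u u)" if "u \<in> pw p \<G>" for u
 proof -
  have "integral {0..1} (Re \<circ> (\<lambda>t. u (?l t) * cnj (u (?l t)))) = Re (line_ip a b u u)"
   unfolding line_ip_def by (rule integral_linear[OF int[OF that that] bounded_linear_Re])
  moreover have "0 \<le> integral {0..1} (Re \<circ> (\<lambda>t. u (?l t) * cnj (u (?l t))))"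
   by (rule integral_nonneg[OF integrable_linear[OF int[OF that that] bounded_linear_Re]])
    (simp add: complex_mult_cnj)
  ultimately show ?thesis by simp
 qed
 have ad: "line_ip a b (u + v) w = line_ip a b u w + line_ip a b v w" if "u \<in> pw p \<G>" "v \<in> pw p \<G>" "w \<in> pw p \<G>" for u v w
  unfolding line_ip_def plus_fun_apply distrib_right by (rule integral_add[OF int int]) (use that in auto)
 have sc: "line_ip a b (c *\<^sub>C u) w = c * line_ip a b u w" for c u w
  unfolding line_ip_def scl_apply mult.assoc by simp
 have ad2: "line_ip a b w (u + v) = line_ip a b w u + line_ip a b w v" if "u \<in> pw p \<G>" "v \<in> pw p \<G>" "w \<in> pw p \<G>" for u v w
  unfolding line_ip_def plus_fun_apply complex_cnj_add distrib_left by (rule integral_add[OF int int]) (use that in auto)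
 have sc2: "line_ip a b w (c *\<^sub>C u) = cnj c * line_ip a b w u" for c u w
  unfolding line_ip_def scl_apply complex_cnj_mult mult.left_commute[of _ "cnj c"] by simp
 show ?thesis
  unfolding psd_def sesq_def
  by (intro conjI ballI allI; (rule ad ad2 sc sc2 cn nn; assumption | rule sc sc2))
qed

text \<open>A continuous function whose square integrates to zero along the segment vanishes on it.\<close>

lemma line_ip_zero:
 assumes T: "convex T" "T \<in> \<G>" "a \<in> T" "b \<in> T" and u: "u \<in> pw p \<G>" and z: "line_ip a b u u = 0"
  and x: "x \<in> closed_segment a b"
 shows "u x = 0"
proof -
 let ?l = "linepath a b"
 have c: "continuous_on {0..1} (\<lambda>t. (cmod (u (?l t)))\<^sup>2)"
  by (intro continuous_intros pw_continuous_on_line[OF T u])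
 have ci: "(\<lambda>t. u (?l t) * cnj (u (?l t))) integrable_on {0..1}"
  by (intro integrable_continuous_real continuous_intros pw_continuous_on_line[OF T u])
 have "integral {0..1} (Re \<circ> (\<lambda>t. u (?l t) * cnj (u (?l t)))) = Re (line_ip a b u u)"
  unfolding line_ip_def by (rule integral_linear[OF ci bounded_linear_Re])
 moreover have "Re \<circ> (\<lambda>t. u (?l t) * cnj (u (?l t))) = (\<lambda>t. (cmod (u (?l t)))\<^sup>2)"
  by (rule ext) (simp add: complex_mult_cnj cmod_power2)
 ultimately have "integral {0..1} (\<lambda>t. (cmod (u (?l t)))\<^sup>2) = 0" using z by simp
 then have "\<forall>t\<in>{0..1}. (cmod (u (?l t)))\<^sup>2 = 0"
  using integral_eq_0_iff[OF c] by simp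
 moreover obtain t where "t \<in> {0..1}" "x = ?l t"
  using x by (auto simp: closed_segment_def linepath_def)
 ultimately show ?thesis by simp
qed

lemma edge_integral_line: "edge_integral (closed_segment a b) (\<lambda>x. u x * cnj (v x)) = of_real (dist a b) * line_ip a b u v"
 by (simp add: edge_integral_segment line_ip_def)

lemma boundary_edgeE:
 assumes "conforming \<G>" "e \<in> boundary_edges \<G>"
 obtains T a b where "T \<in> \<G>" "tri T" "e edge_of T" "a \<noteq> b" "e = closed_segment a b" "a \<in> T" "b \<in> T"
  "a \<in> verts T" "b \<in> verts T"
proof -
 from assms(2) obtain T where T: "T \<in> \<G>" "e edge_of T" by (auto simp: boundary_edges_def)
 have t: "tri T" using assms(1) T(1) unfolding conforming_def by blast
 obtain a b where ab: "a \<noteq> b" "e = closed_segment a b" "a \<in> verts T" "b \<in> verts T" using tri_edge[OF t T(2)] by metis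
 have "e \<subseteq> T" using T(2) edge_of_imp_subset by blast
 then have "a \<in> T" "b \<in> T" using ab(2) by auto
 then show ?thesis using that T t ab by blast
qed

lemma psd_boundary_ip:
 assumes G: "conforming \<G>" shows "psd (pw p \<G>) (boundary_ip \<G>)"
proof -
 have "psd (pw p \<G>) (\<lambda>u v. \<Sum>e\<in>boundary_edges \<G>. edge_integral e (\<lambda>x. u x * cnj (v x)))"
 proof (rule psd_sum_forms)
  fix e assume "e \<in> boundary_edges \<G>"
  then obtain T a b where T: "T \<in> \<G>" "tri T" "e = closed_segment a b" "a \<in> T" "b \<in> T"
   using boundary_edgeE[OF G] by metis
  have "convex T" using tri_elt[OF T(2)] by (simp add: elt_def)
  then have "psd (pw p \<G>) (\<lambda>u v. of_real (dist a b) * line_ip a b u v)"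
   by (intro psd_scale_form psd_line_ip[OF _ T(1,4,5)]) auto
  then show "psd (pw p \<G>) (\<lambda>u v. edge_integral e (\<lambda>x. u x * cnj (v x)))"
   unfolding T(3) edge_integral_line .
 qed
 then show ?thesis by (simp only: boundary_ip_def[abs_def])
qed

text \<open>Definiteness of the boundary form on traces; the boundary edges leave out no point of the frontier.\<close>

lemma boundary_ip_zero_frontier:
 assumes G: "conforming \<G>" and u: "u \<in> pw p \<G>" and z: "boundary_ip \<G> u u = 0" and x: "x \<in> frontier (\<Union>\<G>)"
 shows "u x = 0"
proof -
 obtain e where e: "e \<in> boundary_edges \<G>" "x \<in> e" using frontier_boundary_edges[OF G x] by blast
 have nn: "0 \<le> Re (edge_integral e (\<lambda>x. u x * cnj (u x)))" if e: "e \<in> boundary_edges \<G>" for e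
 proof -
  obtain T a b where T: "T \<in> \<G>" "tri T" "e = closed_segment a b" "a \<in> T" "b \<in> T"
   using boundary_edgeE[OF G e] by metis
  have cT: "convex T" using tri_elt[OF T(2)] by (simp add: elt_def)
  show ?thesis
   unfolding T(3) edge_integral_line
   using psd_nonneg[OF psd_line_ip[OF cT T(1,4,5)] u] by simp
 qed
 obtain T a b where T: "T \<in> \<G>" "tri T" "a \<noteq> b" "e = closed_segment a b" "a \<in> T" "b \<in> T"
  using boundary_edgeE[OF G e(1)] by metis
 have cT: "convex T" using tri_elt[OF T(2)] by (simp add: elt_def)
 note ps = psd_line_ip[OF cT T(1,5,6)]
 have "(\<Sum>e\<in>boundary_edges \<G>. Re (edge_integral e (\<lambda>x. u x * cnj (u x)))) = 0"
  using z unfolding boundary_ip_def Re_sum[symmetric] by simp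
 then have "Re (edge_integral e (\<lambda>x. u x * cnj (u x))) = 0"
  using sum_nonneg_eq_0_iff[OF boundary_edges_finite[OF G], of "\<lambda>e. Re (edge_integral e (\<lambda>x. u x * cnj (u x)))"] nn e(1)
  by blast
 then have "dist a b * Re (line_ip a b u u) = 0" unfolding T(4) edge_integral_line by simp
 then have "Re (line_ip a b u u) = 0" using T(3) by simp
 then have "line_ip a b u u = 0" using psd_real[OF ps u] by simp
 then show ?thesis using line_ip_zero[OF cT T(1,5,6) u _ , of x] e(2) T(4) by blast
qed

lemma edge_integral_cong:
 assumes "\<And>x. x \<in> e ==> f x = g x" "e = closed_segment a b"
 shows "edge_integral e f = edge_integral e g"
proof -
 have "integral {0..1} (\<lambda>t. f (linepath a b t)) = integral {0..1} (\<lambda>t. g (linepath a b t))"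
  by (rule Henstock_Kurzweil_Integration.integral_cong) (use assms linepath_in_path in blast)
 then show ?thesis unfolding assms(2) edge_integral_segment by simp
qed

lemma boundary_ip_cong:
 assumes G: "conforming \<G>" and eq: "\<And>x. x \<in> frontier (\<Union>\<G>) ==> u x * cnj (v x) = u' x * cnj (v' x)"
 shows "boundary_ip \<G> u v = boundary_ip \<G> u' v'"
 unfolding boundary_ip_def
proof (rule sum.cong[OF refl])
 fix e assume e: "e \<in> boundary_edges \<G>"
 obtain a b where ab: "e = closed_segment a b" using boundary_edgeE[OF G e] by metis
 have "e \<subseteq> frontier (\<Union>\<G>)" using e by (auto simp: boundary_edges_def)
 then show "edge_integral e (\<lambda>x. u x * cnj (v x)) = edge_integral e (\<lambda>x. u' x * cnj (v' x))"
  by (intro edge_integral_cong[OF _ ab]) (use eq in auto)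
qed

lemma boundary_ip_zero_right:
 assumes G: "conforming \<G>" and eq: "\<And>x. x \<in> frontier (\<Union>\<G>) ==> v x = 0"
 shows "boundary_ip \<G> u v = 0"
proof -
 have "boundary_ip \<G> u v = boundary_ip \<G> (\<lambda>x. 0) (\<lambda>x. 0)"
 proof -
  have "boundary_ip \<G> u v = (\<Sum>e\<in>boundary_edges \<G>. edge_integral e (\<lambda>x. 0))"
   unfolding boundary_ip_def
  proof (rule sum.cong[OF refl])
   fix e assume e: "e \<in> boundary_edges \<G>"
   obtain a b where ab: "e = closed_segment a b" using boundary_edgeE[OF G e] by metis
   have "e \<subseteq> frontier (\<Union>\<G>)" using e by (auto simp: boundary_edges_def)
   then show "edge_integral e (\<lambda>x. u x * cnj (v x)) = edge_integral e (\<lambda>x. 0)"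
    by (intro edge_integral_cong[OF _ ab]) (use eq in auto)
  qed
  then show ?thesis by (simp add: boundary_ip_def)
 qed
 also have "... = (\<Sum>e\<in>boundary_edges \<G>. 0)"
  unfolding boundary_ip_def
 proof (rule sum.cong[OF refl])
  fix e assume e: "e \<in> boundary_edges \<G>"
  obtain a b where ab: "e = closed_segment a b" using boundary_edgeE[OF G e] by metis
  show "edge_integral e (\<lambda>x. 0 * cnj 0) = 0" unfolding ab edge_integral_segment by simp
 qed
 finally show ?thesis by simp
qed

lemma line_ip_bound:
 assumes T: "convex T" "T \<in> \<G>" "a \<in> T" "b \<in> T" and u: "u \<in> pw p \<G>" and B: "\<And>x. x \<in> T ==> (cmod (u x))\<^sup>2 \<le> B"
 shows "Re (line_ip a b u u) \<le> B"
proof -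
 let ?l = "linepath a b"
 have ci: "(\<lambda>t. u (?l t) * cnj (u (?l t))) integrable_on {0..1}"
  by (intro integrable_continuous_real continuous_intros pw_continuous_on_line[OF T u])
 have "Re (line_ip a b u u) = integral {0..1} (Re \<circ> (\<lambda>t. u (?l t) * cnj (u (?l t))))"
  unfolding line_ip_def by (rule integral_linear[OF ci bounded_linear_Re, symmetric])
 also have "... \<le> integral {0..1::real} (\<lambda>t. B)"
 proof (rule integral_le[OF integrable_linear[OF ci bounded_linear_Re]])
  fix t :: real assume "t \<in> {0..1}"
  then have "(cmod (u (?l t)))\<^sup>2 \<le> B" using B linepath_mem[OF T(1,3,4)] by blast
  then show "(Re \<circ> (\<lambda>t. u (?l t) * cnj (u (?l t)))) t \<le> B"
   by (simp add: complex_mult_cnj cmod_power2)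
 qed auto
 finally show ?thesis by simp
qed

text \<open>The elementwise trace inequality; it loses a factor \<open>1 / h\<close> and is used both as it stands and
 on the layer of boundary elements.\<close>

lemma boundary_ip_le_local:
 assumes G: "conforming \<G>" and p: "1 \<le> p" and K: "1 \<le> K" and fat: "\<And>T. T \<in> \<G> ==> fat K T"
  and d: "\<And>T. T \<in> \<G> ==> h \<le> K * diameter T" and h: "0 < h" and u: "u \<in> pw p \<G>"
 shows "Re (boundary_ip \<G> u u) \<le>
  9 * invC p K * K / h * (\<Sum>T | T \<in> \<G> \<and> T \<inter> frontier (\<Union>\<G>) \<noteq> {}. mass T u)"
proof -
 let ?G = "{T. T \<in> \<G> \<and> T \<inter> frontier (\<Union>\<G>) \<noteq> {}}"
 let ?S = "Sigma ?G (\<lambda>T. verts T \<times> verts T)"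
 define F where "F = (\<lambda>(T::pt set, a, b). dist a b * Re (line_ip a b u u))"
 have tr: "tri T" if "T \<in> \<G>" for T using G that unfolding conforming_def by blast
 have fV: "finite (verts T)" "card (verts T) = 3" if "T \<in> \<G>" for T
  using tri_verts(1)[OF tr[OF that]] by (auto simp: triangle_verts_def)
 have fG: "finite ?G" using G by (simp add: conforming_def)
 have fS: "finite ?S" using fG fV by (intro finite_SigmaI finite_cartesian_product) auto
 have vT: "a \<in> T" if "T \<in> \<G>" "a \<in> verts T" for a T
  using that(2) by (auto simp: verts_def extreme_point_of_def)
 have cT: "convex T" if "T \<in> \<G>" for T using tri_elt[OF tr[OF that]] by (simp add: elt_def)
 have "\<forall>e\<in>boundary_edges \<G>. \<exists>s. s \<in> ?S \<and> e = closed_segment (fst (snd s)) (snd (snd s))"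
 proof
  fix e assume e: "e \<in> boundary_edges \<G>"
  obtain T a b where T: "T \<in> \<G>" "e = closed_segment a b" "a \<in> T" "a \<in> verts T" "b \<in> verts T"
   using boundary_edgeE[OF G e] by metis
  have "e \<subseteq> frontier (\<Union>\<G>)" using e by (auto simp: boundary_edges_def)
  then have "a \<in> T \<inter> frontier (\<Union>\<G>)" using T by auto
  then have "(T, a, b) \<in> ?S" using T by auto
  then show "\<exists>s. s \<in> ?S \<and> e = closed_segment (fst (snd s)) (snd (snd s))"
   using T(2) by (intro exI[of _ "(T, a, b)"]) auto
 qed
 from bchoice[OF this] obtain s where s: "\<forall>e\<in>boundary_edges \<G>. s e \<in> ?S \<and> e = closed_segment (fst (snd (s e))) (snd (snd (s e)))"
  by blast
 have nn: "0 \<le> F x" if xS: "x \<in> ?S" for x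
 proof -
  obtain T a b where x: "x = (T, a, b)" "T \<in> \<G>" "a \<in> verts T" "b \<in> verts T" using xS by auto
  then show ?thesis
   using psd_nonneg[OF psd_line_ip[OF cT[OF x(2)] x(2) vT[OF x(2,3)] vT[OF x(2,4)]] u] by (simp add: F_def)
 qed
 have "Re (boundary_ip \<G> u u) = (\<Sum>e\<in>boundary_edges \<G>. F (s e))"
  unfolding boundary_ip_def Re_sum
 proof (rule sum.cong[OF refl])
  fix e assume "e \<in> boundary_edges \<G>"
  then have e: "e = closed_segment (fst (snd (s e))) (snd (snd (s e)))" using s by blast
  obtain T a b where x: "s e = (T, a, b)" by (cases "s e") auto
  have "e = closed_segment a b" using e x by simp
  then show "Re (edge_integral e (\<lambda>x. u x * cnj (u x))) = F (s e)"
   unfolding x F_def using edge_integral_line[of a b u u] by simp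
 qed
 also have "... = sum F (s ` boundary_edges \<G>)"
 proof -
  have "inj_on s (boundary_edges \<G>)"
  proof (rule inj_onI)
   fix e e' assume a: "e \<in> boundary_edges \<G>" "e' \<in> boundary_edges \<G>" "s e = s e'"
   have "e = closed_segment (fst (snd (s e))) (snd (snd (s e)))" using s a(1) by blast
   also have "... = closed_segment (fst (snd (s e'))) (snd (snd (s e')))" using a(3) by simp
   also have "... = e'" using s a(2) by blast
   finally show "e = e'" .
  qed
  then show ?thesis by (simp add: sum.reindex)
 qed
 also have "... \<le> sum F ?S"
 proof (rule sum_mono2[OF fS])
  show "s ` boundary_edges \<G> \<subseteq> ?S" using s by blast
  show "0 \<le> F x" if "x \<in> ?S - s ` boundary_edges \<G>" for x using nn that by blast
 qed
 also have "... \<le> (\<Sum>x\<in>?S. invC p K * K / h * mass (fst x) u)"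
 proof (rule sum_mono)
  fix x assume "x \<in> ?S"
  then obtain T a b where x: "x = (T, a, b)" "T \<in> \<G>" "a \<in> verts T" "b \<in> verts T" by auto
  have uT: "u \<in> pw p {T}" using u x(2) pw_mono[of "{T}" \<G> p] by blast
  have eT: "elt T" using fat[OF x(2)] by (simp add: fat_def)
  have dT: "0 < diameter T" by (rule elt_diameter_pos[OF eT])
  have N0: "0 \<le> mass T u" unfolding l2_ip_self by (simp add: lint_nonneg)
  have l: "Re (line_ip a b u u) \<le> invC p K / (diameter T)\<^sup>2 * mass T u"
   by (rule line_ip_bound[OF cT[OF x(2)] x(2) vT[OF x(2,3)] vT[OF x(2,4)] u])
    (rule local_inverse(1)[OF p K fat[OF x(2)] uT])
  have "F x \<le> diameter T * (invC p K / (diameter T)\<^sup>2 * mass T u)"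
   unfolding x(1) F_def prod.case
   using diameter_bounded_bound[of T a b] eT vT[OF x(2,3)] vT[OF x(2,4)] l dT
    psd_nonneg[OF psd_line_ip[OF cT[OF x(2)] x(2) vT[OF x(2,3)] vT[OF x(2,4)]] u]
   by (intro mult_mono) (auto simp: elt_def compact_imp_bounded)
  also have "... = invC p K * mass T u * (1 / diameter T)"
   using dT by (simp add: power2_eq_square)
  also have "... \<le> invC p K * mass T u * (K / h)"
  proof (rule mult_left_mono)
   show "1 / diameter T \<le> K / h" using d[OF x(2)] dT h by (simp add: field_simps)
   show "0 \<le> invC p K * mass T u" using N0 invC_pos[OF p K] by simp
  qed
  finally show "F x \<le> invC p K * K / h * mass (fst x) u" by (simp add: x(1) mult_ac)
 qed
 also have "... = (\<Sum>T\<in>?G. \<Sum>x\<in>verts T \<times> verts T. invC p K * K / h * mass T u)"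
  using fG fV by (subst sum.Sigma) (auto simp: case_prod_beta)
 also have "... = (\<Sum>T\<in>?G. 9 * invC p K * K / h * mass T u)"
  by (intro sum.cong refl) (simp add: card_cartesian_product fV)
 finally show ?thesis by (simp add: sum_distrib_left)
qed

section \<open>Differentiation along dilations\<close>

lemma lebesgue_integrable_affine:
 fixes f :: "pt \<Rightarrow> real"
 assumes f: "integrable lebesgue f" and h: "h \<noteq> 0"
 shows "integrable lebesgue (\<lambda>y. f (z + h *\<^sub>R y))"
proof -
 let ?D = "distr lebesgue lebesgue (\<lambda>y. z + h *\<^sub>R y)"
 have fm: "f \<in> borel_measurable lebesgue" using f by (rule borel_measurable_integrable)
 then have fd: "f \<in> borel_measurable ?D" by simp
 have "integrable (density ?D (\<lambda>_. ennreal (h\<^sup>2))) f" using f lebesgue_affine(1)[OF h] by simp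
 then have "integrable ?D (\<lambda>x. h\<^sup>2 *\<^sub>R f x)" by (subst (asm) integrable_density[OF fd]) auto
 then have "integrable ?D f" using h by simp
 then show ?thesis by (subst (asm) integrable_distr_eq[OF lebesgue_affine(2)[OF h] fm])
qed

lemma negligible_dilate:
 fixes z :: pt
 assumes "negligible N"
 shows "negligible ((\<lambda>y. z + c *\<^sub>R (y - z)) ` N)"
 by (rule negligible_differentiable_image_negligible[OF _ assms])
  (auto intro!: derivative_intros differentiable_on_subset[OF _ subset_UNIV])

abbreviation dil :: "pt \<Rightarrow> real \<Rightarrow> pt \<Rightarrow> pt" where
 "dil z r x \<equiv> z + r *\<^sub>R (x - z)"

text \<open>Differentiation of an integral along dilations about \<open>z\<close>. Only Lipschitz continuity along rays
 and differentiability off a null set are required, which piecewise polynomials have.\<close>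

lemma dilation_derivative:
 fixes g :: "pt \<Rightarrow> real"
 assumes S: "S \<in> sets lebesgue" "set_integrable lebesgue S (\<lambda>x. L)" and s: "s0 < s" "s < s1" "0 < s"
  and int: "\<And>r. s0 < r ==> r < s1 ==> set_integrable lebesgue S (\<lambda>x. g (dil z r x))"
  and lip: "\<And>x r r'. x \<in> S ==> s0 < r ==> r < s1 ==> s0 < r' ==> r' < s1 ==>
    \<bar>g (dil z r x) - g (dil z r' x)\<bar> \<le> L * \<bar>r - r'\<bar>"
  and N: "negligible N"
  and der: "\<And>x. x \<in> S ==> dil z s x \<notin> N ==> (g has_derivative G (dil z s x)) (at (dil z s x))"
 shows "set_integrable lebesgue S (\<lambda>x. if dil z s x \<in> N then 0 else G (dil z s x) (x - z))"
  "((\<lambda>r. LINT x:S|lebesgue. g (dil z r x)) has_real_derivative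
   (LINT x:S|lebesgue. if dil z s x \<in> N then 0 else G (dil z s x) (x - z))) (at s)"
proof -
 let ?F = "\<lambda>x. if dil z s x \<in> N then 0 else G (dil z s x) (x - z)"
 let ?I = "{s0<..<s1}"
 define N0 where "N0 = {x. dil z s x \<in> N}"
 have "N0 \<subseteq> (\<lambda>y. z + (1 / s) *\<^sub>R (y - z)) ` N"
 proof
  fix x assume x: "x \<in> N0"
  have "x = z + (1 / s) *\<^sub>R (dil z s x - z)" using s by simp
  then show "x \<in> (\<lambda>y. z + (1 / s) *\<^sub>R (y - z)) ` N" using x unfolding N0_def by blast
 qed
 then have N0: "negligible N0" using negligible_dilate[OF N] negligible_subset by blast
 have deriv: "((\<lambda>r. g (dil z r x)) has_real_derivative G (dil z s x) (x - z)) (at s)"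
  if x: "x \<in> S" "dil z s x \<notin> N" for x
 proof -
  have inner: "((\<lambda>r. dil z r x) has_derivative (\<lambda>t. t *\<^sub>R (x - z))) (at s)"
   by (auto intro!: derivative_eq_intros)
  have lin: "linear (G (dil z s x))" using der[OF x] has_derivative_linear by blast
  have "((\<lambda>r. g (dil z r x)) has_derivative (\<lambda>t. G (dil z s x) (t *\<^sub>R (x - z)))) (at s)"
   by (rule has_derivative_compose[OF inner der[OF x]])
  moreover have "(\<lambda>t. G (dil z s x) (t *\<^sub>R (x - z))) = (*) (G (dil z s x) (x - z))"
   by (rule ext) (simp add: linear_scale[OF lin] mult.commute)
  ultimately show ?thesis by (simp only: has_field_derivative_def)
 qed
 define Q where "Q = (\<lambda>r x. indicat_real S x * (if x \<in> N0 then 0 else (g (dil z r x) - g (dil z s x)) / (r - s)))"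
 have Qint: "integrable lebesgue (Q r)" and Qeq: "integral\<^sup>L lebesgue (Q r) =
   ((LINT x:S|lebesgue. g (dil z r x)) - (LINT x:S|lebesgue. g (dil z s x))) / (r - s)"
  if r: "r \<in> ?I" for r
 proof -
  have i1: "set_integrable lebesgue S (\<lambda>x. g (dil z r x) - g (dil z s x))"
   using int[of r] int[OF s(1,2)] r by (intro set_integral_diff) auto
  then have i2: "set_integrable lebesgue S (\<lambda>x. (g (dil z r x) - g (dil z s x)) / (r - s))"
   by (rule set_integrable_divide)
  have i3: "set_integrable lebesgue S (\<lambda>x. if x \<in> N0 then 0 else (g (dil z r x) - g (dil z s x)) / (r - s))"
   by (rule lint_spike(1)[OF i2 N0]) auto
  then show "integrable lebesgue (Q r)" unfolding Q_def set_integrable_def by simp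
  have "integral\<^sup>L lebesgue (Q r) = (LINT x:S|lebesgue. if x \<in> N0 then 0 else (g (dil z r x) - g (dil z s x)) / (r - s))"
   unfolding Q_def set_lebesgue_integral_def by simp
  also have "... = (LINT x:S|lebesgue. (g (dil z r x) - g (dil z s x)) / (r - s))"
   by (rule lint_spike(2)[OF i2 N0]) auto
  also have "... = ((LINT x:S|lebesgue. g (dil z r x)) - (LINT x:S|lebesgue. g (dil z s x))) / (r - s)"
   using int[of r] int[OF s(1,2)] r by simp
  finally show "integral\<^sup>L lebesgue (Q r) =
   ((LINT x:S|lebesgue. g (dil z r x)) - (LINT x:S|lebesgue. g (dil z s x))) / (r - s)" .
 qed
 have ptw: "(\<lambda>n. Q (X n) x) \<longlonglongrightarrow> indicat_real S x * ?F x"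
  if X: "\<And>n. X n \<in> ?I - {s}" "X \<longlonglongrightarrow> s" for X x
 proof (cases "x \<in> S \<and> x \<notin> N0")
  case True
  then have "dil z s x \<notin> N" by (simp add: N0_def)
  from deriv[OF _ this] True have "((\<lambda>r. g (dil z r x)) has_real_derivative G (dil z s x) (x - z)) (at s)" by blast
  then have "((\<lambda>r. (g (dil z r x) - g (dil z s x)) / (r - s)) \<longlongrightarrow> G (dil z s x) (x - z)) (at s)"
   by (simp only: has_field_derivative_iff)
  then have "(\<lambda>n. (g (dil z (X n) x) - g (dil z s x)) / (X n - s)) \<longlonglongrightarrow> G (dil z s x) (x - z)"
   using X unfolding tendsto_at_iff_sequentially o_def by auto
  then show ?thesis using True by (simp add: Q_def N0_def)
 next
  case False
  then show ?thesis by (auto simp: Q_def N0_def)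
 qed
 have bound: "norm (Q r x) \<le> indicat_real S x * L" if "r \<in> ?I - {s}" for r x
 proof (cases "x \<in> S")
  case True
  have "\<bar>g (dil z r x) - g (dil z s x)\<bar> / \<bar>r - s\<bar> \<le> L"
   using lip[OF True, of r s] that s by (simp add: divide_le_eq)
  moreover have "0 \<le> L" using calculation by (meson abs_ge_zero divide_nonneg_nonneg order_trans)
  ultimately show ?thesis using True by (simp add: Q_def abs_divide)
 qed (simp add: Q_def)
 have dom: "integrable lebesgue (\<lambda>x. indicat_real S x * L)" using S(2) by (simp add: set_integrable_def)
 have ex: "\<exists>X. (\<forall>n. X n \<in> ?I - {s}) \<and> X \<longlonglongrightarrow> s"
 proof -
  have "s islimpt ?I" using s by (intro interior_limit_point) (simp add: interior_open)
  then show ?thesis unfolding islimpt_sequential by blast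
 qed
 have meas: "(\<lambda>x. indicat_real S x * ?F x) \<in> borel_measurable lebesgue"
 proof -
  obtain X where X: "\<forall>n. X n \<in> ?I - {s}" "X \<longlonglongrightarrow> s" using ex by blast
  show ?thesis
  proof (rule borel_measurable_LIMSEQ_real)
   show "(\<lambda>n. Q (X n) x) \<longlonglongrightarrow> indicat_real S x * ?F x" for x by (rule ptw) (use X in auto)
   show "Q (X n) \<in> borel_measurable lebesgue" for n
    using Qint[of "X n"] X(1) by (auto intro: borel_measurable_integrable)
  qed
 qed
 have dct: "integrable lebesgue (\<lambda>x. indicat_real S x * ?F x) \<and>
   (\<lambda>n. integral\<^sup>L lebesgue (Q (X n))) \<longlonglongrightarrow> integral\<^sup>L lebesgue (\<lambda>x. indicat_real S x * ?F x)"
  if X: "\<And>n. X n \<in> ?I - {s}" "X \<longlonglongrightarrow> s" for X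
 proof
  have m: "Q (X n) \<in> borel_measurable lebesgue" for n
   using Qint[of "X n"] X(1)[of n] by (auto intro: borel_measurable_integrable)
  have a: "AE x in lebesgue. (\<lambda>n. Q (X n) x) \<longlonglongrightarrow> indicat_real S x * ?F x"
   by (rule AE_I2, rule ptw[OF X])
  have b: "AE x in lebesgue. norm (Q (X n) x) \<le> indicat_real S x * L" for n
   by (rule AE_I2, rule bound[OF X(1)])
  show "integrable lebesgue (\<lambda>x. indicat_real S x * ?F x)"
   by (rule integrable_dominated_convergence[OF meas m dom a b])
  show "(\<lambda>n. integral\<^sup>L lebesgue (Q (X n))) \<longlonglongrightarrow> integral\<^sup>L lebesgue (\<lambda>x. indicat_real S x * ?F x)"
   by (rule integral_dominated_convergence[OF meas m dom a b])
 qed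
 show "set_integrable lebesgue S ?F"
  using ex dct unfolding set_integrable_def real_scaleR_def by blast
 have "((\<lambda>r. ((LINT x:S|lebesgue. g (dil z r x)) - (LINT x:S|lebesgue. g (dil z s x))) / (r - s)) \<longlongrightarrow>
   (LINT x:S|lebesgue. ?F x)) (at s within ?I)"
  unfolding tendsto_at_iff_sequentially
 proof (intro allI impI)
  fix X assume X: "\<forall>n. X n \<in> ?I - {s}" "X \<longlonglongrightarrow> s"
  have "(\<lambda>n. integral\<^sup>L lebesgue (Q (X n))) \<longlonglongrightarrow> integral\<^sup>L lebesgue (\<lambda>x. indicat_real S x * ?F x)"
   using dct X by blast
  moreover have "integral\<^sup>L lebesgue (Q (X n)) = ((LINT x:S|lebesgue. g (dil z (X n) x)) - (LINT x:S|lebesgue. g (dil z s x))) / (X n - s)" for n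
   using Qeq[of "X n"] X(1) by blast
  ultimately show "((\<lambda>r. ((LINT x:S|lebesgue. g (dil z r x)) - (LINT x:S|lebesgue. g (dil z s x))) / (r - s)) \<circ> X)
    \<longlonglongrightarrow> (LINT x:S|lebesgue. ?F x)"
   by (simp add: o_def set_lebesgue_integral_def)
 qed
 then have "((\<lambda>r. LINT x:S|lebesgue. g (dil z r x)) has_real_derivative (LINT x:S|lebesgue. ?F x)) (at s within ?I)"
  unfolding has_field_derivative_iff .
 then show "((\<lambda>r. LINT x:S|lebesgue. g (dil z r x)) has_real_derivative (LINT x:S|lebesgue. ?F x)) (at s)"
  using s by (simp add: at_within_open[of s ?I])
qed

text \<open>A path through finitely many closed pieces on each of which the function is Lipschitz: the constant
 does not grow when the path crosses from one piece to another.\<close>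

lemma lipschitz_on_ray:
 fixes g :: "pt \<Rightarrow> real"
 assumes F: "finite F" "\<And>A. A \<in> F ==> closed A" "\<And>A. A \<in> F ==> M-lipschitz_on A g" and M: "0 \<le> M"
  and D: "norm (x - z) \<le> D" and r: "r \<le> r'"
  and path: "\<And>\<rho>. r \<le> \<rho> ==> \<rho> \<le> r' ==> dil z \<rho> x \<in> \<Union>F"
 shows "\<bar>g (dil z r x) - g (dil z r' x)\<bar> \<le> M * D * \<bar>r - r'\<bar>"
proof -
 have D0: "0 \<le> D" using D norm_ge_zero order_trans by blast
 let ?U = "\<lambda>A. (\<lambda>\<rho>. dil z \<rho> x) -` A"
 have "(M * D)-lipschitz_on {r..r'} (\<lambda>\<rho>. g (dil z \<rho> x))"
 proof (rule lipschitz_on_closed_Union[where I = F and U = ?U])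
  fix A assume A: "A \<in> F"
  show "closed (?U A)" by (rule closed_vimage[OF F(2)[OF A]]) (auto intro!: continuous_intros)
  show "(M * D)-lipschitz_on (?U A) (\<lambda>\<rho>. g (dil z \<rho> x))"
  proof (rule lipschitz_onI)
   fix a b assume "a \<in> ?U A" "b \<in> ?U A"
   then have "dil z a x \<in> A" "dil z b x \<in> A" by (simp_all only: vimage_eq)
   then have "dist (g (dil z a x)) (g (dil z b x)) \<le> M * dist (dil z a x) (dil z b x)"
    by (rule lipschitz_onD[OF F(3)[OF A]])
   also have "dist (dil z a x) (dil z b x) = \<bar>a - b\<bar> * norm (x - z)"
    unfolding dist_norm add_diff_cancel_left scaleR_diff_left[symmetric] norm_scaleR ..
   also have "M * (\<bar>a - b\<bar> * norm (x - z)) \<le> M * (\<bar>a - b\<bar> * D)"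
    using M D by (intro mult_left_mono) auto
   finally show "dist (g (dil z a x)) (g (dil z b x)) \<le> M * D * dist a b"
    by (simp add: dist_real_def mult_ac)
  qed (use M D0 in simp)
 qed (use F M D0 path in auto)
 from lipschitz_onD[OF this, of r r'] r show ?thesis by (simp add: dist_real_def)
qed

lemma pw_lipschitz_sq:
 assumes T: "elt T" "T \<in> \<G>" and u: "u \<in> pw p \<G>"
 shows "\<exists>M\<ge>0. M-lipschitz_on T (\<lambda>x. (cmod (u x))\<^sup>2)"
proof -
 obtain q where q: "q \<in> Pol p" "\<And>x. x \<in> T ==> u x = q x" using pwE[OF u T(2)] by blast
 obtain q1 q2 where d: "q1 \<in> Pol p" "q2 \<in> Pol p"
  "\<And>x. (q has_derivative (\<lambda>h. q1 x * of_real (h $ 1) + q2 x * of_real (h $ 2))) (at x)"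
  using Pol_derivative[OF q(1)] by blast
 have cT: "compact T" "convex T" using T(1) by (auto simp: elt_def)
 have bd: "\<exists>B\<ge>0. \<forall>x\<in>T. cmod (f x) \<le> B" if f: "f \<in> Pol p" for f
 proof -
  have "bounded (f ` T)" by (intro compact_imp_bounded compact_continuous_image Pol_continuous[OF f] cT)
  then obtain B where "\<forall>x\<in>T. cmod (f x) \<le> B" unfolding bounded_iff by blast
  then show ?thesis by (intro exI[of _ "max B 0"]) auto
 qed
 obtain B where B: "0 \<le> B" "\<And>x. x \<in> T ==> cmod (q x) \<le> B" using bd[OF q(1)] by blast
 obtain B1 where B1: "0 \<le> B1" "\<And>x. x \<in> T ==> cmod (q1 x) \<le> B1" using bd[OF d(1)] by blast
 obtain B2 where B2: "0 \<le> B2" "\<And>x. x \<in> T ==> cmod (q2 x) \<le> B2" using bd[OF d(2)] by blast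
 have lq: "(B1 + B2)-lipschitz_on T q"
 proof (rule bounded_derivative_imp_lipschitz[OF _ cT(2)])
  fix x assume x: "x \<in> T"
  show "(q has_derivative (\<lambda>h. q1 x * of_real (h $ 1) + q2 x * of_real (h $ 2))) (at x within T)"
   using d(3) has_derivative_at_withinI by blast
  have bl: "bounded_linear (\<lambda>h::pt. q1 x * of_real (h $ 1) + q2 x * of_real (h $ 2))"
   using d(3) has_derivative_bounded_linear by blast
  show "onorm (\<lambda>h::pt. q1 x * of_real (h $ 1) + q2 x * of_real (h $ 2)) \<le> B1 + B2"
  proof (rule onorm_bound)
   fix h :: pt
   have "cmod (q1 x * of_real (h $ 1)) \<le> B1 * norm h" "cmod (q2 x * of_real (h $ 2)) \<le> B2 * norm h"
    unfolding norm_mult using B1 B2 x component_le_norm_cart[of h 1] component_le_norm_cart[of h 2]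
    by (auto intro!: mult_mono)
   then show "cmod (q1 x * of_real (h $ 1) + q2 x * of_real (h $ 2)) \<le> (B1 + B2) * norm h"
    using norm_triangle_le[OF add_mono] by (simp add: distrib_right)
  qed (use B1 B2 in simp)
 qed (use B1 B2 in simp)
 have "(2 * B * (B1 + B2))-lipschitz_on T (\<lambda>x. (cmod (u x))\<^sup>2)"
 proof (rule lipschitz_onI)
  fix x y assume xy: "x \<in> T" "y \<in> T"
  have "(cmod (q x))\<^sup>2 - (cmod (q y))\<^sup>2 = (cmod (q x) + cmod (q y)) * (cmod (q x) - cmod (q y))"
   by (simp add: power2_eq_square algebra_simps)
  then have "dist ((cmod (q x))\<^sup>2) ((cmod (q y))\<^sup>2) = \<bar>cmod (q x) + cmod (q y)\<bar> * \<bar>cmod (q x) - cmod (q y)\<bar>"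
   by (simp only: dist_real_def abs_mult)
  also have "... \<le> (2 * B) * dist (q x) (q y)"
  proof (rule mult_mono)
   have "cmod (q x) + cmod (q y) \<le> B + B" by (rule add_mono[OF B(2)[OF xy(1)] B(2)[OF xy(2)]])
   then show "\<bar>cmod (q x) + cmod (q y)\<bar> \<le> 2 * B" by simp
   show "\<bar>cmod (q x) - cmod (q y)\<bar> \<le> dist (q x) (q y)" unfolding dist_norm by (rule norm_triangle_ineq3)
  qed (use B in auto)
  also have "... \<le> (2 * B) * ((B1 + B2) * dist x y)"
   using lipschitz_onD[OF lq xy] B by (intro mult_left_mono) auto
  finally show "dist ((cmod (u x))\<^sup>2) ((cmod (u y))\<^sup>2) \<le> 2 * B * (B1 + B2) * dist x y"
   using q(2) xy by (simp add: mult.assoc)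
 qed (use B B1 B2 in simp)
 then show ?thesis using B B1 B2 by (intro exI[of _ "2 * B * (B1 + B2)"]) simp
qed

lemma uniform_lipschitz:
 assumes "finite F" "\<And>A. A \<in> F ==> \<exists>M\<ge>0. M-lipschitz_on A g"
 shows "\<exists>M\<ge>0. \<forall>A\<in>F. M-lipschitz_on A g"
 using assms
proof (induction F rule: finite_induct)
 case empty then show ?case by (intro exI[of _ 0]) auto
next
 case (insert A F)
 then obtain M1 M2 where M: "M1 \<ge> 0" "\<forall>A\<in>F. M1-lipschitz_on A g" "M2 \<ge> 0" "M2-lipschitz_on A g"
  by (metis insertI1 insertI2)
 have "\<forall>B\<in>insert A F. (max M1 M2)-lipschitz_on B g"
  using M by (auto intro: lipschitz_on_le)
 then show ?case using M by (intro exI[of _ "max M1 M2"]) auto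
qed

definition gsq :: "scalar_fun \<Rightarrow> pt \<Rightarrow> real" where
 "gsq u x = (\<Sum>i\<in>UNIV. (cmod (grad u x $ i))\<^sup>2)"

definition dsq :: "scalar_fun \<Rightarrow> pt \<Rightarrow> pt \<Rightarrow> real" where
 "dsq u x k = 2 * Re (cnj (u x) * frechet_derivative u (at x) k)"

lemma cauchy_schwarz_2: "(a * c + b * d)\<^sup>2 \<le> (a\<^sup>2 + b\<^sup>2) * (c\<^sup>2 + d\<^sup>2)" for a b c d :: real
proof -
 have "(a\<^sup>2 + b\<^sup>2) * (c\<^sup>2 + d\<^sup>2) - (a * c + b * d)\<^sup>2 = (a * d - b * c)\<^sup>2"
  by (simp add: power2_eq_square algebra_simps)
 then show ?thesis using zero_le_power2[of "a * d - b * c"] by linarith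
qed

text \<open>The second part is the weighted product inequality that trades the derivative of \<open>\<bar>u\<bar>\<^sup>2\<close> for the
 energy density; the weight will be the wave number.\<close>

lemma dsq_derivative:
 assumes "(u has_derivative E) (at x)"
 shows "((\<lambda>x. (cmod (u x))\<^sup>2) has_derivative dsq u x) (at x)"
  "\<bar>c * dsq u x k\<bar> \<le> norm k * (c\<^sup>2 * (cmod (u x))\<^sup>2 + gsq u x)"
proof -
 have E: "E = frechet_derivative u (at x)" by (rule frechet_derivative_at[OF assms])
 have cm: "(\<lambda>x. (cmod (u x))\<^sup>2) = (\<lambda>x. Re (u x * cnj (u x)))"
  by (rule ext) (simp add: complex_mult_cnj cmod_power2)
 have "((\<lambda>x. u x * cnj (u x)) has_derivative (\<lambda>k. u x * cnj (E k) + E k * cnj (u x))) (at x)"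
  by (rule has_derivative_mult[OF assms bounded_linear.has_derivative[OF bounded_linear_cnj assms]])
 from bounded_linear.has_derivative[OF bounded_linear_Re this]
 show "((\<lambda>x. (cmod (u x))\<^sup>2) has_derivative dsq u x) (at x)"
  unfolding cm by (rule has_derivative_eq_rhs) (auto simp: dsq_def E fun_eq_iff algebra_simps)
 let ?g = "\<lambda>i. cmod (grad u x $ i)"
 have Ek1: "cmod (E k) \<le> ?g 1 * \<bar>k $ 1\<bar> + ?g 2 * \<bar>k $ 2\<bar>"
  unfolding derivative_grad[OF assms] by (rule norm_triangle_le) (simp add: norm_mult)
 have Ek2: "(?g 1 * \<bar>k $ 1\<bar> + ?g 2 * \<bar>k $ 2\<bar>)\<^sup>2 \<le> gsq u x * (norm k)\<^sup>2"
 proof -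
  have "(norm k)\<^sup>2 = \<bar>k $ 1\<bar>\<^sup>2 + \<bar>k $ 2\<bar>\<^sup>2" by (simp add: norm_vec_def L2_set_def sum_2)
  then show ?thesis unfolding gsq_def sum_2 using cauchy_schwarz_2[of "?g 1" "\<bar>k $ 1\<bar>" "?g 2" "\<bar>k $ 2\<bar>"] by simp
 qed
 have "(cmod (E k))\<^sup>2 \<le> gsq u x * (norm k)\<^sup>2"
  by (rule order_trans[OF power_mono[OF Ek1 norm_ge_zero] Ek2])
 then have "cmod (E k) \<le> sqrt (gsq u x * (norm k)\<^sup>2)" by (rule real_le_rsqrt)
 then have Ek: "cmod (E k) \<le> sqrt (gsq u x) * norm k" by (simp add: real_sqrt_mult)
 have g0: "0 \<le> gsq u x" unfolding gsq_def by (intro sum_nonneg) auto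
 have "\<bar>c * dsq u x k\<bar> \<le> \<bar>c\<bar> * (2 * (cmod (u x) * cmod (E k)))"
  unfolding dsq_def E[symmetric] abs_mult
  using abs_Re_le_cmod[of "cnj (u x) * E k"] by (intro mult_left_mono) (auto simp: norm_mult)
 also have "... \<le> \<bar>c\<bar> * (2 * (cmod (u x) * (sqrt (gsq u x) * norm k)))"
  using Ek by (intro mult_left_mono) auto
 also have "... = norm k * (2 * (\<bar>c\<bar> * cmod (u x)) * sqrt (gsq u x))" by simp
 also have "... \<le> norm k * ((\<bar>c\<bar> * cmod (u x))\<^sup>2 + (sqrt (gsq u x))\<^sup>2)"
  by (intro mult_left_mono sum_squares_bound) auto
 also have "... = norm k * (c\<^sup>2 * (cmod (u x))\<^sup>2 + gsq u x)" using g0 by (simp add: power_mult_distrib)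
 finally show "\<bar>c * dsq u x k\<bar> \<le> norm k * (c\<^sup>2 * (cmod (u x))\<^sup>2 + gsq u x)" .
qed

lemma energy_integrable:
 assumes "elts \<G>" "u \<in> pw p \<G>"
 shows "set_integrable lebesgue (\<Union>\<G>) (\<lambda>x. (cmod (u x))\<^sup>2)" "set_integrable lebesgue (\<Union>\<G>) (gsq u)"
  "set_integrable lebesgue (\<Union>\<G>) (\<lambda>x. c\<^sup>2 * (cmod (u x))\<^sup>2 + gsq u x)"
  "(LINT x:(\<Union>\<G>)|lebesgue. c\<^sup>2 * (cmod (u x))\<^sup>2 + gsq u x) = energy1 c (\<Union>\<G>) u"
proof -
 have re: "set_integrable lebesgue S (\<lambda>x. Re (f x))" if "set_integrable lebesgue S f" for S and f :: scalar_fun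
 proof -
  have "integrable lebesgue (\<lambda>x. Re (indicat_real S x *\<^sub>R f x))"
   using that unfolding set_integrable_def by (rule integrable_Re)
  then show ?thesis unfolding set_integrable_def by simp
 qed
 have "(\<lambda>x. Re (val_ip u u x)) = (\<lambda>x. (cmod (u x))\<^sup>2)"
  by (rule ext) (simp add: val_ip_def complex_mult_cnj cmod_power2)
 then show a: "set_integrable lebesgue (\<Union>\<G>) (\<lambda>x. (cmod (u x))\<^sup>2)"
  using re[OF ip_integrable(1)[OF assms assms(2)]] by simp
 have "(\<lambda>x. Re (grad_ip u u x)) = gsq u"
  by (rule ext) (simp add: grad_ip_def gsq_def complex_mult_cnj cmod_power2)
 then show b: "set_integrable lebesgue (\<Union>\<G>) (gsq u)"
  using re[OF ip_integrable(2)[OF assms assms(2)]] by simp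
 have a': "set_integrable lebesgue (\<Union>\<G>) (\<lambda>x. c\<^sup>2 * (cmod (u x))\<^sup>2)" using a by simp
 show "set_integrable lebesgue (\<Union>\<G>) (\<lambda>x. c\<^sup>2 * (cmod (u x))\<^sup>2 + gsq u x)"
  by (rule set_integral_add(1)[OF a' b])
 have "(LINT x:(\<Union>\<G>)|lebesgue. c\<^sup>2 * (cmod (u x))\<^sup>2 + gsq u x) = c\<^sup>2 * (LINT x:(\<Union>\<G>)|lebesgue. (cmod (u x))\<^sup>2) + (LINT x:(\<Union>\<G>)|lebesgue. gsq u x)"
  unfolding set_integral_add(2)[OF a' b] by simp
 then show "(LINT x:(\<Union>\<G>)|lebesgue. c\<^sup>2 * (cmod (u x))\<^sup>2 + gsq u x) = energy1 c (\<Union>\<G>) u"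
  unfolding ip1_def dirichlet_ip_self l2_ip_self gsq_def by simp
qed

section \<open>Nodal interpolation on the mesh\<close>

lemma tri_nodes_eq: 
 assumes T: "tri T" and p: "1 \<le> p"
 shows "{x. \<exists>k :: pt \<Rightarrow> nat. (\<Sum>a | a extreme_point_of T. k a) = p \<and>
    x = (\<Sum>a | a extreme_point_of T. (real (k a) / real p) *\<^sub>R a)} = node p (verts T) ` multi_idx p (verts T)"
 (is "?L = ?R")
proof
 show "?L \<subseteq> ?R"
 proof
  fix x assume "x \<in> ?L"
  then obtain k where k: "sum k (verts T) = p" "x = (\<Sum>a\<in>verts T. (real (k a) / real p) *\<^sub>R a)"
   unfolding verts_def by blast
  define k' where "k' a = (if a \<in> verts T then k a else 0)" for a
  have "k' \<in> multi_idx p (verts T)" using k(1) by (simp add: multi_idx_def k'_def)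
  moreover have "x = node p (verts T) k'" unfolding k(2) node_def k'_def by simp
  ultimately show "x \<in> ?R" by blast
 qed
 show "?R \<subseteq> ?L"
 proof
  fix x assume "x \<in> ?R"
  then obtain k where k: "k \<in> multi_idx p (verts T)" "x = node p (verts T) k" by blast
  then show "x \<in> ?L" unfolding verts_def multi_idx_def node_def by blast
 qed
qed

definition tnodes :: "nat \<Rightarrow> pt set \<Rightarrow> pt set" where
 "tnodes p T = node p (verts T) ` multi_idx p (verts T)"

lemma nodes_tnodes:
 assumes "\<And>T. T \<in> \<T> ==> tri T" "1 \<le> p"
 shows "nodes p \<T> = (\<Union>T\<in>\<T>. tnodes p T)"
proof -
 have "nodes p \<T> = (\<Union>T\<in>\<T>. {x. \<exists>k :: pt \<Rightarrow> nat. (\<Sum>a | a extreme_point_of T. k a) = p \<and>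
    x = (\<Sum>a | a extreme_point_of T. (real (k a) / real p) *\<^sub>R a)})"
  unfolding nodes_def by blast
 also have "... = (\<Union>T\<in>\<T>. tnodes p T)"
  unfolding tnodes_def by (intro SUP_cong refl tri_nodes_eq assms)
 finally show ?thesis .
qed

lemma tnodes_subset: "tri T ==> 1 \<le> p ==> tnodes p T \<subseteq> T"
 unfolding tnodes_def using node_in_hull[OF tri_verts(1)] tri_verts(2) by blast

lemma finite_tnodes: "tri T ==> finite (tnodes p T)"
 unfolding tnodes_def using tri_verts(1)[of T] by (intro finite_imageI finite_multi_idx) (simp add: triangle_verts_def)

definition node_const :: "nat \<Rightarrow> real" where
 "node_const p = (real p + 1) ^ 3 * real p ^ p"

lemma node_const_ge1: "1 \<le> p ==> 1 \<le> node_const p"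
proof -
 assume "1 \<le> p"
 then have "1 * 1 \<le> (real p + 1) ^ 3 * real p ^ p" by (intro mult_mono one_le_power) auto
 then show ?thesis by (simp add: node_const_def)
qed

lemma lagr_interp_tri_bound:
 assumes "tri T" "1 \<le> p" "x \<in> T" "\<And>y. y \<in> tnodes p T ==> cmod (f y) \<le> B"
 shows "cmod (lagr_interp p (verts T) f x) \<le> node_const p * B"
proof -
 have "x \<in> convex hull verts T" using assms(3) tri_verts(2)[OF assms(1)] by simp
 from lagr_interp_bound[OF tri_verts(1)[OF assms(1)] assms(2) this] assms(4) show ?thesis
  by (simp add: node_const_def tnodes_def)
qed

locale fe_mesh =
 fixes K :: real and \<Omega> :: "pt set" and \<T> :: "pt set set" and p :: nat
 assumes mesh: "regular_mesh K \<Omega> \<T>" and p: "1 \<le> p" and K: "1 \<le> K"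
begin

abbreviation "h \<equiv> mesh_size \<T>"
abbreviation "V \<equiv> fe_space p \<T>"
abbreviation "I\<^sub>h \<equiv> interp p \<T>"

lemma conf: "conforming \<T>"
 unfolding conforming_def
proof (intro conjI ballI)
 have t: "triangulation \<T>" using mesh by (simp add: regular_mesh_def)
 show "finite \<T>" using t by (simp add: triangulation_def)
 show "tri T" if "T \<in> \<T>" for T using mesh that two_simplex_tri by (simp add: regular_mesh_def)
 have f: "(T \<inter> T') face_of T" if "T \<in> \<T>" "T' \<in> \<T>" for T T'
  using t that by (auto simp: triangulation_def)
 show "(T \<inter> T') face_of T" "(T \<inter> T') face_of T'" if "T \<in> \<T>" "T' \<in> \<T>" for T T'
  using f[OF that] f[OF that(2,1)] by (simp_all add: Int_commute)
qed

lemma fin: "finite \<T>" and ne: "\<T> \<noteq> {}" and cover: "\<Union>\<T> = closure \<Omega>"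
 using mesh conf by (auto simp: regular_mesh_def conforming_def)

lemma tri: "T \<in> \<T> ==> tri T"
 using conf by (simp add: conforming_def)

lemma els: "elts \<T>" by (rule conforming_elts[OF conf])

lemma elt: "T \<in> \<T> ==> elt T" by (rule tri_elt[OF tri])

lemma fat: "T \<in> \<T> ==> fat K T"
 using mesh elt by (simp add: fat_def regular_mesh_def)

lemma diam_le: "T \<in> \<T> ==> diameter T \<le> h"
 unfolding mesh_size_def using fin by (intro Max_ge) auto

lemma le_diam: "T \<in> \<T> ==> h \<le> K * diameter T"
 using mesh by (simp add: regular_mesh_def)

lemma h_pos: "0 < h"
 using ne diam_le elt_diameter_pos[OF elt] by (metis all_not_in_conv less_le_trans)

lemma dist_le: "T \<in> \<T> ==> x \<in> T ==> y \<in> T ==> dist x y \<le> h"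
 using diameter_bounded_bound[of T x y] elt[of T] diam_le[of T] by (simp add: elt_def compact_imp_bounded)

lemma closed_Union: "closed (\<Union>\<T>)" and compact_Union: "compact (\<Union>\<T>)"
 by (rule conforming_Union_closed[OF conf])+

lemma common_face:
 assumes "T \<in> \<T>" "T' \<in> \<T>"
 obtains W where "W \<subseteq> verts T" "W \<subseteq> verts T'" "T \<inter> T' = convex hull W"
proof -
 have ai: "\<not> affine_dependent (verts T)" "\<not> affine_dependent (verts T')"
  using tri_verts(1)[OF tri] assms by (auto simp: triangle_verts_def)
 have hT: "T = convex hull (verts T)" "T' = convex hull (verts T')" using tri_verts(2)[OF tri] assms by auto
 have fT: "(T \<inter> T') face_of convex hull (verts T)" "(T \<inter> T') face_of convex hull (verts T')"
  using conf assms hT unfolding conforming_def by auto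
 obtain W where W: "W \<subseteq> verts T" "T \<inter> T' = convex hull W"
  using fT(1) face_of_convex_hull_affine_independent[OF ai(1)] by blast
 obtain W' where W': "W' \<subseteq> verts T'" "T \<inter> T' = convex hull W'"
  using fT(2) face_of_convex_hull_affine_independent[OF ai(2)] by blast
 have "verts (T \<inter> T') = W" using W ai affine_dependent_subset verts_hull by metis
 moreover have "verts (T \<inter> T') = W'" using W' ai affine_dependent_subset verts_hull by metis
 ultimately have "W = W'" by simp
 then show thesis using that W W' by blast
qed

lemma nodes_eq: "nodes p \<T> = (\<Union>T\<in>\<T>. tnodes p T)"
 by (rule nodes_tnodes[OF tri p])

lemma finite_nodes: "finite (nodes p \<T>)"
 unfolding nodes_eq using fin finite_tnodes[OF tri] by auto

lemma tnodes_sub: "T \<in> \<T> ==> tnodes p T \<subseteq> T" "T \<in> \<T> ==> tnodes p T \<subseteq> nodes p \<T>"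
 using tnodes_subset[OF tri p] nodes_eq by auto

lemma nodes_sub: "nodes p \<T> \<subseteq> \<Union>\<T>"
 using tnodes_sub(1) nodes_eq by auto

lemma fe_pw: "V \<subseteq> pw p \<T>"
 by (auto simp: fe_space_def pw_def)

lemma V_subspace: "cvs.subspace V"
 unfolding cvs.subspace_def
proof (intro conjI ballI allI)
 note s = pw_subspace[of p \<T>]
 show "0 \<in> V" using cvs.subspace_0[OF s] by (auto simp: fe_space_def pw_def zero_fun_def)
 show "u + v \<in> V" if "u \<in> V" "v \<in> V" for u v
  using cvs.subspace_add[OF s, of u v] that fe_pw
  by (auto simp: fe_space_def pw_def plus_fun_def intro!: continuous_intros)
 show "c *\<^sub>C u \<in> V" if "u \<in> V" for c u
  using cvs.subspace_scale[OF s, of u c] that fe_pw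
  by (auto simp: fe_space_def pw_def scl_def intro!: continuous_intros)
qed

lemma fe_lagr:
 assumes "v \<in> pw p {T}" "T \<in> \<T>" "x \<in> T"
 shows "v x = lagr_interp p (verts T) v x"
proof -
 obtain q where q: "q \<in> Pol p" "\<And>x. x \<in> T ==> v x = q x" using pwE[OF assms(1), of T] by blast
 have "v x = (\<Sum>k\<in>multi_idx p (verts T). q (node p (verts T) k) * lagr p (verts T) k x)"
  unfolding q(2)[OF assms(3)] by (rule Pol_lagrange[OF tri_verts(1)[OF tri[OF assms(2)]] p q(1)])
 also have "... = lagr_interp p (verts T) v x"
  unfolding lagr_interp_def
  by (intro sum.cong refl) (use q(2) tnodes_sub(1)[OF assms(2)] in \<open>auto simp: tnodes_def\<close>)
 finally show ?thesis .
qed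

text \<open>The elementwise interpolants match on common faces, so the element picked by the choice is immaterial.\<close>

definition glue :: "scalar_fun \<Rightarrow> scalar_fun" where
 "glue f x = (if x \<in> \<Union>\<T> then lagr_interp p (verts (SOME T. T \<in> \<T> \<and> x \<in> T)) f x else 0)"

lemma glue_eq:
 assumes "T \<in> \<T>" "x \<in> T"
 shows "glue f x = lagr_interp p (verts T) f x"
proof -
 define T' where "T' = (SOME T. T \<in> \<T> \<and> x \<in> T)"
 have T': "T' \<in> \<T> \<and> x \<in> T'" unfolding T'_def by (rule someI[of _ T]) (use assms in blast)
 obtain W where W: "W \<subseteq> verts T" "W \<subseteq> verts T'" "T \<inter> T' = convex hull W"
  using common_face[OF assms(1)] T' by blast
 have x: "x \<in> convex hull W" using W(3) assms(2) T' by blast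
 have "lagr_interp p (verts T') f x = lagr_interp p (verts T) f x"
  using lagr_interp_face[OF tri_verts(1)[OF tri] W(1) x] lagr_interp_face[OF tri_verts(1)[OF tri] W(2) x] assms T' by simp
 then show ?thesis using assms by (auto simp: glue_def T'_def)
qed

lemma glue_fe: "glue f \<in> V"
 unfolding fe_space_def
proof (intro CollectI conjI ballI allI impI)
 have c: "continuous_on T (glue f)" if "T \<in> \<T>" for T
  by (rule continuous_on_eq[OF Pol_continuous[OF lagr_interp_Pol[OF tri_verts(1)[OF tri[OF that]], of p f]]])
   (simp add: glue_eq[OF that])
 have "continuous_on (\<Union>T\<in>\<T>. T) (glue f)"
  by (rule continuous_on_closed_Union[OF fin]) (use c elt in \<open>auto simp: elt_def compact_imp_closed\<close>)
 then show "continuous_on (\<Union>\<T>) (glue f)" by simp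
 show "poly_on p T (glue f)" if "T \<in> \<T>" for T
  unfolding poly_on_iff
  by (rule bexI[OF _ lagr_interp_Pol[OF tri_verts(1)[OF tri[OF that]], of p f]]) (simp add: glue_eq[OF that])
qed (simp add: glue_def)

lemma glue_node: "x \<in> nodes p \<T> ==> glue f x = f x"
proof -
 assume "x \<in> nodes p \<T>"
 then obtain T k where T: "T \<in> \<T>" "k \<in> multi_idx p (verts T)" "x = node p (verts T) k"
  unfolding nodes_eq tnodes_def by blast
 have "x \<in> T" using T tnodes_sub(1)[OF T(1)] by (auto simp: tnodes_def)
 then show ?thesis using glue_eq[OF T(1)] T lagr_interp_node[OF tri_verts(1)[OF tri[OF T(1)]] p T(2)] by simp
qed

lemma lagr_interp_cong:
 "(\<And>y. y \<in> tnodes p T ==> f y = g y) ==> lagr_interp p (verts T) f x = lagr_interp p (verts T) g x"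
 unfolding lagr_interp_def tnodes_def by (intro sum.cong refl) auto

lemma fe_outside: "v \<in> V ==> x \<notin> \<Union>\<T> ==> v x = 0"
 by (simp add: fe_space_def)

lemma fe_unique:
 assumes "u \<in> V" "v \<in> V" "\<And>x. x \<in> nodes p \<T> ==> u x = v x"
 shows "u = v"
proof
 fix x
 show "u x = v x"
 proof (cases "x \<in> \<Union>\<T>")
  case True
  then obtain T where T: "T \<in> \<T>" "x \<in> T" by blast
  have "u \<in> pw p {T}" "v \<in> pw p {T}" using assms(1,2) fe_pw pw_mono[of "{T}" \<T> p] T(1) by auto
  then have "u x = lagr_interp p (verts T) u x" "v x = lagr_interp p (verts T) v x"
   using fe_lagr T by auto
  moreover have "lagr_interp p (verts T) u x = lagr_interp p (verts T) v x"
   by (rule lagr_interp_cong) (use assms(3) tnodes_sub(2)[OF T(1)] in blast)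
  ultimately show ?thesis by simp
 next
  case False
  then show ?thesis using fe_outside[OF assms(1)] fe_outside[OF assms(2)] by simp
 qed
qed

lemma interp_glue: "I\<^sub>h f = glue f"
 unfolding interp_def
proof (rule the_equality)
 show "glue f \<in> V \<and> (\<forall>x\<in>nodes p \<T>. glue f x = f x)" using glue_fe glue_node by blast
 show "v = glue f" if "v \<in> V \<and> (\<forall>x\<in>nodes p \<T>. v x = f x)" for v
  using that glue_fe glue_node by (intro fe_unique) auto
qed

lemma interp_fe: "I\<^sub>h f \<in> V" by (simp add: interp_glue glue_fe)

lemma interp_node: "x \<in> nodes p \<T> ==> I\<^sub>h f x = f x" by (simp add: interp_glue glue_node)

lemma interp_local: "T \<in> \<T> ==> x \<in> T ==> I\<^sub>h f x = lagr_interp p (verts T) f x"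
 by (simp add: interp_glue glue_eq)

lemma interp_eqI: "v \<in> V ==> (\<And>x. x \<in> nodes p \<T> ==> v x = f x) ==> I\<^sub>h f = v"
 using fe_unique[OF interp_fe] interp_node by simp

lemma interp_cong: "(\<And>x. x \<in> nodes p \<T> ==> f x = g x) ==> I\<^sub>h f = I\<^sub>h g"
 by (rule interp_eqI[OF interp_fe]) (simp add: interp_node)

lemma interp_id: "v \<in> V ==> I\<^sub>h v = v"
 by (rule interp_eqI) auto

lemma interp_add: "I\<^sub>h (\<lambda>x. f x + g x) = I\<^sub>h f + I\<^sub>h g"
 by (rule interp_eqI[OF cvs.subspace_add[OF V_subspace interp_fe interp_fe]]) (simp add: plus_fun_apply interp_node)

lemma interp_scl: "I\<^sub>h (\<lambda>x. c * f x) = c *\<^sub>C I\<^sub>h f"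
 by (rule interp_eqI[OF cvs.subspace_scale[OF V_subspace interp_fe]]) (simp add: scl_apply interp_node)

lemma interp_sum: "I\<^sub>h (\<lambda>x. \<Sum>i\<in>A. f i x) = (\<Sum>i\<in>A. I\<^sub>h (f i))"
 by (rule interp_eqI[OF cvs.subspace_sum[OF V_subspace interp_fe]]) (simp add: sum_fun_apply interp_node)

lemma interp_zero_local:
 assumes "T \<in> \<T>" "x \<in> T" "\<And>y. y \<in> tnodes p T ==> f y = 0"
 shows "I\<^sub>h f x = 0"
 unfolding interp_local[OF assms(1,2)] lagr_interp_def
 by (rule sum.neutral) (use assms(3) in \<open>auto simp: tnodes_def\<close>)

lemma interp_bound:
 assumes "T \<in> \<T>" "x \<in> T" "\<And>y. y \<in> tnodes p T ==> cmod (f y) \<le> B"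
 shows "cmod (I\<^sub>h f x) \<le> node_const p * B"
 unfolding interp_local[OF assms(1,2)] by (rule lagr_interp_tri_bound[OF tri[OF assms(1)] p assms(2,3)])

lemma V_fdim: "fdim V"
 unfolding fdim_def
proof (intro conjI V_subspace exI[of _ "(\<lambda>y. I\<^sub>h (\<lambda>x. if x = y then 1 else 0)) ` nodes p \<T>"])
 show "finite ((\<lambda>y. I\<^sub>h (\<lambda>x. if x = y then 1 else 0)) ` nodes p \<T>)" using finite_nodes by simp
 show "V \<subseteq> cvs.span ((\<lambda>y. I\<^sub>h (\<lambda>x. if x = y then 1 else 0)) ` nodes p \<T>)"
 proof
  fix v assume v: "v \<in> V"
  have "v = I\<^sub>h (\<lambda>x. \<Sum>y\<in>nodes p \<T>. v y * (if x = y then 1 else 0))"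
  proof (rule sym, rule interp_eqI[OF v])
   fix x assume x: "x \<in> nodes p \<T>"
   have "(\<Sum>y\<in>nodes p \<T>. v y * (if x = y then 1 else 0)) = (\<Sum>y\<in>nodes p \<T>. if x = y then v y else 0)"
    by (intro sum.cong) auto
   then show "v x = (\<Sum>y\<in>nodes p \<T>. v y * (if x = y then 1 else 0))"
    using x finite_nodes by simp
  qed
  also have "... = (\<Sum>y\<in>nodes p \<T>. v y *\<^sub>C I\<^sub>h (\<lambda>x. if x = y then 1 else 0))"
   unfolding interp_sum interp_scl ..
  also have "... \<in> cvs.span ((\<lambda>y. I\<^sub>h (\<lambda>x. if x = y then 1 else 0)) ` nodes p \<T>)"
   by (intro cvs.span_sum cvs.span_scale cvs.span_base) auto
  finally show "v \<in> cvs.span ((\<lambda>y. I\<^sub>h (\<lambda>x. if x = y then 1 else 0)) ` nodes p \<T>)" .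
 qed
qed

text \<open>Only boundedly many elements touch a given one, because each occupies a fixed portion of a disc
 of radius comparable to the mesh size.\<close>

definition touching :: "pt set set \<Rightarrow> pt set \<Rightarrow> pt set set" where
 "touching \<G> T = {T'\<in>\<G>. T' \<inter> T \<noteq> {}}"

lemma card_touching:
 assumes T: "T \<in> \<T>"
 shows "real (card (touching \<T> T)) \<le> 9 * K ^ 4"
proof -
 let ?A = "touching \<T> T"
 have fA: "finite ?A" and sub: "?A \<subseteq> \<T>" using fin by (auto simp: touching_def)
 have eA: "elts ?A" by (rule elts_subset[OF els sub])
 obtain x where x: "x \<in> T" using elt[OF T] interior_subset unfolding elt_def by blast
 have big: "\<Union>?A \<subseteq> ball x (3 * h)"
 proof
  fix y assume "y \<in> \<Union>?A"
  then obtain T' z where z: "T' \<in> \<T>" "y \<in> T'" "z \<in> T'" "z \<in> T" by (auto simp: touching_def)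
  have "dist x y \<le> dist x z + dist z y" by (rule dist_triangle)
  also have "... \<le> h + h" using dist_le[OF T x z(4)] dist_le[OF z(1,3,2)] by simp
  also have "... < 3 * h" using h_pos by simp
  finally show "y \<in> ball x (3 * h)" by simp
 qed
 have small: "(h / K\<^sup>2)\<^sup>2 * disc_area \<le> measure lebesgue T'" if T': "T' \<in> ?A" for T'
 proof -
  have T'': "T' \<in> \<T>" using T' sub by blast
  obtain z where z: "ball z (diameter T' / K) \<subseteq> T'" using fat[OF T''] by (auto simp: fat_def)
  have "h / K\<^sup>2 \<le> diameter T' / K" using le_diam[OF T''] K by (simp add: field_simps power2_eq_square)
  then have "ball z (h / K\<^sup>2) \<subseteq> T'" using z subset_ball by blast
  then have "measure lebesgue (ball z (h / K\<^sup>2)) \<le> measure lebesgue T'"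
   using elt[OF T''] by (intro measure_mono_fmeasurable) (auto simp: elt_def lmeasurable_compact)
  moreover have "measure lebesgue (ball z (h / K\<^sup>2)) = (h / K\<^sup>2)\<^sup>2 * disc_area"
   using h_pos by (intro measure_ball2) auto
  ultimately show ?thesis by simp
 qed
 have lint: "(LINT x:S|lebesgue. 1) = measure lebesgue S" if "S \<in> sets lebesgue" for S :: "pt set"
  unfolding set_lebesgue_integral_def using that by simp
 have cU: "compact (\<Union>?A)" using conforming_Union_closed(2)[OF conforming_subset[OF conf sub]] .
 have "real (card ?A) * ((h / K\<^sup>2)\<^sup>2 * disc_area) \<le> (\<Sum>T'\<in>?A. measure lebesgue T')"
  using sum_mono[of ?A "\<lambda>_. (h / K\<^sup>2)\<^sup>2 * disc_area" "\<lambda>T'. measure lebesgue T'"] small by simp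
 also have "... = (\<Sum>T'\<in>?A. LINT x:T'|lebesgue. (1::real))"
  by (intro sum.cong refl lint[symmetric] elt_sets elt) (use sub in blast)
 also have "... = (LINT x:(\<Union>?A)|lebesgue. (1::real))"
  by (rule lint_union_elts[OF eA, symmetric], rule lint_compact_continuous)
   (use elt sub in \<open>auto simp: elt_def\<close>)
 also have "... = measure lebesgue (\<Union>?A)" using cU by (intro lint) (simp add: borel_compact)
 also have "... \<le> measure lebesgue (ball x (3 * h))"
  using big cU by (intro measure_mono_fmeasurable) (auto simp: borel_compact)
 also have "... = (3 * h)\<^sup>2 * disc_area" using h_pos by (intro measure_ball2) auto
 finally have "real (card ?A) * ((h / K\<^sup>2)\<^sup>2) * disc_area \<le> (3 * h)\<^sup>2 * disc_area" by (simp add: mult.assoc)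
 then have "real (card ?A) * ((h / K\<^sup>2)\<^sup>2) \<le> (3 * h)\<^sup>2" using disc_area_pos by simp
 then have "real (card ?A) * h\<^sup>2 / K ^ 4 \<le> 9 * h\<^sup>2" by (simp add: power_divide power_mult_distrib)
 then have "real (card ?A) * h\<^sup>2 \<le> 9 * K ^ 4 * h\<^sup>2" using K by (simp add: field_simps)
 then show ?thesis using h_pos by simp
qed

end

section \<open>Zero extension and multiplication by a weight\<close>

lemma restr_add: "restr S (u + v) = restr S u + restr S v"
 by (auto simp: restr_def fun_eq_iff plus_fun_apply)

lemma restr_scl: "restr S (c *\<^sub>C u) = c *\<^sub>C restr S u"
 by (auto simp: restr_def fun_eq_iff scl_apply)

lemma restr_zero: "restr S 0 = 0"
 by (auto simp: restr_def fun_eq_iff zero_fun_apply)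

lemma restr_sum: "restr S (\<Sum>i\<in>I. c i *\<^sub>C f i) = (\<Sum>i\<in>I. c i *\<^sub>C restr S (f i))"
 by (rule ext) (simp add: restr_def sum_fun_apply scl_apply)

lemma restr_image_fdim: assumes "fdim V" shows "fdim (restr S ` V)"
 unfolding fdim_def
proof
 have V: "cvs.subspace V" using assms by auto
 show "cvs.subspace (restr S ` V)"
  unfolding cvs.subspace_def
 proof (intro conjI ballI allI)
  show "0 \<in> restr S ` V" using cvs.subspace_0[OF V] restr_zero[of S] by (metis image_eqI)
  fix u v assume "u \<in> restr S ` V" "v \<in> restr S ` V"
  then obtain a b where "a \<in> V" "b \<in> V" "u = restr S a" "v = restr S b" by blast
  then show "u + v \<in> restr S ` V" using cvs.subspace_add[OF V, of a b] restr_add[of S a b] by (metis image_eqI)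
 next
  fix c u assume "u \<in> restr S ` V"
  then obtain a where "a \<in> V" "u = restr S a" by blast
  then show "c *\<^sub>C u \<in> restr S ` V" using cvs.subspace_scale[OF V, of a c] restr_scl[of S c a] by (metis image_eqI)
 qed
 obtain B where B: "finite B" "V \<subseteq> cvs.span B" using assms by (auto simp: fdim_def)
 have "restr S ` V \<subseteq> cvs.span (restr S ` B)"
 proof
  fix u assume "u \<in> restr S ` V"
  then obtain a where a: "a \<in> V" "u = restr S a" by blast
  have "a \<in> cvs.span B" using a(1) B(2) by blast
  then obtain c where "a = (\<Sum>x\<in>B. c x *\<^sub>C x)" by (rule span_finite_sum[OF B(1)])
  then have "u = (\<Sum>x\<in>B. c x *\<^sub>C restr S x)" unfolding a(2) using restr_sum[of S c "\<lambda>x. x" B] by simp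
  also have "... \<in> cvs.span (restr S ` B)" by (intro cvs.span_sum cvs.span_scale cvs.span_base) auto
  finally show "u \<in> cvs.span (restr S ` B)" .
 qed
 then show "\<exists>B. finite B \<and> restr S ` V \<subseteq> cvs.span B" using B(1) by blast
qed

lemma psd_two_terms:
 assumes b: "psd V b" and V: "cvs.subspace V" and u: "u \<in> V" and v: "v \<in> V"
 shows "Re (b (u + v) (u + v)) \<le> 2 * Re (b u u) + 2 * Re (b v v)"
proof -
 have w: "u + v \<in> V" using cvs.subspace_add[OF V u v] .
 have "(snorm b (u + v))\<^sup>2 \<le> (snorm b u + snorm b v)\<^sup>2"
  using snorm_triangle[OF b V u v] snorm_nonneg[OF b w] by (intro power_mono)
 also have "... \<le> 2 * (snorm b u)\<^sup>2 + 2 * (snorm b v)\<^sup>2"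
  using sum_squares_bound[of "snorm b u" "snorm b v"] by (simp add: power2_sum)
 finally show ?thesis using snorm_sq[OF b w] snorm_sq[OF b u] snorm_sq[OF b v] by simp
qed

lemma sum_square_le_card: "(\<Sum>i\<in>A. f i)\<^sup>2 \<le> real (card A) * (\<Sum>i\<in>A. (f i)\<^sup>2)" for f :: "'a \<Rightarrow> real"
proof -
 have "(\<Sum>i\<in>A. 1 * f i)\<^sup>2 \<le> (\<Sum>i\<in>A. 1\<^sup>2) * (\<Sum>i\<in>A. (f i)\<^sup>2)" by (rule Cauchy_Schwarz_ineq_sum)
 then show ?thesis by simp
qed

lemma psd_many_terms:
 assumes b: "psd V b" and V: "cvs.subspace V" and u: "\<And>i. i \<in> A ==> u i \<in> V"
 shows "Re (b (\<Sum>i\<in>A. u i) (\<Sum>i\<in>A. u i)) \<le> real (card A) * (\<Sum>i\<in>A. Re (b (u i) (u i)))"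
proof -
 have w: "(\<Sum>i\<in>A. u i) \<in> V" using cvs.subspace_sum[OF V u] .
 have "(snorm b (\<Sum>i\<in>A. u i))\<^sup>2 \<le> (\<Sum>i\<in>A. snorm b (u i))\<^sup>2"
  using snorm_sum[OF b V u] snorm_nonneg[OF b w] by (intro power_mono)
 also have "... \<le> real (card A) * (\<Sum>i\<in>A. (snorm b (u i))\<^sup>2)" by (rule sum_square_le_card)
 also have "(\<Sum>i\<in>A. (snorm b (u i))\<^sup>2) = (\<Sum>i\<in>A. Re (b (u i) (u i)))"
  by (intro sum.cong refl snorm_sq[OF b u])
 finally show ?thesis using snorm_sq[OF b w] by simp
qed

lemma elt_single: "elt T ==> elts {T}" by (simp add: elts_def)

lemma psd_elt:
 assumes "elt T"
 shows "psd (pw p {T}) (l2_ip T)" "psd (pw p {T}) (dirichlet_ip T)" "psd (pw p {T}) (ip1 \<kappa> T)"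
 using psd_ips[OF elt_single[OF assms], of p] psd_ip1[OF elt_single[OF assms], of p \<kappa>] by simp_all

lemma ip_cong_elt:
 assumes T: "elt T" and u: "u \<in> pw p {T}" "v \<in> pw p {T}" and eq: "\<And>x. x \<in> T ==> u' x = u x" "\<And>x. x \<in> T ==> v' x = v x"
 shows "l2_ip T u' v' = l2_ip T u v" "dirichlet_ip T u' v' = dirichlet_ip T u v"
proof -
 show "l2_ip T u' v' = l2_ip T u v"
  unfolding l2_ip_def by (rule set_lebesgue_integral_cong[OF elt_sets[OF T]]) (simp add: eq)
 have g: "grad w' x = grad w x" if w: "w \<in> pw p {T}" "\<And>x. x \<in> T ==> w' x = w x" and x: "x \<in> interior T" for w w' x
 proof -
  obtain D where D: "(w has_derivative D) (at x)" using pw_has_derivative[OF w(1) _ x] by blast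
  have "(w' has_derivative D) (at x)"
   by (rule has_derivative_transform_within_open[OF D open_interior x]) (use w(2) interior_subset in force)
  then show ?thesis using grad_derivative[OF D] grad_derivative[of w' D x] by (simp add: vec_eq_iff)
 qed
 have i: "set_integrable lebesgue T (grad_ip u v)"
  by (rule grad_ip_integrable_elt[OF T u]) simp
 show "dirichlet_ip T u' v' = dirichlet_ip T u v"
  unfolding dirichlet_ip_eq
 proof (rule lint_spike(2)[OF i elt_frontier_negligible[OF T]])
  fix x assume "x \<in> T - frontier T"
  then have "x \<in> interior T" by (rule elt_minus_frontier[OF T])
  then show "grad_ip u' v' x = grad_ip u v x" using g[OF u(1) eq(1)] g[OF u(2) eq(2)] by (simp add: grad_ip_def)
 qed
qed

lemma ip_cong:
 assumes E: "elts \<G>" and u: "u \<in> pw p \<G>" "v \<in> pw p \<G>" and eq: "\<And>x. x \<in> \<Union>\<G> ==> u' x = u x" "\<And>x. x \<in> \<Union>\<G> ==> v' x = v x"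
 shows "l2_ip (\<Union>\<G>) u' v' = l2_ip (\<Union>\<G>) u v" "dirichlet_ip (\<Union>\<G>) u' v' = dirichlet_ip (\<Union>\<G>) u v"
proof -
 have u': "u' \<in> pw p \<G>" "v' \<in> pw p \<G>"
 proof -
  show "u' \<in> pw p \<G>" unfolding pw_def poly_on_iff
  proof clarify
   fix T assume T: "T \<in> \<G>"
   obtain q where q: "q \<in> Pol p" "\<And>x. x \<in> T ==> u x = q x" using pwE[OF u(1) T] by blast
   show "\<exists>q\<in>Pol p. \<forall>x\<in>T. u' x = q x"
   proof (rule bexI[OF _ q(1)], rule ballI)
    fix x assume x: "x \<in> T"
    then have "x \<in> \<Union>\<G>" using T by blast
    then show "u' x = q x" using eq(1)[of x] q(2)[OF x] by simp
   qed
  qed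
  show "v' \<in> pw p \<G>" unfolding pw_def poly_on_iff
  proof clarify
   fix T assume T: "T \<in> \<G>"
   obtain q where q: "q \<in> Pol p" "\<And>x. x \<in> T ==> v x = q x" using pwE[OF u(2) T] by blast
   show "\<exists>q\<in>Pol p. \<forall>x\<in>T. v' x = q x"
   proof (rule bexI[OF _ q(1)], rule ballI)
    fix x assume x: "x \<in> T"
    then have "x \<in> \<Union>\<G>" using T by blast
    then show "v' x = q x" using eq(2)[of x] q(2)[OF x] by simp
   qed
  qed
 qed
 have c: "l2_ip T u' v' = l2_ip T u v \<and> dirichlet_ip T u' v' = dirichlet_ip T u v" if T: "T \<in> \<G>" for T
 proof -
  have "elt T" using E T by (simp add: elts_def)
  moreover have "u \<in> pw p {T}" "v \<in> pw p {T}" using u T pw_mono[of "{T}" \<G> p] by auto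
  ultimately show ?thesis using ip_cong_elt[of T u p v u' v'] eq T by blast
 qed
 show "l2_ip (\<Union>\<G>) u' v' = l2_ip (\<Union>\<G>) u v" "dirichlet_ip (\<Union>\<G>) u' v' = dirichlet_ip (\<Union>\<G>) u v"
  unfolding ip_union[OF E u] ip_union[OF E u'] using c by (auto intro: sum.cong)
qed

lemma ip1_cong:
 assumes "elts \<G>" "u \<in> pw p \<G>" "v \<in> pw p \<G>" "\<And>x. x \<in> \<Union>\<G> ==> u' x = u x" "\<And>x. x \<in> \<Union>\<G> ==> v' x = v x"
 shows "ip1 \<kappa> (\<Union>\<G>) u' v' = ip1 \<kappa> (\<Union>\<G>) u v"
 using ip_cong[OF assms] by (simp add: ip1_def)

lemma ip1_union:
 assumes "elts \<G>" "u \<in> pw p \<G>" "v \<in> pw p \<G>"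
 shows "ip1 \<kappa> (\<Union>\<G>) u v = (\<Sum>T\<in>\<G>. ip1 \<kappa> T u v)"
 by (simp add: ip1_def ip_union[OF assms] sum.distrib sum_distrib_left)

context fe_mesh
begin

lemma pw_single: "u \<in> pw p \<G> ==> T \<in> \<G> ==> u \<in> pw p {T}"
 using pw_mono[of "{T}" \<G> p] by blast

lemma ips_nonneg:
 assumes "T \<in> \<T>" "u \<in> pw p {T}"
 shows "0 \<le> mass T u" "0 \<le> energy T u" "0 \<le> energy1 \<kappa> T u"
 using psd_nonneg[OF psd_elt(1)[OF elt[OF assms(1)]] assms(2)] psd_nonneg[OF psd_elt(2)[OF elt[OF assms(1)]] assms(2)]
  psd_nonneg[OF psd_elt(3)[OF elt[OF assms(1)]] assms(2)] by auto

lemma ip1_zero_elt: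
 assumes T: "T \<in> \<T>" and u: "u \<in> V" "v \<in> V" and z: "\<And>x. x \<in> T ==> u x = 0"
 shows "l2_ip T u v = 0" "dirichlet_ip T u v = 0" "l2_ip T v u = 0" "dirichlet_ip T v u = 0"
proof -
 have o: "0 \<in> pw p {T}" by (rule cvs.subspace_0[OF pw_subspace])
 have v: "v \<in> pw p {T}" by (rule pw_single[OF subsetD[OF fe_pw u(2)] T])
 note s1 = sesq_zero[OF psd_sesq[OF psd_elt(1)[OF elt[OF T]]] pw_subspace v]
 note s2 = sesq_zero[OF psd_sesq[OF psd_elt(2)[OF elt[OF T]]] pw_subspace v]
 show "l2_ip T u v = 0" "dirichlet_ip T u v = 0"
  using ip_cong_elt[OF elt[OF T] o v, of u v] z s1 s2 by (simp_all add: zero_fun_apply)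
 show "l2_ip T v u = 0" "dirichlet_ip T v u = 0"
  using ip_cong_elt[OF elt[OF T] v o, of v u] z s1 s2 by (simp_all add: zero_fun_apply)
qed

lemma local_fdim: "fdim (fe_local p \<T> \<G>)"
 unfolding fe_local_def by (rule restr_image_fdim[OF V_fdim])

lemma local_subspace: "cvs.subspace (fe_local p \<T> \<G>)"
 using local_fdim by auto

lemma restr_local: "v \<in> V ==> restr (\<Union>\<G>) v \<in> fe_local p \<T> \<G>"
 by (simp add: fe_local_def)

lemma local_outside: "u \<in> fe_local p \<T> \<G> ==> x \<notin> \<Union>\<G> ==> u x = 0"
 by (auto simp: fe_local_def restr_def)

lemma local_pw: assumes "\<G> \<subseteq> \<T>" shows "fe_local p \<T> \<G> \<subseteq> pw p \<G>"
proof
 fix u assume "u \<in> fe_local p \<T> \<G>"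
 then obtain v where v: "v \<in> V" "u = restr (\<Union>\<G>) v" by (auto simp: fe_local_def)
 show "u \<in> pw p \<G>" unfolding pw_def poly_on_iff
 proof clarify
  fix T assume T: "T \<in> \<G>"
  then have "v \<in> pw p \<T>" "T \<in> \<T>" using v fe_pw assms by auto
  then obtain q where q: "q \<in> Pol p" "\<And>x. x \<in> T ==> v x = q x" using pwE by blast
  show "\<exists>q\<in>Pol p. \<forall>x\<in>T. u x = q x"
   by (rule bexI[OF _ q(1)]) (use q(2) T in \<open>auto simp: v(2) restr_def\<close>)
 qed
qed

lemma local_continuous: assumes "\<G> \<subseteq> \<T>" "u \<in> fe_local p \<T> \<G>" shows "continuous_on (\<Union>\<G>) u"
proof -
 obtain v where v: "v \<in> V" "u = restr (\<Union>\<G>) v" using assms(2) by (auto simp: fe_local_def)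
 have "continuous_on (\<Union>\<G>) v"
  by (rule continuous_on_subset[of "\<Union>\<T>"]) (use v(1) assms(1) in \<open>auto simp: fe_space_def\<close>)
 then show ?thesis by (rule continuous_on_eq) (simp add: v(2) restr_def)
qed

lemma outer_point_frontier:
 assumes G: "\<G> \<subseteq> \<T>" and T: "T \<in> \<T>" "T \<notin> \<G>" and x: "x \<in> T" "x \<in> \<Union>\<G>"
 shows "x \<in> frontier (\<Union>\<G>)"
proof (rule ccontr)
 assume "x \<notin> frontier (\<Union>\<G>)"
 then have xi: "x \<in> interior (\<Union>\<G>)" using x(2) closure_subset[of "\<Union>\<G>"] by (auto simp: frontier_def)
 have "closure (interior T) = T"
  using elt[OF T(1)] convex_closure_interior[of T] by (simp add: elt_def compact_imp_closed)
 then have "x \<in> closure (interior T)" using x by simp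
 then have "interior T \<inter> interior (\<Union>\<G>) \<noteq> {}" using xi open_Int_closure_eq_empty[OF open_interior] by blast
 then obtain y T' where y: "y \<in> interior T" "T' \<in> \<G>" "y \<in> T'" using interior_subset by blast
 then have "T' \<inter> interior T = {}" using conforming_disjoint_interior[OF conf T(1), of T'] G T(2) by blast
 then show False using y by blast
qed

text \<open>Vanishing boundary values make the extension by zero continuous, hence a finite element function on
 the whole mesh; such functions are the test functions that separate interior from boundary behaviour.\<close>

lemma zero_extension:
 assumes G: "\<G> \<subseteq> \<T>" and u: "u \<in> fe_local p \<T> \<G>" and z: "\<And>x. x \<in> frontier (\<Union>\<G>) ==> u x = 0"
 shows "u \<in> V"
 unfolding fe_space_def
proof (intro CollectI conjI ballI allI impI)
 let ?O = "\<Union>(\<T> - \<G>)"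
 have zO: "u x = 0" if "x \<in> ?O" for x
 proof (cases "x \<in> \<Union>\<G>")
  case True
  then show ?thesis using that outer_point_frontier[OF G] z by blast
 qed (rule local_outside[OF u])
 have e: "\<Union>\<T> = \<Union>\<G> \<union> ?O" using G by blast
 show "continuous_on (\<Union>\<T>) u"
  unfolding e
 proof (rule continuous_on_closed_Un)
  show "closed (\<Union>\<G>)" by (rule conforming_Union_closed(1)[OF conforming_subset[OF conf G]])
  show "closed ?O" by (rule conforming_Union_closed(1)[OF conforming_subset[OF conf]]) blast
  show "continuous_on (\<Union>\<G>) u" by (rule local_continuous[OF G u])
  show "continuous_on ?O u" by (rule continuous_on_eq[OF continuous_on_const[of _ 0]]) (simp add: zO)
 qed
 show "poly_on p T u" if T: "T \<in> \<T>" for T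
 proof (cases "T \<in> \<G>")
  case True then show ?thesis using local_pw[OF G] u by (auto simp: pw_def)
 next
  case False
  then show ?thesis unfolding poly_on_iff using zO T by (intro bexI[OF _ Pol_const[of 0]]) auto
 qed
 show "u x = 0" if "x \<notin> \<Union>\<T>" for x using that local_outside[OF u, of x] G by blast
qed

lemma local_sup:
 assumes "T \<in> \<T>" "u \<in> pw p {T}" "x \<in> T"
 shows "(cmod (u x))\<^sup>2 \<le> invC p K * K\<^sup>2 / h\<^sup>2 * mass T u"
proof -
 have d: "0 < diameter T" by (rule elt_diameter_pos[OF elt[OF assms(1)]])
 have "(cmod (u x))\<^sup>2 \<le> invC p K / (diameter T)\<^sup>2 * mass T u"
  by (rule local_inverse(1)[OF p K fat[OF assms(1)] assms(2,3)])
 also have "... \<le> invC p K * K\<^sup>2 / h\<^sup>2 * mass T u"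
 proof (rule mult_right_mono)
  have "h\<^sup>2 \<le> (K * diameter T)\<^sup>2" using le_diam[OF assms(1)] h_pos by (intro power_mono) auto
  then have "1 / (diameter T)\<^sup>2 \<le> K\<^sup>2 / h\<^sup>2" using d h_pos by (simp add: field_simps power_mult_distrib)
  then have "invC p K * (1 / (diameter T)\<^sup>2) \<le> invC p K * (K\<^sup>2 / h\<^sup>2)"
   using invC_pos[OF p K] by (intro mult_left_mono) auto
  then show "invC p K / (diameter T)\<^sup>2 \<le> invC p K * K\<^sup>2 / h\<^sup>2" by simp
 qed (rule ips_nonneg[OF assms(1,2)])
 finally show ?thesis .
qed

definition inv_sup :: real where "inv_sup = invC p K * K\<^sup>2"

lemma inv_sup_pos: "0 < inv_sup"
 using invC_pos[OF p K] K by (simp add: inv_sup_def)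

definition ext_const :: real where
 "ext_const = 36 * K ^ 4 * disc_area * (node_const p)\<^sup>2 * inv_sup"

lemma ext_const_pos: "0 < ext_const"
 using K disc_area_pos inv_sup_pos node_const_ge1[OF p] by (simp add: ext_const_def)

lemma ext_local:
 assumes G: "\<G> \<subseteq> \<T>" and w: "w \<in> fe_local p \<T> \<G>" and T: "T \<in> \<T>"
 shows "mass T (I\<^sub>h w) \<le>
  4 * disc_area * (node_const p)\<^sup>2 * inv_sup * (\<Sum>T'\<in>touching \<G> T. mass T' w)"
proof -
 let ?s = "\<Sum>T'\<in>touching \<G> T. mass T' w"
 define B where "B = sqrt (inv_sup / h\<^sup>2 * ?s)"
 have fin': "finite (touching \<G> T)" using finite_subset[OF G fin] by (simp add: touching_def)
 have wT: "w \<in> pw p {T'}" if "T' \<in> \<G>" for T' using w local_pw[OF G] pw_single that by blast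
 have nn: "0 \<le> mass T' w" if "T' \<in> \<G>" for T'
  using ips_nonneg(1)[OF _ wT[OF that]] that G by blast
 have s0: "0 \<le> ?s" using nn by (intro sum_nonneg) (auto simp: touching_def)
 have Bsq: "B\<^sup>2 = inv_sup / h\<^sup>2 * ?s" using s0 inv_sup_pos by (simp add: B_def)
 have nb: "cmod (w y) \<le> B" if y: "y \<in> tnodes p T" for y
 proof (cases "y \<in> \<Union>\<G>")
  case False
  then have "w y = 0" by (rule local_outside[OF w])
  then show ?thesis using s0 inv_sup_pos by (simp add: B_def)
 next
  case True
  then obtain T' where T': "T' \<in> \<G>" "y \<in> T'" by blast
  have yT: "y \<in> T" using y tnodes_sub(1)[OF T] by blast
  have mem: "T' \<in> touching \<G> T" using T' yT by (auto simp: touching_def)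
  have T'': "T' \<in> \<T>" using T' G by blast
  have "(cmod (w y))\<^sup>2 \<le> inv_sup / h\<^sup>2 * mass T' w"
   using local_sup[OF T'' wT[OF T'(1)] T'(2)] by (simp add: inv_sup_def)
  also have "... \<le> inv_sup / h\<^sup>2 * ?s"
   using member_le_sum[OF mem, of "\<lambda>T'. mass T' w"] nn fin' inv_sup_pos
   by (intro mult_left_mono) (auto simp: touching_def)
  finally show ?thesis unfolding B_def by (rule real_le_rsqrt)
 qed
 have "mass T (I\<^sub>h w) \<le> 4 * (diameter T)\<^sup>2 * disc_area * (node_const p * B)\<^sup>2"
  by (rule local_l2_sup[OF p K fat[OF T] pw_single[OF subsetD[OF fe_pw interp_fe] T]])
   (rule interp_bound[OF T _ nb])
 also have "... \<le> 4 * h\<^sup>2 * disc_area * (node_const p * B)\<^sup>2"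
  using diam_le[OF T] elt_diameter_pos[OF elt[OF T]] disc_area_pos
  by (intro mult_right_mono mult_left_mono power_mono) auto
 also have "... = 4 * disc_area * (node_const p)\<^sup>2 * inv_sup * ?s"
  unfolding power_mult_distrib Bsq using h_pos by simp
 finally show ?thesis .
qed

lemma sum_touching:
 assumes "\<G> \<subseteq> \<T>" and nn: "\<And>T. T \<in> \<G> ==> 0 \<le> f T"
 shows "(\<Sum>T\<in>\<T>. \<Sum>T'\<in>touching \<G> T. f T') \<le> 9 * K ^ 4 * (\<Sum>T\<in>\<G>. f T)"
proof -
 have "(\<Sum>T\<in>\<T>. \<Sum>T'\<in>{T'\<in>\<G>. T' \<inter> T \<noteq> {}}. f T') = (\<Sum>T'\<in>\<G>. \<Sum>T\<in>{T\<in>\<T>. T' \<inter> T \<noteq> {}}. f T')"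
  by (rule sum.swap_restrict[OF fin finite_subset[OF assms(1) fin]])
 also have "... = (\<Sum>T'\<in>\<G>. real (card (touching \<T> T')) * f T')"
  by (simp add: touching_def Int_commute)
 also have "... \<le> (\<Sum>T'\<in>\<G>. (9 * K ^ 4) * f T')"
  using card_touching nn assms(1) by (intro sum_mono mult_right_mono) auto
 finally show ?thesis by (simp add: touching_def sum_distrib_left)
qed

lemma ext_l2:
 assumes G: "\<G> \<subseteq> \<T>" and w: "w \<in> fe_local p \<T> \<G>"
 shows "mass (\<Union>\<T>) (I\<^sub>h w) \<le> ext_const * mass (\<Union>\<G>) w"
proof -
 let ?c = "4 * disc_area * (node_const p)\<^sup>2 * inv_sup"
 have wG: "w \<in> pw p \<G>" using w local_pw[OF G] by blast
 have i: "I\<^sub>h w \<in> pw p \<T>" by (rule subsetD[OF fe_pw interp_fe])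
 have nn: "0 \<le> mass T w" if "T \<in> \<G>" for T
  using ips_nonneg(1)[OF _ pw_single[OF wG that]] that G by blast
 have "mass (\<Union>\<T>) (I\<^sub>h w) = (\<Sum>T\<in>\<T>. mass T (I\<^sub>h w))"
  unfolding ip_union(1)[OF els i i] by simp
 also have "... \<le> (\<Sum>T\<in>\<T>. ?c * (\<Sum>T'\<in>touching \<G> T. mass T' w))"
  by (intro sum_mono ext_local[OF G w])
 also have "... = ?c * (\<Sum>T\<in>\<T>. \<Sum>T'\<in>touching \<G> T. mass T' w)" by (simp add: sum_distrib_left)
 also have "... \<le> ?c * (9 * K ^ 4 * (\<Sum>T\<in>\<G>. mass T w))"
  using sum_touching[OF G, of "\<lambda>T. mass T w"] nn disc_area_pos inv_sup_pos
  by (intro mult_left_mono) auto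
 also have "... = ext_const * mass (\<Union>\<G>) w"
  unfolding ip_union(1)[OF elts_subset[OF els G] wG wG] by (simp add: ext_const_def)
 finally show ?thesis .
qed

lemma ext_zero:
 assumes "w \<in> fe_local p \<T> \<G>" "T \<in> \<T>" "T \<inter> \<Union>\<G> = {}" "x \<in> T"
 shows "I\<^sub>h w x = 0"
 by (rule interp_zero_local[OF assms(2,4)]) (use assms local_outside tnodes_sub(1)[OF assms(2)] in blast)

definition weight_const :: real where
 "weight_const = 64 * disc_area\<^sup>2 * invC p K * (node_const p)\<^sup>2 * inv_sup"

lemma weight_const_pos: "0 < weight_const"
 using disc_area_pos inv_sup_pos invC_pos[OF p K] node_const_ge1[OF p] by (simp add: weight_const_def)

text \<open>Subtracting from the weight its value at one point of the element leaves a weight of size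
 \<open>\<Lambda> h\<close>, and the inverse estimate turns this into \<open>\<Lambda>\<close>.\<close>

lemma weight_local:
 assumes u: "u \<in> V" and T: "T \<in> \<T>" and b: "\<And>x. x \<in> T ==> 0 \<le> \<phi> x \<and> \<phi> x \<le> 1"
  and l: "\<And>x y. x \<in> T ==> y \<in> T ==> \<bar>\<phi> x - \<phi> y\<bar> \<le> \<Lambda> * dist x y" and L0: "0 \<le> \<Lambda>"
 shows "energy T (weight p \<T> \<phi> u) \<le>
   2 * energy T u + weight_const * \<Lambda>\<^sup>2 * mass T u"
  "mass T (weight p \<T> \<phi> u) \<le> ext_const * mass T u"
proof -
 let ?N = "mass T u"
 have eT: "elt T" by (rule elt[OF T])
 have uT: "u \<in> pw p {T}" by (rule pw_single[OF subsetD[OF fe_pw u] T])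
 have iT: "I\<^sub>h f \<in> pw p {T}" for f by (rule pw_single[OF subsetD[OF fe_pw interp_fe] T])
 have N0: "0 \<le> ?N" and D0: "0 \<le> energy T u" using ips_nonneg[OF T uT] by auto
 define B where "B = sqrt (inv_sup / h\<^sup>2 * ?N)"
 have Bsq: "B\<^sup>2 = inv_sup / h\<^sup>2 * ?N" using N0 inv_sup_pos by (simp add: B_def)
 have B0: "0 \<le> B" using N0 inv_sup_pos by (simp add: B_def)
 have ub: "cmod (u x) \<le> B" if "x \<in> T" for x
  unfolding B_def using local_sup[OF T uT that] by (intro real_le_rsqrt) (simp add: inv_sup_def)
 obtain x0 where x0: "x0 \<in> T" using eT interior_subset unfolding elt_def by blast
 let ?f = "\<lambda>x. of_real (\<phi> x - \<phi> x0) * u x"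
 have split: "weight p \<T> \<phi> u = of_real (\<phi> x0) *\<^sub>C u + I\<^sub>h ?f"
 proof -
  have "weight p \<T> \<phi> u = I\<^sub>h (\<lambda>x. of_real (\<phi> x0) * u x + ?f x)"
   unfolding weight_def by (rule interp_cong) (simp add: algebra_simps)
  then show ?thesis by (simp only: interp_add interp_scl interp_id[OF u])
 qed
 have fb: "cmod (?f y) \<le> \<Lambda> * h * B" if y: "y \<in> tnodes p T" for y
 proof -
  have yT: "y \<in> T" using y tnodes_sub(1)[OF T] by blast
  have "\<bar>\<phi> y - \<phi> x0\<bar> \<le> \<Lambda> * h"
   using l[OF yT x0] mult_left_mono[OF dist_le[OF T yT x0] L0] by linarith
  moreover have "cmod (?f y) = \<bar>\<phi> y - \<phi> x0\<bar> * cmod (u y)"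
   by (simp only: norm_mult norm_of_real)
  ultimately show ?thesis using ub[OF yT] h_pos L0 by (simp add: mult_mono)
 qed
 have "energy T (I\<^sub>h ?f) \<le> 32 * disc_area\<^sup>2 * invC p K * (node_const p * (\<Lambda> * h * B))\<^sup>2"
  by (rule local_grad_sup[OF p K fat[OF T] iT]) (rule interp_bound[OF T _ fb])
 also have "... = weight_const / 2 * \<Lambda>\<^sup>2 * ?N"
  unfolding power_mult_distrib Bsq weight_const_def using h_pos by simp
 finally have r: "energy T (I\<^sub>h ?f) \<le> weight_const / 2 * \<Lambda>\<^sup>2 * ?N" .
 have c: "energy T (of_real (\<phi> x0) *\<^sub>C u) \<le> energy T u"
 proof -
  note s = psd_sesq[OF psd_elt(2)[OF eT]]
  have cu: "of_real (\<phi> x0) *\<^sub>C u \<in> pw p {T}" by (rule cvs.subspace_scale[OF pw_subspace uT])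
  have "dirichlet_ip T (of_real (\<phi> x0) *\<^sub>C u) (of_real (\<phi> x0) *\<^sub>C u) = of_real ((\<phi> x0)\<^sup>2) * dirichlet_ip T u u"
   using sesqD(3)[OF s uT cu] sesqD(4)[OF s uT uT] by (simp add: power2_eq_square)
  moreover have "(\<phi> x0)\<^sup>2 \<le> 1" using b[OF x0] by (simp add: power_le_one)
  ultimately show ?thesis using D0 by (simp add: mult_left_le_one_le)
 qed
 have "energy T (weight p \<T> \<phi> u) \<le>
   2 * energy T (of_real (\<phi> x0) *\<^sub>C u) + 2 * energy T (I\<^sub>h ?f)"
  unfolding split by (rule psd_two_terms[OF psd_elt(2)[OF eT] pw_subspace cvs.subspace_scale[OF pw_subspace uT] iT])
 then show "energy T (weight p \<T> \<phi> u) \<le>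
   2 * energy T u + weight_const * \<Lambda>\<^sup>2 * mass T u" using c r by simp
 have wb: "cmod (of_real (\<phi> y) * u y) \<le> B" if y: "y \<in> tnodes p T" for y
 proof -
  have yT: "y \<in> T" using y tnodes_sub(1)[OF T] by blast
  have "cmod (of_real (\<phi> y) * u y) \<le> 1 * B"
   unfolding norm_mult using b[OF yT] ub[OF yT] by (intro mult_mono) auto
  then show ?thesis by simp
 qed
 have "mass T (weight p \<T> \<phi> u) \<le> 4 * (diameter T)\<^sup>2 * disc_area * (node_const p * B)\<^sup>2"
  unfolding weight_def by (rule local_l2_sup[OF p K fat[OF T] iT]) (rule interp_bound[OF T _ wb])
 also have "... \<le> 4 * h\<^sup>2 * disc_area * (node_const p * B)\<^sup>2"
  using diam_le[OF T] elt_diameter_pos[OF eT] disc_area_pos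
  by (intro mult_right_mono mult_left_mono power_mono) auto
 also have "... = (4 * disc_area * (node_const p)\<^sup>2 * inv_sup) * ?N"
  unfolding power_mult_distrib Bsq using h_pos by simp
 also have "... \<le> ext_const * ?N"
 proof (rule mult_right_mono[OF _ N0])
  have "1 \<le> 9 * K ^ 4" using one_le_power[OF K, of 4] by linarith
  then have "(4 * disc_area * (node_const p)\<^sup>2 * inv_sup) * 1 \<le> (4 * disc_area * (node_const p)\<^sup>2 * inv_sup) * (9 * K ^ 4)"
   using disc_area_pos inv_sup_pos by (intro mult_left_mono) auto
  then show "4 * disc_area * (node_const p)\<^sup>2 * inv_sup \<le> ext_const" by (simp add: ext_const_def mult_ac)
 qed
 finally show "mass T (weight p \<T> \<phi> u) \<le> ext_const * mass T u" .
qed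

end

section \<open>The Friedrichs and trace inequalities\<close>

lemma closed_frontiers_negligible: "elts \<G> ==> negligible (\<Union>T\<in>\<G>. frontier T)"
proof (rule negligible_Union)
 assume G: "elts \<G>"
 show "finite (frontier ` \<G>)" using G by (simp add: elts_def)
 fix F assume "F \<in> frontier ` \<G>"
 then obtain T where T: "T \<in> \<G>" "F = frontier T" by blast
 then have "elt T" using G unfolding elts_def by blast
 then show "negligible F" using T elt_frontier_negligible by simp
qed

lemma elts_interior_cases:
 assumes "elts \<G>" "x \<in> \<Union>\<G>" "x \<notin> (\<Union>T\<in>\<G>. frontier T)"
 obtains T where "T \<in> \<G>" "x \<in> interior T"
proof -
 obtain T where T: "T \<in> \<G>" "x \<in> T - frontier T" using assms by blast
 have "elt T" using assms(1) T unfolding elts_def by blast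
 from elt_minus_frontier[OF this T(2)] T(1) show thesis by (rule that[rotated])
qed

text \<open>Dilating about a point of the support changes the integral of \<open>\<bar>u\<bar>\<^sup>2\<close> by a known factor, so the
 derivative of that integral at the identity is \<open>- 2\<close> times it; on the other hand it is controlled by
 the gradient.\<close>

lemma friedrichs:
 assumes G: "conforming \<G>" and ne: "\<G> \<noteq> {}" and u: "u \<in> pw p \<G>" and cont: "continuous_on UNIV u"
  and out: "\<And>x. x \<notin> \<Union>\<G> ==> u x = 0" and D: "\<And>x y. x \<in> \<Union>\<G> ==> y \<in> \<Union>\<G> ==> dist x y \<le> D" and D0: "0 < D"
 shows "mass (\<Union>\<G>) u \<le> D\<^sup>2 * energy (\<Union>\<G>) u"
proof -
 let ?U = "\<Union>\<G>" and ?g = "\<lambda>x. (cmod (u x))\<^sup>2"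
 have E: "elts \<G>" by (rule conforming_elts[OF G])
 have eT: "elt T" if "T \<in> \<G>" for T using E that unfolding elts_def by blast
 obtain z where z: "z \<in> ?U"
 proof -
  obtain T where T: "T \<in> \<G>" using ne by blast
  have "T \<noteq> {}" using eT[OF T] interior_subset unfolding elt_def by blast
  then show thesis using T that by blast
 qed
 define S where "S = cball z (2 * D)"
 have cS: "compact S" by (simp add: S_def)
 define A where "A = (LINT x:?U|lebesgue. ?g x)"
 define B where "B = (LINT x:?U|lebesgue. gsq u x)"
 have gi: "set_integrable lebesgue ?U ?g" by (rule energy_integrable(1)[OF E u])
 have US: "?U \<subseteq> S" using D[OF z] D0 by (force simp: S_def)
 have F: "(LINT x:S|lebesgue. ?g (dil z r x)) = A / r\<^sup>2" if r: "1/2 < r" for r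
 proof -
  let ?f = "\<lambda>x. indicat_real ?U x *\<^sub>R ?g x"
  have "?f \<in> borel_measurable lebesgue"
   using gi unfolding set_integrable_def by (rule borel_measurable_integrable)
  then have "integral\<^sup>L lebesgue ?f = r\<^sup>2 *\<^sub>R integral\<^sup>L lebesgue (\<lambda>y. ?f ((z - r *\<^sub>R z) + r *\<^sub>R y))"
   by (rule lebesgue_integral_affine) (use r in simp)
  moreover have "(\<lambda>y. ?f ((z - r *\<^sub>R z) + r *\<^sub>R y)) = (\<lambda>y. indicat_real S y *\<^sub>R ?g (dil z r y))"
  proof
   fix y
   have e: "(z - r *\<^sub>R z) + r *\<^sub>R y = dil z r y" by (simp add: algebra_simps)
   show "?f ((z - r *\<^sub>R z) + r *\<^sub>R y) = indicat_real S y *\<^sub>R ?g (dil z r y)"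
    unfolding e
   proof (cases "dil z r y \<in> ?U")
    case True
    then have "dist z (dil z r y) \<le> D" using D[OF z] by blast
    then have rd: "r * norm (y - z) \<le> D" using r by (simp add: dist_norm)
    have "1/2 * norm (y - z) \<le> r * norm (y - z)" using r by (intro mult_right_mono) auto
    then have "norm (y - z) \<le> 2 * D" using rd by linarith
    then have "y \<in> S" by (simp add: S_def dist_norm norm_minus_commute)
    then show "?f (dil z r y) = indicat_real S y *\<^sub>R ?g (dil z r y)" using True by simp
   next
    case False
    then show "?f (dil z r y) = indicat_real S y *\<^sub>R ?g (dil z r y)" using out[OF False] by simp
   qed
  qed
  ultimately have "A = r\<^sup>2 * (LINT x:S|lebesgue. ?g (dil z r x))"
   by (simp only: A_def set_lebesgue_integral_def real_scaleR_def)
  then show ?thesis using r by simp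
 qed
 let ?Fam = "insert (closure (- ?U)) \<G>"
 have cl: "closed A" if "A \<in> ?Fam" for A
  using that eT by (auto simp: elt_def compact_imp_closed)
 have zero_cl: "u x = 0" if "x \<in> closure (- ?U)" for x
 proof -
  have "closed {x. u x = 0}" using cont by (intro closed_Collect_eq) (auto intro: continuous_intros)
  moreover have "- ?U \<subseteq> {x. u x = 0}" using out by blast
  ultimately have "closure (- ?U) \<subseteq> {x. u x = 0}" by (rule closure_minimal[rotated])
  then show ?thesis using that by blast
 qed
 have "\<exists>M\<ge>0. \<forall>A\<in>?Fam. M-lipschitz_on A ?g"
 proof (rule uniform_lipschitz)
  show "finite ?Fam" using E by (simp add: elts_def)
  fix A assume "A \<in> ?Fam"
  then consider "A = closure (- ?U)" | "A \<in> \<G>" by blast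
  then show "\<exists>M\<ge>0. M-lipschitz_on A ?g"
  proof cases
   case 1
   have "0-lipschitz_on A ?g" using zero_cl 1 by (intro lipschitz_onI) auto
   then show ?thesis by blast
  next
   case 2
   from pw_lipschitz_sq[OF eT[OF 2] 2 u] show ?thesis .
  qed
 qed
 then obtain M where M: "0 \<le> M" "\<And>A. A \<in> ?Fam ==> M-lipschitz_on A ?g" by blast
 have fam: "\<Union>?Fam = UNIV" using closure_subset[of "- ?U"] by blast
 define L where "L = M * (2 * D)"
 let ?N = "\<Union>T\<in>\<G>. frontier T" and ?W = "\<lambda>x. D\<^sup>2 * ((1 / D)\<^sup>2 * ?g x + gsq u x)"
 let ?f = "\<lambda>x. if dil z 1 x \<in> ?N then 0 else dsq u (dil z 1 x) (x - z)"
 have drv: "((\<lambda>r. LINT x:S|lebesgue. ?g (dil z r x)) has_real_derivative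
   (LINT x:S|lebesgue. ?f x)) (at 1)"
  and dint: "set_integrable lebesgue S ?f"
 proof -
  have s1: "S \<in> sets lebesgue" by (simp add: S_def)
  have s2: "set_integrable lebesgue S (\<lambda>x. L)" using cS by (intro lint_compact_continuous) auto
  have s3: "set_integrable lebesgue S (\<lambda>x. ?g (dil z r x))" for r
   by (intro lint_compact_continuous[OF cS] continuous_intros continuous_on_compose2[OF cont]) auto
  have l0: "\<bar>?g (dil z r x) - ?g (dil z r' x)\<bar> \<le> L * \<bar>r - r'\<bar>" if "x \<in> S" "r \<le> r'" for x r r'
  proof -
   have nx: "norm (x - z) \<le> 2 * D" using that by (simp add: S_def dist_norm norm_minus_commute)
   show ?thesis
    unfolding L_def
   proof (rule lipschitz_on_ray[of ?Fam M ?g x z "2 * D" r r', OF _ cl M(2) M(1) nx that(2)])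
    show "finite ?Fam" using E by (simp add: elts_def)
    show "dil z \<rho> x \<in> \<Union>?Fam" for \<rho> unfolding fam by (rule UNIV_I)
   qed
  qed
  have l: "\<bar>?g (dil z r x) - ?g (dil z r' x)\<bar> \<le> L * \<bar>r - r'\<bar>" if "x \<in> S" for x r r'
   using l0[OF that, of r r'] l0[OF that, of r' r] by (cases "r \<le> r'") (auto simp: abs_minus_commute)
  have d: "(?g has_derivative dsq u (dil z 1 x)) (at (dil z 1 x))" if x: "dil z 1 x \<notin> ?N" for x
  proof (cases "dil z 1 x \<in> ?U")
   case True
   then obtain T where T: "T \<in> \<G>" "dil z 1 x \<in> interior T" using elts_interior_cases[OF E _ x] by blast
   obtain Du where "(u has_derivative Du) (at (dil z 1 x))" using pw_has_derivative[OF u T] by blast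
   then show ?thesis by (rule dsq_derivative(1))
  next
   case False
   have "(u has_derivative (\<lambda>k. 0)) (at (dil z 1 x))"
   proof (rule has_derivative_transform_within_open[of "\<lambda>x. 0" _ _ UNIV "- ?U"])
    show "open (- ?U)" using conforming_Union_closed(1)[OF G] by (rule open_Compl)
   qed (use False out in auto)
   then show ?thesis by (rule dsq_derivative(1))
  qed
  show "((\<lambda>r. LINT x:S|lebesgue. ?g (dil z r x)) has_real_derivative
   (LINT x:S|lebesgue. ?f x)) (at 1)"
   "set_integrable lebesgue S ?f"
   using dilation_derivative[OF s1 s2, of "1/2" 1 2 ?g z ?N "dsq u"] s3 l d closed_frontiers_negligible[OF E]
   by auto
 qed
 have "((\<lambda>r. A / r\<^sup>2) has_real_derivative (- 2 * A)) (at 1)"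
  by (auto intro!: derivative_eq_intros)
 then have "((\<lambda>r. LINT x:S|lebesgue. ?g (dil z r x)) has_real_derivative (- 2 * A)) (at 1)"
  by (rule has_field_derivative_transform_within_open[of _ _ _ "{1/2<..}"]) (use F in auto)
 then have A2: "(LINT x:S|lebesgue. ?f x) = - 2 * A"
  using drv DERIV_unique by blast
 have W: "set_integrable lebesgue ?U (\<lambda>x. (1 / D)\<^sup>2 * ?g x + gsq u x)" by (rule energy_integrable(3)[OF E u])
 have WS: "set_integrable lebesgue S (\<lambda>x. indicat_real ?U x * ?W x)"
 proof -
  have "set_integrable lebesgue ?U (\<lambda>x. ?W x)"
   by (rule set_integrable_mult_right) (use W in blast)
  moreover have "(\<lambda>x. indicat_real S x *\<^sub>R (indicat_real ?U x * ?W x)) =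
    (\<lambda>x. indicat_real ?U x *\<^sub>R ?W x)"
   using US by (auto simp: fun_eq_iff indicator_def)
  ultimately show ?thesis unfolding set_integrable_def by simp
 qed
 have "2 * A = - (LINT x:S|lebesgue. ?f x)" using A2 by simp
 also have "... = (LINT x:S|lebesgue. - ?f x)"
  by (rule set_integral_uminus[OF dint, symmetric])
 also have "... \<le> (LINT x:S|lebesgue. indicat_real ?U x * ?W x)"
 proof (rule set_integral_mono[OF _ WS])
  show "set_integrable lebesgue S (\<lambda>x. - ?f x)"
   using Bochner_Integration.integrable_minus[OF dint[unfolded set_integrable_def]]
   unfolding set_integrable_def scaleR_minus_right .
  fix x assume "x \<in> S"
  have e: "dil z 1 x = x" by simp
  have g0: "0 \<le> gsq u x" unfolding gsq_def by (intro sum_nonneg) auto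
  show "- ?f x \<le> indicat_real ?U x * ?W x"
   unfolding e
  proof (cases "x \<in> ?U")
   case U: True
   show "- (if x \<in> ?N then 0 else dsq u x (x - z)) \<le> indicat_real ?U x * ?W x"
   proof (cases "x \<in> ?N")
    case True then show ?thesis using U g0 by simp
   next
    case False
    then obtain T where T: "T \<in> \<G>" "x \<in> interior T" using elts_interior_cases[OF E U] by blast
    obtain Du where Du: "(u has_derivative Du) (at x)" using pw_has_derivative[OF u T] by blast
    have "\<bar>1 / D * dsq u x (x - z)\<bar> \<le> norm (x - z) * ((1 / D)\<^sup>2 * ?g x + gsq u x)" by (rule dsq_derivative(2)[OF Du])
    also have "... \<le> D * ((1 / D)\<^sup>2 * ?g x + gsq u x)"
     using D[OF U z] g0 by (intro mult_right_mono) (auto simp: dist_norm)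
    finally have "\<bar>dsq u x (x - z)\<bar> / D \<le> D * ((1 / D)\<^sup>2 * ?g x + gsq u x)" using D0 by (simp add: abs_mult)
    then have "\<bar>dsq u x (x - z)\<bar> \<le> ?W x"
     using D0 by (simp only: divide_le_eq power2_eq_square mult.assoc mult.commute)
    then show ?thesis using False U by auto
   qed
  next
   case False
   then have "u x = 0" by (rule out)
   then show "- (if x \<in> ?N then 0 else dsq u x (x - z)) \<le> indicat_real ?U x * ?W x"
    using False by (simp add: dsq_def)
  qed
 qed
 also have "... = (LINT x:?U|lebesgue. ?W x)"
 proof -
  have "(\<lambda>x. indicat_real S x *\<^sub>R (indicat_real ?U x * ?W x)) =
    (\<lambda>x. indicat_real ?U x *\<^sub>R ?W x)"
   using US by (auto simp: fun_eq_iff indicator_def)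
  then show ?thesis unfolding set_lebesgue_integral_def by simp
 qed
 also have "... = D\<^sup>2 * energy1 (1 / D) ?U u"
  using energy_integrable(4)[OF E u, of "1 / D"] by simp
 also have "... = A + D\<^sup>2 * energy ?U u"
  unfolding norm1_sq_eq A_def l2_ip_self using D0 by (simp add: field_simps)
 finally show ?thesis unfolding l2_ip_self A_def by simp
qed

text \<open>The mean value theorem along the dilations. The factor \<open>1 - t\<close> is the gain that will compensate
 the factor \<open>1 / h\<close> of the elementwise trace inequality.\<close>

lemma strip_estimate:
 assumes G: "conforming \<G>" and u: "u \<in> pw p \<G>" and cont: "continuous_on (\<Union>\<G>) u"
  and star: "\<And>x r. x \<in> \<Union>\<G> ==> 0 \<le> r ==> r \<le> 1 ==> dil z r x \<in> \<Union>\<G>"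
  and D: "\<And>x. x \<in> \<Union>\<G> ==> norm (x - z) \<le> D" and D0: "0 < D" and t: "1/2 \<le> t" "t < 1" and \<kappa>: "0 < \<kappa>"
 shows "(LINT x:(\<Union>\<G>)|lebesgue. (cmod (u x))\<^sup>2) - (LINT x:dil z t ` (\<Union>\<G>)|lebesgue. (cmod (u x))\<^sup>2)
  \<le> (1 - t) * (8 * mass (\<Union>\<G>) u + 4 * D / \<kappa> * energy1 \<kappa> (\<Union>\<G>) u)"
proof -
 let ?U = "\<Union>\<G>" and ?g = "\<lambda>x. (cmod (u x))\<^sup>2"
 have E: "elts \<G>" by (rule conforming_elts[OF G])
 have eT: "elt T" if "T \<in> \<G>" for T using E that unfolding elts_def by blast
 have cU: "compact ?U" by (rule conforming_Union_closed(2)[OF G])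
 have sU: "?U \<in> sets lebesgue" using cU by (simp add: borel_compact)
 have gi: "set_integrable lebesgue ?U ?g" by (rule energy_integrable(1)[OF E u])
 define F where "F = (\<lambda>r. LINT x:?U|lebesgue. ?g (dil z r x))"
 have "\<exists>M\<ge>0. \<forall>A\<in>\<G>. M-lipschitz_on A ?g"
  by (rule uniform_lipschitz) (use E pw_lipschitz_sq[OF eT _ u] in \<open>auto simp: elts_def\<close>)
 then obtain M where M: "0 \<le> M" "\<And>A. A \<in> \<G> ==> M-lipschitz_on A ?g" by blast
 define L where "L = M * D"
 have L0: "0 \<le> L" using M D0 by (simp add: L_def)
 have int: "set_integrable lebesgue ?U (\<lambda>x. ?g (dil z r x))" if "0 \<le> r" "r \<le> 1" for r
  by (intro lint_compact_continuous[OF cU] continuous_intros continuous_on_compose2[OF cont]) (use star that in auto)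
 have l0: "\<bar>?g (dil z r x) - ?g (dil z r' x)\<bar> \<le> L * \<bar>r - r'\<bar>" if "x \<in> ?U" "0 \<le> r" "r' \<le> 1" "r \<le> r'" for x r r'
  unfolding L_def
  by (rule lipschitz_on_ray[of \<G>]) (use E eT M D star that in \<open>auto simp: elts_def elt_def compact_imp_closed\<close>)
 have lip: "\<bar>?g (dil z r x) - ?g (dil z r' x)\<bar> \<le> L * \<bar>r - r'\<bar>" if "x \<in> ?U" "0 \<le> r" "r' \<le> 1" "0 \<le> r'" "r \<le> 1" for x r r'
  using l0[of x r r'] l0[of x r' r] that by (cases "r \<le> r'") (auto simp: abs_minus_commute)
 have ic: "set_integrable lebesgue ?U (\<lambda>x. c)" for c :: real by (rule lint_compact_continuous[OF cU]) auto
 have contF: "continuous_on {t..1} F"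
 proof -
  have "(L * measure lebesgue ?U)-lipschitz_on {t..1} F"
  proof (rule lipschitz_onI)
   fix r r' assume "r \<in> {t..1}" "r' \<in> {t..1}"
   then have r: "0 \<le> r" "r \<le> 1" "0 \<le> r'" "r' \<le> 1" using t by auto
   have i: "set_integrable lebesgue ?U (\<lambda>x. ?g (dil z r x) - ?g (dil z r' x))"
    by (intro set_integral_diff int r)
   have "dist (F r) (F r') = \<bar>LINT x:?U|lebesgue. ?g (dil z r x) - ?g (dil z r' x)\<bar>"
    unfolding F_def dist_real_def by (subst set_integral_diff(2)) (auto intro!: int r)
   also have "... \<le> (LINT x:?U|lebesgue. \<bar>?g (dil z r x) - ?g (dil z r' x)\<bar>)"
    using set_integral_norm_bound[OF i] by simp
   also have "... \<le> (LINT x:?U|lebesgue. L * \<bar>r - r'\<bar>)"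
    by (rule set_integral_mono[OF set_integrable_abs[OF i] ic]) (rule lip, auto simp: r)
   also have "... = measure lebesgue ?U * (L * \<bar>r - r'\<bar>)"
    unfolding set_lebesgue_integral_def using sU by simp
   finally show "dist (F r) (F r') \<le> L * measure lebesgue ?U * dist r r'"
    by (simp add: dist_real_def mult_ac)
  qed (use L0 in simp)
  then show ?thesis by (rule lipschitz_on_continuous_on)
 qed
 let ?N = "(\<Union>T\<in>\<G>. frontier T)" and ?W = "\<lambda>x. indicat_real ?U x * (\<kappa>\<^sup>2 * ?g x + gsq u x)"
 have Wi: "integrable lebesgue ?W" using energy_integrable(3)[OF E u, of \<kappa>] by (simp add: set_integrable_def)
 have WI: "integral\<^sup>L lebesgue ?W = energy1 \<kappa> ?U u"
  using energy_integrable(4)[OF E u, of \<kappa>] by (simp add: set_lebesgue_integral_def)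
 have W0: "0 \<le> ?W x" for x unfolding gsq_def by (auto intro!: mult_nonneg_nonneg add_nonneg_nonneg sum_nonneg)
 have der: "\<exists>l. (F has_real_derivative l) (at s) \<and> l \<le> 4 * D / \<kappa> * energy1 \<kappa> ?U u" if s: "t < s" "s < 1" for s
 proof -
  let ?f = "\<lambda>x. if dil z s x \<in> ?N then 0 else dsq u (dil z s x) (x - z)"
  have s0: "0 < s" "1/2 < s" using s t by auto
  have d: "(?g has_derivative dsq u (dil z s x)) (at (dil z s x))" if x: "x \<in> ?U" "dil z s x \<notin> ?N" for x
  proof -
   have "dil z s x \<in> ?U" using star x s s0 by simp
   then obtain T where T: "T \<in> \<G>" "dil z s x \<in> interior T" using elts_interior_cases[OF E _ x(2)] by blast
   obtain Du where "(u has_derivative Du) (at (dil z s x))" using pw_has_derivative[OF u T] by blast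
   then show ?thesis by (rule dsq_derivative(1))
  qed
  have fi: "set_integrable lebesgue ?U ?f" and fd: "(F has_real_derivative (LINT x:?U|lebesgue. ?f x)) (at s)"
   unfolding F_def
   by (rule dilation_derivative[OF sU ic[of L], of 0 s 1 ?g z ?N "dsq u"];
     (use s0 s int lip d closed_frontiers_negligible[OF E] in auto))+
  have Wsi: "integrable lebesgue (\<lambda>x. ?W (dil z s x))" and
   Wsv: "integral\<^sup>L lebesgue ?W = s\<^sup>2 * integral\<^sup>L lebesgue (\<lambda>x. ?W (dil z s x))"
  proof -
   have e: "(z - s *\<^sub>R z) + s *\<^sub>R y = dil z s y" for y by (simp add: algebra_simps)
   show "integrable lebesgue (\<lambda>x. ?W (dil z s x))"
    using lebesgue_integrable_affine[OF Wi, of s "z - s *\<^sub>R z"] s0 unfolding e by simp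
   show "integral\<^sup>L lebesgue ?W = s\<^sup>2 * integral\<^sup>L lebesgue (\<lambda>x. ?W (dil z s x))"
    using lebesgue_integral_affine[OF borel_measurable_integrable[OF Wi], of s "z - s *\<^sub>R z"] s0 unfolding e by simp
  qed
  have "\<kappa> * (LINT x:?U|lebesgue. ?f x) = integral\<^sup>L lebesgue (\<lambda>x. \<kappa> * (indicat_real ?U x *\<^sub>R ?f x))"
   unfolding set_lebesgue_integral_def by simp
  also have "... \<le> integral\<^sup>L lebesgue (\<lambda>x. D * ?W (dil z s x))"
  proof (rule integral_mono)
   show "integrable lebesgue (\<lambda>x. \<kappa> * (indicat_real ?U x *\<^sub>R ?f x))"
    using fi unfolding set_integrable_def by (rule integrable_mult_right)
   show "integrable lebesgue (\<lambda>x. D * ?W (dil z s x))" using Wsi by (rule integrable_mult_right)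
   fix x
   show "\<kappa> * (indicat_real ?U x *\<^sub>R ?f x) \<le> D * ?W (dil z s x)"
   proof (cases "x \<in> ?U \<and> dil z s x \<notin> ?N")
    case True
    then have xs: "dil z s x \<in> ?U" using star s s0 by simp
    then obtain T where T: "T \<in> \<G>" "dil z s x \<in> interior T" using elts_interior_cases[OF E xs] True by blast
    obtain Du where Du: "(u has_derivative Du) (at (dil z s x))" using pw_has_derivative[OF u T] by blast
    have g0: "0 \<le> gsq u (dil z s x)" unfolding gsq_def by (intro sum_nonneg) auto
    have "\<kappa> * dsq u (dil z s x) (x - z) \<le> \<bar>\<kappa> * dsq u (dil z s x) (x - z)\<bar>" by simp
    also have "... \<le> norm (x - z) * (\<kappa>\<^sup>2 * ?g (dil z s x) + gsq u (dil z s x))" by (rule dsq_derivative(2)[OF Du])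
    also have "... \<le> D * (\<kappa>\<^sup>2 * ?g (dil z s x) + gsq u (dil z s x))"
     using D True g0 by (intro mult_right_mono) auto
    finally show ?thesis using True xs by simp
   next
    case False
    then have z0: "indicat_real ?U x *\<^sub>R ?f x = 0" by auto
    have "0 \<le> D * ?W (dil z s x)" by (rule mult_nonneg_nonneg[OF less_imp_le[OF D0] W0])
    then show ?thesis by (simp only: z0 mult_zero_right)
   qed
  qed
  also have "... = D * (energy1 \<kappa> ?U u / s\<^sup>2)" using Wsv WI s0 by simp
  also have "... \<le> D * (energy1 \<kappa> ?U u * 4)"
  proof -
   have i0: "0 \<le> energy1 \<kappa> ?U u" by (rule psd_nonneg[OF psd_ip1[OF E] u])
   have "(1/2)\<^sup>2 \<le> s\<^sup>2" using s0 by (intro power_mono) auto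
   then have "1 \<le> 4 * s\<^sup>2" by (simp add: power2_eq_square)
   then have "energy1 \<kappa> ?U u * 1 \<le> energy1 \<kappa> ?U u * (4 * s\<^sup>2)" using i0 by (rule mult_left_mono)
   then have "energy1 \<kappa> ?U u / s\<^sup>2 \<le> energy1 \<kappa> ?U u * 4" using s0 by (simp add: divide_le_eq)
   then show ?thesis using D0 by (intro mult_left_mono) auto
  qed
  finally have "(LINT x:?U|lebesgue. ?f x) \<le> 4 * D / \<kappa> * energy1 \<kappa> ?U u"
   using \<kappa> by (simp add: field_simps)
  then show ?thesis using fd by blast
 qed
 obtain l s where ls: "t < s" "s < 1" "(F has_real_derivative l) (at s)" "F 1 - F t = (1 - t) * l"
  using MVT[OF t(2) contF] der real_differentiable_def by blast
 have l: "l \<le> 4 * D / \<kappa> * energy1 \<kappa> ?U u" using der[OF ls(1,2)] DERIV_unique[OF ls(3)] by blast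
 have F1: "F 1 = (LINT x:?U|lebesgue. ?g x)" by (simp add: F_def)
 have im: "dil z t ` ?U \<subseteq> ?U"
 proof (rule image_subsetI)
  fix x assume "x \<in> ?U"
  then show "dil z t x \<in> ?U" by (rule star) (use t in auto)
 qed
 have Ft: "(LINT x:dil z t ` ?U|lebesgue. ?g x) = t\<^sup>2 * F t"
 proof -
  have e: "(z - t *\<^sub>R z) + t *\<^sub>R y = dil z t y" for y by (simp add: algebra_simps)
  have "continuous_on (dil z t ` ?U) ?g"
   by (intro continuous_intros continuous_on_subset[OF cont im])
  then show ?thesis
   using lint_affine[OF cU, of "z - t *\<^sub>R z" t ?g] t unfolding e F_def by simp
 qed
 have "compact (dil z t ` ?U)" by (intro compact_continuous_image cU continuous_intros)
 then have "t\<^sup>2 * F t \<le> F 1"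
  unfolding Ft[symmetric] F1 by (intro lint_mono_set[OF gi _ im]) (auto simp: borel_compact)
 moreover have Fpos: "0 \<le> F t" unfolding F_def by (rule lint_nonneg) auto
 moreover have t2: "(1/2)\<^sup>2 \<le> t\<^sup>2" using t by (intro power_mono) auto
 ultimately have Ft4: "F t \<le> 4 * F 1"
  using mult_right_mono[OF t2 Fpos] by (simp add: power2_eq_square)
 have "1 - t\<^sup>2 = (1 - t) * (1 + t)" by (simp add: power2_eq_square algebra_simps)
 also have "... \<le> (1 - t) * 2" using t by (intro mult_left_mono) auto
 finally have "(1 - t\<^sup>2) * F t \<le> ((1 - t) * 2) * (4 * F 1)"
  using Ft4 Fpos t by (intro mult_mono) auto
 moreover have "(1 - t) * l \<le> (1 - t) * (4 * D / \<kappa> * energy1 \<kappa> ?U u)" using l t by (intro mult_left_mono) auto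
 moreover have "F 1 - t\<^sup>2 * F t = (1 - t) * l + (1 - t\<^sup>2) * F t" using ls(4) by (simp add: algebra_simps)
 ultimately have "F 1 - t\<^sup>2 * F t \<le> (1 - t) * (8 * F 1 + 4 * D / \<kappa> * energy1 \<kappa> ?U u)"
  by (simp add: algebra_simps)
 then show ?thesis unfolding Ft l2_ip_self Re_complex_of_real F1 .
qed

lemma star_shaped_closure:
 assumes st: "star_shaped_wrt_disc \<Omega> z r" and x: "x \<in> closure \<Omega>" and y: "y \<in> ball z r" and t: "0 \<le> t" "t \<le> 1"
 shows "y + t *\<^sub>R (x - y) \<in> closure \<Omega>"
proof -
 obtain f where f: "\<And>n. f n \<in> \<Omega>" "f \<longlonglongrightarrow> x"
  using x[unfolded closure_sequential] by blast
 have "y + t *\<^sub>R (f n - y) \<in> \<Omega>" for n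
 proof -
  have "closed_segment y (f n) \<subseteq> \<Omega>" using st y f(1) unfolding star_shaped_wrt_disc_def by blast
  moreover have "y + t *\<^sub>R (f n - y) \<in> closed_segment y (f n)"
   unfolding in_segment using t by (intro exI[of _ t]) (auto simp: algebra_simps)
  ultimately show ?thesis by blast
 qed
 then have "\<forall>n. (\<lambda>n. y + t *\<^sub>R (f n - y)) n \<in> \<Omega>" by blast
 moreover have "(\<lambda>n. y + t *\<^sub>R (f n - y)) \<longlonglongrightarrow> y + t *\<^sub>R (x - y)"
  by (intro tendsto_intros f)
 ultimately show ?thesis unfolding closure_sequential by (intro exI[of _ "\<lambda>n. y + t *\<^sub>R (f n - y)"] conjI)
qed

lemma star_shaped_shrink:
 assumes st: "star_shaped_wrt_disc \<Omega> z r" and x: "x \<in> closure \<Omega>" and t: "0 < t" "t < 1"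
 shows "ball (dil z t x) ((1 - t) * r) \<subseteq> closure \<Omega>"
proof
 fix w assume "w \<in> ball (dil z t x) ((1 - t) * r)"
 then have w: "norm (w - dil z t x) < (1 - t) * r" by (simp add: dist_norm norm_minus_commute)
 define y where "y = z + (1 / (1 - t)) *\<^sub>R (w - dil z t x)"
 have "dist z y = norm (w - dil z t x) / (1 - t)" using t by (simp add: y_def dist_norm)
 also have "... < r" using w t by (simp add: divide_less_eq mult.commute)
 finally have yb: "y \<in> ball z r" by simp
 have "(1 - t) *\<^sub>R y = (1 - t) *\<^sub>R z + (w - dil z t x)" using t by (simp add: y_def scaleR_add_right)
 then have "y + t *\<^sub>R (x - y) = w" by (simp add: algebra_simps)
 then show "w \<in> closure \<Omega>" using star_shaped_closure[OF st x yb, of t] t by simp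
qed

context fe_mesh
begin

definition trace_const :: "real \<Rightarrow> real \<Rightarrow> real \<Rightarrow> real" where
 "trace_const r D \<kappa>0 = 18 * invC p K * K / r * (8 / \<kappa>0 + 4 * D)"

text \<open>The trace inequality on \<open>\<Omega>\<close>. The elementwise estimate costs a factor \<open>1 / h\<close>, but the boundary
 elements lie outside the copy of \<open>\<Omega>\<close> shrunk by a factor \<open>1 - 2 h / r\<close>, and the mass out there is
 smaller by a factor \<open>h\<close>.\<close>

lemma trace_inequality:
 assumes st: "star_shaped_wrt_disc \<Omega> z r" and D: "\<And>x. x \<in> closure \<Omega> ==> norm (x - z) \<le> D" and D0: "0 < D"
  and \<kappa>: "0 < \<kappa>0" "\<kappa>0 \<le> \<kappa>" and u: "u \<in> V"
 shows "\<kappa> * Re (boundary_ip \<T> u u) \<le> trace_const r D \<kappa>0 * energy1 \<kappa> (\<Union>\<T>) u"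
proof -
 let ?U = "\<Union>\<T>" and ?g = "\<lambda>x. (cmod (u x))\<^sup>2"
 define Bd where "Bd = {T. T \<in> \<T> \<and> T \<inter> frontier ?U \<noteq> {}}"
 define N2 where "N2 = mass ?U u"
 define P where "P = energy1 \<kappa> ?U u"
 have r0: "0 < r" and zO: "z \<in> ball z r" using st by (auto simp: star_shaped_wrt_disc_def)
 have up: "u \<in> pw p \<T>" using u fe_pw by blast
 have N20: "0 \<le> N2" unfolding N2_def by (rule psd_nonneg[OF psd_ips(1)[OF els] up])
 have kP: "\<kappa> * N2 \<le> P / \<kappa>0"
 proof -
  have "\<kappa>\<^sup>2 * N2 \<le> P"
   unfolding P_def norm1_sq_eq N2_def using psd_nonneg[OF psd_ips(2)[OF els] up] by simp
  moreover have "\<kappa> * N2 * \<kappa>0 \<le> \<kappa> * N2 * \<kappa>" using \<kappa> N20 by (intro mult_left_mono) auto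
  ultimately have "\<kappa> * N2 * \<kappa>0 \<le> P" by (simp add: power2_eq_square mult_ac)
  then show ?thesis using \<kappa> by (simp add: le_divide_eq)
 qed
 have P0: "0 \<le> P" unfolding P_def by (rule psd_nonneg[OF psd_ip1[OF els] up])
 have c0: "0 < invC p K * K / h" using invC_pos[OF p K] K h_pos by simp
 have b1: "Re (boundary_ip \<T> u u) \<le> 9 * invC p K * K / h * (\<Sum>T\<in>Bd. mass T u)"
  unfolding Bd_def by (rule boundary_ip_le_local[OF conf p K fat le_diam h_pos up])
 have Bd: "Bd \<subseteq> \<T>" by (auto simp: Bd_def)
 have eB: "elts Bd" by (rule elts_subset[OF els Bd])
 have upB: "u \<in> pw p Bd" using up pw_mono[OF Bd] by blast
 have sumB: "(\<Sum>T\<in>Bd. mass T u) = (LINT x:(\<Union>Bd)|lebesgue. ?g x)"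
  using ip_union(1)[OF eB upB upB] unfolding l2_ip_self by (simp flip: of_real_sum)
 have gi: "set_integrable lebesgue ?U ?g" by (rule energy_integrable(1)[OF els up])
 have cB: "compact (\<Union>Bd)" by (rule conforming_Union_closed(2)[OF conforming_subset[OF conf Bd]])
 have main: "\<kappa> * (\<Sum>T\<in>Bd. mass T u) \<le> 2 * h / r * ((8 / \<kappa>0 + 4 * D) * P)"
 proof (cases "2 * h / r \<le> 1/2")
  case True
  define t where "t = 1 - 2 * h / r"
  have t: "1/2 \<le> t" "t < 1" using True h_pos r0 by (auto simp: t_def)
  have tr: "(1 - t) * r = 2 * h" using r0 by (simp add: t_def)
  let ?Ut = "dil z t ` ?U"
  have star: "dil z s x \<in> ?U" if "x \<in> ?U" "0 \<le> s" "s \<le> 1" for x s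
   using star_shaped_closure[OF st _ zO that(2,3), of x] that(1) cover by simp
  have disj: "\<Union>Bd \<inter> ?Ut = {}"
  proof (rule ccontr)
   assume "\<Union>Bd \<inter> ?Ut \<noteq> {}"
   then obtain w T where w0: "w \<in> ?Ut" "T \<in> Bd" "w \<in> T" by blast
   then obtain y where w: "w \<in> ?Ut" "T \<in> \<T>" "w \<in> T" "y \<in> T" "y \<in> frontier ?U"
    unfolding Bd_def by blast
   obtain x where x: "x \<in> ?U" "w = dil z t x" using w(1) by blast
   have "ball w (2 * h) \<subseteq> ?U"
    using star_shaped_shrink[OF st, of x t] x t cover tr by simp
   moreover have "y \<in> ball w (2 * h)" using dist_le[OF w(2,3,4)] h_pos by simp
   ultimately have "y \<in> interior ?U" using interiorI[OF open_ball] by blast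
   then show False using w(5) by (simp add: frontier_def)
  qed
  have cUt: "compact ?Ut" by (intro compact_continuous_image compact_Union continuous_intros)
  have im: "?Ut \<subseteq> ?U"
  proof (rule image_subsetI)
   fix x assume "x \<in> ?U"
   then show "dil z t x \<in> ?U" by (rule star) (use t in auto)
  qed
  have iB: "set_integrable lebesgue (\<Union>Bd) ?g" "set_integrable lebesgue ?Ut ?g"
   using gi Bd cB cUt im by (auto intro!: set_integrable_subset[OF gi] simp: borel_compact)
  have "(LINT x:(\<Union>Bd)|lebesgue. ?g x) + (LINT x:?Ut|lebesgue. ?g x) = (LINT x:(\<Union>Bd \<union> ?Ut)|lebesgue. ?g x)"
   by (rule set_integral_Un[symmetric]) (use disj iB cB cUt in \<open>auto simp: borel_compact\<close>)
  also have "... \<le> (LINT x:?U|lebesgue. ?g x)"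
   using Bd im cB cUt by (intro lint_mono_set[OF gi]) (auto simp: borel_compact)
  finally have "(\<Sum>T\<in>Bd. mass T u) \<le> (LINT x:?U|lebesgue. ?g x) - (LINT x:?Ut|lebesgue. ?g x)"
   unfolding sumB by linarith
  also have "... \<le> (1 - t) * (8 * N2 + 4 * D / \<kappa> * P)"
   unfolding N2_def P_def
   by (rule strip_estimate[OF conf up _ star _ D0 t]) (use u D cover \<kappa> in \<open>auto simp: fe_space_def\<close>)
  finally have "\<kappa> * (\<Sum>T\<in>Bd. mass T u) \<le> \<kappa> * ((1 - t) * (8 * N2 + 4 * D / \<kappa> * P))"
   using \<kappa> by (intro mult_left_mono) auto
  also have "... = (1 - t) * (8 * (\<kappa> * N2) + 4 * D * P)" using \<kappa> by (simp add: field_simps)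
  also have "... \<le> (1 - t) * (8 * (P / \<kappa>0) + 4 * D * P)"
   using kP t D0 by (intro mult_left_mono add_mono) auto
  also have "... = 2 * h / r * ((8 / \<kappa>0 + 4 * D) * P)" by (simp add: t_def algebra_simps)
  finally show ?thesis .
 next
  case False
  have "(\<Sum>T\<in>Bd. mass T u) \<le> N2"
   unfolding sumB unfolding N2_def l2_ip_self Re_complex_of_real
   using Bd cB by (intro lint_mono_set[OF gi]) (auto simp: borel_compact)
  then have "\<kappa> * (\<Sum>T\<in>Bd. mass T u) \<le> \<kappa> * N2" using \<kappa> by (intro mult_left_mono) auto
  also have "... \<le> P / \<kappa>0" by (rule kP)
  also have "... \<le> 1/2 * ((8 / \<kappa>0 + 4 * D) * P)" using P0 \<kappa> D0 by (simp add: field_simps)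
  also have "... \<le> 2 * h / r * ((8 / \<kappa>0 + 4 * D) * P)"
   using False P0 \<kappa> D0 by (intro mult_right_mono) auto
  finally show ?thesis .
 qed
 have "\<kappa> * Re (boundary_ip \<T> u u) \<le> \<kappa> * (9 * invC p K * K / h * (\<Sum>T\<in>Bd. mass T u))"
  using b1 \<kappa> by (intro mult_left_mono) auto
 also have "... = 9 * (invC p K * K / h) * (\<kappa> * (\<Sum>T\<in>Bd. mass T u))" by simp
 also have "... \<le> 9 * (invC p K * K / h) * (2 * h / r * ((8 / \<kappa>0 + 4 * D) * P))"
  using main c0 by (intro mult_left_mono) auto
 also have "... = trace_const r D \<kappa>0 * P" using h_pos by (simp add: trace_const_def)
 finally show ?thesis unfolding P_def .
qed

end

section \<open>Overlapping subdomains\<close>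

lemma orthonormal_frame_expansion:
 fixes w e1 e2 :: pt
 assumes "norm e1 = 1" "norm e2 = 1" "e1 \<bullet> e2 = 0"
 shows "w = (w \<bullet> e1) *\<^sub>R e1 + (w \<bullet> e2) *\<^sub>R e2"
proof -
 have ne: "e1 \<noteq> e2" "e1 \<noteq> 0" "e2 \<noteq> 0" using assms by (auto simp: norm_eq_1)
 have po: "pairwise orthogonal {e1, e2}" using assms by (auto simp: pairwise_def orthogonal_def inner_commute)
 then have "independent {e1, e2}" by (rule pairwise_orthogonal_independent) (use ne in auto)
 then have "UNIV \<subseteq> span {e1, e2}" by (intro card_ge_dim_independent) (use ne in \<open>auto simp: dim_UNIV\<close>)
 then have "(\<Sum>v\<in>{e1, e2}. (w \<bullet> v) *\<^sub>R v) = w"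
  by (intro orthonormal_basis_expand[OF po]) (use assms in auto)
 then show ?thesis using ne by (simp add: inner_commute)
qed

text \<open>A Lipschitz domain has no slits: near a boundary point it stays above a graph, and points strictly
 below the graph are not limits of points of the domain.\<close>

lemma lipschitz_domain_interior_closure:
 assumes "lipschitz_domain \<Omega>"
 shows "interior (closure \<Omega>) \<subseteq> \<Omega>"
proof (rule subsetI, rule ccontr)
 fix x assume xi: "x \<in> interior (closure \<Omega>)" and xn: "x \<notin> \<Omega>"
 have "open \<Omega>" using assms by (simp add: lipschitz_domain_def)
 then have "x \<in> frontier \<Omega>" using xi xn interior_subset by (auto simp: frontier_def interior_open)
 then obtain e1 e2 r s L g where f: "norm e1 = 1" "norm e2 = 1" "e1 \<bullet> e2 = 0" and rs: "0 < r" "0 < s"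
  and g: "L-lipschitz_on {-r..r} g"
  and O: "\<And>a b. \<bar>a\<bar> < r ==> \<bar>b\<bar> < s ==> (x + a *\<^sub>R e1 + b *\<^sub>R e2 \<in> \<Omega> \<longleftrightarrow> g a < b)"
  using assms unfolding lipschitz_domain_def by blast
 have L: "0 \<le> L" using g by (simp add: lipschitz_on_def)
 have g0: "0 \<le> g 0" using O[of 0 0] rs xn by simp
 obtain q where q: "0 < q" "ball x q \<subseteq> closure \<Omega>" using xi mem_interior by blast
 define b where "b = min q s / 2"
 have b: "0 < b" "b < q" "b < s" using q(1) rs by (auto simp: b_def)
 have "dist x (x - b *\<^sub>R e2) = b" using f b by (simp add: dist_norm)
 then have "x - b *\<^sub>R e2 \<in> closure \<Omega>" using q(2) b by auto
 define t where "t = min (min (s - b) r) (b / (1 + L))"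
 have t: "0 < t" "t \<le> s - b" "t \<le> r" "t \<le> b / (1 + L)" using b rs L by (auto simp: t_def)
 obtain y where y: "y \<in> \<Omega>" "dist y (x - b *\<^sub>R e2) < t"
  using \<open>x - b *\<^sub>R e2 \<in> closure \<Omega>\<close> t(1) closure_approachable by blast
 define w where "w = y - (x - b *\<^sub>R e2)"
 define u1 where "u1 = w \<bullet> e1"
 define u2 where "u2 = w \<bullet> e2"
 have wn: "norm w < t" using y(2) by (simp add: w_def dist_norm)
 have u: "\<bar>u1\<bar> < t" "\<bar>u2\<bar> < t"
  using Cauchy_Schwarz_ineq2[of w e1] Cauchy_Schwarz_ineq2[of w e2] f wn by (auto simp: u1_def u2_def)
 have "w = u1 *\<^sub>R e1 + u2 *\<^sub>R e2" unfolding u1_def u2_def by (rule orthonormal_frame_expansion[OF f])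
 then have yx: "y = x + u1 *\<^sub>R e1 + (u2 - b) *\<^sub>R e2" by (simp add: w_def algebra_simps)
 have "g u1 < u2 - b" using O[of u1 "u2 - b"] y(1) u t b unfolding yx by auto
 moreover have "dist (g u1) (g 0) \<le> L * dist u1 0"
  by (rule lipschitz_onD[OF g]) (use u t rs in auto)
 moreover have "L * \<bar>u1\<bar> \<le> L * t" using L u by (intro mult_left_mono) auto
 moreover have "(1 + L) * t \<le> b" using t(4) L by (simp add: le_divide_eq mult.commute)
 ultimately show False using g0 u by (simp add: dist_real_def algebra_simps)
qed

lemma funpow_add_layer_subset: "\<C> \<subseteq> \<T> ==> (add_layer \<T> ^^ n) \<C> \<subseteq> \<T>"
 by (cases n) (auto simp: add_layer_def)

locale decomposed_mesh = fe_mesh K \<Omega> \<T> p for K \<Omega> \<T> p +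
 fixes d \<delta> :: real and N :: nat and \<C> \<G> :: "nat \<Rightarrow> pt set set" and pu :: "nat \<Rightarrow> pt \<Rightarrow> real"
 assumes dom: "lipschitz_domain \<Omega>"
  and dec: "overlapping_decomposition K \<T> d \<delta> N \<C> \<G>"
  and pou: "partition_of_unity K \<Omega> \<delta> N \<G> pu"
  and nb: "\<And>l. l \<in> {1..N} ==> real (card (neighbours N \<G> l)) \<le> K"
  and dd: "d / \<delta> \<le> K"
begin

abbreviation S :: "nat \<Rightarrow> pt set" where "S l \<equiv> \<Union>(\<G> l)"
abbreviation Vl :: "nat \<Rightarrow> scalar_fun set" where "Vl l \<equiv> fe_local p \<T> (\<G> l)"
abbreviation DE :: "nat \<Rightarrow> scalar_fun \<Rightarrow> scalar_fun" where "DE l u \<equiv> weight p \<T> (pu l) (ext p \<T> u)"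

lemma d_pos: "0 < d" and \<delta>_pos: "0 < \<delta>"
 using dec by (auto simp: overlapping_decomposition_def)

lemma G_sub: assumes "l \<in> {1..N}" shows "\<G> l \<subseteq> \<T>"
proof -
 have "\<C> l \<subseteq> \<T>" using dec assms unfolding overlapping_decomposition_def by blast
 moreover obtain n where "\<G> l = (add_layer \<T> ^^ n) (\<C> l)"
  using dec assms unfolding overlapping_decomposition_def by blast
 ultimately show ?thesis using funpow_add_layer_subset by simp
qed

lemma elt_nonempty: "T \<in> \<T> ==> interior T \<noteq> {}" "T \<in> \<T> ==> T \<noteq> {}"
 using elt interior_subset by (auto simp: elt_def)

lemma add_layer_increasing: "\<H> \<subseteq> \<T> ==> \<H> \<subseteq> add_layer \<T> \<H>"
 using elt_nonempty(2) by (auto simp: add_layer_def)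

lemma G_ne: assumes l: "l \<in> {1..N}" shows "\<G> l \<noteq> {}"
proof -
 have C: "\<C> l \<subseteq> \<T>" "\<C> l \<noteq> {}" using dec l unfolding overlapping_decomposition_def by blast+
 obtain n where G: "\<G> l = (add_layer \<T> ^^ n) (\<C> l)"
  using dec l unfolding overlapping_decomposition_def by blast
 have "\<C> l \<subseteq> (add_layer \<T> ^^ n) (\<C> l)"
 proof (induction n)
  case (Suc n)
  then show ?case using add_layer_increasing[OF funpow_add_layer_subset[OF C(1), of n]] by auto
 qed simp
 then show ?thesis using C G by auto
qed

lemma G_els: "l \<in> {1..N} ==> elts (\<G> l)"
 by (rule elts_subset[OF els G_sub])

lemma G_conf: "l \<in> {1..N} ==> conforming (\<G> l)"
 by (rule conforming_subset[OF conf G_sub])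

lemma S_dist:
 assumes l: "l \<in> {1..N}" and xy: "x \<in> S l" "y \<in> S l"
 shows "dist x y \<le> K\<^sup>2 * d"
proof -
 have "bounded (S l)" using conforming_Union_closed(2)[OF G_conf[OF l]] compact_imp_bounded by blast
 then have "dist x y \<le> diameter (S l)" by (rule diameter_bounded_bound[OF _ xy])
 also have "... \<le> K * diameter (\<Union>(\<C> l))" using dec l by (auto simp: overlapping_decomposition_def)
 also have "... \<le> K * (K * d)"
  using dec l K by (intro mult_left_mono) (auto simp: overlapping_decomposition_def)
 finally show ?thesis by (simp add: power2_eq_square)
qed

lemma C_diameter: "l \<in> {1..N} ==> diameter (\<Union>(\<C> l)) \<le> K * d"
 using dec by (auto simp: overlapping_decomposition_def)

lemma pu_range: "l \<in> {1..N} ==> T \<in> \<T> ==> x \<in> T ==> 0 \<le> pu l x \<and> pu l x \<le> 1"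
 using pou cover unfolding partition_of_unity_def by blast

text \<open>Points of an element are approached from its interior, which lies inside \<open>\<Omega>\<close>; there the
 hypotheses on the partition of unity apply, and they persist in the limit.\<close>

lemma approach_from_interior:
 assumes l: "l \<in> {1..N}" and T: "T \<in> \<T>" and c: "c \<in> interior T" and x: "x \<in> T"
 shows "(\<lambda>n. pu l (x - inverse (real (Suc n)) *\<^sub>R (x - c))) \<longlonglongrightarrow> pu l x"
  "x - inverse (real (Suc n)) *\<^sub>R (x - c) \<in> interior T"
proof -
 have cv: "convex T" using elt[OF T] by (simp add: elt_def)
 have i: "x - inverse (real (Suc n)) *\<^sub>R (x - c) \<in> interior T" for n
  by (rule mem_interior_convex_shrink[OF cv c x]) (auto simp: field_simps)
 then show "x - inverse (real (Suc n)) *\<^sub>R (x - c) \<in> interior T" .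
 have cont: "continuous_on (closure \<Omega>) (pu l)" using pou l unfolding partition_of_unity_def by blast
 have sub: "T \<subseteq> closure \<Omega>" using T cover by blast
 have lim: "(\<lambda>n. x - inverse (real (Suc n)) *\<^sub>R (x - c)) \<longlonglongrightarrow> x - 0 *\<^sub>R (x - c)"
  by (intro tendsto_intros LIMSEQ_inverse_real_of_nat)
 show "(\<lambda>n. pu l (x - inverse (real (Suc n)) *\<^sub>R (x - c))) \<longlonglongrightarrow> pu l x"
  by (rule continuous_on_tendsto_compose[OF cont]) (use lim i interior_subset sub x in \<open>auto intro!: always_eventually\<close>)
qed

lemma pu_outside:
 assumes l: "l \<in> {1..N}" and T: "T \<in> \<T>" "T \<notin> \<G> l" and x: "x \<in> T"
 shows "pu l x = 0"
proof -
 obtain c where c: "c \<in> interior T" using elt_nonempty(1)[OF T(1)] by blast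
 note a = approach_from_interior[OF l T(1) c x]
 have "pu l y = 0" if y: "y \<in> interior T" for y
 proof -
  have "y \<notin> S l"
   using conforming_disjoint_interior[OF conf T(1)] G_sub[OF l] T(2) y by fastforce
  moreover have "y \<in> closure \<Omega>" using y T(1) cover interior_subset by blast
  ultimately show ?thesis using pou l unfolding partition_of_unity_def by blast
 qed
 then have "(\<lambda>n. pu l (x - inverse (real (Suc n)) *\<^sub>R (x - c))) = (\<lambda>n. 0)" using a(2) by blast
 then show ?thesis using a(1) LIMSEQ_unique tendsto_const by metis
qed

text \<open>The bound holds with \<open>d\<close> in place of the overlap because the overlap is generous.\<close>

lemma pu_lipschitz:
 assumes l: "l \<in> {1..N}" and T: "T \<in> \<T>" and xy: "x \<in> T" "y \<in> T"
 shows "\<bar>pu l x - pu l y\<bar> \<le> K\<^sup>2 / d * dist x y"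
proof -
 obtain c where c: "c \<in> interior T" using elt_nonempty(1)[OF T(1)] by blast
 note ax = approach_from_interior[OF l T(1) c xy(1)] and ay = approach_from_interior[OF l T(1) c xy(2)]
 have iO: "interior T \<subseteq> \<Omega>"
  using lipschitz_domain_interior_closure[OF dom] interior_mono[of T "closure \<Omega>"] T cover by blast
 have cv: "convex (interior T)" using elt[OF T] by (simp add: elt_def)
 have Kd: "K / \<delta> \<le> K\<^sup>2 / d"
 proof -
  have "d \<le> K * \<delta>" using dd \<delta>_pos by (simp add: divide_le_eq)
  then have "K * d \<le> K * (K * \<delta>)" using K by (intro mult_left_mono) auto
  then show ?thesis using d_pos \<delta>_pos by (simp add: divide_le_eq le_divide_eq power2_eq_square mult_ac)
 qed
 have "\<bar>pu l (x - inverse (real (Suc n)) *\<^sub>R (x - c)) - pu l (y - inverse (real (Suc n)) *\<^sub>R (y - c))\<bar>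
   \<le> K\<^sup>2 / d * dist x y" (is "\<bar>pu l ?x - pu l ?y\<bar> \<le> _") for n
 proof -
  have "closed_segment ?x ?y \<subseteq> \<Omega>" using closed_segment_subset[OF ax(2)[of n] ay(2)[of n] cv] iO by blast
  then have "\<bar>pu l ?x - pu l ?y\<bar> \<le> K / \<delta> * dist ?x ?y" using pou l unfolding partition_of_unity_def by blast
  also have "dist ?x ?y = (1 - inverse (real (Suc n))) * dist x y"
  proof -
   have "(x - s *\<^sub>R (x - c)) - (y - s *\<^sub>R (y - c)) = (1 - s) *\<^sub>R (x - y)" for s
    by (simp add: algebra_simps)
   then have "?x - ?y = (1 - inverse (real (Suc n))) *\<^sub>R (x - y)" .
   moreover have "0 \<le> 1 - inverse (real (Suc n))" by (simp add: field_simps)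
   ultimately show ?thesis unfolding dist_norm by simp
  qed
  also have "K / \<delta> * ... \<le> K\<^sup>2 / d * dist x y"
   using Kd K d_pos by (intro mult_mono mult_left_le_one_le) (auto simp: field_simps)
  finally show ?thesis .
 qed
 then show ?thesis
  by (intro LIMSEQ_le_const2[OF tendsto_rabs[OF tendsto_diff[OF ax(1) ay(1)]]]) auto
qed

lemma card_covering:
 assumes T: "T \<in> \<T>" shows "real (card {l\<in>{1..N}. T \<in> \<G> l}) \<le> K"
proof (cases "\<exists>l\<in>{1..N}. T \<in> \<G> l")
 case True
 then obtain l where l: "l \<in> {1..N}" "T \<in> \<G> l" by blast
 have "interior (S j) \<inter> interior (S l) \<noteq> {}" if "T \<in> \<G> j" for j
 proof -
  have "interior T \<subseteq> interior (S j)" "interior T \<subseteq> interior (S l)"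
   using that l(2) by (auto intro!: interior_mono)
  then show ?thesis using elt_nonempty(1)[OF T] by blast
 qed
 then have "{l\<in>{1..N}. T \<in> \<G> l} \<subseteq> neighbours N \<G> l" by (auto simp: neighbours_def)
 then have "card {l\<in>{1..N}. T \<in> \<G> l} \<le> card (neighbours N \<G> l)"
  by (rule card_mono[rotated]) (simp add: neighbours_def)
 then show ?thesis using nb[OF l(1)] by linarith
next
 case False
 then have e: "{l\<in>{1..N}. T \<in> \<G> l} = {}" by blast
 show ?thesis unfolding e using K by simp
qed

lemma sum_over_families:
 assumes H: "\<And>l. l \<in> {1..N} ==> \<H> l \<subseteq> \<T>" and c: "\<And>T. T \<in> \<T> ==> real (card {l\<in>{1..N}. T \<in> \<H> l}) \<le> c"
  and f: "\<And>T. T \<in> \<T> ==> 0 \<le> f T"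
 shows "(\<Sum>l=1..N. \<Sum>T\<in>\<H> l. f T) \<le> c * (\<Sum>T\<in>\<T>. f T)"
proof -
 have "(\<Sum>l=1..N. \<Sum>T\<in>\<H> l. f T) = (\<Sum>l=1..N. \<Sum>T\<in>{T\<in>\<T>. T \<in> \<H> l}. f T)"
  by (intro sum.cong refl) (use H in blast)
 also have "... = (\<Sum>T\<in>\<T>. \<Sum>l\<in>{l\<in>{1..N}. T \<in> \<H> l}. f T)"
  by (rule sum.swap_restrict) (auto simp: fin)
 also have "... = (\<Sum>T\<in>\<T>. real (card {l\<in>{1..N}. T \<in> \<H> l}) * f T)" by simp
 also have "... \<le> (\<Sum>T\<in>\<T>. c * f T)" by (intro sum_mono mult_right_mono c f)
 finally show ?thesis by (simp add: sum_distrib_left)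
qed

lemma card_covering_layer:
 assumes T: "T \<in> \<T>" shows "real (card {l\<in>{1..N}. T \<in> add_layer \<T> (\<G> l)}) \<le> 9 * K ^ 5"
proof -
 have "{l\<in>{1..N}. T \<in> add_layer \<T> (\<G> l)} \<subseteq> (\<Union>T'\<in>touching \<T> T. {l\<in>{1..N}. T' \<in> \<G> l})"
  using G_sub by (fastforce simp: add_layer_def touching_def)
 moreover have ft: "finite (touching \<T> T)" using fin by (simp add: touching_def)
 ultimately have "card {l\<in>{1..N}. T \<in> add_layer \<T> (\<G> l)} \<le> card (\<Union>T'\<in>touching \<T> T. {l\<in>{1..N}. T' \<in> \<G> l})"
  by (intro card_mono) auto
 also have "... \<le> (\<Sum>T'\<in>touching \<T> T. card {l\<in>{1..N}. T' \<in> \<G> l})" by (rule card_UN_le[OF ft])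
 finally have "real (card {l\<in>{1..N}. T \<in> add_layer \<T> (\<G> l)}) \<le> (\<Sum>T'\<in>touching \<T> T. real (card {l\<in>{1..N}. T' \<in> \<G> l}))"
  by (simp flip: of_nat_sum)
 also have "... \<le> (\<Sum>T'\<in>touching \<T> T. K)" by (intro sum_mono card_covering) (simp add: touching_def)
 also have "... \<le> 9 * K ^ 4 * K" using card_touching[OF T] K by (simp add: mult_right_mono)
 finally show ?thesis by (simp add: power_Suc[symmetric] mult.commute mult.left_commute numeral_eq_Suc)
qed

lemma fe_pw_G: "l \<in> {1..N} ==> u \<in> V ==> u \<in> pw p (\<G> l)"
 using fe_pw pw_mono[OF G_sub] by blast

lemma energy_sum_local:
 assumes H: "\<And>l. l \<in> {1..N} ==> \<H> l \<subseteq> \<T>" and c: "\<And>T. T \<in> \<T> ==> real (card {l\<in>{1..N}. T \<in> \<H> l}) \<le> c" and v: "v \<in> V"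
 shows "(\<Sum>l=1..N. energy1 \<kappa> (\<Union>(\<H> l)) v) \<le> c * energy1 \<kappa> (\<Union>\<T>) v"
proof -
 have vp: "v \<in> pw p \<T>" using v fe_pw by blast
 have "energy1 \<kappa> (\<Union>(\<H> l)) v = (\<Sum>T\<in>\<H> l. energy1 \<kappa> T v)" if "l \<in> {1..N}" for l
 proof -
  have "v \<in> pw p (\<H> l)" using vp pw_mono[OF H[OF that]] by blast
  then show ?thesis using ip1_union[OF elts_subset[OF els H[OF that]]] by simp
 qed
 then have "(\<Sum>l=1..N. energy1 \<kappa> (\<Union>(\<H> l)) v) = (\<Sum>l=1..N. \<Sum>T\<in>\<H> l. energy1 \<kappa> T v)" by simp
 also have "... \<le> c * (\<Sum>T\<in>\<T>. energy1 \<kappa> T v)"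
  by (rule sum_over_families[OF H c]) (use ips_nonneg(3) pw_single[OF vp] in auto)
 also have "(\<Sum>T\<in>\<T>. energy1 \<kappa> T v) = energy1 \<kappa> (\<Union>\<T>) v" using ip1_union[OF els vp vp] by simp
 finally show ?thesis .
qed

text \<open>Only boundedly many summands live on any element, so the sum of local functions costs a constant
 factor instead of \<open>N\<close>.\<close>

lemma energy_overlap_sum:
 assumes u: "\<And>l. l \<in> {1..N} ==> u l \<in> V"
  and z: "\<And>l T x. l \<in> {1..N} ==> T \<in> \<T> ==> T \<notin> \<G> l ==> x \<in> T ==> u l x = 0"
 shows "energy1 \<kappa> (\<Union>\<T>) (\<Sum>l=1..N. u l) \<le> K * (\<Sum>l=1..N. energy1 \<kappa> (S l) (u l))"
proof -
 let ?u = "\<Sum>l=1..N. u l"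
 have uV: "?u \<in> V" by (rule cvs.subspace_sum[OF V_subspace u])
 have up: "?u \<in> pw p \<T>" using uV fe_pw by blast
 have ulp: "u l \<in> pw p {T}" if "l \<in> {1..N}" "T \<in> \<T>" for l T
  using u[OF that(1)] fe_pw pw_single that(2) by blast
 have loc: "energy1 \<kappa> T ?u \<le> K * (\<Sum>l\<in>{l\<in>{1..N}. T \<in> \<G> l}. energy1 \<kappa> T (u l))" if T: "T \<in> \<T>" for T
 proof -
  let ?A = "{l\<in>{1..N}. T \<in> \<G> l}" and ?w = "\<Sum>l\<in>{l\<in>{1..N}. T \<in> \<G> l}. u l"
  have wp: "?w \<in> pw p {T}" by (rule cvs.subspace_sum[OF pw_subspace]) (use ulp T in auto)
  have eq: "?u x = ?w x" if "x \<in> T" for x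
   unfolding sum_fun_apply by (rule sum.mono_neutral_right) (use z T that in auto)
  have e1: "elts {T}" by (rule elt_single[OF elt[OF T]])
  have "ip1 \<kappa> (\<Union>{T}) ?u ?u = ip1 \<kappa> (\<Union>{T}) ?w ?w"
   by (rule ip1_cong[OF e1 wp wp]) (use eq in auto)
  then have "energy1 \<kappa> T ?u = energy1 \<kappa> T ?w" by simp
  also have "... \<le> real (card ?A) * (\<Sum>l\<in>?A. energy1 \<kappa> T (u l))"
   by (rule psd_many_terms[OF psd_elt(3)[OF elt[OF T]] pw_subspace]) (use ulp T in auto)
  also have "... \<le> K * (\<Sum>l\<in>?A. energy1 \<kappa> T (u l))"
   by (intro mult_right_mono card_covering[OF T] sum_nonneg ips_nonneg(3)[OF T]) (use ulp T in auto)
  finally show ?thesis .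
 qed
 have "energy1 \<kappa> (\<Union>\<T>) ?u = (\<Sum>T\<in>\<T>. energy1 \<kappa> T ?u)" using ip1_union[OF els up up] by simp
 also have "... \<le> (\<Sum>T\<in>\<T>. K * (\<Sum>l\<in>{l\<in>{1..N}. T \<in> \<G> l}. energy1 \<kappa> T (u l)))" by (rule sum_mono[OF loc])
 also have "... = K * (\<Sum>T\<in>\<T>. \<Sum>l\<in>{l\<in>{1..N}. T \<in> \<G> l}. energy1 \<kappa> T (u l))" by (simp add: sum_distrib_left)
 also have "(\<Sum>T\<in>\<T>. \<Sum>l\<in>{l\<in>{1..N}. T \<in> \<G> l}. energy1 \<kappa> T (u l))
   = (\<Sum>l=1..N. \<Sum>T\<in>{T\<in>\<T>. T \<in> \<G> l}. energy1 \<kappa> T (u l))"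
  by (rule sum.swap_restrict) (auto simp: fin)
 also have "... = (\<Sum>l=1..N. energy1 \<kappa> (S l) (u l))"
 proof (rule sum.cong[OF refl])
  fix l assume l: "l \<in> {1..N}"
  have "{T\<in>\<T>. T \<in> \<G> l} = \<G> l" using G_sub[OF l] by blast
  then show "(\<Sum>T\<in>{T\<in>\<T>. T \<in> \<G> l}. energy1 \<kappa> T (u l)) = energy1 \<kappa> (S l) (u l)"
   using ip1_union[OF G_els[OF l] fe_pw_G[OF l u[OF l]] fe_pw_G[OF l u[OF l]]] by simp
 qed
 finally show ?thesis .
qed

lemma ext_on_subdomain:
 assumes l: "l \<in> {1..N}" and u: "u \<in> Vl l" and T: "T \<in> \<G> l" and x: "x \<in> T"
 shows "I\<^sub>h u x = u x"
proof -
 have TT: "T \<in> \<T>" using G_sub[OF l] T by blast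
 obtain v where v: "v \<in> V" "u = restr (S l) v" using u by (auto simp: fe_local_def)
 have "I\<^sub>h u x = I\<^sub>h v x"
  unfolding interp_local[OF TT x]
  by (rule lagr_interp_cong) (use tnodes_sub(1)[OF TT] T in \<open>auto simp: v(2) restr_def\<close>)
 then show ?thesis using interp_id[OF v(1)] T x by (auto simp: v(2) restr_def)
qed

lemma DE_V: "DE l u \<in> V"
 by (simp add: weight_def interp_fe)

lemma DE_outside:
 assumes "l \<in> {1..N}" "T \<in> \<T>" "T \<notin> \<G> l" "x \<in> T"
 shows "DE l u x = 0"
 unfolding weight_def
 by (rule interp_zero_local[OF assms(2,4)]) (use pu_outside[OF assms(1-3)] tnodes_sub(1)[OF assms(2)] in auto)

lemma weight_add: "weight p \<T> \<phi> (u + v) = weight p \<T> \<phi> u + weight p \<T> \<phi> v"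
 unfolding weight_def interp_add[symmetric] by (simp add: fapply algebra_simps)

lemma weight_scl: "weight p \<T> \<phi> (c *\<^sub>C u) = c *\<^sub>C weight p \<T> \<phi> u"
 unfolding weight_def interp_scl[symmetric] by (simp add: fapply algebra_simps)

lemma ext_add: "ext p \<T> (u + v) = ext p \<T> u + ext p \<T> v"
 using interp_add[of u v] by (simp only: plus_fun_def ext_def)

lemma ext_scl: "ext p \<T> (c *\<^sub>C u) = c *\<^sub>C ext p \<T> u"
 using interp_scl[of c u] by (simp only: scl_def ext_def)

lemma DE_add: "DE l (u + v) = DE l u + DE l v"
 by (simp add: ext_add weight_add)

lemma DE_scl: "DE l (c *\<^sub>C u) = c *\<^sub>C DE l u"
 by (simp add: ext_scl weight_scl)

lemma DE_zero: "DE l 0 = 0"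
 using DE_scl[of l 0 0] by simp

lemma DE_minus: "DE l (- u) = - DE l u"
proof -
 have "- f = (-1) *\<^sub>C f" for f :: scalar_fun by (simp add: fun_eq_iff fapply)
 then show ?thesis by (simp only: DE_scl)
qed

lemma DE_diff: "DE l (u - v) = DE l u - DE l v"
 using DE_add[of l u "- v"] DE_minus by simp

lemma DE_partition:
 assumes v: "v \<in> V" shows "(\<Sum>l=1..N. DE l (restr (S l) v)) = v"
proof (rule fe_unique)
 show "(\<Sum>l=1..N. DE l (restr (S l) v)) \<in> V" by (rule cvs.subspace_sum[OF V_subspace DE_V])
 show "v \<in> V" by (rule v)
 fix x assume x: "x \<in> nodes p \<T>"
 have xc: "x \<in> closure \<Omega>" using x nodes_sub cover by blast
 have "(\<Sum>l=1..N. DE l (restr (S l) v)) x = (\<Sum>l=1..N. of_real (pu l x) * restr (S l) v x)"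
  unfolding sum_fun_apply weight_def ext_def by (simp add: interp_node[OF x])
 also have "... = (\<Sum>l=1..N. of_real (pu l x) * v x)"
  using pou xc by (intro sum.cong) (auto simp: restr_def partition_of_unity_def)
 also have "... = of_real (\<Sum>l=1..N. pu l x) * v x" by (simp add: sum_distrib_right)
 also have "... = v x" using pou xc by (simp add: partition_of_unity_def)
 finally show "(\<Sum>l=1..N. DE l (restr (S l) v)) x = v x" .
qed

definition grad_weight_const :: real where "grad_weight_const = weight_const * K ^ 4"

text \<open>A function of size \<open>n\<close> multiplied by the weight acquires gradients of size \<open>n / d\<close>.\<close>

lemma DE_bounds:
 assumes l: "l \<in> {1..N}" and u: "u \<in> Vl l"
 shows "energy (S l) (DE l u) \<le>
   2 * energy (S l) u + grad_weight_const / d\<^sup>2 * mass (S l) u"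
  "mass (S l) (DE l u) \<le> ext_const * mass (S l) u"
proof -
 note G = G_els[OF l]
 have up: "u \<in> pw p (\<G> l)" using u local_pw[OF G_sub[OF l]] by blast
 have dp: "DE l u \<in> pw p (\<G> l)" by (rule fe_pw_G[OF l DE_V])
 have loc: "energy T (DE l u) \<le>
   2 * energy T u + grad_weight_const / d\<^sup>2 * mass T u"
  "mass T (DE l u) \<le> ext_const * mass T u" if T: "T \<in> \<G> l" for T
 proof -
  have TT: "T \<in> \<T>" using G_sub[OF l] T by blast
  note ic = ip_cong_elt[OF elt[OF TT] pw_single[OF up T] pw_single[OF up T] ext_on_subdomain[OF l u T] ext_on_subdomain[OF l u T]]
  have c: "l2_ip T (I\<^sub>h u) (I\<^sub>h u) = l2_ip T u u" by (rule ic(1))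
  have c': "dirichlet_ip T (I\<^sub>h u) (I\<^sub>h u) = dirichlet_ip T u u" by (rule ic(2))
  have L: "0 \<le> K\<^sup>2 / d" using d_pos by simp
  have e: "weight_const * (K\<^sup>2 / d)\<^sup>2 = grad_weight_const / d\<^sup>2"
   by (simp add: grad_weight_const_def power_divide power_mult[symmetric])
  note w = weight_local[OF interp_fe TT pu_range[OF l TT] pu_lipschitz[OF l TT] L, of u]
  show "energy T (DE l u) \<le>
   2 * energy T u + grad_weight_const / d\<^sup>2 * mass T u"
   using w(1) unfolding c c' e ext_def .
  show "mass T (DE l u) \<le> ext_const * mass T u"
   using w(2) unfolding c c' ext_def .
 qed
 note s = ip_union[OF G dp dp] ip_union[OF G up up]
 show "energy (S l) (DE l u) \<le>
   2 * energy (S l) u + grad_weight_const / d\<^sup>2 * mass (S l) u"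
  unfolding s Re_sum sum_distrib_left sum.distrib[symmetric] by (rule sum_mono[OF loc(1)])
 show "mass (S l) (DE l u) \<le> ext_const * mass (S l) u"
  unfolding s Re_sum sum_distrib_left by (rule sum_mono[OF loc(2)])
qed

end

section \<open>Discrete harmonic functions and their spectral splitting\<close>

lemma sesq_lincomb3:
 assumes "sesq V b1" "sesq V b2" "sesq V b3"
 shows "sesq V (\<lambda>u v. b1 u v - c * b2 u v - c' * b3 u v)"
 unfolding sesq_def
proof (intro conjI ballI allI)
 fix u v w assume m: "u \<in> V" "v \<in> V" "w \<in> V"
 show "b1 (u + v) w - c * b2 (u + v) w - c' * b3 (u + v) w
   = b1 u w - c * b2 u w - c' * b3 u w + (b1 v w - c * b2 v w - c' * b3 v w)"
  using m by (simp only: sesqD(1)[OF assms(1)] sesqD(1)[OF assms(2)] sesqD(1)[OF assms(3)]) (simp add: algebra_simps)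
 show "b1 w (u + v) - c * b2 w (u + v) - c' * b3 w (u + v)
   = b1 w u - c * b2 w u - c' * b3 w u + (b1 w v - c * b2 w v - c' * b3 w v)"
  using m by (simp only: sesqD(2)[OF assms(1)] sesqD(2)[OF assms(2)] sesqD(2)[OF assms(3)]) (simp add: algebra_simps)
next
 fix a u w assume m: "u \<in> V" "w \<in> V"
 show "b1 (a *\<^sub>C u) w - c * b2 (a *\<^sub>C u) w - c' * b3 (a *\<^sub>C u) w = a * (b1 u w - c * b2 u w - c' * b3 u w)"
  using m by (simp only: sesqD(3)[OF assms(1)] sesqD(3)[OF assms(2)] sesqD(3)[OF assms(3)]) (simp add: algebra_simps)
 show "b1 u (a *\<^sub>C w) - c * b2 u (a *\<^sub>C w) - c' * b3 u (a *\<^sub>C w) = cnj a * (b1 u w - c * b2 u w - c' * b3 u w)"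
  using m by (simp only: sesqD(4)[OF assms(1)] sesqD(4)[OF assms(2)] sesqD(4)[OF assms(3)]) (simp add: algebra_simps)
qed

lemma sesq_adjoint:
 assumes "sesq V b" shows "sesq V (\<lambda>v w. cnj (b w v))"
 unfolding sesq_def
 by (intro conjI ballI allI) (simp_all add: sesqD[OF assms])

lemma antilin_sesq: "sesq V b ==> v \<in> V ==> antilin V (b v)"
 by (simp add: antilin_def sesqD)

lemma sesq_helm:
 assumes "conforming \<G>" shows "sesq (pw p \<G>) (helm \<kappa> \<epsilon> \<G>)"
proof -
 have "sesq (pw p \<G>) (\<lambda>v w. dirichlet_ip (\<Union>\<G>) v w - (of_real (\<kappa>\<^sup>2) + \<i> * of_real \<epsilon>) * l2_ip (\<Union>\<G>) v w
   - \<i> * of_real \<kappa> * boundary_ip \<G> v w)"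
  by (intro sesq_lincomb3 psd_sesq psd_ips psd_boundary_ip conforming_elts assms)
 then show ?thesis unfolding helm_def .
qed

text \<open>For the zero space the supremum ranges over nothing and carries no information; the claim is then trivial.\<close>

lemma inf_sup_estimate:
 assumes stab: "inf_sup C V nrm b" and v: "v \<in> V" and C: "0 \<le> C" and B: "0 \<le> B"
  and bd: "\<And>w. w \<in> V ==> cmod (b v w) \<le> B * nrm w" and pos: "\<And>w. w \<in> V ==> w \<noteq> 0 ==> 0 < nrm w" and n0: "nrm 0 = 0"
 shows "nrm v \<le> C * B"
proof (cases "V - {0} = {}")
 case True
 then have "v = 0" using v by blast
 then show ?thesis using n0 C B by simp
next
 case False
 have "nrm v \<le> C * (SUP w\<in>V - {0}. cmod (b v w) / nrm w)"
  using stab v by (simp add: inf_sup_def zero_fun_def)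
 also have "(SUP w\<in>V - {0}. cmod (b v w) / nrm w) \<le> B"
  by (rule cSUP_least[OF False]) (use bd pos in \<open>auto simp: divide_le_eq\<close>)
 finally show ?thesis using C by (simp add: mult_left_mono)
qed

lemma min_stab_bounds: "0 \<le> s ==> 0 \<le> \<epsilon> ==> 0 \<le> min_stab s \<kappa> \<epsilon> \<and> min_stab s \<kappa> \<epsilon> \<le> s"
 by (simp add: min_stab_def)

lemma psd_restr_image:
 assumes b: "psd V b" and V: "cvs.subspace V"
  and r: "\<And>u v. u \<in> V ==> v \<in> V ==> b (restr F u) (restr F v) = b u v"
 shows "psd (restr F ` V) b"
proof -
 note ad = cvs.subspace_add[OF V] and sc = cvs.subspace_scale[OF V]
 note s = sesqD[OF psd_sesq[OF b]]
 have "sesq (restr F ` V) b"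
  unfolding sesq_def ball_simps
  by (intro conjI ballI allI) (simp_all add: restr_add[symmetric] restr_scl[symmetric] r ad sc s)
 then show ?thesis unfolding psd_def ball_simps
  by (intro conjI ballI) (simp_all add: r psd_nonneg[OF b], rule psd_sym[OF b])
qed

context fe_mesh
begin

lemma l2_definite:
 assumes G: "\<G> \<subseteq> \<T>" and u: "u \<in> pw p \<G>" and z: "mass (\<Union>\<G>) u = 0" and x: "x \<in> \<Union>\<G>"
 shows "u x = 0"
proof -
 have nn: "0 \<le> mass T u" if "T \<in> \<G>" for T
  using ips_nonneg(1)[OF _ pw_single[OF u that]] that G by blast
 have "(\<Sum>T\<in>\<G>. mass T u) = 0"
  using z ip_union(1)[OF elts_subset[OF els G] u u] by simp
 then have z': "mass T u = 0" if "T \<in> \<G>" for T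
  using sum_nonneg_eq_0_iff[OF finite_subset[OF G fin], of "\<lambda>T. mass T u"] nn that by simp
 obtain T where T: "T \<in> \<G>" "x \<in> T" using x by blast
 have "(cmod (u x))\<^sup>2 \<le> invC p K * K\<^sup>2 / h\<^sup>2 * mass T u"
  by (rule local_sup) (use T G pw_single[OF u] in auto)
 then show ?thesis using z'[OF T(1)] by simp
qed

lemma local_l2_definite:
 assumes G: "\<G> \<subseteq> \<T>" and u: "u \<in> fe_local p \<T> \<G>" and z: "mass (\<Union>\<G>) u = 0"
 shows "u = 0"
proof (rule ext)
 fix x
 have "u x = 0"
  using l2_definite[OF G subsetD[OF local_pw[OF G] u] z, of x] local_outside[OF u, of x] by blast
 then show "u x = 0 x" by (simp add: fapply)
qed

lemma fe_local_self: "fe_local p \<T> \<T> = V"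
proof -
 have "restr (\<Union>\<T>) v = v" if "v \<in> V" for v using fe_outside[OF that] by (auto simp: restr_def fun_eq_iff)
 then show ?thesis by (simp add: fe_local_def)
qed

lemma local_norm1:
 assumes G: "\<G> \<subseteq> \<T>" and \<kappa>: "0 < \<kappa>"
 shows "u \<in> fe_local p \<T> \<G> ==> u \<noteq> 0 ==> 0 < norm1 \<kappa> (\<Union>\<G>) u" "norm1 \<kappa> (\<Union>\<G>) 0 = 0"
  "u \<in> pw p \<G> ==> 0 \<le> norm1 \<kappa> (\<Union>\<G>) u" "u \<in> pw p \<G> ==> (norm1 \<kappa> (\<Union>\<G>) u)\<^sup>2 = energy1 \<kappa> (\<Union>\<G>) u"
proof -
 note E = elts_subset[OF els G] and s = psd_sesq[OF psd_ip1[OF elts_subset[OF els G]]]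
 show "norm1 \<kappa> (\<Union>\<G>) 0 = 0"
  unfolding norm1_def using sesq_zero(1)[OF s pw_subspace cvs.subspace_0[OF pw_subspace]] by simp
 show "u \<in> pw p \<G> ==> 0 \<le> norm1 \<kappa> (\<Union>\<G>) u" "u \<in> pw p \<G> ==> (norm1 \<kappa> (\<Union>\<G>) u)\<^sup>2 = energy1 \<kappa> (\<Union>\<G>) u"
  unfolding norm1_def using psd_nonneg[OF psd_ip1[OF E]] by auto
 assume u: "u \<in> fe_local p \<T> \<G>" "u \<noteq> 0"
 then have up: "u \<in> pw p \<G>" using local_pw[OF G] by blast
 have "0 < mass (\<Union>\<G>) u"
  using local_l2_definite[OF G u(1)] u(2) psd_nonneg[OF psd_ips(1)[OF E] up] by fastforce
 moreover have "0 \<le> energy (\<Union>\<G>) u" by (rule psd_nonneg[OF psd_ips(2)[OF E] up])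
 ultimately show "0 < norm1 \<kappa> (\<Union>\<G>) u" using \<kappa> by (simp add: norm1_def norm1_sq_eq add_nonneg_pos)
qed

lemma ips_supported:
 assumes G: "\<G> \<subseteq> \<T>" and v: "v \<in> V" and w: "w \<in> V" and z: "\<And>T x. T \<in> \<T> ==> T \<notin> \<G> ==> x \<in> T ==> w x = 0"
 shows "l2_ip (\<Union>\<T>) v w = l2_ip (\<Union>\<G>) v w" "dirichlet_ip (\<Union>\<T>) v w = dirichlet_ip (\<Union>\<G>) v w"
proof -
 have p: "v \<in> pw p \<T>" "w \<in> pw p \<T>" using v w fe_pw by auto
 then have q: "v \<in> pw p \<G>" "w \<in> pw p \<G>" using pw_mono[OF G] by auto
 note z0 = ip1_zero_elt(3,4)[OF _ w v z]
 show "l2_ip (\<Union>\<T>) v w = l2_ip (\<Union>\<G>) v w"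
  unfolding ip_union[OF els p] ip_union[OF elts_subset[OF els G] q]
  by (rule sum.mono_neutral_right[OF fin G]) (intro ballI, rule z0(1), auto)
 show "dirichlet_ip (\<Union>\<T>) v w = dirichlet_ip (\<Union>\<G>) v w"
  unfolding ip_union[OF els p] ip_union[OF elts_subset[OF els G] q]
  by (rule sum.mono_neutral_right[OF fin G]) (intro ballI, rule z0(2), auto)
qed

lemma vanish_outside_element:
 assumes G: "\<G> \<subseteq> \<T>" and w: "w \<in> fe_local p \<T> \<G>" and z: "\<And>x. x \<in> frontier (\<Union>\<G>) ==> w x = 0"
  and T: "T \<in> \<T>" "T \<notin> \<G>" "x \<in> T"
 shows "w x = 0"
 using outer_point_frontier[OF G T] local_outside[OF w] z by blast

text \<open>Test functions that vanish on the frontier of a subdomain see neither of the two boundary integrals,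
 so the local and the global form agree on them.\<close>

lemma helm_interior_test:
 assumes G: "\<G> \<subseteq> \<T>" and v: "v \<in> V" and w: "w \<in> fe_local p \<T> \<G>" and z: "\<And>x. x \<in> frontier (\<Union>\<G>) ==> w x = 0"
 shows "helm \<kappa> \<epsilon> \<G> (restr (\<Union>\<G>) v) w = helm \<kappa> \<epsilon> \<T> v w"
proof -
 have wV: "w \<in> V" by (rule zero_extension[OF G w z])
 have q: "v \<in> pw p \<G>" "w \<in> pw p \<G>" using v wV fe_pw pw_mono[OF G] by auto
 have "w x = 0" if "x \<in> frontier (\<Union>\<T>)" for x
 proof (cases "x \<in> \<Union>\<G>")
  case True
  have "interior (\<Union>\<G>) \<subseteq> interior (\<Union>\<T>)" by (intro interior_mono Union_mono G)
  then have "x \<notin> interior (\<Union>\<G>)" using that by (auto simp: frontier_def)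
  then have "x \<in> frontier (\<Union>\<G>)" using True closure_subset[of "\<Union>\<G>"] by (auto simp only: frontier_def)
  then show ?thesis by (rule z)
 qed (rule local_outside[OF w])
 then have "boundary_ip \<T> v w = 0" by (rule boundary_ip_zero_right[OF conf])
 moreover have "boundary_ip \<G> (restr (\<Union>\<G>) v) w = 0" by (rule boundary_ip_zero_right[OF conforming_subset[OF conf G] z])
 moreover have "l2_ip (\<Union>\<G>) (restr (\<Union>\<G>) v) w = l2_ip (\<Union>\<G>) v w"
  by (rule ip_cong(1)[OF elts_subset[OF els G] q]) (auto simp: restr_def)
 moreover have "dirichlet_ip (\<Union>\<G>) (restr (\<Union>\<G>) v) w = dirichlet_ip (\<Union>\<G>) v w"
  by (rule ip_cong(2)[OF elts_subset[OF els G] q]) (auto simp: restr_def)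
 ultimately show ?thesis
  unfolding helm_def using ips_supported[OF G v wV vanish_outside_element[OF G w z]] by simp
qed

text \<open>The functional \<open>b(u, \<cdot>)\<close> only sees the trace of the test function, so the Riesz theorem on the
 trace space produces the boundary datum of \<open>u\<close>.\<close>

lemma harmonic_spaceI:
 assumes G: "\<G> \<subseteq> \<T>" and u: "u \<in> fe_local p \<T> \<G>"
  and nd: "\<And>u. u \<in> fe_local p \<T> \<G> ==> (\<forall>w\<in>fe_local p \<T> \<G>. helm \<kappa> \<epsilon> \<G> u w = 0) ==> u = 0"
  and z: "\<And>w. w \<in> fe_local p \<T> \<G> ==> (\<And>x. x \<in> frontier (\<Union>\<G>) ==> w x = 0) ==> helm \<kappa> \<epsilon> \<G> u w = 0"
 shows "u \<in> harmonic_space p \<T> \<kappa> \<epsilon> \<G>"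
proof -
 let ?W = "fe_local p \<T> \<G>" and ?F = "frontier (\<Union>\<G>)" and ?a = "helm \<kappa> \<epsilon> \<G>"
 note cG = conforming_subset[OF conf G]
 have W: "cvs.subspace ?W" by (rule local_subspace)
 have sub: "?W \<subseteq> pw p \<G>" by (rule local_pw[OF G])
 have sa: "sesq ?W ?a" by (rule sesq_subset[OF sesq_helm[OF cG] sub])
 have pb: "psd ?W (boundary_ip \<G>)" by (rule psd_subset[OF psd_boundary_ip[OF cG] sub])
 have cong: "boundary_ip \<G> (restr ?F v) (restr ?F w) = boundary_ip \<G> v w"
  "boundary_ip \<G> v (restr ?F w) = boundary_ip \<G> v w" for v w
  by (rule boundary_ip_cong[OF cG]; simp add: restr_def)+
 have tr: "fe_trace p \<T> \<G> = restr ?F ` ?W" by (simp add: fe_trace_def)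
 have pt: "psd (fe_trace p \<T> \<G>) (boundary_ip \<G>)" unfolding tr by (rule psd_restr_image[OF pb W cong(1)])
 have ft: "fdim (fe_trace p \<T> \<G>)" unfolding tr by (rule restr_image_fdim[OF local_fdim])
 have dt: "t = 0" if t: "t \<in> fe_trace p \<T> \<G>" "boundary_ip \<G> t t = 0" for t
 proof -
  obtain w where w: "w \<in> ?W" "t = restr ?F w" using t(1) unfolding tr by blast
  then have "boundary_ip \<G> w w = 0" using t(2) cong(1) by simp
  then have "w x = 0" if "x \<in> ?F" for x using boundary_ip_zero_frontier[OF cG subsetD[OF sub w(1)] _ that] by blast
  then show ?thesis by (auto simp: w(2) restr_def fun_eq_iff fapply)
 qed
 define F where "F t = ?a u (SOME w. w \<in> ?W \<and> restr ?F w = t)" for t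
 have F: "F (restr ?F w) = ?a u w" if w: "w \<in> ?W" for w
 proof -
  define w' where "w' = (SOME w'. w' \<in> ?W \<and> restr ?F w' = restr ?F w)"
  have "w' \<in> ?W \<and> restr ?F w' = restr ?F w" unfolding w'_def
   by (rule someI_ex[of "\<lambda>w'. w' \<in> ?W \<and> restr ?F w' = restr ?F w"]) (use w in blast)
  then have w': "w' \<in> ?W" "restr ?F w' = restr ?F w" by auto
  have "(w' - w) x = 0" if "x \<in> ?F" for x using fun_cong[OF w'(2), of x] that by (simp add: restr_def fapply)
  then have "?a u (w' - w) = 0" using z[OF cvs.subspace_diff[OF W w'(1) w]] by blast
  then show ?thesis unfolding F_def w'_def[symmetric] sesq_diff(2)[OF sa W w'(1) w u] by simp
 qed
 have aF: "antilin (fe_trace p \<T> \<G>) F"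
  unfolding antilin_def tr ball_simps
  by (intro conjI ballI allI)
   (simp_all only: restr_add[symmetric] restr_scl[symmetric] F cvs.subspace_add[OF W] cvs.subspace_scale[OF W]
    sesqD[OF sa] u)
 obtain g where g: "g \<in> fe_trace p \<T> \<G>" "\<And>t. t \<in> fe_trace p \<T> \<G> ==> boundary_ip \<G> g t = F t"
  using riesz_unique_solution[OF ft pt dt aF] by blast
 have eq: "?a u w = boundary_ip \<G> g w" if w: "w \<in> ?W" for w
 proof -
  have "boundary_ip \<G> g (restr ?F w) = F (restr ?F w)" by (rule g(2)) (use w in \<open>simp add: tr\<close>)
  then show ?thesis using F[OF w] cong(2) by simp
 qed
 have "\<exists>!u. u \<in> ?W \<and> (\<forall>w\<in>?W. ?a u w = boundary_ip \<G> g w)"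
 proof (rule ex1I[of _ u])
  show "u \<in> ?W \<and> (\<forall>w\<in>?W. ?a u w = boundary_ip \<G> g w)" using u eq by blast
  fix u' assume u': "u' \<in> ?W \<and> (\<forall>w\<in>?W. ?a u' w = boundary_ip \<G> g w)"
  then have "u' - u = 0"
   by (intro nd cvs.subspace_diff[OF W] ballI) (use u eq sesq_diff(1)[OF sa W] in auto)
  then show "u' = u" by simp
 qed
 then have "harmonic_ext p \<T> \<kappa> \<epsilon> \<G> g = u"
  unfolding harmonic_ext_def by (rule variational_solution(3)) (use u eq in auto)
 then show ?thesis unfolding harmonic_space_def using g(1) by blast
qed

end

lemma complex_spanI: "(\<lambda>x. \<Sum>i\<in>I. c i * f i x) \<in> complex_span I f"
 by (auto simp: complex_span_def)

text \<open>The eigenfunctions below the cutoff diagonalise both forms, which gives the bound with the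
 largest of the eigenvalues that were left out.\<close>

lemma spectral_split:
 assumes b: "psd W b" and W: "cvs.subspace W" and B: "sesq W' b" and W': "cvs.subspace W'" and HW: "H \<subseteq> W"
  and D: "\<And>u. D u \<in> W'" "\<And>u v. D (u + v) = D u + D v" "\<And>c u. D (c *\<^sub>C u) = c *\<^sub>C D u"
  and sp: "complex_span {1..m} \<xi> = H"
  and on: "\<And>i j. i \<in> {1..m} ==> j \<in> {1..m} ==> b (\<xi> i) (\<xi> j) = (if i = j then 1 else 0)"
  and mono: "\<And>i j. i \<in> {1..m} ==> j \<in> {i..m} ==> ev i \<le> ev j"
  and eig: "\<And>i \<theta>. i \<in> {1..m} ==> \<theta> \<in> H ==> b (D (\<xi> i)) (D \<theta>) = of_real (ev i) * b (\<xi> i) \<theta>"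
  and cut: "cutoff_index \<rho> m ev k" and \<phi>: "\<phi> \<in> H"
 obtains \<phi>0 \<phi>1 where "\<phi> = \<phi>0 + \<phi>1" "\<phi>0 \<in> complex_span {k..m} \<xi>" "\<phi>1 \<in> W"
  "Re (b (D \<phi>1) (D \<phi>1)) \<le> \<rho>\<^sup>2 * Re (b \<phi> \<phi>)"
proof -
 have k: "1 \<le> k" "k \<le> m + 1" "2 \<le> k ==> ev (k - 1) < \<rho>\<^sup>2" using cut by (auto simp: cutoff_index_def)
 obtain c where c: "\<phi> = (\<lambda>x. \<Sum>i\<in>{1..m}. c i * \<xi> i x)" using \<phi> unfolding sp[symmetric] complex_span_def by blast
 have comb: "(\<lambda>x. \<Sum>i\<in>I. c i * \<xi> i x) = (\<Sum>i\<in>I. c i *\<^sub>C \<xi> i)" for I by (simp add: fun_eq_iff fapply)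
 have sub: "(\<Sum>i\<in>I. c i *\<^sub>C \<xi> i) \<in> H" if "I \<subseteq> {1..m}" for I
 proof -
  have "(\<lambda>x. \<Sum>i\<in>{1..m}. (if i \<in> I then c i else 0) * \<xi> i x) \<in> H" unfolding sp[symmetric] by (rule complex_spanI)
  also have "(\<lambda>x. \<Sum>i\<in>{1..m}. (if i \<in> I then c i else 0) * \<xi> i x) = (\<lambda>x. \<Sum>i\<in>I. c i * \<xi> i x)"
   using that by (intro ext sum.mono_neutral_cong_right) auto
  finally show ?thesis unfolding comb .
 qed
 have xH: "\<xi> i \<in> H" if "i \<in> {1..m}" for i
 proof -
  have "(\<lambda>x. \<Sum>j\<in>{1..m}. (if j = i then 1 else 0) * \<xi> j x) \<in> H" unfolding sp[symmetric] by (rule complex_spanI)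
  also have "(\<lambda>x. \<Sum>j\<in>{1..m}. (if j = i then 1 else 0) * \<xi> j x) = \<xi> i"
   using that by (simp add: fun_eq_iff if_distrib[of "\<lambda>c. c * _"] sum.delta cong: if_cong)
  finally show ?thesis .
 qed
 have xW: "\<xi> i \<in> W" if "i \<in> {1..m}" for i using xH[OF that] HW by blast
 note sb = psd_sesq[OF b]
 have coef: "b (\<xi> i) (\<Sum>j\<in>I. c j *\<^sub>C \<xi> j) = (if i \<in> I then cnj (c i) else 0)" if I: "I \<subseteq> {1..m}" and i: "i \<in> {1..m}" for I i
 proof -
  have fI: "finite I" using I finite_subset by blast
  have "b (\<xi> i) (\<Sum>j\<in>I. c j *\<^sub>C \<xi> j) = (\<Sum>j\<in>I. b (\<xi> i) (c j *\<^sub>C \<xi> j))"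
   by (rule sesq_sum(2)[OF sb W]) (use I i xW cvs.subspace_scale[OF W] in auto)
  also have "... = (\<Sum>j\<in>I. cnj (c j) * (if i = j then 1 else 0))"
  proof (rule sum.cong[OF refl])
   fix j assume "j \<in> I"
   then have "j \<in> {1..m}" using I by blast
   then show "b (\<xi> i) (c j *\<^sub>C \<xi> j) = cnj (c j) * (if i = j then 1 else 0)"
    using sesqD(4)[OF sb xW[OF i] xW] on[OF i] by simp
  qed
  also have "... = (if i \<in> I then cnj (c i) else 0)" using fI by (simp add: if_distrib[of "\<lambda>x. _ * x"] cong: if_cong)
  finally show ?thesis .
 qed
 define \<phi>1 where "\<phi>1 = (\<Sum>i\<in>{1..<k}. c i *\<^sub>C \<xi> i)"
 have I: "{1..<k} \<subseteq> {1..m}" using k by auto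
 have H1: "\<phi>1 \<in> H" unfolding \<phi>1_def by (rule sub[OF I])
 have \<phi>e: "\<phi> = (\<Sum>i\<in>{1..m}. c i *\<^sub>C \<xi> i)" using c comb by simp
 have bp: "b \<phi> \<phi> = (\<Sum>i\<in>{1..m}. of_real ((cmod (c i))\<^sup>2))"
 proof -
  have "b \<phi> \<phi> = (\<Sum>i\<in>{1..m}. b (c i *\<^sub>C \<xi> i) \<phi>)"
   by (subst (1) \<phi>e, rule sesq_sum(1)[OF sb W]) (use xW cvs.subspace_scale[OF W] \<phi> HW in auto)
  also have "... = (\<Sum>i\<in>{1..m}. c i * b (\<xi> i) \<phi>)"
   by (rule sum.cong[OF refl], rule sesqD(3)[OF sb xW]) (use \<phi> HW in auto)
  also have "... = (\<Sum>i\<in>{1..m}. of_real ((cmod (c i))\<^sup>2))"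
  proof (rule sum.cong[OF refl])
   fix i assume i: "i \<in> {1..m}"
   have "b (\<xi> i) \<phi> = cnj (c i)" using coef[OF subset_refl i] i by (simp only: \<phi>e if_True)
   then show "c i * b (\<xi> i) \<phi> = of_real ((cmod (c i))\<^sup>2)" by (simp only: complex_norm_square)
  qed
  finally show ?thesis .
 qed
 have Ds: "D (\<Sum>i\<in>A. c i *\<^sub>C \<xi> i) = (\<Sum>i\<in>A. c i *\<^sub>C D (\<xi> i))" if "finite A" for A
  using that
 proof (induction A rule: finite_induct)
  case empty
  have "D 0 = 0" using D(3)[of 0 0] by simp
  then show ?case by simp
 qed (simp add: D)
 have "b (D \<phi>1) (D \<phi>1) = (\<Sum>i\<in>{1..<k}. b (c i *\<^sub>C D (\<xi> i)) (D \<phi>1))"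
  by (subst (1) \<phi>1_def, subst Ds, simp, rule sesq_sum(1)[OF B W']) (use D(1) cvs.subspace_scale[OF W'] in auto)
 also have "... = (\<Sum>i\<in>{1..<k}. of_real (ev i * (cmod (c i))\<^sup>2))"
 proof (rule sum.cong[OF refl])
  fix i assume i: "i \<in> {1..<k}"
  then have im: "i \<in> {1..m}" using I by blast
  have "b (c i *\<^sub>C D (\<xi> i)) (D \<phi>1) = c i * (of_real (ev i) * cnj (c i))"
   unfolding sesqD(3)[OF B D(1) D(1)] eig[OF im H1] using coef[OF I im] i by (simp add: \<phi>1_def)
  then show "b (c i *\<^sub>C D (\<xi> i)) (D \<phi>1) = of_real (ev i * (cmod (c i))\<^sup>2)"
   by (simp only: of_real_mult complex_norm_square mult_ac)
 qed
 finally have "Re (b (D \<phi>1) (D \<phi>1)) = (\<Sum>i\<in>{1..<k}. ev i * (cmod (c i))\<^sup>2)" by (simp flip: of_real_sum)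
 also have "... \<le> (\<Sum>i\<in>{1..<k}. \<rho>\<^sup>2 * (cmod (c i))\<^sup>2)"
 proof (rule sum_mono, rule mult_right_mono)
  fix i assume i: "i \<in> {1..<k}"
  then have "ev i \<le> ev (k - 1)" using k by (intro mono) auto
  then show "ev i \<le> \<rho>\<^sup>2" using k(3) i by fastforce
 qed simp
 also have "... \<le> (\<Sum>i\<in>{1..m}. \<rho>\<^sup>2 * (cmod (c i))\<^sup>2)" by (rule sum_mono2[OF _ I]) auto
 also have "... = \<rho>\<^sup>2 * Re (b \<phi> \<phi>)" by (simp add: bp sum_distrib_left)
 finally have bound: "Re (b (D \<phi>1) (D \<phi>1)) \<le> \<rho>\<^sup>2 * Re (b \<phi> \<phi>)" .
 have e: "{1..m} = {k..m} \<union> {1..<k}" using k by auto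
 have "\<phi> = (\<Sum>i\<in>{k..m}. c i *\<^sub>C \<xi> i) + \<phi>1"
  unfolding \<phi>e \<phi>1_def e by (rule sum.union_disjoint) auto
 moreover have "(\<Sum>i\<in>{k..m}. c i *\<^sub>C \<xi> i) \<in> complex_span {k..m} \<xi>"
  unfolding comb[symmetric] by (rule complex_spanI)
 ultimately show thesis using that[OF _ _ _ bound] H1 HW by blast
qed

section \<open>Local solvers\<close>

context fe_mesh
begin

lemma ext_on_patch:
 assumes G: "\<G> \<subseteq> \<T>" and u: "u \<in> V" and T: "T \<in> \<G>" and x: "x \<in> T"
 shows "I\<^sub>h (restr (\<Union>\<G>) u) x = u x"
proof -
 have TT: "T \<in> \<T>" using G T by blast
 have "I\<^sub>h (restr (\<Union>\<G>) u) x = I\<^sub>h u x"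
  unfolding interp_local[OF TT x]
  by (rule lagr_interp_cong) (use tnodes_sub(1)[OF TT] T in \<open>auto simp: restr_def\<close>)
 then show ?thesis using interp_id[OF u] by simp
qed

definition inv_grad :: real where "inv_grad = 8 * disc_area * invC p K * K\<^sup>2"

lemma inv_grad_pos: "0 < inv_grad"
 using disc_area_pos invC_pos[OF p K] K by (simp add: inv_grad_def)

lemma inverse_estimate:
 assumes "u \<in> V" shows "energy (\<Union>\<T>) u \<le> inv_grad / h\<^sup>2 * mass (\<Union>\<T>) u"
proof -
 have up: "u \<in> pw p \<T>" using assms fe_pw by blast
 have loc: "energy T u \<le> inv_grad / h\<^sup>2 * mass T u" if T: "T \<in> \<T>" for T
 proof -
  have d0: "0 < diameter T" by (rule elt_diameter_pos[OF elt[OF T]])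
  have "h\<^sup>2 \<le> (K * diameter T)\<^sup>2" by (intro power_mono le_diam[OF T]) (use h_pos in simp)
  then have "1 / (diameter T)\<^sup>2 \<le> K\<^sup>2 / h\<^sup>2" using d0 h_pos by (simp add: field_simps)
  then have "8 * disc_area * invC p K * (1 / (diameter T)\<^sup>2) \<le> 8 * disc_area * invC p K * (K\<^sup>2 / h\<^sup>2)"
   using disc_area_pos invC_pos[OF p K] by (intro mult_left_mono) auto
  then have c: "8 * disc_area * invC p K / (diameter T)\<^sup>2 \<le> inv_grad / h\<^sup>2" by (simp add: inv_grad_def)
  have "energy T u \<le> 8 * disc_area * invC p K / (diameter T)\<^sup>2 * mass T u"
   by (rule local_inverse_grad[OF p K fat[OF T] pw_single[OF up T]])
  also have "... \<le> inv_grad / h\<^sup>2 * mass T u"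
   by (rule mult_right_mono[OF c ips_nonneg(1)[OF T pw_single[OF up T]]])
  finally show ?thesis .
 qed
 show ?thesis
  unfolding ip_union[OF els up up] Re_sum sum_distrib_left by (rule sum_mono[OF loc])
qed

lemma boundary_ip_crude:
 assumes "u \<in> V" shows "Re (boundary_ip \<T> u u) \<le> 9 * invC p K * K / h * mass (\<Union>\<T>) u"
proof -
 have up: "u \<in> pw p \<T>" using assms fe_pw by blast
 have "(\<Sum>T | T \<in> \<T> \<and> T \<inter> frontier (\<Union>\<T>) \<noteq> {}. mass T u) \<le> (\<Sum>T\<in>\<T>. mass T u)"
  by (rule sum_mono2[OF fin]) (use ips_nonneg(1) pw_single[OF up] in auto)
 also have "... = mass (\<Union>\<T>) u" by (simp add: ip_union(1)[OF els up up])
 finally have "9 * invC p K * K / h * (\<Sum>T | T \<in> \<T> \<and> T \<inter> frontier (\<Union>\<T>) \<noteq> {}. mass T u)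
   \<le> 9 * invC p K * K / h * mass (\<Union>\<T>) u"
  using invC_pos[OF p K] K h_pos by (intro mult_left_mono) auto
 then show ?thesis using boundary_ip_le_local[OF conf p K fat le_diam h_pos up] by linarith
qed

lemma norm1_components:
 assumes G: "\<G> \<subseteq> \<T>" and u: "u \<in> pw p \<G>" and \<kappa>: "0 < \<kappa>"
 shows "snorm (dirichlet_ip (\<Union>\<G>)) u \<le> norm1 \<kappa> (\<Union>\<G>) u" "\<kappa> * snorm (l2_ip (\<Union>\<G>)) u \<le> norm1 \<kappa> (\<Union>\<G>) u"
proof -
 note n = psd_nonneg[OF psd_ips(1)[OF elts_subset[OF els G]] u] psd_nonneg[OF psd_ips(2)[OF elts_subset[OF els G]] u]
 show "snorm (dirichlet_ip (\<Union>\<G>)) u \<le> norm1 \<kappa> (\<Union>\<G>) u"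
  unfolding norm1_def snorm_def norm1_sq_eq using n by simp
 have "\<kappa> * snorm (l2_ip (\<Union>\<G>)) u = sqrt (\<kappa>\<^sup>2 * mass (\<Union>\<G>) u)"
  using \<kappa> by (simp add: snorm_def real_sqrt_mult)
 also have "... \<le> norm1 \<kappa> (\<Union>\<G>) u" unfolding norm1_def norm1_sq_eq using n by simp
 finally show "\<kappa> * snorm (l2_ip (\<Union>\<G>)) u \<le> norm1 \<kappa> (\<Union>\<G>) u" .
qed

lemma interior_form_bound:
 assumes G: "\<G> \<subseteq> \<T>" and u: "u \<in> pw p \<G>" and w: "w \<in> pw p \<G>" and \<kappa>: "0 < \<kappa>0" "\<kappa>0 \<le> \<kappa>" and \<epsilon>: "0 \<le> \<epsilon>" "\<epsilon> \<le> \<kappa>"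
 shows "cmod (dirichlet_ip (\<Union>\<G>) u w - (of_real (\<kappa>\<^sup>2) + \<i> * of_real \<epsilon>) * l2_ip (\<Union>\<G>) u w)
  \<le> (2 + 1 / \<kappa>0) * (norm1 \<kappa> (\<Union>\<G>) u * norm1 \<kappa> (\<Union>\<G>) w)"
proof -
 note E = elts_subset[OF els G]
 have k: "0 < \<kappa>" using \<kappa> by linarith
 let ?n = "norm1 \<kappa> (\<Union>\<G>)"
 have n0: "0 \<le> ?n u" "0 \<le> ?n w" using local_norm1(3)[OF G k] u w by auto
 have d: "cmod (dirichlet_ip (\<Union>\<G>) u w) \<le> ?n u * ?n w"
  by (rule order_trans[OF psd_cauchy_schwarz[OF psd_ips(2)[OF E] pw_subspace u w]])
   (intro mult_mono norm1_components(1)[OF G _ k] u w n0 snorm_nonneg[OF psd_ips(2)[OF E] u] snorm_nonneg[OF psd_ips(2)[OF E] w])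
 have "\<kappa>\<^sup>2 * cmod (l2_ip (\<Union>\<G>) u w) \<le> \<kappa>\<^sup>2 * (snorm (l2_ip (\<Union>\<G>)) u * snorm (l2_ip (\<Union>\<G>)) w)"
  by (intro mult_left_mono psd_cauchy_schwarz[OF psd_ips(1)[OF E] pw_subspace u w]) simp
 also have "... = (\<kappa> * snorm (l2_ip (\<Union>\<G>)) u) * (\<kappa> * snorm (l2_ip (\<Union>\<G>)) w)" by (simp add: power2_eq_square)
 also have "... \<le> ?n u * ?n w"
  by (intro mult_mono norm1_components(2)[OF G _ k] u w n0 mult_nonneg_nonneg
   snorm_nonneg[OF psd_ips(1)[OF E] u] snorm_nonneg[OF psd_ips(1)[OF E] w])
   (use k in auto)
 finally have l: "\<kappa>\<^sup>2 * cmod (l2_ip (\<Union>\<G>) u w) \<le> ?n u * ?n w" .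
 have "\<epsilon> \<le> \<kappa>\<^sup>2 / \<kappa>0"
 proof -
  have "\<kappa> * \<kappa>0 \<le> \<kappa> * \<kappa>" using \<kappa> k by (intro mult_left_mono) auto
  then have "\<epsilon> * \<kappa>0 \<le> \<kappa>\<^sup>2" using \<epsilon> \<kappa> mult_mono[of \<epsilon> \<kappa> \<kappa>0 \<kappa>] by (simp add: power2_eq_square)
  then show ?thesis using \<kappa> by (simp add: le_divide_eq)
 qed
 then have "cmod (of_real (\<kappa>\<^sup>2) + \<i> * of_real \<epsilon>) \<le> (1 + 1 / \<kappa>0) * \<kappa>\<^sup>2"
  using norm_triangle_ineq[of "of_real (\<kappa>\<^sup>2)" "\<i> * of_real \<epsilon>"] \<epsilon> by (simp add: norm_mult norm_power algebra_simps)
 then have "cmod ((of_real (\<kappa>\<^sup>2) + \<i> * of_real \<epsilon>) * l2_ip (\<Union>\<G>) u w) \<le> (1 + 1 / \<kappa>0) * \<kappa>\<^sup>2 * cmod (l2_ip (\<Union>\<G>) u w)"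
  unfolding norm_mult by (rule mult_right_mono) simp
 also have "... \<le> (1 + 1 / \<kappa>0) * (?n u * ?n w)"
  unfolding mult.assoc using l \<kappa> by (intro mult_left_mono) auto
 finally show ?thesis
  using d norm_triangle_ineq4[of "dirichlet_ip (\<Union>\<G>) u w" "(of_real (\<kappa>\<^sup>2) + \<i> * of_real \<epsilon>) * l2_ip (\<Union>\<G>) u w"]
  by (simp add: algebra_simps)
qed

end

text \<open>The numbers \<open>\<kappa>0\<close>, \<open>D\<close>, \<open>r\<close>, \<open>ch\<close> only depend on the domain, the regularity and \<open>\<gamma>\<close>;
 every constant below is a function of these, of \<open>K\<close>, \<open>M\<close> and of the order \<open>p\<close>. The last condition makes
 subdomains small against the wave length.\<close>

locale helmholtz_dd = decomposed_mesh K \<Omega> \<T> p d \<delta> N \<C> \<G> pu for K \<Omega> \<T> p d \<delta> N \<C> \<G> pu +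
 fixes \<kappa> \<epsilon> M \<kappa>0 D r ch \<rho> :: real and z :: pt and m k :: "nat \<Rightarrow> nat" and ev :: "nat \<Rightarrow> nat \<Rightarrow> real"
  and \<xi> :: "nat \<Rightarrow> nat \<Rightarrow> scalar_fun"
 assumes \<kappa>0: "0 < \<kappa>0" "\<kappa>0 \<le> \<kappa>" and eps: "0 \<le> \<epsilon>" "\<epsilon> \<le> \<kappa>" and M: "1 \<le> M"
  and star: "star_shaped_wrt_disc \<Omega> z r" and D: "\<And>x. x \<in> closure \<Omega> ==> norm (x - z) \<le> D" "0 < D"
  and ch: "0 < ch" "1 \<le> ch * \<kappa>\<^sup>2 * h"
  and stab: "inf_sup (M * min_stab (1 + \<kappa>) \<kappa> \<epsilon>) V (norm1 \<kappa> (\<Union>\<T>)) (helm \<kappa> \<epsilon> \<T>)"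
   "inf_sup (M * min_stab (1 + \<kappa>) \<kappa> \<epsilon>) V (norm1 \<kappa> (\<Union>\<T>)) (\<lambda>v w. cnj (helm \<kappa> \<epsilon> \<T> w v))"
  and stab_loc: "\<And>l. l \<in> {1..N} ==> inf_sup (M * min_stab (1 + \<kappa> * diameter (\<Union>(\<C> l))) \<kappa> \<epsilon>)
    (fe_local p \<T> (\<G> l)) (norm1 \<kappa> (\<Union>(\<G> l))) (helm \<kappa> \<epsilon> (\<G> l))"
  and eig: "\<And>l. l \<in> {1..N} ==> eigenpairs p \<T> \<kappa> \<epsilon> (\<G> l) (pu l) (m l) (ev l) (\<xi> l)"
  and cut: "\<And>l. l \<in> {1..N} ==> cutoff_index \<rho> (m l) (ev l) (k l)"
  and \<rho>: "0 < \<rho>" "\<rho> < 1" and kd: "2 * K\<^sup>2 * (\<kappa> * d) \<le> 1"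
begin

abbreviation a where "a \<equiv> helm \<kappa> \<epsilon> \<T>"
abbreviation al where "al l \<equiv> helm \<kappa> \<epsilon> (\<G> l)"
abbreviation nrm where "nrm \<equiv> norm1 \<kappa> (\<Union>\<T>)"
abbreviation nl where "nl l \<equiv> norm1 \<kappa> (S l)"

lemma \<kappa>_pos: "0 < \<kappa>" using \<kappa>0 by linarith

lemma kd1: "\<kappa> * d \<le> 1"
proof -
 have "0 \<le> \<kappa> * d" using \<kappa>_pos d_pos by simp
 moreover have "1 * (\<kappa> * d) \<le> K\<^sup>2 * (\<kappa> * d)" using K calculation by (intro mult_right_mono) (auto simp: one_le_power)
 ultimately show ?thesis using kd by linarith
qed

lemma sesq_a: "sesq V a"
 by (rule sesq_subset[OF sesq_helm[OF conf] fe_pw])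

lemma sesq_al: "l \<in> {1..N} ==> sesq (Vl l) (al l)"
 by (rule sesq_subset[OF sesq_helm[OF G_conf] local_pw[OF G_sub]])

lemma nrm_psd: "psd V (ip1 \<kappa> (\<Union>\<T>))" "l \<in> {1..N} ==> psd (Vl l) (ip1 \<kappa> (S l))" "l \<in> {1..N} ==> psd V (ip1 \<kappa> (S l))"
proof -
 show "psd V (ip1 \<kappa> (\<Union>\<T>))" by (rule psd_subset[OF psd_ip1[OF els] fe_pw])
 show "psd (Vl l) (ip1 \<kappa> (S l))" if "l \<in> {1..N}" by (rule psd_subset[OF psd_ip1[OF G_els] local_pw[OF G_sub]]) (use that in auto)
 show "psd V (ip1 \<kappa> (S l))" if "l \<in> {1..N}" by (rule psd_subset[OF psd_ip1[OF G_els] subsetI[OF fe_pw_G]]) (use that in auto)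
qed

lemma nrm_props: "u \<in> V ==> 0 \<le> nrm u" "u \<in> V ==> (nrm u)\<^sup>2 = energy1 \<kappa> (\<Union>\<T>) u" "u \<in> V ==> u \<noteq> 0 ==> 0 < nrm u" "nrm 0 = 0"
 using local_norm1[OF subset_refl \<kappa>_pos] fe_pw unfolding fe_local_self by auto

lemma nl_props:
 assumes "l \<in> {1..N}"
 shows "u \<in> pw p (\<G> l) ==> 0 \<le> nl l u" "u \<in> pw p (\<G> l) ==> (nl l u)\<^sup>2 = energy1 \<kappa> (S l) u"
  "u \<in> Vl l ==> u \<noteq> 0 ==> 0 < nl l u" "nl l 0 = 0"
 using local_norm1[OF G_sub[OF assms] \<kappa>_pos] by auto

lemma Vl_pw: "l \<in> {1..N} ==> u \<in> Vl l ==> u \<in> pw p (\<G> l)"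
 using local_pw[OF G_sub] by blast

lemma stability:
 assumes v: "v \<in> V" and B: "0 \<le> B"
 shows "(\<And>w. w \<in> V ==> cmod (a v w) \<le> B * nrm w) ==> nrm v \<le> M * (1 + \<kappa>) * B"
  "(\<And>w. w \<in> V ==> cmod (a w v) \<le> B * nrm w) ==> nrm v \<le> M * (1 + \<kappa>) * B"
proof -
 have ms: "0 \<le> min_stab (1 + \<kappa>) \<kappa> \<epsilon> \<and> min_stab (1 + \<kappa>) \<kappa> \<epsilon> \<le> 1 + \<kappa>"
  by (rule min_stab_bounds) (use \<kappa>_pos eps in auto)
 have C0: "0 \<le> M * min_stab (1 + \<kappa>) \<kappa> \<epsilon>" using ms M by simp
 have le: "M * min_stab (1 + \<kappa>) \<kappa> \<epsilon> * B \<le> M * (1 + \<kappa>) * B" using ms M B by (intro mult_mono) auto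
 show "nrm v \<le> M * (1 + \<kappa>) * B" if "\<And>w. w \<in> V ==> cmod (a v w) \<le> B * nrm w"
  by (rule order_trans[OF inf_sup_estimate[OF stab(1) v C0 B that nrm_props(3,4)] le])
 show "nrm v \<le> M * (1 + \<kappa>) * B" if "\<And>w. w \<in> V ==> cmod (a w v) \<le> B * nrm w"
  by (rule order_trans[OF inf_sup_estimate[OF stab(2) v C0 B _ nrm_props(3,4)] le]) (use that in simp)
qed

lemma local_stability:
 assumes l: "l \<in> {1..N}" and v: "v \<in> Vl l" and B: "0 \<le> B" and bd: "\<And>w. w \<in> Vl l ==> cmod (al l v w) \<le> B * nl l w"
 shows "nl l v \<le> M * (1 + K) * B"
proof -
 let ?s = "1 + \<kappa> * diameter (\<Union>(\<C> l))"
 have "\<kappa> * diameter (\<Union>(\<C> l)) \<le> \<kappa> * (K * d)" using C_diameter[OF l] \<kappa>_pos by (intro mult_left_mono) auto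
 also have "... \<le> K" using kd1 K mult_left_mono[of "\<kappa> * d" 1 K] by (simp add: mult_ac)
 finally have s: "?s \<le> 1 + K" by simp
 have "0 \<le> diameter (\<Union>(\<C> l))"
  using dec l d_pos K unfolding overlapping_decomposition_def by (smt (verit) mult_nonneg_nonpos)
 then have "0 \<le> ?s" using \<kappa>_pos by simp
 then have ms: "0 \<le> min_stab ?s \<kappa> \<epsilon> \<and> min_stab ?s \<kappa> \<epsilon> \<le> ?s" by (rule min_stab_bounds[OF _ eps(1)])
 have C0: "0 \<le> M * min_stab ?s \<kappa> \<epsilon>" using ms M by simp
 have le: "M * min_stab ?s \<kappa> \<epsilon> * B \<le> M * (1 + K) * B" using ms s M B by (intro mult_mono) auto
 show ?thesis
  by (rule order_trans[OF inf_sup_estimate[OF stab_loc[OF l] v C0 B bd nl_props(3,4)[OF l]] le])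
qed

lemma local_nondegenerate:
 assumes l: "l \<in> {1..N}" and u: "u \<in> Vl l" and z: "\<forall>w\<in>Vl l. al l u w = 0" shows "u = 0"
proof -
 have "nl l u \<le> M * (1 + K) * 0" by (rule local_stability[OF l u]) (use z in auto)
 then show ?thesis using nl_props(3)[OF l u] by fastforce
qed

lemma nondegenerate: "u \<in> V ==> \<forall>w\<in>V. a u w = 0 ==> u = 0" "u \<in> V ==> \<forall>w\<in>V. a w u = 0 ==> u = 0"
 using stability[of u 0] nrm_props(3)[of u] by fastforce+

definition tc :: real where "tc = trace_const r D \<kappa>0"
definition Ca :: real where "Ca = 2 + 1 / \<kappa>0 + tc"

lemma tc_nonneg: "0 \<le> tc"
 using invC_pos[OF p K] K star D(2) \<kappa>0 by (simp add: tc_def trace_const_def star_shaped_wrt_disc_def)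

lemma Ca_ge: "2 \<le> Ca" using tc_nonneg \<kappa>0 by (simp add: Ca_def)

text \<open>The trace inequality absorbs the factor \<open>\<kappa>\<close>, so the form is bounded uniformly in the wave number.\<close>

lemma boundary_form_bound:
 assumes u: "u \<in> V" and w: "w \<in> V"
 shows "\<kappa> * cmod (boundary_ip \<T> u w) \<le> tc * (nrm u * nrm w)"
proof -
 let ?b = "boundary_ip \<T>"
 note pb = psd_subset[OF psd_boundary_ip[OF conf] fe_pw]
 have t: "sqrt \<kappa> * snorm ?b v \<le> sqrt tc * nrm v" if v: "v \<in> V" for v
 proof -
  have "\<kappa> * Re (?b v v) \<le> tc * energy1 \<kappa> (\<Union>\<T>) v"
   unfolding tc_def by (rule trace_inequality[OF star D \<kappa>0 v])
  then show ?thesis unfolding snorm_def norm1_def by (simp flip: real_sqrt_mult)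
 qed
 have "\<kappa> * cmod (?b u w) \<le> \<kappa> * (snorm ?b u * snorm ?b w)"
  using \<kappa>_pos by (intro mult_left_mono psd_cauchy_schwarz[OF pb V_subspace u w]) auto
 also have "... = (sqrt \<kappa> * snorm ?b u) * (sqrt \<kappa> * snorm ?b w)" using \<kappa>_pos by simp
 also have "... \<le> (sqrt tc * nrm u) * (sqrt tc * nrm w)"
  by (intro mult_mono t u w mult_nonneg_nonneg snorm_nonneg[OF pb] nrm_props(1)) (use \<kappa>_pos tc_nonneg in auto)
 also have "... = tc * (nrm u * nrm w)" using tc_nonneg by simp
 finally show ?thesis .
qed

lemma form_bound:
 assumes u: "u \<in> V" and w: "w \<in> V"
 shows "cmod (a u w) \<le> Ca * (nrm u * nrm w)"
proof -
 have "cmod (a u w) \<le> cmod (dirichlet_ip (\<Union>\<T>) u w - (of_real (\<kappa>\<^sup>2) + \<i> * of_real \<epsilon>) * l2_ip (\<Union>\<T>) u w)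
   + cmod (\<i> * of_real \<kappa> * boundary_ip \<T> u w)"
  unfolding helm_def by (rule norm_triangle_ineq4)
 also have "cmod (\<i> * of_real \<kappa> * boundary_ip \<T> u w) \<le> tc * (nrm u * nrm w)"
  using boundary_form_bound[OF u w] \<kappa>_pos by (simp add: norm_mult)
 also have "cmod (dirichlet_ip (\<Union>\<T>) u w - (of_real (\<kappa>\<^sup>2) + \<i> * of_real \<epsilon>) * l2_ip (\<Union>\<T>) u w)
   \<le> (2 + 1 / \<kappa>0) * (nrm u * nrm w)"
  by (rule interior_form_bound[OF subset_refl _ _ \<kappa>0 eps]) (use u w fe_pw in auto)
 finally show ?thesis by (simp add: Ca_def algebra_simps)
qed

definition ce :: real where "ce = sqrt (ext_const * (inv_grad * ch\<^sup>2 + 1 / \<kappa>0\<^sup>2))"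

lemma ce_nonneg: "0 \<le> ce"
 using ext_const_pos inv_grad_pos by (simp add: ce_def)

text \<open>Extension by zero at the nodes creates gradients of size \<open>1 / h\<close>, hence the factor \<open>\<kappa>\<close>; it is
 compensated by the smallness of \<open>\<rho> \<kappa>\<close> later.\<close>

lemma extension_bound:
 assumes l: "l \<in> {1..N}" and w: "w \<in> Vl l"
 shows "nrm (ext p \<T> w) \<le> ce * \<kappa> * nl l w"
proof -
 let ?E = "ext p \<T> w"
 define n2 where "n2 = mass (S l) w"
 define c where "c = ext_const * (inv_grad * ch\<^sup>2 + 1 / \<kappa>0\<^sup>2)"
 note wp = Vl_pw[OF l w]
 have EV: "?E \<in> V" by (simp add: ext_def interp_fe)
 have n20: "0 \<le> n2" unfolding n2_def by (rule psd_nonneg[OF psd_ips(1)[OF G_els[OF l]] wp])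
 have nn: "\<kappa>\<^sup>2 * n2 \<le> (nl l w)\<^sup>2"
  unfolding nl_props(2)[OF l wp] norm1_sq_eq n2_def
  using psd_nonneg[OF psd_ips(2)[OF G_els[OF l]] wp] by simp
 have E2: "mass (\<Union>\<T>) ?E \<le> ext_const * n2"
  unfolding ext_def n2_def by (rule ext_l2[OF G_sub[OF l] w])
 have "1 / h\<^sup>2 \<le> ch\<^sup>2 * \<kappa> ^ 4"
 proof -
  have "1 \<le> (ch * \<kappa>\<^sup>2 * h)\<^sup>2" using ch(2) by (simp add: one_le_power)
  then show ?thesis using h_pos by (simp add: divide_le_eq power_mult_distrib power_mult[symmetric])
 qed
 then have hi: "inv_grad * (1 / h\<^sup>2) \<le> inv_grad * (ch\<^sup>2 * \<kappa> ^ 4)" using inv_grad_pos by (intro mult_left_mono) auto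
 have kk: "\<kappa>\<^sup>2 \<le> \<kappa> ^ 4 * (1 / \<kappa>0\<^sup>2)"
 proof -
  have "\<kappa>0\<^sup>2 \<le> \<kappa>\<^sup>2" using \<kappa>0 by (intro power_mono) auto
  then have "\<kappa>\<^sup>2 * \<kappa>0\<^sup>2 \<le> \<kappa>\<^sup>2 * \<kappa>\<^sup>2" by (intro mult_left_mono) auto
  then show ?thesis using \<kappa>0 by (simp add: le_divide_eq power_add[symmetric])
 qed
 have "(nrm ?E)\<^sup>2 = energy (\<Union>\<T>) ?E + \<kappa>\<^sup>2 * mass (\<Union>\<T>) ?E"
  unfolding nrm_props(2)[OF EV] norm1_sq_eq ..
 also have "... \<le> (inv_grad * (1 / h\<^sup>2) + \<kappa>\<^sup>2) * mass (\<Union>\<T>) ?E"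
  using inverse_estimate[OF EV] by (simp add: algebra_simps)
 also have "... \<le> (inv_grad * (ch\<^sup>2 * \<kappa> ^ 4) + \<kappa> ^ 4 * (1 / \<kappa>0\<^sup>2)) * (ext_const * n2)"
  using inv_grad_pos psd_nonneg[OF psd_ips(1)[OF els] subsetD[OF fe_pw EV]]
  by (intro mult_mono[OF add_mono[OF hi kk] E2]) auto
 also have "... = c * \<kappa>\<^sup>2 * (\<kappa>\<^sup>2 * n2)" by (simp add: c_def algebra_simps power_add[symmetric])
 also have "... \<le> c * \<kappa>\<^sup>2 * (nl l w)\<^sup>2"
  using nn ext_const_pos inv_grad_pos by (intro mult_left_mono) (auto simp: c_def)
 also have "... = (ce * \<kappa> * nl l w)\<^sup>2"
  using ext_const_pos inv_grad_pos by (simp add: ce_def c_def power_mult_distrib)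
 finally show ?thesis
  by (rule power2_le_imp_le) (use ce_nonneg \<kappa>_pos nl_props(1)[OF l wp] in auto)
qed

abbreviation Gp where "Gp l \<equiv> add_layer \<T> (\<G> l)"

definition Cb :: real where "Cb = (2 + 1 / \<kappa>0) * ce + 9 * invC p K * K * ext_const * ch"

lemma Cb_nonneg: "0 \<le> Cb"
 using ce_nonneg \<kappa>0 invC_pos[OF p K] K ext_const_pos ch by (simp add: Cb_def)

text \<open>The functional is localised to the patch of elements that touch the subdomain. On the boundary
 of \<open>\<Omega>\<close> the function may be replaced by the interpolant of its restriction to the patch, because the
 two agree wherever the extended test function does not vanish.\<close>

lemma localised_form_bound:
 assumes l: "l \<in> {1..N}" and v: "v \<in> V" and w: "w \<in> Vl l"
 shows "cmod (a v (ext p \<T> w)) \<le> Cb * \<kappa> * (norm1 \<kappa> (\<Union>(Gp l)) v * nl l w)"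
proof -
 let ?E = "ext p \<T> w" and ?U = "\<Union>(Gp l)"
 define v' where "v' = I\<^sub>h (restr ?U v)"
 have GP: "Gp l \<subseteq> \<T>" by (auto simp: add_layer_def)
 have EV: "?E \<in> V" by (simp add: ext_def interp_fe)
 have v'V: "v' \<in> V" by (simp add: v'_def interp_fe)
 have Ez: "?E x = 0" if "T \<in> \<T>" "T \<notin> Gp l" "x \<in> T" for T x
 proof -
  have "T \<inter> S l = {}" using that by (auto simp: add_layer_def)
  then show ?thesis unfolding ext_def by (rule ext_zero[OF w that(1) _ that(3)])
 qed
 have sp1: "l2_ip (\<Union>\<T>) v ?E = l2_ip ?U v ?E" by (rule ips_supported(1)[OF GP v EV]) (rule Ez)
 have sp2: "dirichlet_ip (\<Union>\<T>) v ?E = dirichlet_ip ?U v ?E" by (rule ips_supported(2)[OF GP v EV]) (rule Ez)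
 have vp: "v \<in> pw p (Gp l)" "?E \<in> pw p (Gp l)" using v EV fe_pw pw_mono[OF GP] by auto
 have nEG: "norm1 \<kappa> ?U ?E \<le> nrm ?E"
 proof -
  have "l2_ip (\<Union>\<T>) ?E ?E = l2_ip ?U ?E ?E" by (rule ips_supported(1)[OF GP EV EV]) (rule Ez)
  moreover have "dirichlet_ip (\<Union>\<T>) ?E ?E = dirichlet_ip ?U ?E ?E" by (rule ips_supported(2)[OF GP EV EV]) (rule Ez)
  ultimately show ?thesis by (simp add: norm1_def norm1_sq_eq)
 qed
 have n0: "0 \<le> norm1 \<kappa> ?U v" "0 \<le> nl l w" using local_norm1(3)[OF GP \<kappa>_pos vp(1)] nl_props(1)[OF l Vl_pw[OF l w]] by auto
 have int: "cmod (dirichlet_ip (\<Union>\<T>) v ?E - (of_real (\<kappa>\<^sup>2) + \<i> * of_real \<epsilon>) * l2_ip (\<Union>\<T>) v ?E)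
   \<le> (2 + 1 / \<kappa>0) * (norm1 \<kappa> ?U v * (ce * \<kappa> * nl l w))"
 proof -
  have "cmod (dirichlet_ip (\<Union>\<T>) v ?E - (of_real (\<kappa>\<^sup>2) + \<i> * of_real \<epsilon>) * l2_ip (\<Union>\<T>) v ?E)
    \<le> (2 + 1 / \<kappa>0) * (norm1 \<kappa> ?U v * norm1 \<kappa> ?U ?E)"
   unfolding sp1 sp2 by (rule interior_form_bound[OF GP vp \<kappa>0 eps])
  also have "... \<le> (2 + 1 / \<kappa>0) * (norm1 \<kappa> ?U v * (ce * \<kappa> * nl l w))"
   using n0 \<kappa>0 order_trans[OF nEG extension_bound[OF l w]] by (intro mult_left_mono) auto
  finally show ?thesis .
 qed
 have beq: "boundary_ip \<T> v ?E = boundary_ip \<T> v' ?E"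
 proof (rule boundary_ip_cong[OF conf])
  fix x assume "x \<in> frontier (\<Union>\<T>)"
  then have "x \<in> \<Union>\<T>" using closed_Union by (auto simp: frontier_def)
  then obtain T where T: "T \<in> \<T>" "x \<in> T" by blast
  show "v x * cnj (?E x) = v' x * cnj (?E x)"
  proof (cases "T \<in> Gp l")
   case True
   then have "v' x = v x" unfolding v'_def by (rule ext_on_patch[OF GP v _ T(2)])
   then show ?thesis by simp
  qed (use Ez[OF T(1) _ T(2)] in simp)
 qed
 let ?c = "9 * invC p K * K / h" and ?b = "boundary_ip \<T>"
 note pb = psd_subset[OF psd_boundary_ip[OF conf] fe_pw]
 have c0: "0 \<le> ?c" using invC_pos[OF p K] K h_pos by simp
 then have cc0: "0 \<le> ?c * ext_const" using ext_const_pos by (intro mult_nonneg_nonneg) auto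
 have bs: "snorm ?b u \<le> sqrt (?c * ext_const) * B"
  if u: "u \<in> V" "mass (\<Union>\<T>) u \<le> ext_const * B\<^sup>2" and B: "0 \<le> B" for u B
 proof -
  have "Re (?b u u) \<le> ?c * (ext_const * B\<^sup>2)"
   using boundary_ip_crude[OF u(1)] mult_left_mono[OF u(2) c0] by linarith
  then have "snorm ?b u \<le> sqrt ((?c * ext_const) * B\<^sup>2)" unfolding snorm_def by (simp add: mult.assoc)
  also have "... = sqrt (?c * ext_const) * B" unfolding real_sqrt_mult[of "?c * ext_const"] using B by simp
  finally show ?thesis .
 qed
 have rv: "restr ?U v \<in> fe_local p \<T> (Gp l)" using v by (simp add: fe_local_def)
 have "mass (\<Union>\<T>) v' \<le> ext_const * mass ?U (restr ?U v)"
  unfolding v'_def by (rule ext_l2[OF GP rv])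
 also have "l2_ip ?U (restr ?U v) (restr ?U v) = l2_ip ?U v v"
  by (rule ip_cong(1)[OF elts_subset[OF els GP] vp(1) vp(1)]) (auto simp: restr_def)
 finally have b1: "snorm ?b v' \<le> sqrt (?c * ext_const) * snorm (l2_ip ?U) v"
  using snorm_sq[OF psd_ips(1)[OF elts_subset[OF els GP]] vp(1)] snorm_nonneg[OF psd_ips(1)[OF elts_subset[OF els GP]] vp(1)]
  by (intro bs v'V) auto
 have b2: "snorm ?b ?E \<le> sqrt (?c * ext_const) * snorm (l2_ip (S l)) w"
  using snorm_sq[OF psd_ips(1)[OF G_els[OF l]] Vl_pw[OF l w]] snorm_nonneg[OF psd_ips(1)[OF G_els[OF l]] Vl_pw[OF l w]]
   ext_l2[OF G_sub[OF l] w] by (intro bs EV) (auto simp: ext_def)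
 have hk: "1 / h \<le> ch * \<kappa>\<^sup>2" using ch h_pos by (simp add: divide_le_eq)
 have s0: "0 \<le> snorm (l2_ip ?U) v" "0 \<le> snorm (l2_ip (S l)) w"
  using snorm_nonneg[OF psd_ips(1)[OF elts_subset[OF els GP]] vp(1)] snorm_nonneg[OF psd_ips(1)[OF G_els[OF l]] Vl_pw[OF l w]] by auto
 have "cmod (?b v' ?E) \<le> snorm ?b v' * snorm ?b ?E" by (rule psd_cauchy_schwarz[OF pb V_subspace v'V EV])
 also have "... \<le> (sqrt (?c * ext_const) * snorm (l2_ip ?U) v) * (sqrt (?c * ext_const) * snorm (l2_ip (S l)) w)"
  by (intro mult_mono b1 b2 mult_nonneg_nonneg s0 snorm_nonneg[OF pb EV] real_sqrt_ge_zero cc0)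
 also have "... = (sqrt (?c * ext_const))\<^sup>2 * (snorm (l2_ip ?U) v * snorm (l2_ip (S l)) w)" by (simp only: power2_eq_square mult_ac)
 also have "(sqrt (?c * ext_const))\<^sup>2 = 9 * invC p K * K * ext_const * (1 / h)" unfolding real_sqrt_pow2[OF cc0] by simp
 also have "... * (snorm (l2_ip ?U) v * snorm (l2_ip (S l)) w)
   \<le> 9 * invC p K * K * ext_const * (ch * \<kappa>\<^sup>2) * (snorm (l2_ip ?U) v * snorm (l2_ip (S l)) w)"
  using s0 hk invC_pos[OF p K] K ext_const_pos by (intro mult_right_mono mult_left_mono) auto
 also have "... = 9 * invC p K * K * ext_const * ch * ((\<kappa> * snorm (l2_ip ?U) v) * (\<kappa> * snorm (l2_ip (S l)) w))"
  by (simp add: power2_eq_square)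
 also have "... \<le> 9 * invC p K * K * ext_const * ch * (norm1 \<kappa> ?U v * nl l w)"
  using invC_pos[OF p K] K ext_const_pos ch \<kappa>_pos n0 s0
  by (intro mult_left_mono mult_mono norm1_components(2)[OF GP vp(1) \<kappa>_pos]
   norm1_components(2)[OF G_sub[OF l] Vl_pw[OF l w] \<kappa>_pos]) auto
 finally have bd: "\<kappa> * cmod (?b v ?E) \<le> \<kappa> * (9 * invC p K * K * ext_const * ch * (norm1 \<kappa> ?U v * nl l w))"
  unfolding beq using \<kappa>_pos by (intro mult_left_mono) auto
 have "cmod (a v ?E) \<le> cmod (dirichlet_ip (\<Union>\<T>) v ?E - (of_real (\<kappa>\<^sup>2) + \<i> * of_real \<epsilon>) * l2_ip (\<Union>\<T>) v ?E)
   + cmod (\<i> * of_real \<kappa> * ?b v ?E)"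
  unfolding helm_def by (rule norm_triangle_ineq4)
 also have "cmod (\<i> * of_real \<kappa> * ?b v ?E) = \<kappa> * cmod (?b v ?E)" using \<kappa>_pos by (simp add: norm_mult)
 finally have "cmod (a v ?E) \<le> (2 + 1 / \<kappa>0) * (norm1 \<kappa> ?U v * (ce * \<kappa> * nl l w))
   + \<kappa> * (9 * invC p K * K * ext_const * ch * (norm1 \<kappa> ?U v * nl l w))" using int bd by linarith
 also have "... = Cb * \<kappa> * (norm1 \<kappa> ?U v * nl l w)" by (simp add: Cb_def algebra_simps)
 finally show ?thesis .
qed

definition Pl :: "nat \<Rightarrow> scalar_fun \<Rightarrow> scalar_fun" where
 "Pl l v = variational_solution (Vl l) (al l) (\<lambda>w. a v (ext p \<T> w))"

lemma local_problem:
 assumes l: "l \<in> {1..N}" and v: "v \<in> V"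
 shows "\<exists>!u. u \<in> Vl l \<and> (\<forall>w\<in>Vl l. al l u w = a v (ext p \<T> w))"
proof (rule galerkin_unique_solution[OF local_fdim sesq_al[OF l] local_nondegenerate[OF l]])
 have e: "ext p \<T> w \<in> V" for w by (simp add: ext_def interp_fe)
 show "antilin (Vl l) (\<lambda>w. a v (ext p \<T> w))"
  unfolding antilin_def by (intro conjI ballI allI) (simp_all only: ext_add ext_scl sesqD(2,4)[OF sesq_a] v e)
qed

lemmas Pl = variational_solution(1,2)[OF local_problem, folded Pl_def]

text \<open>The local inf-sup constant is bounded because \<open>\<kappa> d \<le> 1\<close>; the factor \<open>\<kappa>\<close> is the price of the extension
 by zero.\<close>

lemma Pl_bound:
 assumes l: "l \<in> {1..N}" and v: "v \<in> V"
 shows "nl l (Pl l v) \<le> M * (1 + K) * Cb * \<kappa> * norm1 \<kappa> (\<Union>(Gp l)) v"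
proof -
 have GP: "Gp l \<subseteq> \<T>" by (auto simp: add_layer_def)
 have vp: "v \<in> pw p (Gp l)" using v fe_pw pw_mono[OF GP] by auto
 have "nl l (Pl l v) \<le> M * (1 + K) * (Cb * \<kappa> * norm1 \<kappa> (\<Union>(Gp l)) v)"
 proof (rule local_stability[OF l Pl(1)[OF l v]])
  show "0 \<le> Cb * \<kappa> * norm1 \<kappa> (\<Union>(Gp l)) v" using Cb_nonneg \<kappa>_pos local_norm1(3)[OF GP \<kappa>_pos vp] by simp
  show "cmod (al l (Pl l v) w) \<le> Cb * \<kappa> * norm1 \<kappa> (\<Union>(Gp l)) v * nl l w" if "w \<in> Vl l" for w
   unfolding Pl(2)[OF l v that] using localised_form_bound[OF l v that] by (simp add: mult.assoc)
 qed
 then show ?thesis by (simp add: mult.assoc)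
qed

text \<open>On test functions with zero trace the local problem repeats the global form, so its solution has
 the same right-hand side as the restriction itself.\<close>

lemma residual_harmonic:
 assumes l: "l \<in> {1..N}" and v: "v \<in> V"
 shows "restr (S l) v - Pl l v \<in> harmonic_space p \<T> \<kappa> \<epsilon> (\<G> l)"
proof (rule harmonic_spaceI[OF G_sub[OF l] _ local_nondegenerate[OF l]])
 note s = restr_local[OF v, of "\<G> l"] Pl(1)[OF l v]
 show "restr (S l) v - Pl l v \<in> Vl l" by (intro cvs.subspace_diff[OF local_subspace] s)
 fix w assume w: "w \<in> Vl l" "\<And>x. x \<in> frontier (S l) ==> w x = 0"
 have "ext p \<T> w = w" unfolding ext_def by (rule interp_id[OF zero_extension[OF G_sub[OF l] w]])
 then show "al l (restr (S l) v - Pl l v) w = 0"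
  unfolding sesq_diff(1)[OF sesq_al[OF l] local_subspace s w(1)] Pl(2)[OF l v w(1)]
  using helm_interior_test[OF G_sub[OF l] v w] by simp
qed

abbreviation V0 where "V0 \<equiv> coarse_space p \<T> N pu m k \<xi>"

text \<open>A family of discrete Helmholtz-harmonic functions, glued by the partition of unity, differs from the
 coarse space by little: the modes that are left out have small weighted energy.\<close>

lemma harmonic_coarse_split:
 assumes \<phi>: "\<And>l. l \<in> {1..N} ==> \<phi> l \<in> harmonic_space p \<T> \<kappa> \<epsilon> (\<G> l)"
 obtains c r' where "c \<in> V0" "r' \<in> V" "(\<Sum>l=1..N. DE l (\<phi> l)) = c + r'"
  "(nrm r')\<^sup>2 \<le> K * \<rho>\<^sup>2 * (\<Sum>l=1..N. energy1 \<kappa> (S l) (\<phi> l))"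
proof -
 have "\<exists>\<phi>0 \<phi>1. \<phi> l = \<phi>0 + \<phi>1 \<and> \<phi>0 \<in> complex_span {k l..m l} (\<xi> l) \<and>
   energy1 \<kappa> (S l) (DE l \<phi>1) \<le> \<rho>\<^sup>2 * energy1 \<kappa> (S l) (\<phi> l)" if l: "l \<in> {1..N}" for l
 proof -
  note e = eig[OF l, unfolded eigenpairs_def]
  have H: "harmonic_space p \<T> \<kappa> \<epsilon> (\<G> l) \<subseteq> Vl l"
  proof
   fix u assume "u \<in> harmonic_space p \<T> \<kappa> \<epsilon> (\<G> l)"
   then obtain g where g: "g \<in> fe_trace p \<T> (\<G> l)" "u = harmonic_ext p \<T> \<kappa> \<epsilon> (\<G> l) g"
    by (auto simp: harmonic_space_def)
   obtain g' where g': "g' \<in> Vl l" "g = restr (frontier (S l)) g'" using g(1) by (auto simp: fe_trace_def)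
   have "boundary_ip (\<G> l) g = boundary_ip (\<G> l) g'"
    by (rule ext, rule boundary_ip_cong[OF G_conf[OF l]]) (simp add: g'(2) restr_def)
   moreover have "antilin (Vl l) (boundary_ip (\<G> l) g')"
    by (rule antilin_sesq[OF psd_sesq[OF psd_subset[OF psd_boundary_ip[OF G_conf[OF l]] local_pw[OF G_sub[OF l]]]] g'(1)])
   ultimately have "antilin (Vl l) (boundary_ip (\<G> l) g)" by simp
   then show "u \<in> Vl l" unfolding g(2) harmonic_ext_def
    by (intro variational_solution(1) galerkin_unique_solution[OF local_fdim sesq_al[OF l] local_nondegenerate[OF l]])
  qed
  obtain \<phi>0 \<phi>1 where "\<phi> l = \<phi>0 + \<phi>1" "\<phi>0 \<in> complex_span {k l..m l} (\<xi> l)" "\<phi>1 \<in> Vl l"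
   "energy1 \<kappa> (S l) (DE l \<phi>1) \<le> \<rho>\<^sup>2 * energy1 \<kappa> (S l) (\<phi> l)"
   by (rule spectral_split[OF nrm_psd(2)[OF l] local_subspace psd_sesq[OF nrm_psd(3)[OF l]] V_subspace H DE_V
    DE_add DE_scl _ _ _ _ cut[OF l] \<phi>[OF l]]) (use e in auto)
  then show ?thesis by blast
 qed
 then obtain \<phi>0 \<phi>1 where f: "\<And>l. l \<in> {1..N} ==> \<phi> l = \<phi>0 l + \<phi>1 l \<and> \<phi>0 l \<in> complex_span {k l..m l} (\<xi> l) \<and>
   energy1 \<kappa> (S l) (DE l (\<phi>1 l)) \<le> \<rho>\<^sup>2 * energy1 \<kappa> (S l) (\<phi> l)" by metis
 define c where "c = (\<Sum>l=1..N. DE l (\<phi>0 l))"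
 define r' where "r' = (\<Sum>l=1..N. DE l (\<phi>1 l))"
 have "c = (\<lambda>x. \<Sum>l=1..N. DE l (\<phi>0 l) x)" by (simp add: c_def fun_eq_iff fapply)
 then have "c \<in> V0" unfolding coarse_space_def using f by blast
 moreover have r'V: "r' \<in> V" unfolding r'_def by (rule cvs.subspace_sum[OF V_subspace DE_V])
 moreover have "(\<Sum>l=1..N. DE l (\<phi> l)) = c + r'"
  unfolding c_def r'_def sum.distrib[symmetric] by (rule sum.cong) (use f DE_add in auto)
 moreover have "(nrm r')\<^sup>2 \<le> K * (\<Sum>l=1..N. energy1 \<kappa> (S l) (DE l (\<phi>1 l)))"
  unfolding nrm_props(2)[OF r'V] unfolding r'_def by (rule energy_overlap_sum[OF DE_V DE_outside])
 moreover have "... \<le> K * (\<Sum>l=1..N. \<rho>\<^sup>2 * energy1 \<kappa> (S l) (\<phi> l))"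
  by (intro mult_left_mono sum_mono conjunct2[OF conjunct2[OF f]]) (use K in auto)
 ultimately show thesis using that[of c r'] by (simp add: sum_distrib_left mult.assoc)
qed

definition Cr :: real where "Cr = sqrt (K * (2 * K / \<kappa>0\<^sup>2 + 18 * K ^ 5 * (M * (1 + K) * Cb)\<^sup>2))"

text \<open>The one-level method reproduces \<open>v\<close> up to glued harmonic functions. Boundedly many of them overlap,
 so the local bounds, one factor \<open>\<kappa>\<close> too large, add up and are paid for by \<open>\<rho>\<close>.\<close>

lemma one_level_residual:
 assumes v: "v \<in> V"
 obtains c r' where "c \<in> V0" "r' \<in> V" "v - (\<Sum>l=1..N. DE l (Pl l v)) = c + r'" "nrm r' \<le> Cr * (\<rho> * \<kappa>) * nrm v"
proof -
 define \<phi> where "\<phi> l = restr (S l) v - Pl l v" for l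
 obtain c r' where cr: "c \<in> V0" "r' \<in> V" "(\<Sum>l=1..N. DE l (\<phi> l)) = c + r'"
  "(nrm r')\<^sup>2 \<le> K * \<rho>\<^sup>2 * (\<Sum>l=1..N. energy1 \<kappa> (S l) (\<phi> l))"
  by (rule harmonic_coarse_split[of \<phi>]) (use residual_harmonic[OF _ v] in \<open>auto simp: \<phi>_def\<close>)
 have eq: "v - (\<Sum>l=1..N. DE l (Pl l v)) = (\<Sum>l=1..N. DE l (\<phi> l))"
  unfolding \<phi>_def DE_diff sum_subtractf DE_partition[OF v] ..
 let ?B = "M * (1 + K) * Cb * \<kappa>"
 have loc: "energy1 \<kappa> (S l) (\<phi> l) \<le> 2 * energy1 \<kappa> (S l) v + 2 * (?B\<^sup>2 * energy1 \<kappa> (\<Union>(Gp l)) v)"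
  if l: "l \<in> {1..N}" for l
 proof -
  have GP: "Gp l \<subseteq> \<T>" by (auto simp: add_layer_def)
  have vp: "v \<in> pw p (Gp l)" "v \<in> pw p (\<G> l)" using v fe_pw pw_mono[OF GP] fe_pw_G[OF l] by auto
  note s = restr_local[OF v, of "\<G> l"] Pl(1)[OF l v]
  have "\<phi> l = restr (S l) v + - Pl l v" by (simp add: \<phi>_def)
  then have "energy1 \<kappa> (S l) (\<phi> l) \<le> 2 * energy1 \<kappa> (S l) (restr (S l) v)
    + 2 * energy1 \<kappa> (S l) (- Pl l v)"
   using psd_two_terms[OF nrm_psd(2)[OF l] local_subspace s(1) cvs.subspace_neg[OF local_subspace s(2)]] by simp
  also have "ip1 \<kappa> (S l) (- Pl l v) (- Pl l v) = ip1 \<kappa> (S l) (Pl l v) (Pl l v)"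
   using sesq_minus[OF psd_sesq[OF nrm_psd(2)[OF l]] local_subspace] s(2) cvs.subspace_neg[OF local_subspace s(2)] by simp
  also have "ip1 \<kappa> (S l) (restr (S l) v) (restr (S l) v) = ip1 \<kappa> (S l) v v"
   by (rule ip1_cong[OF G_els[OF l] vp(2) vp(2)]) (auto simp: restr_def)
  also have "energy1 \<kappa> (S l) (Pl l v) \<le> (?B * norm1 \<kappa> (\<Union>(Gp l)) v)\<^sup>2"
   unfolding nl_props(2)[OF l Vl_pw[OF l s(2)], symmetric]
   by (rule power_mono[OF Pl_bound[OF l v] nl_props(1)[OF l Vl_pw[OF l s(2)]]])
  also have "... = ?B\<^sup>2 * energy1 \<kappa> (\<Union>(Gp l)) v"
   unfolding power_mult_distrib local_norm1(4)[OF GP \<kappa>_pos vp(1)] ..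
  finally show ?thesis by simp
 qed
 have "(\<Sum>l=1..N. energy1 \<kappa> (S l) (\<phi> l))
   \<le> (\<Sum>l=1..N. 2 * energy1 \<kappa> (S l) v + 2 * (?B\<^sup>2 * energy1 \<kappa> (\<Union>(Gp l)) v))" by (rule sum_mono[OF loc])
 also have "... = 2 * (\<Sum>l=1..N. energy1 \<kappa> (S l) v) + 2 * ?B\<^sup>2 * (\<Sum>l=1..N. energy1 \<kappa> (\<Union>(Gp l)) v)"
  by (simp add: sum.distrib sum_distrib_left mult.assoc)
 also have "... \<le> 2 * (K * (nrm v)\<^sup>2) + 2 * ?B\<^sup>2 * (9 * K ^ 5 * (nrm v)\<^sup>2)"
  unfolding nrm_props(2)[OF v]
  by (intro add_mono mult_left_mono energy_sum_local[OF G_sub card_covering v]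
   energy_sum_local[OF _ card_covering_layer v]) (auto simp: add_layer_def)
 also have "... \<le> (2 * K / \<kappa>0\<^sup>2 + 18 * K ^ 5 * (M * (1 + K) * Cb)\<^sup>2) * \<kappa>\<^sup>2 * (nrm v)\<^sup>2"
 proof -
  have "\<kappa>0\<^sup>2 \<le> \<kappa>\<^sup>2" using \<kappa>0 by (intro power_mono) auto
  then have "2 * K \<le> 2 * K / \<kappa>0\<^sup>2 * \<kappa>\<^sup>2" using \<kappa>0 K by (simp add: field_simps)
  then have "2 * K * (nrm v)\<^sup>2 \<le> 2 * K / \<kappa>0\<^sup>2 * \<kappa>\<^sup>2 * (nrm v)\<^sup>2" by (rule mult_right_mono) simp
  moreover define X where "X = (M * (1 + K) * Cb)\<^sup>2"
  moreover have "?B\<^sup>2 = X * \<kappa>\<^sup>2" by (simp only: X_def power_mult_distrib)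
  ultimately show ?thesis by (simp only: flip: X_def) (simp add: algebra_simps)
 qed
 finally have "K * \<rho>\<^sup>2 * (\<Sum>l=1..N. energy1 \<kappa> (S l) (\<phi> l))
   \<le> K * \<rho>\<^sup>2 * ((2 * K / \<kappa>0\<^sup>2 + 18 * K ^ 5 * (M * (1 + K) * Cb)\<^sup>2) * \<kappa>\<^sup>2 * (nrm v)\<^sup>2)"
  using K by (intro mult_left_mono) auto
 also have "... = (Cr * (\<rho> * \<kappa>) * nrm v)\<^sup>2"
 proof -
  have "Cr\<^sup>2 = K * (2 * K / \<kappa>0\<^sup>2 + 18 * K ^ 5 * (M * (1 + K) * Cb)\<^sup>2)"
   unfolding Cr_def using K by (intro real_sqrt_pow2 mult_nonneg_nonneg add_nonneg_nonneg) auto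
  then show ?thesis by (simp only: power_mult_distrib mult_ac)
 qed
 finally have sq: "(nrm r')\<^sup>2 \<le> (Cr * (\<rho> * \<kappa>) * nrm v)\<^sup>2" using cr(4) by linarith
 have "0 \<le> Cr" unfolding Cr_def using K by (intro real_sqrt_ge_zero mult_nonneg_nonneg add_nonneg_nonneg) auto
 then have "nrm r' \<le> Cr * (\<rho> * \<kappa>) * nrm v"
  by (intro power2_le_imp_le[OF sq] mult_nonneg_nonneg nrm_props(1)[OF v]) (use \<rho> \<kappa>_pos in auto)
 then show thesis using that[OF cr(1,2)] cr(3) eq by simp
qed

end

section \<open>Approximation by the coarse space\<close>

context helmholtz_dd
begin

definition Cw :: real where "Cw = 2 * M * (1 + 1 / \<kappa>0)"

text \<open>The dual problem of the Schatz argument; its solution is controlled by the adjoint inf-sup estimate.\<close>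

lemma adjoint_solution:
 assumes e: "e \<in> V"
 obtains w where "w \<in> V" "\<And>v. v \<in> V ==> a v w = 2 * of_real (\<kappa>\<^sup>2) * l2_ip (\<Union>\<T>) v e" "nrm w \<le> Cw * \<kappa> * nrm e"
proof -
 let ?l2 = "l2_ip (\<Union>\<T>)"
 note pl = psd_subset[OF psd_ips(1)[OF els] fe_pw]
 have nd: "u = 0" if "u \<in> V" "\<forall>v\<in>V. cnj (a v u) = 0" for u
  by (rule nondegenerate(2)[OF that(1)]) (use that(2) in simp)
 have "antilin V (\<lambda>v. cnj (2 * of_real (\<kappa>\<^sup>2) * ?l2 v e))"
  unfolding antilin_def
  by (intro conjI ballI allI) (simp_all only: sesqD(1,3)[OF psd_sesq[OF pl]] e, simp_all add: algebra_simps)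
 then obtain w where w: "w \<in> V" "\<And>v. v \<in> V ==> cnj (a v w) = cnj (2 * of_real (\<kappa>\<^sup>2) * ?l2 v e)"
  using galerkin_unique_solution[OF V_fdim sesq_adjoint[OF sesq_a] nd] by blast
 have aw: "a v w = 2 * of_real (\<kappa>\<^sup>2) * ?l2 v e" if "v \<in> V" for v
  using w(2)[OF that] by (simp only: complex_cnj_cancel_iff)
 have "nrm w \<le> M * (1 + \<kappa>) * (2 * nrm e)"
 proof (rule stability(2)[OF w(1)])
  show "0 \<le> 2 * nrm e" using nrm_props(1)[OF e] by simp
  fix v assume v: "v \<in> V"
  have ep: "e \<in> pw p \<T>" "v \<in> pw p \<T>" using e v fe_pw by auto
  have "cmod (a v w) = 2 * (\<kappa>\<^sup>2 * cmod (?l2 v e))" unfolding aw[OF v] by (simp add: norm_mult norm_power)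
  also have "... \<le> 2 * (\<kappa>\<^sup>2 * (snorm ?l2 v * snorm ?l2 e))"
   by (intro mult_left_mono psd_cauchy_schwarz[OF pl V_subspace v e]) auto
  also have "... = 2 * ((\<kappa> * snorm ?l2 v) * (\<kappa> * snorm ?l2 e))" by (simp add: power2_eq_square)
  also have "... \<le> 2 * (nrm v * nrm e)"
   by (intro mult_left_mono mult_mono norm1_components(2)[OF subset_refl _ \<kappa>_pos] ep nrm_props(1)[OF v]
    mult_nonneg_nonneg snorm_nonneg[OF pl e]) (use \<kappa>_pos in auto)
  finally show "cmod (a v w) \<le> 2 * nrm e * nrm v" by (simp add: mult_ac)
 qed
 also have "... \<le> M * ((1 + 1 / \<kappa>0) * \<kappa>) * (2 * nrm e)"
  using M \<kappa>0 nrm_props(1)[OF e] by (intro mult_right_mono mult_left_mono) (auto simp: field_simps)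
 finally have "nrm w \<le> Cw * \<kappa> * nrm e" by (simp only: Cw_def mult_ac)
 then show thesis using that w(1) aw by blast
qed

text \<open>The discrete functions on a subdomain with zero trace.\<close>

definition W0 :: "nat \<Rightarrow> scalar_fun set" where
 "W0 l = {u \<in> Vl l. \<forall>x\<in>frontier (S l). u x = 0}"

lemma W0:
 assumes l: "l \<in> {1..N}"
 shows "fdim (W0 l)" "cvs.subspace (W0 l)" "W0 l \<subseteq> Vl l" "W0 l \<subseteq> V"
  "u \<in> W0 l ==> al l u v = dirichlet_ip (S l) u v - (of_real (\<kappa>\<^sup>2) + \<i> * of_real \<epsilon>) * l2_ip (S l) u v"
  "u \<in> W0 l ==> mass (S l) u \<le> (K\<^sup>2 * d)\<^sup>2 * energy (S l) u"
proof -
 show sub: "W0 l \<subseteq> Vl l" by (auto simp: W0_def)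
 show sp: "cvs.subspace (W0 l)"
  using local_subspace[of "\<G> l"] unfolding W0_def cvs.subspace_def by (auto simp: fapply)
 show "fdim (W0 l)" by (rule fdim_subset[OF local_fdim sp sub])
 have z: "u x = 0" if "u \<in> W0 l" "x \<in> frontier (S l)" for u x using that by (auto simp: W0_def)
 show VV: "W0 l \<subseteq> V" using zero_extension[OF G_sub[OF l]] z sub by blast
 show "al l u v = dirichlet_ip (S l) u v - (of_real (\<kappa>\<^sup>2) + \<i> * of_real \<epsilon>) * l2_ip (S l) u v" if u: "u \<in> W0 l"
 proof -
  have "boundary_ip (\<G> l) u v = boundary_ip (\<G> l) (\<lambda>x. 0) (\<lambda>x. 0)"
   by (rule boundary_ip_cong[OF G_conf[OF l]]) (use z[OF u] in simp)
  also have "... = 0" by (rule boundary_ip_zero_right[OF G_conf[OF l]]) simp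
  finally show ?thesis by (simp add: helm_def)
 qed
 show "mass (S l) u \<le> (K\<^sup>2 * d)\<^sup>2 * energy (S l) u" if u: "u \<in> W0 l"
 proof (rule friedrichs[OF G_conf[OF l] G_ne[OF l] Vl_pw[OF l subsetD[OF sub u]]])
  show out: "u x = 0" if "x \<notin> S l" for x by (rule local_outside[OF subsetD[OF sub u] that])
  show "0 < K\<^sup>2 * d" using K d_pos by simp
  show "dist x y \<le> K\<^sup>2 * d" if "x \<in> S l" "y \<in> S l" for x y by (rule S_dist[OF l that])
  have cl: "closed (S l)" by (rule conforming_Union_closed(1)[OF G_conf[OF l]])
  have "continuous_on (S l \<union> closure (- S l)) u"
  proof (rule continuous_on_closed_Un[OF cl closed_closure local_continuous[OF G_sub[OF l] subsetD[OF sub u]]])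
   have "u x = 0" if "x \<in> closure (- S l)" for x
   proof (cases "x \<in> S l")
    case True
    then have "x \<in> frontier (S l)" using that cl by (auto simp: frontier_closures)
    then show ?thesis by (rule z[OF u])
   qed (rule out)
   then show "continuous_on (closure (- S l)) u"
    by (intro continuous_on_eq[OF continuous_on_const[of _ 0]]) simp
  qed
  moreover have "S l \<union> closure (- S l) = UNIV" using closure_subset[of "- S l"] by blast
  ultimately show "continuous_on UNIV u" by simp
 qed
qed

text \<open>The subdomain is smaller than the wave length, so the Friedrichs inequality absorbs the negative zeroth
 order term.\<close>

lemma helm_re:
 assumes l: "l \<in> {1..N}" and u: "u \<in> W0 l"
 shows "3/4 * energy (S l) u \<le> cmod (al l u u)"
proof -
 note up = Vl_pw[OF l subsetD[OF W0(3)[OF l] u]]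
 let ?D2 = "energy (S l) u"
 have D0: "0 \<le> ?D2" by (rule psd_nonneg[OF psd_ips(2)[OF G_els[OF l]] up])
 have "Im (l2_ip (S l) u u) = 0" unfolding l2_ip_self by simp
 then have re: "Re (al l u u) = ?D2 - \<kappa>\<^sup>2 * mass (S l) u"
  unfolding W0(5)[OF l u] by (simp flip: of_real_power)
 have "(\<kappa> * (K\<^sup>2 * d))\<^sup>2 \<le> (1/2)\<^sup>2" using kd \<kappa>_pos d_pos by (intro power_mono) (auto simp: mult_ac)
 then have q: "(\<kappa> * (K\<^sup>2 * d))\<^sup>2 \<le> 1/4" by (simp add: power2_eq_square)
 have "\<kappa>\<^sup>2 * mass (S l) u \<le> \<kappa>\<^sup>2 * ((K\<^sup>2 * d)\<^sup>2 * ?D2)" by (intro mult_left_mono W0(6)[OF l u]) auto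
 also have "... = (\<kappa> * (K\<^sup>2 * d))\<^sup>2 * ?D2" by (simp only: power_mult_distrib mult_ac)
 also have "... \<le> 1/4 * ?D2" by (rule mult_right_mono[OF q D0])
 finally show ?thesis using re complex_Re_le_cmod[of "al l u u"] by simp
qed

text \<open>The part of the adjoint solution that is not discrete Helmholtz-harmonic in the subdomain. It has zero
 boundary values, so by the Friedrichs inequality it is small with the size of the subdomain.\<close>

lemma dirichlet_corrector:
 assumes l: "l \<in> {1..N}" and e: "e \<in> V" and w: "w \<in> V"
  and aw: "\<And>v. v \<in> V ==> a v w = 2 * of_real (\<kappa>\<^sup>2) * l2_ip (\<Union>\<T>) v e"
 obtains q where "q \<in> Vl l" "restr (S l) w - q \<in> harmonic_space p \<T> \<kappa> \<epsilon> (\<G> l)"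
  "energy (S l) q \<le> 32 * K ^ 4 * d\<^sup>2 * (\<kappa>\<^sup>2 * energy1 \<kappa> (S l) e + energy1 \<kappa> (S l) w)"
  "mass (S l) q \<le> (K\<^sup>2 * d)\<^sup>2 * energy (S l) q"
proof -
 let ?l2 = "l2_ip (S l)" and ?di = "dirichlet_ip (S l)"
 note pl = psd_ips(1)[OF G_els[OF l], of p] and pd = psd_ips(2)[OF G_els[OF l], of p]
 have sW: "sesq (W0 l) (al l)" by (rule sesq_subset[OF sesq_al[OF l] W0(3)[OF l]])
 have nd: "u = 0" if u: "u \<in> W0 l" "\<forall>v\<in>W0 l. al l u v = 0" for u
 proof -
  note up = Vl_pw[OF l subsetD[OF W0(3)[OF l] u(1)]]
  have "Re (?di u u) = 0" using helm_re[OF l u(1)] u psd_nonneg[OF pd up] by simp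
  then have "Re (?l2 u u) = 0" using W0(6)[OF l u(1)] psd_nonneg[OF pl up] by simp
  then show ?thesis by (rule local_l2_definite[OF G_sub[OF l] subsetD[OF W0(3)[OF l] u(1)]])
 qed
 have an: "antilin (W0 l) (a w)" using antilin_sesq[OF sesq_a w] W0(4)[OF l] unfolding antilin_def by blast
 obtain q where q: "q \<in> W0 l" "\<And>v. v \<in> W0 l ==> al l q v = a w v"
  using galerkin_unique_solution[OF W0(1)[OF l] sW nd an] by blast
 note qV = subsetD[OF W0(3)[OF l] q(1)] and qp = Vl_pw[OF l subsetD[OF W0(3)[OF l] q(1)]]
 have harm: "restr (S l) w - q \<in> harmonic_space p \<T> \<kappa> \<epsilon> (\<G> l)"
 proof (rule harmonic_spaceI[OF G_sub[OF l] _ local_nondegenerate[OF l]])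
  note s = restr_local[OF w, of "\<G> l"] qV
  show "restr (S l) w - q \<in> Vl l" by (intro cvs.subspace_diff[OF local_subspace] s)
  fix v assume v: "v \<in> Vl l" "\<And>x. x \<in> frontier (S l) ==> v x = 0"
  then have "v \<in> W0 l" by (simp add: W0_def)
  then show "al l (restr (S l) w - q) v = 0"
   unfolding sesq_diff(1)[OF sesq_al[OF l] local_subspace s v(1)] q(2)[OF \<open>v \<in> W0 l\<close>]
   using helm_interior_test[OF G_sub[OF l] w v] by simp
 qed
 have ep: "e \<in> pw p (\<G> l)" "w \<in> pw p (\<G> l)" using fe_pw_G[OF l] e w by auto
 have awq: "a w q = 2 * of_real (\<kappa>\<^sup>2) * ?l2 e q - 2 * \<i> * of_real \<epsilon> * ?l2 w q"
 proof -
  have qVg: "q \<in> V" using q(1) W0(4)[OF l] by blast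
  have zq: "q x = 0" if "x \<in> frontier (S l)" for x using q(1) that by (auto simp: W0_def)
  have sp: "l2_ip (\<Union>\<T>) v q = ?l2 v q" if "v \<in> V" for v
   by (rule ips_supported(1)[OF G_sub[OF l] that qVg]) (rule vanish_outside_element[OF G_sub[OF l] qV zq])
  have spd: "dirichlet_ip (\<Union>\<T>) w q = ?di w q"
   by (rule ips_supported(2)[OF G_sub[OF l] w qVg]) (rule vanish_outside_element[OF G_sub[OF l] qV zq])
  have "al l (restr (S l) w) q = ?di w q - (of_real (\<kappa>\<^sup>2) + \<i> * of_real \<epsilon>) * ?l2 w q"
  proof -
   have "boundary_ip (\<G> l) (restr (S l) w) q = 0" by (rule boundary_ip_zero_right[OF G_conf[OF l] zq])
   moreover have "?l2 (restr (S l) w) q = ?l2 w q" "?di (restr (S l) w) q = ?di w q"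
    by (rule ip_cong(1)[OF G_els[OF l] ep(2) qp], simp_all add: restr_def)
     (rule ip_cong(2)[OF G_els[OF l] ep(2) qp], simp_all add: restr_def)
   ultimately show ?thesis by (simp add: helm_def)
  qed
  then have aw1: "a w q = ?di w q - (of_real (\<kappa>\<^sup>2) + \<i> * of_real \<epsilon>) * ?l2 w q"
   using helm_interior_test[OF G_sub[OF l] w qV zq] by simp
  have symV: "l2_ip (\<Union>\<T>) q v = cnj (l2_ip (\<Union>\<T>) v q)" "dirichlet_ip (\<Union>\<T>) q v = cnj (dirichlet_ip (\<Union>\<T>) v q)"
   "boundary_ip \<T> q v = cnj (boundary_ip \<T> v q)" if "v \<in> V" for v
   using psd_sym[OF psd_ips(1)[OF els] subsetD[OF fe_pw that] subsetD[OF fe_pw qVg]]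
    psd_sym[OF psd_ips(2)[OF els] subsetD[OF fe_pw that] subsetD[OF fe_pw qVg]]
    psd_sym[OF psd_boundary_ip[OF conf] subsetD[OF fe_pw that] subsetD[OF fe_pw qVg]] by auto
  have b0: "boundary_ip \<T> w q = 0"
  proof -
   have "a w q = ?di w q - (of_real (\<kappa>\<^sup>2) + \<i> * of_real \<epsilon>) * ?l2 w q - \<i> * of_real \<kappa> * boundary_ip \<T> w q"
    unfolding helm_def sp[OF w] spd ..
   then show ?thesis using aw1 \<kappa>_pos by simp
  qed
  have "cnj (?di w q) - (of_real (\<kappa>\<^sup>2) + \<i> * of_real \<epsilon>) * cnj (?l2 w q) = 2 * of_real (\<kappa>\<^sup>2) * cnj (?l2 e q)"
   using aw[OF qVg] unfolding helm_def symV[OF w] symV[OF e] b0 sp[OF w] sp[OF e] spd by simp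
  then have "cnj (cnj (?di w q) - (of_real (\<kappa>\<^sup>2) + \<i> * of_real \<epsilon>) * cnj (?l2 w q)) = cnj (2 * of_real (\<kappa>\<^sup>2) * cnj (?l2 e q))"
   by simp
  then have "?di w q - (of_real (\<kappa>\<^sup>2) - \<i> * of_real \<epsilon>) * ?l2 w q = 2 * of_real (\<kappa>\<^sup>2) * ?l2 e q" by simp
  then show ?thesis unfolding aw1 by (simp add: algebra_simps)
 qed
 define sq where "sq = sqrt (Re (?di q q))"
 define Phi where "Phi = 2 * \<kappa>\<^sup>2 * snorm ?l2 e + 2 * \<epsilon> * snorm ?l2 w"
 define x where "x = \<kappa> * (\<kappa> * snorm ?l2 e)"
 define y where "y = \<kappa> * snorm ?l2 w"
 have sn: "0 \<le> snorm ?l2 e" "0 \<le> snorm ?l2 w" "0 \<le> snorm ?l2 q" using snorm_nonneg[OF pl] ep qp by auto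
 have D0: "0 \<le> Re (?di q q)" by (rule psd_nonneg[OF pd qp])
 have Kd0: "0 \<le> K\<^sup>2 * d" using d_pos by simp
 have sl: "snorm ?l2 q \<le> K\<^sup>2 * d * sq"
 proof -
  have "snorm ?l2 q \<le> sqrt ((K\<^sup>2 * d)\<^sup>2 * Re (?di q q))" unfolding snorm_def by (rule real_sqrt_le_mono[OF W0(6)[OF l q(1)]])
  then show ?thesis using Kd0 unfolding sq_def real_sqrt_mult by simp
 qed
 have "cmod (a w q) \<le> 2 * \<kappa>\<^sup>2 * cmod (?l2 e q) + 2 * \<epsilon> * cmod (?l2 w q)"
  unfolding awq using norm_triangle_ineq4[of "2 * of_real (\<kappa>\<^sup>2) * ?l2 e q" "2 * \<i> * of_real \<epsilon> * ?l2 w q"] eps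
  by (simp add: norm_mult norm_power)
 also have "... \<le> 2 * \<kappa>\<^sup>2 * (snorm ?l2 e * snorm ?l2 q) + 2 * \<epsilon> * (snorm ?l2 w * snorm ?l2 q)"
  using eps by (intro add_mono mult_left_mono psd_cauchy_schwarz[OF pl pw_subspace] ep qp) auto
 also have "... = Phi * snorm ?l2 q" by (simp add: Phi_def algebra_simps)
 also have "... \<le> (2 * x + 2 * y) * (K\<^sup>2 * d * sq)"
 proof (rule mult_mono[OF _ sl _ sn(3)])
  have "\<epsilon> * snorm ?l2 w \<le> \<kappa> * snorm ?l2 w" using eps sn by (intro mult_right_mono) auto
  then show "Phi \<le> 2 * x + 2 * y" by (simp add: Phi_def x_def y_def power2_eq_square mult.assoc)
  show "0 \<le> 2 * x + 2 * y" using sn \<kappa>_pos by (simp add: x_def y_def)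
 qed
 finally have up: "cmod (a w q) \<le> (2 * x + 2 * y) * (K\<^sup>2 * d) * sq" by (simp add: mult.assoc)
 have sq2: "sq * sq = Re (?di q q)" using D0 by (simp add: sq_def)
 have "3/4 * (sq * sq) \<le> (2 * x + 2 * y) * (K\<^sup>2 * d) * sq"
  using helm_re[OF l q(1)] up unfolding q(2)[OF q(1)] sq2 by linarith
 moreover have sq0: "0 \<le> sq" using D0 by (simp add: sq_def)
 ultimately have "3/4 * sq \<le> (2 * x + 2 * y) * (K\<^sup>2 * d)"
 proof (cases "sq = 0")
  case True
  have "0 \<le> (2 * x + 2 * y) * (K\<^sup>2 * d)" using sn \<kappa>_pos Kd0 by (simp add: x_def y_def)
  then show ?thesis using True by simp
 next
  case False
  assume "3/4 * (sq * sq) \<le> (2 * x + 2 * y) * (K\<^sup>2 * d) * sq"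
  then have "(3/4 * sq) * sq \<le> (2 * x + 2 * y) * (K\<^sup>2 * d) * sq" by simp
  then show ?thesis using False sq0 by (simp add: mult_le_cancel_right)
 qed
 then have "sq \<le> 4 * (x + y) * (K\<^sup>2 * d)" using sq0 by (simp add: algebra_simps)
 then have "sq\<^sup>2 \<le> (4 * (x + y) * (K\<^sup>2 * d))\<^sup>2" by (rule power_mono[OF _ sq0])
 also have "... = 16 * (K\<^sup>2 * d)\<^sup>2 * (x + y)\<^sup>2" by (simp only: power_mult_distrib) simp
 also have "... \<le> 16 * (K\<^sup>2 * d)\<^sup>2 * (2 * (x\<^sup>2 + y\<^sup>2))"
 proof (rule mult_left_mono)
  have "0 \<le> (x - y)\<^sup>2" by simp
  then show "(x + y)\<^sup>2 \<le> 2 * (x\<^sup>2 + y\<^sup>2)" by (simp add: power2_eq_square algebra_simps)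
 qed simp
 also have "... = 32 * K ^ 4 * d\<^sup>2 * (x\<^sup>2 + y\<^sup>2)" by (simp add: power_mult_distrib flip: power_mult)
 also have "... \<le> 32 * K ^ 4 * d\<^sup>2 * (\<kappa>\<^sup>2 * energy1 \<kappa> (S l) e + energy1 \<kappa> (S l) w)"
 proof (rule mult_left_mono[OF add_mono])
  show "x\<^sup>2 \<le> \<kappa>\<^sup>2 * energy1 \<kappa> (S l) e"
   unfolding x_def power_mult_distrib[of \<kappa> "\<kappa> * _"] nl_props(2)[OF l ep(1), symmetric]
   using norm1_components(2)[OF G_sub[OF l] ep(1) \<kappa>_pos] sn \<kappa>_pos by (intro mult_left_mono power_mono) auto
  show "y\<^sup>2 \<le> energy1 \<kappa> (S l) w"
   unfolding y_def nl_props(2)[OF l ep(2), symmetric]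
   using norm1_components(2)[OF G_sub[OF l] ep(2) \<kappa>_pos] sn \<kappa>_pos by (intro power_mono) auto
 qed simp
 finally have "Re (?di q q) \<le> 32 * K ^ 4 * d\<^sup>2 * (\<kappa>\<^sup>2 * energy1 \<kappa> (S l) e + energy1 \<kappa> (S l) w)"
  using sq2 by (simp add: power2_eq_square)
 then show thesis using that[OF qV harm _ W0(6)[OF l q(1)]] by blast
qed

definition Cd :: real where "Cd = 32 * K ^ 4 * (2 + grad_weight_const * K ^ 4 + ext_const)"
definition C1 :: real where "C1 = sqrt (K\<^sup>2 * Cd * (1 + Cw\<^sup>2))"
definition C2 :: real where "C2 = sqrt (K\<^sup>2 * (2 * Cw\<^sup>2 + 128 * K ^ 4 * ((1 + Cw\<^sup>2) / \<kappa>0\<^sup>2)))"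

lemma Cd_nonneg: "0 \<le> Cd"
 using K weight_const_pos ext_const_pos by (simp add: Cd_def grad_weight_const_def)

text \<open>Locally \<open>w\<close> is a small corrector plus a harmonic function. Gluing the correctors costs \<open>1 / d\<close> in the
 gradient, which their \<open>L\<^sup>2\<close> size \<open>O(d)\<close> relative to their energy compensates; the glued harmonic
 functions are in the coarse space up to the discarded modes.\<close>

lemma coarse_approximation:
 assumes e: "e \<in> V" and w: "w \<in> V"
  and aw: "\<And>v. v \<in> V ==> a v w = 2 * of_real (\<kappa>\<^sup>2) * l2_ip (\<Union>\<T>) v e" and nw: "nrm w \<le> Cw * \<kappa> * nrm e"
 obtains c where "c \<in> V0" "w - c \<in> V" "nrm (w - c) \<le> (C1 * (\<kappa> * d) + C2 * (\<rho> * \<kappa>)) * nrm e"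
proof -
 define X where "X l = \<kappa>\<^sup>2 * energy1 \<kappa> (S l) e + energy1 \<kappa> (S l) w" for l
 have "\<exists>q. q \<in> Vl l \<and> restr (S l) w - q \<in> harmonic_space p \<T> \<kappa> \<epsilon> (\<G> l) \<and>
  energy (S l) q \<le> 32 * K ^ 4 * d\<^sup>2 * X l \<and>
  mass (S l) q \<le> (K\<^sup>2 * d)\<^sup>2 * energy (S l) q" if l: "l \<in> {1..N}" for l
  using dirichlet_corrector[OF l e w aw] unfolding X_def by metis
 then obtain q where q: "\<And>l. l \<in> {1..N} ==> q l \<in> Vl l"
  "\<And>l. l \<in> {1..N} ==> restr (S l) w - q l \<in> harmonic_space p \<T> \<kappa> \<epsilon> (\<G> l)"
  "\<And>l. l \<in> {1..N} ==> energy (S l) (q l) \<le> 32 * K ^ 4 * d\<^sup>2 * X l"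
  "\<And>l. l \<in> {1..N} ==> mass (S l) (q l) \<le> (K\<^sup>2 * d)\<^sup>2 * energy (S l) (q l)"
  by metis
 define n2 where "n2 = (nrm e)\<^sup>2"
 have w2: "(nrm w)\<^sup>2 \<le> Cw\<^sup>2 * \<kappa>\<^sup>2 * n2"
  using power_mono[OF nw nrm_props(1)[OF w], of 2] by (simp add: n2_def power_mult_distrib)
 have X0: "0 \<le> X l" if "l \<in> {1..N}" for l
  unfolding X_def using psd_nonneg[OF nrm_psd(3)[OF that]] e w by simp
 have sumX: "(\<Sum>l=1..N. X l) \<le> K * ((1 + Cw\<^sup>2) * \<kappa>\<^sup>2 * n2)"
 proof -
  have "(\<Sum>l=1..N. X l) = \<kappa>\<^sup>2 * (\<Sum>l=1..N. energy1 \<kappa> (S l) e) + (\<Sum>l=1..N. energy1 \<kappa> (S l) w)"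
   by (simp add: X_def sum.distrib sum_distrib_left)
  also have "... \<le> \<kappa>\<^sup>2 * (K * n2) + K * (nrm w)\<^sup>2"
   unfolding n2_def nrm_props(2)[OF e] nrm_props(2)[OF w]
   by (intro add_mono mult_left_mono energy_sum_local[OF G_sub card_covering] e w) auto
  also have "... \<le> \<kappa>\<^sup>2 * (K * n2) + K * (Cw\<^sup>2 * \<kappa>\<^sup>2 * n2)" using w2 K by simp
  finally show ?thesis by (simp add: algebra_simps)
 qed
 have "(\<kappa> * (K\<^sup>2 * d))\<^sup>2 \<le> 1\<^sup>2" using kd \<kappa>_pos d_pos by (intro power_mono) (auto simp: mult_ac)
 then have kd2: "\<kappa>\<^sup>2 * (K\<^sup>2 * d)\<^sup>2 \<le> 1" by (simp add: power_mult_distrib)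
 have E0: "0 \<le> energy (S l) (q l)" if l: "l \<in> {1..N}" for l
  by (rule psd_nonneg[OF psd_ips(2)[OF G_els[OF l]] Vl_pw[OF l q(1)[OF l]]])
 have kq: "\<kappa>\<^sup>2 * mass (S l) (q l) \<le> energy (S l) (q l)" if l: "l \<in> {1..N}" for l
 proof -
  have "\<kappa>\<^sup>2 * mass (S l) (q l) \<le> \<kappa>\<^sup>2 * ((K\<^sup>2 * d)\<^sup>2 * energy (S l) (q l))"
   by (intro mult_left_mono q(4)[OF l]) simp
  also have "... \<le> 1 * energy (S l) (q l)"
   unfolding mult.assoc[symmetric] by (rule mult_right_mono[OF kd2 E0[OF l]])
  finally show ?thesis by simp
 qed
 define s where "s = (\<Sum>l=1..N. DE l (q l))"
 have sV: "s \<in> V" unfolding s_def by (rule cvs.subspace_sum[OF V_subspace DE_V])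
 have loc1: "energy1 \<kappa> (S l) (DE l (q l)) \<le> Cd * d\<^sup>2 * X l" if l: "l \<in> {1..N}" for l
 proof -
  let ?d = "energy (S l) (q l)" and ?n = "mass (S l) (q l)"
  have g0: "0 \<le> grad_weight_const / d\<^sup>2" using weight_const_pos K by (simp add: grad_weight_const_def)
  have "grad_weight_const / d\<^sup>2 * ?n \<le> grad_weight_const / d\<^sup>2 * ((K\<^sup>2 * d)\<^sup>2 * ?d)"
   by (rule mult_left_mono[OF q(4)[OF l] g0])
  also have "... = grad_weight_const * K ^ 4 * ?d" using d_pos by (simp add: power_mult_distrib flip: power_mult)
  finally have 1: "energy (S l) (DE l (q l)) \<le> (2 + grad_weight_const * K ^ 4) * ?d"
   using DE_bounds(1)[OF l q(1)[OF l]] by (simp add: algebra_simps)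
  have "\<kappa>\<^sup>2 * mass (S l) (DE l (q l)) \<le> \<kappa>\<^sup>2 * (ext_const * ?n)"
   by (intro mult_left_mono DE_bounds(2)[OF l q(1)[OF l]]) simp
  also have "... = ext_const * (\<kappa>\<^sup>2 * ?n)" by simp
  also have "... \<le> ext_const * ?d" using kq[OF l] ext_const_pos by (intro mult_left_mono) auto
  finally have "energy1 \<kappa> (S l) (DE l (q l)) \<le> (2 + grad_weight_const * K ^ 4 + ext_const) * ?d"
   unfolding norm1_sq_eq using 1 by (simp add: algebra_simps)
  also have "... \<le> (2 + grad_weight_const * K ^ 4 + ext_const) * (32 * K ^ 4 * d\<^sup>2 * X l)"
   using weight_const_pos ext_const_pos K by (intro mult_left_mono q(3)[OF l]) (simp add: grad_weight_const_def)
  finally show ?thesis by (simp add: Cd_def mult_ac)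
 qed
 have "(nrm s)\<^sup>2 \<le> K * (\<Sum>l=1..N. energy1 \<kappa> (S l) (DE l (q l)))"
  unfolding nrm_props(2)[OF sV] unfolding s_def by (rule energy_overlap_sum[OF DE_V DE_outside])
 also have "... \<le> K * (\<Sum>l=1..N. Cd * d\<^sup>2 * X l)" using K by (intro mult_left_mono sum_mono loc1) auto
 also have "... = K * (Cd * d\<^sup>2 * (\<Sum>l=1..N. X l))" by (simp add: sum_distrib_left)
 also have "... \<le> K * (Cd * d\<^sup>2 * (K * ((1 + Cw\<^sup>2) * \<kappa>\<^sup>2 * n2)))"
  using sumX K Cd_nonneg by (intro mult_left_mono) auto
 also have "... = (C1 * (\<kappa> * d) * nrm e)\<^sup>2"
 proof -
  have "C1\<^sup>2 = K\<^sup>2 * Cd * (1 + Cw\<^sup>2)" unfolding C1_def using Cd_nonneg by (intro real_sqrt_pow2) simp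
  then show ?thesis unfolding n2_def by (simp only: power_mult_distrib power2_eq_square[of K] mult_ac)
 qed
 finally have "nrm s \<le> C1 * (\<kappa> * d) * nrm e"
  by (rule power2_le_imp_le) (use nrm_props(1)[OF e] \<kappa>_pos d_pos Cd_nonneg in \<open>simp add: C1_def\<close>)
 note s_bound = this
 define \<phi> where "\<phi> l = restr (S l) w - q l" for l
 obtain c r' where cr: "c \<in> V0" "r' \<in> V" "(\<Sum>l=1..N. DE l (\<phi> l)) = c + r'"
  "(nrm r')\<^sup>2 \<le> K * \<rho>\<^sup>2 * (\<Sum>l=1..N. energy1 \<kappa> (S l) (\<phi> l))"
  by (rule harmonic_coarse_split[of \<phi>]) (use q(2) in \<open>auto simp: \<phi>_def\<close>)
 have loc2: "energy1 \<kappa> (S l) (\<phi> l) \<le> 2 * energy1 \<kappa> (S l) w + 128 * K ^ 4 * d\<^sup>2 * X l" if l: "l \<in> {1..N}" for l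
 proof -
  note sr = restr_local[OF w, of "\<G> l"] q(1)[OF l]
  have "\<phi> l = restr (S l) w + - q l" by (simp add: \<phi>_def)
  then have "energy1 \<kappa> (S l) (\<phi> l) \<le> 2 * energy1 \<kappa> (S l) (restr (S l) w)
    + 2 * energy1 \<kappa> (S l) (- q l)"
   using psd_two_terms[OF nrm_psd(2)[OF l] local_subspace sr(1) cvs.subspace_neg[OF local_subspace sr(2)]] by simp
  also have "ip1 \<kappa> (S l) (- q l) (- q l) = ip1 \<kappa> (S l) (q l) (q l)"
   using sesq_minus[OF psd_sesq[OF nrm_psd(2)[OF l]] local_subspace] sr(2) cvs.subspace_neg[OF local_subspace sr(2)] by simp
  also have "ip1 \<kappa> (S l) (restr (S l) w) (restr (S l) w) = ip1 \<kappa> (S l) w w"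
   by (rule ip1_cong[OF G_els[OF l] fe_pw_G[OF l w] fe_pw_G[OF l w]]) (auto simp: restr_def)
  also have "energy1 \<kappa> (S l) (q l) \<le> 2 * (32 * K ^ 4 * d\<^sup>2 * X l)"
   unfolding norm1_sq_eq using kq[OF l] q(3)[OF l] by linarith
  finally show ?thesis by simp
 qed
 have d2: "d\<^sup>2 * \<kappa>0\<^sup>2 \<le> 1"
 proof -
  have "\<kappa>0 * d \<le> \<kappa> * d" using \<kappa>0 d_pos by (intro mult_right_mono) auto
  then have "\<kappa>0 * d \<le> 1" using kd1 by linarith
  then have "(\<kappa>0 * d)\<^sup>2 \<le> 1\<^sup>2" using \<kappa>0 d_pos by (intro power_mono) auto
  then show ?thesis by (simp add: power_mult_distrib mult.commute)
 qed
 have "(\<Sum>l=1..N. energy1 \<kappa> (S l) (\<phi> l)) \<le> (\<Sum>l=1..N. 2 * energy1 \<kappa> (S l) w + 128 * K ^ 4 * d\<^sup>2 * X l)"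
  by (rule sum_mono[OF loc2])
 also have "... = 2 * (\<Sum>l=1..N. energy1 \<kappa> (S l) w) + 128 * K ^ 4 * d\<^sup>2 * (\<Sum>l=1..N. X l)"
  by (simp add: sum.distrib sum_distrib_left)
 also have "... \<le> 2 * (K * (Cw\<^sup>2 * \<kappa>\<^sup>2 * n2)) + 128 * K ^ 4 * (1 / \<kappa>0\<^sup>2) * (K * ((1 + Cw\<^sup>2) * \<kappa>\<^sup>2 * n2))"
 proof (intro add_mono mult_left_mono)
  have "(\<Sum>l=1..N. energy1 \<kappa> (S l) w) \<le> K * (nrm w)\<^sup>2"
   unfolding nrm_props(2)[OF w] by (rule energy_sum_local[OF G_sub card_covering w])
  also have "... \<le> K * (Cw\<^sup>2 * \<kappa>\<^sup>2 * n2)" using w2 K by (intro mult_left_mono) auto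
  finally show "(\<Sum>l=1..N. energy1 \<kappa> (S l) w) \<le> K * (Cw\<^sup>2 * \<kappa>\<^sup>2 * n2)" .
  have dk: "128 * K ^ 4 * d\<^sup>2 \<le> 128 * K ^ 4 * (1 / \<kappa>0\<^sup>2)" using d2 \<kappa>0 by (intro mult_left_mono) (auto simp: le_divide_eq)
  show "128 * K ^ 4 * d\<^sup>2 * (\<Sum>l=1..N. X l) \<le> 128 * K ^ 4 * (1 / \<kappa>0\<^sup>2) * (K * ((1 + Cw\<^sup>2) * \<kappa>\<^sup>2 * n2))"
   by (rule mult_mono[OF dk sumX]) (use X0 in \<open>auto intro!: sum_nonneg\<close>)
 qed simp
 finally have sp: "(\<Sum>l=1..N. energy1 \<kappa> (S l) (\<phi> l))
   \<le> 2 * (K * (Cw\<^sup>2 * \<kappa>\<^sup>2 * n2)) + 128 * K ^ 4 * (1 / \<kappa>0\<^sup>2) * (K * ((1 + Cw\<^sup>2) * \<kappa>\<^sup>2 * n2))" .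
 have "(nrm r')\<^sup>2 \<le> K * \<rho>\<^sup>2 * (2 * (K * (Cw\<^sup>2 * \<kappa>\<^sup>2 * n2)) + 128 * K ^ 4 * (1 / \<kappa>0\<^sup>2) * (K * ((1 + Cw\<^sup>2) * \<kappa>\<^sup>2 * n2)))"
  by (rule order_trans[OF cr(4) mult_left_mono[OF sp]]) (use K in simp)
 also have "... = K\<^sup>2 * (2 * Cw\<^sup>2 + 128 * K ^ 4 * ((1 + Cw\<^sup>2) / \<kappa>0\<^sup>2)) * (\<rho> * \<kappa>)\<^sup>2 * n2"
 proof -
  have id: "K * R * (2 * (K * (A * k * n)) + B * (1 / i) * (K * (A' * k * n))) = K\<^sup>2 * (2 * A + B * (A' / i)) * (R * k) * n"
   for R A B A' i k n :: real by (simp add: algebra_simps power2_eq_square)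
  show ?thesis unfolding power_mult_distrib by (rule id)
 qed
 also have "... = (C2 * (\<rho> * \<kappa>) * nrm e)\<^sup>2"
 proof -
  have "C2\<^sup>2 = K\<^sup>2 * (2 * Cw\<^sup>2 + 128 * K ^ 4 * ((1 + Cw\<^sup>2) / \<kappa>0\<^sup>2))" unfolding C2_def using K by (intro real_sqrt_pow2) simp
  then show ?thesis unfolding n2_def by (simp only: power_mult_distrib)
 qed
 finally have r_bound: "nrm r' \<le> C2 * (\<rho> * \<kappa>) * nrm e"
  by (rule power2_le_imp_le) (use nrm_props(1)[OF e] \<kappa>_pos \<rho> K in \<open>simp add: C2_def\<close>)
 have "w = (\<Sum>l=1..N. DE l (restr (S l) w))" by (rule DE_partition[OF w, symmetric])
 also have "... = s + (c + r')"
  unfolding s_def cr(3)[symmetric] sum.distrib[symmetric] \<phi>_def DE_diff by simp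
 finally have wc: "w - c = s + r'" by simp
 have "nrm (w - c) \<le> nrm s + nrm r'"
  unfolding wc norm1_eq by (rule snorm_triangle[OF nrm_psd(1) V_subspace sV cr(2)])
 also have "... \<le> (C1 * (\<kappa> * d) + C2 * (\<rho> * \<kappa>)) * nrm e" using s_bound r_bound by (simp add: algebra_simps)
 finally show thesis using that[OF cr(1)] wc cvs.subspace_add[OF V_subspace sV cr(2)] by simp
qed

lemma V0_subspace: "cvs.subspace V0" and V0_sub: "V0 \<subseteq> V"
proof -
 have eq: "(\<lambda>x. \<Sum>l=1..N. DE l (v l) x) = (\<Sum>l=1..N. DE l (v l))" for v by (simp add: fun_eq_iff fapply)
 show "V0 \<subseteq> V"
 proof
  fix u assume "u \<in> V0"
  then obtain v where "u = (\<Sum>l=1..N. DE l (v l))" unfolding coarse_space_def eq by blast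
  then show "u \<in> V" using cvs.subspace_sum[OF V_subspace DE_V] by simp
 qed
 have sp: "cvs.subspace (complex_span {k l..m l} (\<xi> l))" for l unfolding complex_span_eq[OF finite_atLeastAtMost] by (rule cvs.subspace_span)
 have mem: "u \<in> V0 \<longleftrightarrow> (\<exists>v. u = (\<Sum>l=1..N. DE l (v l)) \<and> (\<forall>l\<in>{1..N}. v l \<in> complex_span {k l..m l} (\<xi> l)))" for u
  unfolding coarse_space_def eq by blast
 show "cvs.subspace V0"
  unfolding cvs.subspace_def
 proof (intro conjI ballI allI)
  show "0 \<in> V0" unfolding mem by (rule exI[of _ "\<lambda>l. 0"]) (simp add: DE_zero cvs.subspace_0[OF sp])
 next
  fix u v assume "u \<in> V0" "v \<in> V0"
  then obtain u' v' where "u = (\<Sum>l=1..N. DE l (u' l))" "\<forall>l\<in>{1..N}. u' l \<in> complex_span {k l..m l} (\<xi> l)"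
   "v = (\<Sum>l=1..N. DE l (v' l))" "\<forall>l\<in>{1..N}. v' l \<in> complex_span {k l..m l} (\<xi> l)" unfolding mem by blast
  then show "u + v \<in> V0" unfolding mem
   by (intro exI[of _ "\<lambda>l. u' l + v' l"]) (simp add: DE_add sum.distrib cvs.subspace_add[OF sp])
 next
  fix c u assume "u \<in> V0"
  then obtain u' where "u = (\<Sum>l=1..N. DE l (u' l))" "\<forall>l\<in>{1..N}. u' l \<in> complex_span {k l..m l} (\<xi> l)" unfolding mem by blast
  then show "c *\<^sub>C u \<in> V0" unfolding mem
   by (intro exI[of _ "\<lambda>l. c *\<^sub>C u' l"]) (simp add: DE_scl cvs.scale_sum_right cvs.subspace_scale[OF sp])
 qed
qed

text \<open>Schatz' argument: Galerkin orthogonality and duality turn the Garding inequality into coercivity.\<close>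

lemma schatz:
 assumes e: "e \<in> V" and orth: "\<And>c. c \<in> V0 ==> a e c = 0"
  and eta: "C1 * (\<kappa> * d) + C2 * (\<rho> * \<kappa>) \<le> 1 / (2 * Ca)"
 shows "(nrm e)\<^sup>2 \<le> 2 * Re (a e e)"
proof -
 obtain w where w: "w \<in> V" "\<And>v. v \<in> V ==> a v w = 2 * of_real (\<kappa>\<^sup>2) * l2_ip (\<Union>\<T>) v e" "nrm w \<le> Cw * \<kappa> * nrm e"
  by (rule adjoint_solution[OF e]) (rule that)
 obtain c where c: "c \<in> V0" "w - c \<in> V" "nrm (w - c) \<le> (C1 * (\<kappa> * d) + C2 * (\<rho> * \<kappa>)) * nrm e"
  by (rule coarse_approximation[OF e w])
 have cV: "c \<in> V" using c(1) V0_sub by blast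
 have ep: "e \<in> pw p \<T>" using e fe_pw by blast
 let ?N = "mass (\<Union>\<T>) e"
 have "2 * \<kappa>\<^sup>2 * ?N = Re (a e w)" unfolding w(2)[OF e] by (simp flip: of_real_power)
 also have "a e w = a e (w - c)" using sesq_diff(2)[OF sesq_a V_subspace w(1) cV e] orth[OF c(1)] by simp
 also have "Re (a e (w - c)) \<le> Ca * (nrm e * nrm (w - c))"
  using form_bound[OF e c(2)] complex_Re_le_cmod order_trans by blast
 also have "... \<le> Ca * (nrm e * (1 / (2 * Ca) * nrm e))"
  using order_trans[OF c(3) mult_right_mono[OF eta nrm_props(1)[OF e]]] nrm_props(1)[OF e] Ca_ge
  by (intro mult_left_mono) auto
 also have "... = (nrm e)\<^sup>2 / 2" using Ca_ge by (simp add: power2_eq_square)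
 finally have 1: "2 * \<kappa>\<^sup>2 * ?N \<le> (nrm e)\<^sup>2 / 2" .
 have "Im (l2_ip (\<Union>\<T>) e e) = 0" unfolding l2_ip_self by simp
 moreover have "Im (boundary_ip \<T> e e) = 0"
  using psd_real[OF psd_boundary_ip[OF conf] ep] by (metis Im_complex_of_real)
 ultimately have "Re (a e e) = energy (\<Union>\<T>) e - \<kappa>\<^sup>2 * ?N"
  by (simp add: helm_def flip: of_real_power)
 then show ?thesis using 1 nrm_props(2)[OF e] unfolding norm1_sq_eq by linarith
qed

end

section \<open>The preconditioned operator\<close>

lemma variational_solution_cong:
 assumes "\<And>w. w \<in> V ==> F w = F' w"
 shows "variational_solution V b F = variational_solution V b F'"
proof -
 have "(\<lambda>u. u \<in> V \<and> (\<forall>w\<in>V. b u w = F w)) = (\<lambda>u. u \<in> V \<and> (\<forall>w\<in>V. b u w = F' w))" using assms by auto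
 then show ?thesis by (simp only: variational_solution_def)
qed

text \<open>Representing both sides of a variational problem by the \<open>L\<^sup>2\<close> inner product and inverting the
 resulting operator is the same as solving the variational problem.\<close>

lemma the_inv_form_op:
 assumes W: "fdim W" and l2: "psd W (l2_ip (\<Union>\<G>))" and df: "\<And>u. u \<in> W ==> l2_ip (\<Union>\<G>) u u = 0 ==> u = 0"
  and b: "sesq W (helm \<kappa> \<epsilon> \<G>)" and nd: "\<And>u. u \<in> W ==> \<forall>w\<in>W. helm \<kappa> \<epsilon> \<G> u w = 0 ==> u = 0" and F: "antilin W F"
 shows "the_inv_into W (form_op W \<G> \<kappa> \<epsilon>) (variational_solution W (l2_ip (\<Union>\<G>)) F) = variational_solution W (helm \<kappa> \<epsilon> \<G>) F"
proof -
 let ?a = "helm \<kappa> \<epsilon> \<G>" and ?l = "l2_ip (\<Union>\<G>)"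
 have sub: "cvs.subspace W" using W by auto
 have f: "?l (form_op W \<G> \<kappa> \<epsilon> u) w = ?a u w" if "u \<in> W" "w \<in> W" for u w
  unfolding form_op_def
  by (rule variational_solution(2)[OF riesz_unique_solution[OF W l2 df antilin_sesq[OF b that(1)]] that(2)])
 note uF = galerkin_unique_solution[OF W b nd F] and yF = riesz_unique_solution[OF W l2 df F]
 define u where "u = variational_solution W ?a F"
 have u1: "u \<in> W" unfolding u_def by (rule variational_solution(1)[OF uF])
 have u2: "?a u w = F w" if "w \<in> W" for w unfolding u_def by (rule variational_solution(2)[OF uF that])
 have eq: "form_op W \<G> \<kappa> \<epsilon> u = variational_solution W ?l F"
  unfolding form_op_def by (rule variational_solution_cong[OF u2])
 have "inj_on (form_op W \<G> \<kappa> \<epsilon>) W"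
 proof (rule inj_onI)
  fix x y assume xy: "x \<in> W" "y \<in> W" "form_op W \<G> \<kappa> \<epsilon> x = form_op W \<G> \<kappa> \<epsilon> y"
  have "?a (x - y) w = 0" if "w \<in> W" for w
   using sesq_diff(1)[OF b sub xy(1,2) that] f[OF xy(1) that] f[OF xy(2) that] xy(3) by simp
  then have "x - y = 0" using nd[OF cvs.subspace_diff[OF sub xy(1,2)]] by blast
  then show "x = y" by simp
 qed
 then have "the_inv_into W (form_op W \<G> \<kappa> \<epsilon>) (form_op W \<G> \<kappa> \<epsilon> u) = u" by (rule the_inv_into_f_f[OF _ u1])
 then show ?thesis unfolding eq unfolding u_def .
qed

context helmholtz_dd
begin

lemma l2_V: "psd V (l2_ip (\<Union>\<T>))" "u \<in> V ==> l2_ip (\<Union>\<T>) u u = 0 ==> u = 0"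
proof -
 show "psd V (l2_ip (\<Union>\<T>))" by (rule psd_subset[OF psd_ips(1)[OF els] fe_pw])
 show "u = 0" if "u \<in> V" "l2_ip (\<Union>\<T>) u u = 0"
  by (rule local_l2_definite[OF subset_refl]) (simp_all add: that fe_local_self)
qed

lemma form_op_V: "v \<in> V ==> w \<in> V ==> l2_ip (\<Union>\<T>) (form_op V \<T> \<kappa> \<epsilon> v) w = a v w"
 unfolding form_op_def
 by (rule variational_solution(2)[OF riesz_unique_solution[OF V_fdim l2_V antilin_sesq[OF sesq_a]]])

lemma one_level_eq:
 assumes v: "v \<in> V"
 shows "one_level p \<T> \<kappa> \<epsilon> N \<G> pu (form_op V \<T> \<kappa> \<epsilon> v) = (\<Sum>l=1..N. DE l (Pl l v))"
proof -
 have "the_inv_into (Vl l) (form_op (Vl l) (\<G> l) \<kappa> \<epsilon>) (ext_adjoint p \<T> (\<G> l) (form_op V \<T> \<kappa> \<epsilon> v)) = Pl l v"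
  if l: "l \<in> {1..N}" for l
 proof -
  have eV: "ext p \<T> w \<in> V" for w by (simp add: ext_def interp_fe)
  have "ext_adjoint p \<T> (\<G> l) (form_op V \<T> \<kappa> \<epsilon> v) = variational_solution (Vl l) (l2_ip (S l)) (\<lambda>w. a v (ext p \<T> w))"
   unfolding ext_adjoint_def by (rule variational_solution_cong) (rule form_op_V[OF v eV])
  moreover have "antilin (Vl l) (\<lambda>w. a v (ext p \<T> w))"
   unfolding antilin_def by (intro conjI ballI allI) (simp_all only: ext_add ext_scl sesqD(2,4)[OF sesq_a] v eV)
  moreover have "u = 0" if "u \<in> Vl l" "l2_ip (S l) u u = 0" for u
   by (rule local_l2_definite[OF G_sub[OF l] that(1)]) (simp add: that(2))
  ultimately show ?thesis
   using the_inv_form_op[OF local_fdim psd_subset[OF psd_ips(1)[OF G_els[OF l]] local_pw[OF G_sub[OF l]]] _ sesq_al[OF l]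
    local_nondegenerate[OF l]] by (simp only: Pl_def)
 qed
 then show ?thesis unfolding one_level_def by (intro ext) (simp add: fapply)
qed

context
 assumes eta: "C1 * (\<kappa> * d) + C2 * (\<rho> * \<kappa>) \<le> 1 / (2 * Ca)"
begin

lemma coarse_nondegenerate:
 assumes u: "u \<in> V0" and z: "\<forall>c\<in>V0. a u c = 0" shows "u = 0"
proof -
 have uV: "u \<in> V" using u V0_sub by blast
 have "(nrm u)\<^sup>2 \<le> 2 * Re (a u u)" by (rule schatz[OF uV _ eta]) (use z in blast)
 then have "(nrm u)\<^sup>2 \<le> 0" using z u by simp
 then show ?thesis using nrm_props(3)[OF uV] by fastforce
qed

definition P0 :: "scalar_fun \<Rightarrow> scalar_fun" where "P0 y = variational_solution V0 a (a y)"

lemma V0_fdim: "fdim V0"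
 by (rule fdim_subset[OF V_fdim V0_subspace V0_sub])

lemma sesq_V0: "sesq V0 a"
 by (rule sesq_subset[OF sesq_a V0_sub])

lemma antilin_V0: "y \<in> V ==> antilin V0 (a y)"
 using antilin_sesq[OF sesq_a] V0_sub unfolding antilin_def by blast

lemma P0:
 assumes y: "y \<in> V" shows "P0 y \<in> V0" "w \<in> V0 ==> a (P0 y) w = a y w"
proof -
 note u = galerkin_unique_solution[OF V0_fdim sesq_V0 coarse_nondegenerate antilin_V0[OF y]]
 show "P0 y \<in> V0" unfolding P0_def by (rule variational_solution(1)[OF u])
 show "a (P0 y) w = a y w" if "w \<in> V0" unfolding P0_def by (rule variational_solution(2)[OF u that])
qed

lemma coarse_solve_eq:
 assumes y: "y \<in> V" shows "coarse_solve \<T> \<kappa> \<epsilon> V0 (form_op V \<T> \<kappa> \<epsilon> y) = P0 y"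
proof -
 have "coarse_adjoint \<T> V0 (form_op V \<T> \<kappa> \<epsilon> y) = variational_solution V0 (l2_ip (\<Union>\<T>)) (a y)"
  unfolding coarse_adjoint_def by (rule variational_solution_cong) (use form_op_V[OF y] V0_sub in blast)
 moreover have "the_inv_into V0 (form_op V0 \<T> \<kappa> \<epsilon>) (variational_solution V0 (l2_ip (\<Union>\<T>)) (a y)) = variational_solution V0 a (a y)"
 proof (rule the_inv_form_op[OF V0_fdim psd_subset[OF l2_V(1) V0_sub] _ sesq_V0 coarse_nondegenerate antilin_V0[OF y]])
  show "u = 0" if "u \<in> V0" "l2_ip (\<Union>\<T>) u u = 0" for u by (rule l2_V(2)[OF subsetD[OF V0_sub that(1)] that(2)])
 qed
 ultimately show ?thesis by (simp only: coarse_solve_def P0_def)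
qed

text \<open>Quasi-optimality of the coarse Galerkin projection.\<close>

lemma coarse_correction_bound:
 assumes r': "r' \<in> V" shows "nrm (r' - P0 r') \<le> 2 * Ca * nrm r'"
proof -
 let ?e = "r' - P0 r'"
 have PV: "P0 r' \<in> V" using P0(1)[OF r'] V0_sub by blast
 have eV: "?e \<in> V" by (rule cvs.subspace_diff[OF V_subspace r' PV])
 have orth: "a ?e c = 0" if "c \<in> V0" for c
  using sesq_diff(1)[OF sesq_a V_subspace r' PV] P0(2)[OF r' that] V0_sub that by auto
 have "(nrm ?e)\<^sup>2 \<le> 2 * Re (a ?e ?e)" by (rule schatz[OF eV orth eta])
 also have "a ?e ?e = a ?e r'"
  unfolding sesq_diff(2)[OF sesq_a V_subspace r' PV eV] orth[OF P0(1)[OF r']] by simp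
 also have "2 * Re (a ?e r') \<le> 2 * (Ca * (nrm ?e * nrm r'))"
  using form_bound[OF eV r'] complex_Re_le_cmod[of "a ?e r'"] by linarith
 finally have *: "nrm ?e * nrm ?e \<le> nrm ?e * (2 * Ca * nrm r')" by (simp add: power2_eq_square mult_ac)
 show ?thesis
 proof (cases "nrm ?e = 0")
  case True
  then show ?thesis using nrm_props(1)[OF r'] Ca_ge by simp
 next
  case False
  then show ?thesis using * nrm_props(1)[OF eV] by simp
 qed
qed

text \<open>The coarse projection removes the coarse component of the one-level residual, leaving the projection
 error of the small remainder.\<close>

lemma preconditioned_close_to_identity:
 assumes v: "v \<in> V" and small: "4 * Ca * (Cr * (\<rho> * \<kappa>)) \<le> 1"
 obtains e where "e \<in> V" "P_op p \<T> \<kappa> \<epsilon> N \<G> pu V0 v = v - e" "nrm e \<le> 1/2 * nrm v"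
proof -
 define y where "y = (\<Sum>l=1..N. DE l (Pl l v))"
 have y: "y \<in> V" unfolding y_def by (rule cvs.subspace_sum[OF V_subspace DE_V])
 obtain c r' where cr: "c \<in> V0" "r' \<in> V" "v - y = c + r'" "nrm r' \<le> Cr * (\<rho> * \<kappa>) * nrm v"
  by (rule one_level_residual[OF v]) (rule that[unfolded y_def])
 have cV: "c \<in> V" using cr(1) V0_sub by blast
 have "P0 v - P0 y - (c + P0 r') = 0"
 proof (rule coarse_nondegenerate)
  note s = V0_subspace and m = P0(1)[OF v] P0(1)[OF y] P0(1)[OF cr(2)] cr(1)
  note d = cvs.subspace_diff[OF s m(1,2)] and ad = cvs.subspace_add[OF s m(4,3)]
  show "P0 v - P0 y - (c + P0 r') \<in> V0" by (rule cvs.subspace_diff[OF s d ad])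
  show "\<forall>w\<in>V0. a (P0 v - P0 y - (c + P0 r')) w = 0"
  proof
   fix w assume w: "w \<in> V0"
   then have wV: "w \<in> V" using V0_sub by blast
   have "a (P0 v - P0 y - (c + P0 r')) w = a v w - a y w - (a c w + a r' w)"
    unfolding sesq_diff(1)[OF sesq_V0 s d ad w] sesq_diff(1)[OF sesq_V0 s m(1,2) w] sesqD(1)[OF sesq_V0 m(4,3) w]
     P0(2)[OF v w] P0(2)[OF y w] P0(2)[OF cr(2) w] ..
   also have "a v w - a y w = a (c + r') w"
    unfolding cr(3)[symmetric] by (rule sesq_diff(1)[OF sesq_a V_subspace v y wV, symmetric])
   also have "... = a c w + a r' w" by (rule sesqD(1)[OF sesq_a cV cr(2) wV])
   finally show "a (P0 v - P0 y - (c + P0 r')) w = 0" by simp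
  qed
 qed
 then have Pd: "P0 v - P0 y = c + P0 r'" by simp
 define e where "e = r' - P0 r'"
 have eV: "e \<in> V"
  unfolding e_def by (rule cvs.subspace_diff[OF V_subspace cr(2)]) (use P0(1)[OF cr(2)] V0_sub in blast)
 have "P_op p \<T> \<kappa> \<epsilon> N \<G> pu V0 v = (\<lambda>x. y x - P0 y x + P0 v x)"
  unfolding P_op_def B_inv_def Let_def one_level_eq[OF v] y_def[symmetric] coarse_solve_eq[OF y] coarse_solve_eq[OF v] ..
 also have "... = y + (P0 v - P0 y)" by (simp add: fun_eq_iff fapply)
 also have "... = v - e"
 proof -
  have "y = v - (c + r')" using cr(3) by (simp add: algebra_simps)
  then show ?thesis unfolding Pd e_def by simp
 qed
 finally have P: "P_op p \<T> \<kappa> \<epsilon> N \<G> pu V0 v = v - e" .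
 have "nrm e \<le> 2 * Ca * (Cr * (\<rho> * \<kappa>) * nrm v)"
  unfolding e_def
  by (rule order_trans[OF coarse_correction_bound[OF cr(2)] mult_left_mono[OF cr(4)]]) (use Ca_ge in simp)
 also have "... = (4 * Ca * (Cr * (\<rho> * \<kappa>))) * (1/2 * nrm v)" by simp
 also have "... \<le> 1 * (1/2 * nrm v)" by (rule mult_right_mono[OF small]) (use nrm_props(1)[OF v] in simp)
 finally show thesis using that[OF eV P] by simp
qed

lemma preconditioned_field_of_values:
 assumes v: "v \<in> V" and small: "4 * Ca * (Cr * (\<rho> * \<kappa>)) \<le> 1"
 shows "nrm (P_op p \<T> \<kappa> \<epsilon> N \<G> pu V0 v) \<le> 3/2 * nrm v"
  "1/2 * (nrm v)\<^sup>2 \<le> cmod (ip1 \<kappa> (\<Union>\<T>) v (P_op p \<T> \<kappa> \<epsilon> N \<G> pu V0 v))"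
proof -
 obtain e where e: "e \<in> V" "P_op p \<T> \<kappa> \<epsilon> N \<G> pu V0 v = v - e" "nrm e \<le> 1/2 * nrm v"
  by (rule preconditioned_close_to_identity[OF v small])
 show "nrm (P_op p \<T> \<kappa> \<epsilon> N \<G> pu V0 v) \<le> 3/2 * nrm v"
  using snorm_diff[OF nrm_psd(1) V_subspace v e(1)] e(3) unfolding e(2) norm1_eq by linarith
 have "cmod (ip1 \<kappa> (\<Union>\<T>) v e) \<le> nrm v * nrm e"
  unfolding norm1_eq by (rule psd_cauchy_schwarz[OF nrm_psd(1) V_subspace v e(1)])
 also have "... \<le> nrm v * (1/2 * nrm v)" by (rule mult_left_mono[OF e(3) nrm_props(1)[OF v]])
 finally have "cmod (ip1 \<kappa> (\<Union>\<T>) v e) \<le> 1/2 * (nrm v)\<^sup>2" by (simp add: power2_eq_square)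
 then have "(nrm v)\<^sup>2 - 1/2 * (nrm v)\<^sup>2 \<le> Re (ip1 \<kappa> (\<Union>\<T>) v (v - e))"
  using sesq_diff(2)[OF psd_sesq[OF nrm_psd(1)] V_subspace v e(1) v] nrm_props(2)[OF v]
   complex_Re_le_cmod[of "ip1 \<kappa> (\<Union>\<T>) v e"] by simp
 then show "1/2 * (nrm v)\<^sup>2 \<le> cmod (ip1 \<kappa> (\<Union>\<T>) v (P_op p \<T> \<kappa> \<epsilon> N \<G> pu V0 v))"
  unfolding e(2) using complex_Re_le_cmod[of "ip1 \<kappa> (\<Union>\<T>) v (v - e)"] by linarith
qed

end

end

section \<open>The parameters and the constants\<close>

text \<open>A mesh size comparable to \<open>\<kappa>\<close> to the power \<open>-(1 + \<gamma>)\<close> cannot exceed the size of the domain, so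
 \<open>\<kappa>\<close> is bounded below; and \<open>\<gamma> \<le> 1\<close> bounds \<open>1 / h\<close> by a multiple of \<open>\<kappa>\<^sup>2\<close>.\<close>

lemma wavenumber_lower_bound:
 fixes \<kappa> \<gamma> B :: real
 assumes \<kappa>: "0 < \<kappa>" and \<gamma>: "0 < \<gamma>" and B: "\<kappa> powr (- (1 + \<gamma>)) \<le> B"
 shows "B powr (- (1 / (1 + \<gamma>))) \<le> \<kappa>"
proof -
 have "B powr (- (1 / (1 + \<gamma>))) \<le> (\<kappa> powr (- (1 + \<gamma>))) powr (- (1 / (1 + \<gamma>)))"
  by (rule powr_mono2'[OF _ _ B]) (use \<kappa> \<gamma> in auto)
 also have "... = \<kappa>"
 proof -
  have "(- (1 + \<gamma>)) * (- (1 / (1 + \<gamma>))) = 1" using \<gamma> by (simp only: minus_mult_minus) simp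
  then show ?thesis unfolding powr_powr using \<kappa> by simp
 qed
 finally show ?thesis .
qed

lemma mesh_size_lower_bound:
 fixes \<kappa> \<gamma> \<kappa>0 h K :: real
 assumes \<kappa>: "0 < \<kappa>0" "\<kappa>0 \<le> \<kappa>" and \<gamma>: "\<gamma> \<le> 1" and K: "1 \<le> K" and h: "\<kappa> powr (- (1 + \<gamma>)) \<le> K * h"
 shows "1 \<le> K / \<kappa>0 powr (1 - \<gamma>) * \<kappa>\<^sup>2 * h"
proof -
 have k: "0 < \<kappa>" using \<kappa> by linarith
 have "\<kappa>0 powr (1 - \<gamma>) \<le> \<kappa> powr (1 - \<gamma>)" by (rule powr_mono2) (use \<kappa> \<gamma> in auto)
 also have "... = \<kappa>\<^sup>2 * \<kappa> powr (- (1 + \<gamma>))"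
 proof -
  have "\<kappa>\<^sup>2 = \<kappa> powr 2" using k by simp
  then show ?thesis by (simp add: powr_add[symmetric])
 qed
 also have "... \<le> \<kappa>\<^sup>2 * (K * h)" by (rule mult_left_mono[OF h]) simp
 finally show ?thesis using \<kappa> by (simp add: field_simps)
qed

theorem theorem6p2:
  fixes \<Omega> :: "pt set" and p :: nat and \<gamma> \<tau> K M :: real
  assumes "lipschitz_domain \<Omega>"
    and "\<exists>z r. star_shaped_wrt_disc \<Omega> z r"
    and "1 \<le> p"
    and "0 < \<gamma>" and "\<gamma> \<le> 1"
    and "0 \<le> \<tau>" and "\<tau> \<le> 1/3"
    and "1 \<le> K" and "1 \<le> M"
  shows "\<exists>C0>0. \<forall>L\<ge>1. \<exists>C>0. \<exists>c>0.
    \<forall>(\<kappa>::real) (\<epsilon>::real) (\<rho>::real) (d::real) (\<delta>::real) (hbar :: real \<Rightarrow> nat \<Rightarrow> real)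
      (\<T> :: pt set set) (N::nat) (\<C> :: nat \<Rightarrow> pt set set) (\<G> :: nat \<Rightarrow> pt set set)
      (pu :: nat \<Rightarrow> pt \<Rightarrow> real) (m :: nat \<Rightarrow> nat) (k :: nat \<Rightarrow> nat)
      (ev :: nat \<Rightarrow> nat \<Rightarrow> real) (\<xi> :: nat \<Rightarrow> nat \<Rightarrow> scalar_fun).
      0 < \<kappa> \<and> 0 \<le> \<epsilon> \<and> \<epsilon> \<le> \<kappa> \<and>
      regular_mesh K \<Omega> \<T> \<and>
      mesh_size \<T> \<le> K * \<kappa> powr (- (1 + \<gamma>)) \<and> \<kappa> powr (- (1 + \<gamma>)) \<le> K * mesh_size \<T> \<and>
      mesh_threshold K M \<Omega> p hbar \<and> mesh_size \<T> < hbar \<kappa> p \<and>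
      overlapping_decomposition K \<T> d \<delta> N \<C> \<G> \<and>
      partition_of_unity K \<Omega> \<delta> N \<G> pu \<and>
      star_shaped_subdomains K N \<C> \<G> \<and>
      (\<forall>l\<in>{1..N}. real (card (neighbours N \<G> l)) \<le> K) \<and>
      d / \<delta> \<le> K \<and>
      d \<le> K * \<kappa> powr (- (1 + \<tau>)) \<and> \<kappa> powr (- (1 + \<tau>)) \<le> L * d \<and>
      (\<forall>l\<in>{1..N}. eigenpairs p \<T> \<kappa> \<epsilon> (\<G> l) (pu l) (m l) (ev l) (\<xi> l)) \<and>
      0 < \<rho> \<and> \<rho> < 1 \<and>
      (\<forall>l\<in>{1..N}. cutoff_index \<rho> (m l) (ev l) (k l)) \<and>
      \<kappa> * d \<le> C0 \<and> \<rho> * \<kappa> \<le> C0 \<longrightarrow>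
      (\<forall>v\<in>fe_space p \<T>.
         let Pv = P_op p \<T> \<kappa> \<epsilon> N \<G> pu (coarse_space p \<T> N pu m k \<xi>) v
         in norm1 \<kappa> (\<Union>\<T>) Pv \<le> C * norm1 \<kappa> (\<Union>\<T>) v \<and>
            cmod (ip1 \<kappa> (\<Union>\<T>) v Pv) \<ge> c * (norm1 \<kappa> (\<Union>\<T>) v)\<^sup>2)"
proof -
 obtain z r where star: "star_shaped_wrt_disc \<Omega> z r" using assms(2) by blast
 have bd: "bounded (closure \<Omega>)" using assms(1) bounded_closure unfolding lipschitz_domain_def by blast
 then obtain D0 where D0: "\<And>x. x \<in> closure \<Omega> ==> dist z x \<le> D0" using bounded_any_center[of _ z] by blast
 define D where "D = max D0 1"
 have D: "0 < D" "norm (x - z) \<le> D" if "x \<in> closure \<Omega>" for x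
  using D0[OF that] by (auto simp: D_def dist_norm norm_minus_commute)
 have D1: "0 < D" by (simp add: D_def)
 define \<kappa>0 where "\<kappa>0 = (K * (2 * D)) powr (- (1 / (1 + \<gamma>)))"
 have \<kappa>0: "0 < \<kappa>0" using D1 \<open>1 \<le> K\<close> by (simp add: \<kappa>0_def)
 define ch where "ch = K / \<kappa>0 powr (1 - \<gamma>)"
 have ch: "0 < ch" using \<kappa>0 \<open>1 \<le> K\<close> by (simp add: ch_def)
 define ca where "ca = helmholtz_dd.Ca K p \<kappa>0 D r"
 define c1 where "c1 = helmholtz_dd.C1 K p M \<kappa>0"
 define c2 where "c2 = helmholtz_dd.C2 K M \<kappa>0"
 define cr where "cr = helmholtz_dd.Cr K p M \<kappa>0 ch"
 define A where "A = \<bar>ca\<bar> + 1"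
 define B where "B = \<bar>c1\<bar> + \<bar>c2\<bar> + \<bar>cr\<bar> + 1"
 have AB: "0 < A" "0 < B" by (auto simp: A_def B_def)
 have cB: "c1 \<le> B" "c2 \<le> B" "cr \<le> B" by (auto simp: B_def)
 \<comment> \<open>The first bound makes the subdomains small against the wave length, the second one makes the coarse
 approximation error and the remainder small against the continuity constant.\<close>
 define C0 where "C0 = min (1 / (2 * K\<^sup>2)) (1 / (4 * A * B))"
 have C0: "0 < C0" using AB \<open>1 \<le> K\<close> by (simp add: C0_def)
 show ?thesis
 proof (rule exI[of _ C0], intro conjI allI impI, rule C0, rule exI[of _ "3/2"], rule conjI, simp,
   rule exI[of _ "1/2"], rule conjI, simp, intro allI impI, goal_cases)
  case (1 L \<kappa> \<epsilon> \<rho> d \<delta> hbar \<T> N \<C> \<G> pu m k ev \<xi>)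
  note H = 1(2)
  interpret fe_mesh K \<Omega> \<T> p by unfold_locales (use H assms in auto)
  have "mesh_size \<T> \<le> 2 * D"
  proof -
   have "diameter T \<le> 2 * D" if T: "T \<in> \<T>" for T
   proof (rule diameter_le)
    show "T \<noteq> {} \<or> 0 \<le> 2 * D" using D1 by simp
    fix x y assume "x \<in> T" "y \<in> T"
    then have "norm (x - z) \<le> D" "norm (y - z) \<le> D" using T cover D(2) by blast+
    then show "norm (x - y) \<le> 2 * D" using norm_triangle_ineq4[of "x - z" "y - z"] by simp
   qed
   then show ?thesis unfolding mesh_size_def using fin ne by simp
  qed
  then have "K * mesh_size \<T> \<le> K * (2 * D)" using \<open>1 \<le> K\<close> by (intro mult_left_mono) auto
  then have "\<kappa> powr (- (1 + \<gamma>)) \<le> K * (2 * D)" using H by linarith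
  then have k0: "\<kappa>0 \<le> \<kappa>" unfolding \<kappa>0_def by (intro wavenumber_lower_bound) (use H assms in auto)
  have chh: "1 \<le> ch * \<kappa>\<^sup>2 * mesh_size \<T>"
   unfolding ch_def by (rule mesh_size_lower_bound[OF \<kappa>0 k0]) (use H assms in auto)
  have "mesh_threshold K M \<Omega> p hbar" using H by blast
  note thresh = this[unfolded mesh_threshold_def, THEN spec, THEN spec, THEN spec, THEN spec, THEN spec, THEN spec,
    THEN spec, THEN spec, THEN mp, of \<kappa> \<epsilon> \<T> d \<delta> N \<C> \<G>]
  have thr: "0 < \<kappa> \<and> 0 \<le> \<epsilon> \<and> \<epsilon> \<le> \<kappa> \<and> regular_mesh K \<Omega> \<T> \<and> overlapping_decomposition K \<T> d \<delta> N \<C> \<G> \<and>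
    star_shaped_subdomains K N \<C> \<G> \<and> mesh_size \<T> < hbar \<kappa> p" using H by blast
  note thr = thresh[OF thr]
  have d0: "0 < d" using H by (simp add: overlapping_decomposition_def)
  have kd: "2 * K\<^sup>2 * (\<kappa> * d) \<le> 1"
  proof -
   have "\<kappa> * d \<le> 1 / (2 * K\<^sup>2)" using H by (simp add: C0_def)
   then show ?thesis using \<open>1 \<le> K\<close> by (simp add: le_divide_eq mult.commute)
  qed
  interpret helmholtz_dd K \<Omega> \<T> p d \<delta> N \<C> \<G> pu \<kappa> \<epsilon> M \<kappa>0 D r ch \<rho> z m k ev \<xi>
   by unfold_locales (use H assms(1) \<kappa>0 k0 \<open>1 \<le> M\<close> star D(2) D1 ch chh thr kd in blast)+
  have ca: "0 < ca" "ca \<le> A" using Ca_ge by (auto simp: ca_def A_def)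
  have s: "\<kappa> * d \<le> 1 / (4 * A * B)" "\<rho> * \<kappa> \<le> 1 / (4 * A * B)" using H by (auto simp: C0_def)
  have nn: "0 \<le> \<kappa> * d" "0 \<le> \<rho> * \<kappa>" using H d0 by auto
  have eta: "c1 * (\<kappa> * d) + c2 * (\<rho> * \<kappa>) \<le> 1 / (2 * ca)"
  proof -
   have "c1 * (\<kappa> * d) + c2 * (\<rho> * \<kappa>) \<le> B * (1 / (4 * A * B)) + B * (1 / (4 * A * B))"
    using s nn AB cB by (intro add_mono mult_mono) auto
   also have "\<dots> = 1 / (2 * A)" using AB by (simp add: field_simps)
   also have "\<dots> \<le> 1 / (2 * ca)" using ca by (intro divide_left_mono) auto
   finally show ?thesis .
  qed
  have small: "4 * ca * (cr * (\<rho> * \<kappa>)) \<le> 1"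
  proof -
   have "cr * (\<rho> * \<kappa>) \<le> B * (1 / (4 * A * B))" using s nn AB cB by (intro mult_mono) auto
   also have "\<dots> = 1 / (4 * A)" using AB by simp
   finally have "4 * ca * (cr * (\<rho> * \<kappa>)) \<le> 4 * ca * (1 / (4 * A))" using ca by (intro mult_left_mono) auto
   also have "\<dots> \<le> 1" using ca AB by simp
   finally show ?thesis .
  qed
  note est = preconditioned_field_of_values[OF eta[unfolded ca_def c1_def c2_def] _ small[unfolded ca_def cr_def]]
  show ?case unfolding Let_def using est by blast
 qed
qed

end
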